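(* Let $\omega$ be a pure, split, translation invariant and $\alpha$-invariant state on $\mathcal A$ with index $\mathrm{ind}\,\omega=(1,\mathfrak q,[\upsilon])$. For each $N\in\mathbb N$ let $Q_N$ be the support projection of the density matrix of $\omega|_{\mathcal A_{[0,N-1]}}$, and assume $\sup_{N\in\mathbb N}\mathrm{rank}(Q_N)<\infty$. Then there are $m\in\mathbb N$, a faithful density matrix $D\in M_m$, matrices $\{v_\mu\}_{\mu\in\mathcal P}\subset M_m$ and $\sigma_0\in\{0,1\}$ satisfying the following. (i) Set $\hat v_\mu:=v_\mu\otimes\sigma_z^{\sigma_0+|\mu|}$ on $\mathbb C^m\otimes\mathbb C^2$ and $T_{\hat{\mathbf v}}(b)=\sum_{\mu\in\mathcal P}\hat v_\mu b\hat v_\mu^*$. Then for all $b\in M_m\otimes\mathfrak C$, $\lim_{N\to\infty}T_{\hat{\mathbf v}}^N(b)=\mathrm{Tr}\big((D\otimes\tfrac12 1_{\mathbb C^2})b\big)\,1_{M_m}\otimes1_{\mathbb C^2}$ in norm. (ii) For any $l\in\mathbb N\cup\{0\}$ and $\mu_0,\dots,\mu_l,\nu_0,\dots,\nu_l\in\mathcal P$, $$\omega\big(E^{(0)}_{\mu_0,\nu_0}E^{(1)}_{\mu_1,\nu_1}\cdots E^{(l)}_{\mu_l,\nu_l}\big)=(-1)^{\sum_{k=1}^l(|\mu_k|+|\nu_k|)\sum_{j=0}^{k-1}(\sigma_0+|\nu_j|)}\ \delta_{\sum_{i=0}^l(|\mu_i|+|\nu_i|),\,0}\ \mathrm{Tr}\big(Dv_{\mu_0}\cdots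 v_{\mu_l}v_{\nu_l}^*\cdots v_{\nu_0}^*\big),$$ where the sum in the Kronecker delta is taken in $\mathbb Z_2$. (iii) There is a projective unitary/anti-unitary representation $W$ of $G$ on $\mathbb C^m$ relative to $\mathfrak p$ and, for each $g\in G$, some $c_g\in\mathbb T$ such that for all $g\in G$ and $\nu\in\mathcal P$ $$(-1)^{\mathfrak q(g)|\nu|}\sum_{\mu\in\mathcal P}\langle\psi_\mu,\boldsymbol\Gamma(U_g)\psi_\nu\rangle v_\mu=c_gW_gv_\nu W_g^*,\qquad \mathrm{Ad}_{W_g}(D)=D.$$ The second cohomology class associated to $W$ is $[\upsilon]$.
   Context: **CAR algebra and symmetry.** Fix $d\in\mathbb N$, a finite group $G$ and a homomorphism $\mathfrak p:G\to\mathbb Z_2=\{0,1\}$ (additive). $\mathcal A$ is the CAR algebra over $l^2(\mathbb Z)\otimes\mathbb C^d$, generated by $a(f)$ (antilinear in $f$), $\{a(f_1),a(f_2)\}=0$, $\{a(f_1),a(f_2)^*\}=\langle f_1,f_2\rangle$. For $X\subset\mathbb Z$, $\mathcal A_X\subset\mathcal A$ is the CAR algebra over $l^2(X)\otimes\mathbb C^d$; $\mathcal A_R=\mathcal A_{\mathbb Z_{\ge0}}$; $\mathcal A_{[0,N-1]}$ is a full matrix algebra. For a unitary/anti-unitary $w$, $\beta_w$ is the linear/anti-linear $*$-automorphism with $\beta_w(a(f))=a(wf)$; $\Theta=\beta_{-1}$ is the parity; $\beta_{S_x}$ ($x\in\mathbb Z$) is translation by $x$, $S_x$ being the shift by $x$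 on $l^2(\mathbb Z)$ tensored with $1_{\mathbb C^d}$. A projective unitary/anti-unitary representation of $G$ relative to $\mathfrak p$ is a family $V_g$, unitary if $\mathfrak p(g)=0$, anti-unitary if $\mathfrak p(g)=1$, with $V_gV_h=\upsilon(g,h)V_{gh}$, $\upsilon(g,h)\in U(1)$, $\upsilon(e,g)=\upsilon(g,e)=1$; then $\upsilon$ is a 2-cocycle: $\overline{\upsilon(g,h)}^{\mathfrak p(f)}\upsilon(f,gh)=\upsilon(f,g)\upsilon(fg,h)$, where $\overline z^{0}=z$, $\overline z^{1}=\overline z$. Its class modulo coboundaries $b(g)\overline{b(h)}^{\mathfrak p(g)}/b(gh)$ lies in $H^2(G,U(1)_{\mathfrak p})$. Fix such a projective representation $U$ on $\mathbb C^d$ and let $\alpha_g=\beta_{\bigoplus_{\mathbb Z}U_g}$, $g\in G$, a linear (resp. anti-linear) $*$-automorphism of $\mathcal A$ if $\mathfrak p(g)=0$ (resp. $1$). A state $\varphi$ is $\alpha$-invariant if for all $g\in G$ and all $A$: $\varphi(\alpha_g(A))=\varphi(A)$ when $\mathfrak p(g)=0$, and $\varphi(\alpha_g(A^* ))=\varphi(A)$ when $\mathfrak p(g)=1$; translation invariant if $\varphi\circ\beta_{S_x}=\varphi$ for all $x$ (then it is $\Theta$-invariant). $(\mathcal H_\varphi,\pi_\varphi,\Omega_\varphi)$ is the GNS triple; $\hat\Gamma_\varphi\pi_\varphi(A)\Omega_\varphi=\pi_\varphi(\Theta(A))\Omega_\varphi$; $\hat\alpha_\varphi$ is the extension of $\alpha|_{\mathcal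 A_R}$ to $\pi_\varphi(\mathcal A_R)''$. **Fock basis.** $\boldsymbol\Gamma(U_g)$ is the (unitary/anti-unitary) second quantization of $U_g$ on the fermionic Fock space $\mathcal F(\mathbb C^d)$. $\mathcal P$ is the power set of $\{1,\dots,d\}$ and $|\mu|=\#\mu$ mod 2. $\{\psi_\mu\}_{\mu\in\mathcal P}$ is the standard orthonormal basis of $\mathcal F(\mathbb C^d)$: $\psi_\emptyset$ is the vacuum and, for $\mu=\{\mu_1<\dots<\mu_l\}$, $\psi_\mu\propto a^*(e_{\mu_1})\cdots a^*(e_{\mu_l})\psi_\emptyset$, normalized, with $\{e_i\}$ the standard basis of $\mathbb C^d$. $E^{(0)}_{\mu,\nu}$ are the matrix units of $\mathcal A_{\{0\}}\simeq\mathcal B(\mathcal F(\mathbb C^d))$ for this basis, and $E^{(x)}_{\mu,\nu}=\beta_{S_x}(E^{(0)}_{\mu,\nu})$. $\mathrm{Ad}_Y(x)=YxY^*$. **Index.** A graded von Neumann algebra $(\mathcal M,\theta)$ is a von Neumann algebra with an involutive automorphism $\theta$; $\mathcal M^{(\sigma)}=\{x:\theta(x)=(-1)^\sigma x\}$. It is balanced if $\mathcal M^{(1)}$ contains a self-adjoint unitary, central if $Z(\mathcal M)\cap\mathcal M^{(0)}=\mathbb C1$. A graded $W^*$-$(G,\mathfrak p)$-dynamical system $(\mathcal M,\theta,\hat\alpha)$ has in addition an action $\hat\alpha$ of $G$ commuting with $\theta$, $\hat\alpha_g$ being a linear (resp. anti-linear) $*$-automorphism if $\mathfrak p(g)=0$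 (resp. $1$). Two systems are equivalent if there is a $*$-isomorphism intertwining gradings and actions. Let $\sigma_x,\sigma_y,\sigma_z$ be the Pauli matrices, $\mathfrak C=\mathrm{span}\{1,\sigma_x\}\subset M_2$, and for a Hilbert space $\mathcal K$ let $\Gamma_{\mathcal K}=1_{\mathcal K}\otimes\sigma_z$, $\mathcal R_{0,\mathcal K}=\mathcal B(\mathcal K)\otimes M_2$, $\mathcal R_{1,\mathcal K}=\mathcal B(\mathcal K)\otimes\mathfrak C$. $\mathcal S_\kappa$ ($\kappa=0,1$) is the set of systems $(\mathcal R_{\kappa,\mathcal K},\mathrm{Ad}_{\Gamma_{\mathcal K}},\mathrm{Ad}_{V_g})$ with $V$ a projective unitary/anti-unitary representation of $G$ on $\mathcal K\otimes\mathbb C^2$ relative to $\mathfrak p$ and $\mathfrak q:G\to\mathbb Z_2$ a homomorphism with $\mathrm{Ad}_{V_g}(\Gamma_{\mathcal K})=(-1)^{\mathfrak q(g)}\Gamma_{\mathcal K}$ and, if $\kappa=1$, also $\mathrm{Ad}_{V_g}(1\otimes\sigma_x)=(-1)^{\mathfrak q(g)}1\otimes\sigma_x$. For $\kappa=1$ there is a unique projective representation $V^{(0)}$ on $\mathcal K$ with $V_g=V^{(0)}_g\otimes C^{\mathfrak p(g)}\sigma_y^{\mathfrak q(g)}$, $C$ = complex conjugation on $\mathbb C^2$. Every balanced, central, type I system is equivalent to a member of exactly one $\mathcal S_\kappa$, and $\mathrm{Ind}:=(\kappa,\mathfrak q,[\upsilon])\in\mathbb Z_2\times H^1(G,\mathbb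 Z_2)\times H^2(G,U(1)_{\mathfrak p})$, with $[\upsilon]$ the class of $V$ if $\kappa=0$ and of $V^{(0)}$ if $\kappa=1$; this is well defined. A pure $\Theta$-invariant state $\varphi$ is split if $\pi_{\varphi|_{\mathcal A_R}}(\mathcal A_R)''$ is type I. For a pure, split, $\Theta$- and $\alpha$-invariant $\varphi$, $(\pi_\varphi(\mathcal A_R)'',\mathrm{Ad}_{\hat\Gamma_\varphi},\hat\alpha_\varphi)$ is a balanced, central, type I system and $\mathrm{ind}\,\varphi$ is its $\mathrm{Ind}$. *)

theory Defs
  imports
    "HOL-Analysis.Analysis"
    "HOL-Algebra.Group"
    "HOL-Library.Z2"
    "Jordan_Normal_Form.Schur_Decomposition"
    "Jordan_Normal_Form.DL_Rank"
begin

section \<open>Complex Hilbert spaces and C*-algebras\<close>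

class scaleC =
  fixes scaleC :: "complex \<Rightarrow> 'a \<Rightarrow> 'a"  (infixr \<open>*\<^sub>C\<close> 75)

class complex_vector = real_vector + scaleC +
  assumes scaleC_add_right: "c *\<^sub>C (x + y) = c *\<^sub>C x + c *\<^sub>C y"
    and scaleC_add_left: "(b + c) *\<^sub>C x = b *\<^sub>C x + c *\<^sub>C x"
    and scaleC_scaleC: "b *\<^sub>C c *\<^sub>C x = (b * c) *\<^sub>C x"
    and scaleC_of_real: "complex_of_real r *\<^sub>C x = r *\<^sub>R x"

text \<open>The complex inner product is linear in the second argument. The underlying real inner
  product is its real part, so the library's \<^const>\<open>adjoint\<close> of a bounded complex-linear operator
  is the usual Hilbert space adjoint, and for an anti-unitary operator it is the inverse.\<close>

class complex_hilbert = real_inner + complete_space + complex_vector +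
  fixes cinner :: "'a \<Rightarrow> 'a \<Rightarrow> complex"
  assumes cinner_commute: "cinner x y = cnj (cinner y x)"
    and cinner_add_right: "cinner x (y + z) = cinner x y + cinner x z"
    and cinner_scaleC_right: "cinner x (c *\<^sub>C y) = c * cinner x y"
    and Re_cinner: "Re (cinner x y) = inner x y"

class cstar_algebra = real_normed_algebra_1 + banach + complex_vector +
  fixes cstar :: "'a \<Rightarrow> 'a"
  assumes mult_scaleC_left: "(c *\<^sub>C x) * y = c *\<^sub>C (x * y)"
    and mult_scaleC_right: "x * (c *\<^sub>C y) = c *\<^sub>C (x * y)"
    and norm_scaleC: "norm (c *\<^sub>C x) = cmod c * norm x"
    and cstar_cstar: "cstar (cstar x) = x"
    and cstar_add: "cstar (x + y) = cstar x + cstar y"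
    and cstar_scaleC: "cstar (c *\<^sub>C x) = cnj c *\<^sub>C cstar x"
    and cstar_mult: "cstar (x * y) = cstar y * cstar x"
    and norm_cstar_mult: "norm (cstar x * x) = (norm x)\<^sup>2"

instantiation prod :: (complex_vector, complex_vector) complex_vector
begin
definition "c *\<^sub>C z = (c *\<^sub>C fst z, c *\<^sub>C snd z)"
instance
  by standard
    (simp_all add: scaleC_prod_def scaleC_add_right scaleC_add_left scaleC_scaleC
      scaleC_of_real scaleR_prod_def)
end

text \<open>\<open>\<K> \<otimes> \<complex>\<^sup>2\<close> is realised as \<open>\<K> \<oplus> \<K>\<close>, the pair \<open>(x, y)\<close> standing for
  \<open>x \<otimes> e\<^sub>0 + y \<otimes> e\<^sub>1\<close>.\<close>

instantiation prod :: (complex_hilbert, complex_hilbert) complex_hilbert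
begin
definition "cinner z w = cinner (fst z) (fst w) + cinner (snd z) (snd w)"
instance
proof
  fix x y z :: "'a \<times> 'b" and c :: complex
  show "cinner x y = cnj (cinner y x)"
    unfolding cinner_prod_def complex_cnj_add
    by (metis cinner_commute)
  show "cinner x (y + z) = cinner x y + cinner x z"
    by (simp add: cinner_prod_def cinner_add_right)
  show "cinner x (c *\<^sub>C y) = c * cinner x y"
    by (simp add: cinner_prod_def scaleC_prod_def cinner_scaleC_right distrib_left)
  show "Re (cinner x y) = inner x y"
    by (simp add: cinner_prod_def Re_cinner inner_prod_def)
qed
end

section \<open>Signs and conjugations indexed by the two-element field\<close>

definition bit_sign :: "bit \<Rightarrow> complex" where
  "bit_sign b = (if b = 0 then 1 else - 1)"

definition conj_bit :: "bit \<Rightarrow> complex \<Rightarrow> complex" where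
  "conj_bit s z = (if s = 0 then z else cnj z)"

definition card_parity :: "nat set \<Rightarrow> bit" where
  "card_parity \<mu> = of_nat (card \<mu>)"

definition z2_hom :: "('g, 'b) monoid_scheme \<Rightarrow> ('g \<Rightarrow> bit) \<Rightarrow> bool" where
  "z2_hom G p \<longleftrightarrow>
     (\<forall>g\<in>carrier G. \<forall>h\<in>carrier G. p (g \<otimes>\<^bsub>G\<^esub> h) = p g + p h)"

section \<open>Twisted second cohomology\<close>

definition cocycle :: "('g, 'b) monoid_scheme \<Rightarrow> ('g \<Rightarrow> bit) \<Rightarrow> ('g \<Rightarrow> 'g \<Rightarrow> complex) \<Rightarrow> bool" where
  "cocycle G p \<upsilon> \<longleftrightarrow>
     (\<forall>g\<in>carrier G. \<forall>h\<in>carrier G. cmod (\<upsilon> g h) = 1) \<and>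
     (\<forall>f\<in>carrier G. \<forall>g\<in>carrier G. \<forall>h\<in>carrier G.
        conj_bit (p f) (\<upsilon> g h) * \<upsilon> f (g \<otimes>\<^bsub>G\<^esub> h) = \<upsilon> f g * \<upsilon> (f \<otimes>\<^bsub>G\<^esub> g) h)"

definition cohomologous ::
  "('g, 'b) monoid_scheme \<Rightarrow> ('g \<Rightarrow> bit) \<Rightarrow> ('g \<Rightarrow> 'g \<Rightarrow> complex) \<Rightarrow> ('g \<Rightarrow> 'g \<Rightarrow> complex) \<Rightarrow> bool" where
  "cohomologous G p \<upsilon> \<upsilon>' \<longleftrightarrow>
     (\<exists>b. (\<forall>g\<in>carrier G. cmod (b g) = 1) \<and>
        (\<forall>g\<in>carrier G. \<forall>h\<in>carrier G.
           \<upsilon>' g h = \<upsilon> g h * (b g * conj_bit (p g) (b h) / b (g \<otimes>\<^bsub>G\<^esub> h))))"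

definition coh_class ::
  "('g, 'b) monoid_scheme \<Rightarrow> ('g \<Rightarrow> bit) \<Rightarrow> ('g \<Rightarrow> 'g \<Rightarrow> complex) \<Rightarrow> ('g \<Rightarrow> 'g \<Rightarrow> complex) set" where
  "coh_class G p \<upsilon> = {\<upsilon>'. cocycle G p \<upsilon>' \<and> cohomologous G p \<upsilon> \<upsilon>'}"

definition normalized_multiplier :: "('g, 'b) monoid_scheme \<Rightarrow> ('g \<Rightarrow> 'g \<Rightarrow> complex) \<Rightarrow> bool" where
  "normalized_multiplier G \<upsilon> \<longleftrightarrow>
     (\<forall>g\<in>carrier G. \<forall>h\<in>carrier G. cmod (\<upsilon> g h) = 1) \<and>
     (\<forall>g\<in>carrier G. \<upsilon> \<one>\<^bsub>G\<^esub> g = 1 \<and> \<upsilon> g \<one>\<^bsub>G\<^esub> = 1)"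

section \<open>Matrices\<close>

definition mat_conj :: "bit \<Rightarrow> complex mat \<Rightarrow> complex mat" where
  "mat_conj s A = map_mat (conj_bit s) A"

definition vec_conj :: "bit \<Rightarrow> complex vec \<Rightarrow> complex vec" where
  "vec_conj s x = map_vec (conj_bit s) x"

definition mat_trace :: "complex mat \<Rightarrow> complex" where
  "mat_trace A = (\<Sum>i<dim_row A. A $$ (i, i))"

definition mat_sum :: "nat \<Rightarrow> ('i \<Rightarrow> complex mat) \<Rightarrow> 'i set \<Rightarrow> complex mat" where
  "mat_sum n F I = mat n n (\<lambda>ij. \<Sum>k\<in>I. F k $$ ij)"

definition mat_list_prod :: "nat \<Rightarrow> complex mat list \<Rightarrow> complex mat" where
  "mat_list_prod n As = foldr (*) As (1\<^sub>m n)"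

definition kron :: "complex mat \<Rightarrow> complex mat \<Rightarrow> complex mat" where
  "kron A B = mat (dim_row A * dim_row B) (dim_col A * dim_col B)
     (\<lambda>(i, j). A $$ (i div dim_row B, j div dim_col B) * B $$ (i mod dim_row B, j mod dim_col B))"

definition mat_op_norm :: "complex mat \<Rightarrow> real" where
  "mat_op_norm A = (SUP x \<in> {x \<in> carrier_vec (dim_col A). Re (x \<bullet>c x) \<le> 1}.
     sqrt (Re ((A *\<^sub>v x) \<bullet>c (A *\<^sub>v x))))"

definition density_matrix :: "nat \<Rightarrow> complex mat \<Rightarrow> bool" where
  "density_matrix n D \<longleftrightarrow> D \<in> carrier_mat n n \<and>
     (\<forall>x\<in>carrier_vec n. (D *\<^sub>v x) \<bullet>c x \<in> \<real>\<^sub>\<ge>\<^sub>0) \<and> mat_trace D = 1"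

definition faithful_density_matrix :: "nat \<Rightarrow> complex mat \<Rightarrow> bool" where
  "faithful_density_matrix n D \<longleftrightarrow> density_matrix n D \<and>
     (\<forall>b\<in>carrier_mat n n. mat_trace (D * (mat_adjoint b * b)) = 0 \<longrightarrow> b = 0\<^sub>m n n)"

definition mat_projection :: "nat \<Rightarrow> complex mat \<Rightarrow> bool" where
  "mat_projection n P \<longleftrightarrow> P \<in> carrier_mat n n \<and> P * P = P \<and> mat_adjoint P = P"

definition support_projection :: "nat \<Rightarrow> complex mat \<Rightarrow> complex mat \<Rightarrow> bool" where
  "support_projection n D Q \<longleftrightarrow> mat_projection n Q \<and> Q * D = D \<and>
     (\<forall>P. mat_projection n P \<and> P * D = D \<longrightarrow> P * Q = Q)"

definition pauli_x :: "complex mat" where "pauli_x = mat_of_rows_list 2 [[0, 1], [1, 0]]"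
definition pauli_y :: "complex mat" where "pauli_y = mat_of_rows_list 2 [[0, - \<i>], [\<i>, 0]]"
definition pauli_z :: "complex mat" where "pauli_z = mat_of_rows_list 2 [[1, 0], [0, - 1]]"

definition mat_bit_power :: "complex mat \<Rightarrow> bit \<Rightarrow> complex mat" where
  "mat_bit_power A b = (if b = 0 then 1\<^sub>m (dim_row A) else A)"

text \<open>A unitary (\<open>s = 0\<close>) or anti-unitary (\<open>s = 1\<close>) operator on \<open>\<complex>\<^sup>n\<close> is encoded by the unitary
  matrix \<open>M\<close> for which it is \<open>x \<mapsto> M *\<^sub>v vec_conj s x\<close>. Composing the operators of \<open>(M, s)\<close> and
  \<open>(M', s')\<close> gives that of \<open>(M * mat_conj s M', s + s')\<close>, and \<open>Ad\<close> of the operator of \<open>(M, s)\<close>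
  is \<open>A \<mapsto> M * mat_conj s A * mat_adjoint M\<close>.\<close>

definition mat_apply :: "bit \<Rightarrow> complex mat \<Rightarrow> complex vec \<Rightarrow> complex vec" where
  "mat_apply s M x = M *\<^sub>v vec_conj s x"

definition mat_Ad :: "bit \<Rightarrow> complex mat \<Rightarrow> complex mat \<Rightarrow> complex mat" where
  "mat_Ad s M A = M * mat_conj s A * mat_adjoint M"

definition proj_rep_mat ::
  "('g, 'b) monoid_scheme \<Rightarrow> ('g \<Rightarrow> bit) \<Rightarrow> nat \<Rightarrow> ('g \<Rightarrow> complex mat) \<Rightarrow> ('g \<Rightarrow> 'g \<Rightarrow> complex) \<Rightarrow> bool" where
  "proj_rep_mat G p n M \<upsilon> \<longleftrightarrow> normalized_multiplier G \<upsilon> \<and>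
     (\<forall>g\<in>carrier G. M g \<in> carrier_mat n n \<and> M g * mat_adjoint (M g) = 1\<^sub>m n) \<and>
     (\<forall>g\<in>carrier G. \<forall>h\<in>carrier G. M g * mat_conj (p g) (M h) = \<upsilon> g h \<cdot>\<^sub>m M (g \<otimes>\<^bsub>G\<^esub> h))"

section \<open>Fermionic Fock space over \<open>\<complex>\<^sup>d\<close>\<close>

text \<open>Modes are numbered from 0, so the index set is the power set of \<open>{..<d}\<close>. A Fock vector is
  given by its coefficients in the occupation number basis; the sign in the creation operator
  is the one for which the basis vector of \<open>\<mu> = {\<mu>\<^sub>1 < \<dots> < \<mu>\<^sub>l}\<close> is
  \<open>a\<^sup>*(e\<^bsub>\<mu>\<^sub>1\<^esub>) \<dots> a\<^sup>*(e\<^bsub>\<mu>\<^sub>l\<^esub>)\<close> applied to the vacuum.\<close>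

type_synonym fock = "nat set \<Rightarrow> complex"

definition fock_space :: "nat \<Rightarrow> fock set" where
  "fock_space d = {\<psi>. \<forall>\<mu>. \<not> \<mu> \<subseteq> {..<d} \<longrightarrow> \<psi> \<mu> = 0}"

definition fock_inner :: "nat \<Rightarrow> fock \<Rightarrow> fock \<Rightarrow> complex" where
  "fock_inner d \<phi> \<psi> = (\<Sum>\<mu>\<in>Pow {..<d}. cnj (\<phi> \<mu>) * \<psi> \<mu>)"

definition fock_vacuum :: fock where
  "fock_vacuum = (\<lambda>\<mu>. if \<mu> = {} then 1 else 0)"

definition fock_create :: "nat \<Rightarrow> complex vec \<Rightarrow> fock \<Rightarrow> fock" where
  "fock_create d f \<psi> = (\<lambda>\<mu>. if \<mu> \<subseteq> {..<d}
     then \<Sum>i\<in>\<mu>. (- 1) ^ card {j\<in>\<mu>. j < i} * f $ i * \<psi> (\<mu> - {i}) else 0)"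

definition fock_basis :: "nat \<Rightarrow> nat set \<Rightarrow> fock" where
  "fock_basis d \<mu> = foldr (\<lambda>i. fock_create d (unit_vec d i)) (sorted_list_of_set \<mu>) fock_vacuum"

text \<open>Second quantization of the (anti-)unitary \<^term>\<open>mat_apply s M\<close>: it sends
  \<open>a\<^sup>*(e\<^sub>i) \<dots> a\<^sup>*(e\<^sub>j)\<close> applied to the vacuum to \<open>a\<^sup>*(U e\<^sub>i) \<dots> a\<^sup>*(U e\<^sub>j)\<close> applied to the vacuum and
  is (anti-)linear.\<close>

definition fock_second_quant :: "nat \<Rightarrow> bit \<Rightarrow> complex mat \<Rightarrow> fock \<Rightarrow> fock" where
  "fock_second_quant d s M \<psi> = (\<lambda>\<tau>. \<Sum>\<nu>\<in>Pow {..<d}. conj_bit s (fock_inner d (fock_basis d \<nu>) \<psi>) *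
     foldr (\<lambda>i. fock_create d (mat_apply s M (unit_vec d i))) (sorted_list_of_set \<nu>) fock_vacuum \<tau>)"

section \<open>The CAR algebra\<close>

definition l2_chain :: "nat \<Rightarrow> (int \<Rightarrow> complex vec) set" where
  "l2_chain d = {f. (\<forall>x. f x \<in> carrier_vec d) \<and> (\<lambda>x. Re (f x \<bullet>c f x)) summable_on UNIV}"

definition l2_inner :: "(int \<Rightarrow> complex vec) \<Rightarrow> (int \<Rightarrow> complex vec) \<Rightarrow> complex" where
  "l2_inner f g = infsum (\<lambda>x. g x \<bullet>c f x) UNIV"

definition site_vec :: "nat \<Rightarrow> complex vec \<Rightarrow> int \<Rightarrow> complex vec" where
  "site_vec d u = (\<lambda>x. if x = 0 then u else 0\<^sub>v d)"

inductive_set star_alg_gen :: "'a::cstar_algebra set \<Rightarrow> 'a set" for S where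
  base: "x \<in> S \<Longrightarrow> x \<in> star_alg_gen S"
| one: "1 \<in> star_alg_gen S"
| add: "x \<in> star_alg_gen S \<Longrightarrow> y \<in> star_alg_gen S \<Longrightarrow> x + y \<in> star_alg_gen S"
| scaleC: "x \<in> star_alg_gen S \<Longrightarrow> c *\<^sub>C x \<in> star_alg_gen S"
| mult: "x \<in> star_alg_gen S \<Longrightarrow> y \<in> star_alg_gen S \<Longrightarrow> x * y \<in> star_alg_gen S"
| cstar: "x \<in> star_alg_gen S \<Longrightarrow> cstar x \<in> star_alg_gen S"

definition car_sub :: "nat \<Rightarrow> ((int \<Rightarrow> complex vec) \<Rightarrow> 'a::cstar_algebra) \<Rightarrow> int set \<Rightarrow> 'a set" where
  "car_sub d a X = closure (star_alg_gen (a ` {f \<in> l2_chain d. \<forall>x. x \<notin> X \<longrightarrow> f x = 0\<^sub>v d}))"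

text \<open>The CAR algebra is unique up to *-isomorphism respecting the generators, so it is specified
  as a C*-algebra generated by elements satisfying the canonical anticommutation relations.\<close>

definition car_algebra :: "nat \<Rightarrow> ((int \<Rightarrow> complex vec) \<Rightarrow> 'a::cstar_algebra) \<Rightarrow> bool" where
  "car_algebra d a \<longleftrightarrow>
     (\<forall>f\<in>l2_chain d. \<forall>g\<in>l2_chain d.
        a (\<lambda>x. f x + g x) = a f + a g \<and>
        a f * a g + a g * a f = 0 \<and>
        a f * cstar (a g) + cstar (a g) * a f = l2_inner f g *\<^sub>C 1) \<and>
     (\<forall>f\<in>l2_chain d. \<forall>c. a (\<lambda>x. c \<cdot>\<^sub>v f x) = cnj c *\<^sub>C a f) \<and>
     car_sub d a UNIV = UNIV"

text \<open>Linear (\<open>s = 0\<close>) and anti-linear (\<open>s = 1\<close>) *-automorphisms.\<close>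

definition star_automorphism :: "bit \<Rightarrow> ('a::cstar_algebra \<Rightarrow> 'a) \<Rightarrow> bool" where
  "star_automorphism s \<beta> \<longleftrightarrow> bij \<beta> \<and>
     (\<forall>x y. \<beta> (x + y) = \<beta> x + \<beta> y \<and> \<beta> (x * y) = \<beta> x * \<beta> y) \<and>
     (\<forall>c x. \<beta> (c *\<^sub>C x) = conj_bit s c *\<^sub>C \<beta> x) \<and>
     (\<forall>x. \<beta> (cstar x) = cstar (\<beta> x))"

definition car_aut ::
  "nat \<Rightarrow> ((int \<Rightarrow> complex vec) \<Rightarrow> 'a::cstar_algebra) \<Rightarrow> bit \<Rightarrow>
   ((int \<Rightarrow> complex vec) \<Rightarrow> (int \<Rightarrow> complex vec)) \<Rightarrow> 'a \<Rightarrow> 'a" where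
  "car_aut d a s w = (THE \<beta>. star_automorphism s \<beta> \<and> (\<forall>f\<in>l2_chain d. \<beta> (a f) = a (w f)))"

definition car_parity :: "nat \<Rightarrow> ((int \<Rightarrow> complex vec) \<Rightarrow> 'a::cstar_algebra) \<Rightarrow> 'a \<Rightarrow> 'a" where
  "car_parity d a = car_aut d a 0 (\<lambda>f x. - f x)"

definition car_shift :: "nat \<Rightarrow> ((int \<Rightarrow> complex vec) \<Rightarrow> 'a::cstar_algebra) \<Rightarrow> int \<Rightarrow> 'a \<Rightarrow> 'a" where
  "car_shift d a y = car_aut d a 0 (\<lambda>f x. f (x - y))"

definition car_onsite ::
  "nat \<Rightarrow> ((int \<Rightarrow> complex vec) \<Rightarrow> 'a::cstar_algebra) \<Rightarrow> ('g \<Rightarrow> bit) \<Rightarrow> ('g \<Rightarrow> complex mat) \<Rightarrow> 'g \<Rightarrow> 'a \<Rightarrow> 'a" where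
  "car_onsite d a p U g = car_aut d a (p g) (\<lambda>f x. mat_apply (p g) (U g) (f x))"

text \<open>The identification of the algebra of site 0 with the operators on the Fock space; it is
  determined by its values on the creation operators.\<close>

definition fock_rep ::
  "nat \<Rightarrow> ((int \<Rightarrow> complex vec) \<Rightarrow> 'a::cstar_algebra) \<Rightarrow> ('a \<Rightarrow> fock \<Rightarrow> fock) \<Rightarrow> bool" where
  "fock_rep d a \<rho> \<longleftrightarrow>
     (\<forall>A\<in>car_sub d a {0}. \<forall>\<psi>\<in>fock_space d.
        \<rho> A \<psi> \<in> fock_space d \<and>
        (\<forall>c. \<rho> A (\<lambda>\<tau>. c * \<psi> \<tau>) = (\<lambda>\<tau>. c * \<rho> A \<psi> \<tau>)) \<and>
        (\<forall>\<phi>\<in>fock_space d.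
           \<rho> A (\<lambda>\<tau>. \<phi> \<tau> + \<psi> \<tau>) = (\<lambda>\<tau>. \<rho> A \<phi> \<tau> + \<rho> A \<psi> \<tau>) \<and>
           fock_inner d \<phi> (\<rho> (cstar A) \<psi>) = fock_inner d (\<rho> A \<phi>) \<psi>) \<and>
        (\<forall>c. \<rho> (c *\<^sub>C A) \<psi> = (\<lambda>\<tau>. c * \<rho> A \<psi> \<tau>)) \<and>
        (\<forall>B\<in>car_sub d a {0}.
           \<rho> (A + B) \<psi> = (\<lambda>\<tau>. \<rho> A \<psi> \<tau> + \<rho> B \<psi> \<tau>) \<and> \<rho> (A * B) \<psi> = \<rho> A (\<rho> B \<psi>))) \<and>
     (\<forall>\<psi>\<in>fock_space d. \<rho> 1 \<psi> = \<psi> \<and>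
        (\<forall>u\<in>carrier_vec d. \<rho> (cstar (a (site_vec d u))) \<psi> = fock_create d u \<psi>))"

definition matrix_unit0 ::
  "nat \<Rightarrow> ((int \<Rightarrow> complex vec) \<Rightarrow> 'a::cstar_algebra) \<Rightarrow> nat set \<Rightarrow> nat set \<Rightarrow> 'a" where
  "matrix_unit0 d a \<mu> \<nu> = (THE E. E \<in> car_sub d a {0} \<and>
     (\<forall>\<rho>. fock_rep d a \<rho> \<longrightarrow>
        (\<forall>\<psi>\<in>fock_space d. \<rho> E \<psi> = (\<lambda>\<tau>. fock_inner d (fock_basis d \<nu>) \<psi> * fock_basis d \<mu> \<tau>))))"

definition matrix_unit ::
  "nat \<Rightarrow> ((int \<Rightarrow> complex vec) \<Rightarrow> 'a::cstar_algebra) \<Rightarrow> int \<Rightarrow> nat set \<Rightarrow> nat set \<Rightarrow> 'a" where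
  "matrix_unit d a x \<mu> \<nu> = car_shift d a x (matrix_unit0 d a \<mu> \<nu>)"

section \<open>States\<close>

definition is_state :: "('a::cstar_algebra \<Rightarrow> complex) \<Rightarrow> bool" where
  "is_state \<phi> \<longleftrightarrow> (\<forall>x y. \<phi> (x + y) = \<phi> x + \<phi> y) \<and> (\<forall>c x. \<phi> (c *\<^sub>C x) = c * \<phi> x) \<and>
     (\<forall>x. \<phi> (cstar x * x) \<in> \<real>\<^sub>\<ge>\<^sub>0) \<and> \<phi> 1 = 1"

definition pure_state :: "('a::cstar_algebra \<Rightarrow> complex) \<Rightarrow> bool" where
  "pure_state \<phi> \<longleftrightarrow> is_state \<phi> \<and>
     (\<forall>\<phi>\<^sub>1 \<phi>\<^sub>2. \<forall>t::real. is_state \<phi>\<^sub>1 \<and> is_state \<phi>\<^sub>2 \<and> 0 < t \<and> t < 1 \<and>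
        (\<forall>x. \<phi> x = of_real t * \<phi>\<^sub>1 x + of_real (1 - t) * \<phi>\<^sub>2 x) \<longrightarrow> \<phi>\<^sub>1 = \<phi> \<and> \<phi>\<^sub>2 = \<phi>)"

definition translation_invariant ::
  "nat \<Rightarrow> ((int \<Rightarrow> complex vec) \<Rightarrow> 'a::cstar_algebra) \<Rightarrow> ('a \<Rightarrow> complex) \<Rightarrow> bool" where
  "translation_invariant d a \<phi> \<longleftrightarrow> (\<forall>y A. \<phi> (car_shift d a y A) = \<phi> A)"

definition action_invariant ::
  "('g, 'b) monoid_scheme \<Rightarrow> ('g \<Rightarrow> bit) \<Rightarrow> ('g \<Rightarrow> 'a \<Rightarrow> 'a) \<Rightarrow> ('a::cstar_algebra \<Rightarrow> complex) \<Rightarrow> bool" where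
  "action_invariant G p \<alpha> \<phi> \<longleftrightarrow>
     (\<forall>g\<in>carrier G. \<forall>A. \<phi> (\<alpha> g (if p g = 0 then A else cstar A)) = \<phi> A)"

text \<open>The density matrix of \<open>\<phi>\<close> on \<open>[0, N - 1]\<close> is formed after identifying the local algebra with
  a full matrix algebra; a different identification changes it, and \<open>Q\<close>, by a unitary conjugation.\<close>

definition local_matrix_iso ::
  "nat \<Rightarrow> ((int \<Rightarrow> complex vec) \<Rightarrow> 'a::cstar_algebra) \<Rightarrow> nat \<Rightarrow> ('a \<Rightarrow> complex mat) \<Rightarrow> bool" where
  "local_matrix_iso d a N \<Phi> \<longleftrightarrow>
     bij_betw \<Phi> (car_sub d a {0..<int N}) (carrier_mat (2 ^ (d * N)) (2 ^ (d * N))) \<and>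
     (\<forall>A\<in>car_sub d a {0..<int N}.
        \<Phi> (cstar A) = mat_adjoint (\<Phi> A) \<and> (\<forall>c. \<Phi> (c *\<^sub>C A) = c \<cdot>\<^sub>m \<Phi> A) \<and>
        (\<forall>B\<in>car_sub d a {0..<int N}. \<Phi> (A + B) = \<Phi> A + \<Phi> B \<and> \<Phi> (A * B) = \<Phi> A * \<Phi> B))"

definition local_support ::
  "nat \<Rightarrow> ((int \<Rightarrow> complex vec) \<Rightarrow> 'a::cstar_algebra) \<Rightarrow> ('a \<Rightarrow> complex) \<Rightarrow> nat \<Rightarrow> complex mat \<Rightarrow> bool" where
  "local_support d a \<phi> N Q \<longleftrightarrow>
     (\<exists>\<Phi> D. local_matrix_iso d a N \<Phi> \<and> density_matrix (2 ^ (d * N)) D \<and>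
        (\<forall>A\<in>car_sub d a {0..<int N}. \<phi> A = mat_trace (D * \<Phi> A)) \<and>
        support_projection (2 ^ (d * N)) D Q)"

section \<open>Von Neumann algebras\<close>

definition bounded_op :: "bit \<Rightarrow> ('h::complex_hilbert \<Rightarrow> 'h) \<Rightarrow> bool" where
  "bounded_op s T \<longleftrightarrow> bounded_linear T \<and> (\<forall>c x. T (c *\<^sub>C x) = conj_bit s c *\<^sub>C T x)"

definition unitary_op :: "bit \<Rightarrow> ('h::complex_hilbert \<Rightarrow> 'h) \<Rightarrow> bool" where
  "unitary_op s T \<longleftrightarrow> bounded_op s T \<and> surj T \<and> (\<forall>x y. cinner (T x) (T y) = conj_bit s (cinner x y))"

definition op_Ad :: "('h::complex_hilbert \<Rightarrow> 'h) \<Rightarrow> ('h \<Rightarrow> 'h) \<Rightarrow> ('h \<Rightarrow> 'h)" where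
  "op_Ad Y T = Y \<circ> T \<circ> adjoint Y"

definition commutant :: "('h::complex_hilbert \<Rightarrow> 'h) set \<Rightarrow> ('h \<Rightarrow> 'h) set" where
  "commutant M = {T. bounded_op 0 T \<and> (\<forall>S\<in>M. S \<circ> T = T \<circ> S)}"

definition op_projection :: "('h::complex_hilbert \<Rightarrow> 'h) \<Rightarrow> bool" where
  "op_projection P \<longleftrightarrow> bounded_op 0 P \<and> P \<circ> P = P \<and> adjoint P = P"

definition type_I :: "('h::complex_hilbert \<Rightarrow> 'h) set \<Rightarrow> bool" where
  "type_I M \<longleftrightarrow>
     (\<forall>Z \<in> M \<inter> commutant M. op_projection Z \<and> Z \<noteq> (\<lambda>x. 0) \<longrightarrow>
        (\<exists>E\<in>M. op_projection E \<and> E \<noteq> (\<lambda>x. 0) \<and> Z \<circ> E = E \<and>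
           (\<forall>S\<in>M. \<forall>T\<in>M. (E \<circ> S \<circ> E) \<circ> (E \<circ> T \<circ> E) = (E \<circ> T \<circ> E) \<circ> (E \<circ> S \<circ> E))))"

definition vN_iso ::
  "bit \<Rightarrow> ('h::complex_hilbert \<Rightarrow> 'h) set \<Rightarrow> ('k::complex_hilbert \<Rightarrow> 'k) set \<Rightarrow>
   (('h \<Rightarrow> 'h) \<Rightarrow> ('k \<Rightarrow> 'k)) \<Rightarrow> bool" where
  "vN_iso s M N \<iota> \<longleftrightarrow> bij_betw \<iota> M N \<and>
     (\<forall>S\<in>M. \<iota> (adjoint S) = adjoint (\<iota> S) \<and>
        (\<forall>c. \<iota> (\<lambda>x. c *\<^sub>C S x) = (\<lambda>x. conj_bit s c *\<^sub>C \<iota> S x)) \<and>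
        (\<forall>T\<in>M. \<iota> (\<lambda>x. S x + T x) = (\<lambda>x. \<iota> S x + \<iota> T x) \<and> \<iota> (S \<circ> T) = \<iota> S \<circ> \<iota> T))"

definition proj_rep_op ::
  "('g, 'b) monoid_scheme \<Rightarrow> ('g \<Rightarrow> bit) \<Rightarrow> ('g \<Rightarrow> 'h::complex_hilbert \<Rightarrow> 'h) \<Rightarrow> ('g \<Rightarrow> 'g \<Rightarrow> complex) \<Rightarrow> bool" where
  "proj_rep_op G p V \<upsilon> \<longleftrightarrow> normalized_multiplier G \<upsilon> \<and>
     (\<forall>g\<in>carrier G. unitary_op (p g) (V g)) \<and>
     (\<forall>g\<in>carrier G. \<forall>h\<in>carrier G. V g \<circ> V h = (\<lambda>x. \<upsilon> g h *\<^sub>C V (g \<otimes>\<^bsub>G\<^esub> h) x))"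

section \<open>GNS representations and the split property\<close>

definition gns_triple ::
  "'a::cstar_algebra set \<Rightarrow> ('a \<Rightarrow> complex) \<Rightarrow> ('a \<Rightarrow> 'h \<Rightarrow> 'h) \<Rightarrow> 'h::complex_hilbert \<Rightarrow> bool" where
  "gns_triple B \<phi> \<pi> \<Omega> \<longleftrightarrow>
     \<pi> 1 = id \<and>
     (\<forall>x\<in>B. bounded_op 0 (\<pi> x) \<and> \<pi> (cstar x) = adjoint (\<pi> x) \<and>
        (\<forall>c. \<pi> (c *\<^sub>C x) = (\<lambda>\<xi>. c *\<^sub>C \<pi> x \<xi>)) \<and>
        (\<forall>y\<in>B. \<pi> (x + y) = (\<lambda>\<xi>. \<pi> x \<xi> + \<pi> y \<xi>) \<and> \<pi> (x * y) = \<pi> x \<circ> \<pi> y) \<and>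
        \<phi> x = cinner \<Omega> (\<pi> x \<Omega>)) \<and>
     closure ((\<lambda>x. \<pi> x \<Omega>) ` B) = UNIV"

text \<open>HOL cannot quantify over Hilbert spaces inside a formula, so the type carrying the GNS space
  (below also the type carrying \<open>\<K>\<close>) is a parameter. By uniqueness of the GNS triple the outcome
  is the same for every type that carries one.\<close>

definition split_state ::
  "'h::complex_hilbert itself \<Rightarrow> nat \<Rightarrow> ((int \<Rightarrow> complex vec) \<Rightarrow> 'a::cstar_algebra) \<Rightarrow> ('a \<Rightarrow> complex) \<Rightarrow> bool" where
  "split_state _ d a \<phi> \<longleftrightarrow>
     (\<exists>\<pi> (\<Omega>::'h). gns_triple (car_sub d a {0..}) \<phi> \<pi> \<Omega> \<and>
        type_I (commutant (commutant (\<pi> ` car_sub d a {0..}))))"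

section \<open>The index\<close>

text \<open>\<open>A \<otimes> B\<close> on \<open>\<K> \<otimes> \<complex>\<^sup>2\<close>, where \<open>B e\<^sub>j = M $$ (0, j) e\<^sub>0 + M $$ (1, j) e\<^sub>1\<close>
  and \<open>A\<close>, \<open>B\<close> are both linear or both anti-linear.\<close>

definition op_tensor :: "('k::complex_hilbert \<Rightarrow> 'k) \<Rightarrow> complex mat \<Rightarrow> 'k \<times> 'k \<Rightarrow> 'k \<times> 'k" where
  "op_tensor A M = (\<lambda>(x, y).
     (M $$ (0, 0) *\<^sub>C A x + M $$ (0, 1) *\<^sub>C A y, M $$ (1, 0) *\<^sub>C A x + M $$ (1, 1) *\<^sub>C A y))"

definition model_algebra :: "bit \<Rightarrow> ('k::complex_hilbert \<times> 'k \<Rightarrow> 'k \<times> 'k) set" where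
  "model_algebra \<kappa> =
     (if \<kappa> = 0 then {T. bounded_op 0 T}
      else {\<lambda>z. op_tensor A (1\<^sub>m 2) z + op_tensor B pauli_x z | A B. bounded_op 0 A \<and> bounded_op 0 B})"

definition model_system ::
  "('g, 'b) monoid_scheme \<Rightarrow> ('g \<Rightarrow> bit) \<Rightarrow> bit \<Rightarrow> ('g \<Rightarrow> bit) \<Rightarrow>
   ('g \<Rightarrow> 'k::complex_hilbert \<times> 'k \<Rightarrow> 'k \<times> 'k) \<Rightarrow> ('g \<Rightarrow> 'g \<Rightarrow> complex) \<Rightarrow> bool" where
  "model_system G p \<kappa> q V \<upsilon> \<longleftrightarrow> proj_rep_op G p V \<upsilon> \<and> z2_hom G q \<and>
     (\<forall>g\<in>carrier G.
        op_Ad (V g) (op_tensor id pauli_z) = (\<lambda>z. bit_sign (q g) *\<^sub>C op_tensor id pauli_z z) \<and>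
        (\<kappa> = 1 \<longrightarrow>
           op_Ad (V g) (op_tensor id pauli_x) = (\<lambda>z. bit_sign (q g) *\<^sub>C op_tensor id pauli_x z)))"

definition model_class ::
  "('g, 'b) monoid_scheme \<Rightarrow> ('g \<Rightarrow> bit) \<Rightarrow> bit \<Rightarrow> ('g \<Rightarrow> bit) \<Rightarrow>
   ('g \<Rightarrow> 'k::complex_hilbert \<times> 'k \<Rightarrow> 'k \<times> 'k) \<Rightarrow> ('g \<Rightarrow> 'g \<Rightarrow> complex) \<Rightarrow>
   ('g \<Rightarrow> 'g \<Rightarrow> complex) set \<Rightarrow> bool" where
  "model_class G p \<kappa> q V \<upsilon> c \<longleftrightarrow>
     (if \<kappa> = 0 then c = coh_class G p \<upsilon>
      else \<exists>V\<^sub>0 \<upsilon>\<^sub>0. proj_rep_op G p V\<^sub>0 \<upsilon>\<^sub>0 \<and>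
             (\<forall>g\<in>carrier G. V g = op_tensor (V\<^sub>0 g) (mat_conj (p g) (mat_bit_power pauli_y (q g)))) \<and>
             c = coh_class G p \<upsilon>\<^sub>0)"

text \<open>\<open>Ind\<close> of the system \<open>(M, \<theta>, \<alpha>)\<close>, as the relation of having index \<open>(\<kappa>, q, c)\<close>: the system is
  equivalent to the member of \<open>\<S>\<^sub>\<kappa>\<close> given by \<open>V\<close> and \<open>q\<close>.\<close>

definition has_Ind ::
  "'k::complex_hilbert itself \<Rightarrow> ('g, 'b) monoid_scheme \<Rightarrow> ('g \<Rightarrow> bit) \<Rightarrow> ('h::complex_hilbert \<Rightarrow> 'h) set \<Rightarrow>
   (('h \<Rightarrow> 'h) \<Rightarrow> ('h \<Rightarrow> 'h)) \<Rightarrow> ('g \<Rightarrow> ('h \<Rightarrow> 'h) \<Rightarrow> ('h \<Rightarrow> 'h)) \<Rightarrow>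
   bit \<times> ('g \<Rightarrow> bit) \<times> ('g \<Rightarrow> 'g \<Rightarrow> complex) set \<Rightarrow> bool" where
  "has_Ind _ G p M \<theta> \<alpha> = (\<lambda>(\<kappa>, q, c).
     \<exists>(V :: 'g \<Rightarrow> 'k \<times> 'k \<Rightarrow> 'k \<times> 'k) \<upsilon> \<iota>.
       model_system G p \<kappa> q V \<upsilon> \<and> model_class G p \<kappa> q V \<upsilon> c \<and>
       vN_iso 0 M (model_algebra \<kappa>) \<iota> \<and>
       (\<forall>T\<in>M. \<iota> (\<theta> T) = op_Ad (op_tensor id pauli_z) (\<iota> T) \<and>
          (\<forall>g\<in>carrier G. \<iota> (\<alpha> g T) = op_Ad (V g) (\<iota> T))))"

text \<open>The extension \<open>\<alpha>'\<close> of the on-site action is determined by the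
  conditions below, since *-automorphisms of von Neumann algebras are normal.\<close>

definition has_ind ::
  "'h::complex_hilbert itself \<Rightarrow> 'k::complex_hilbert itself \<Rightarrow> ('g, 'b) monoid_scheme \<Rightarrow> ('g \<Rightarrow> bit) \<Rightarrow>
   nat \<Rightarrow> ((int \<Rightarrow> complex vec) \<Rightarrow> 'a::cstar_algebra) \<Rightarrow> ('g \<Rightarrow> complex mat) \<Rightarrow> ('a \<Rightarrow> complex) \<Rightarrow>
   bit \<times> ('g \<Rightarrow> bit) \<times> ('g \<Rightarrow> 'g \<Rightarrow> complex) set \<Rightarrow> bool" where
  "has_ind _ K G p d a U \<phi> i \<longleftrightarrow>
     (\<exists>\<pi> (\<Omega>::'h) \<Gamma> \<alpha>' M.
        gns_triple UNIV \<phi> \<pi> \<Omega> \<and>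
        M = commutant (commutant (\<pi> ` car_sub d a {0..})) \<and>
        bounded_op 0 \<Gamma> \<and> (\<forall>A. \<Gamma> (\<pi> A \<Omega>) = \<pi> (car_parity d a A) \<Omega>) \<and>
        (\<forall>g\<in>carrier G. vN_iso (p g) M M (\<alpha>' g) \<and>
           (\<forall>A\<in>car_sub d a {0..}. \<alpha>' g (\<pi> A) = \<pi> (car_onsite d a p U g A))) \<and>
        has_Ind K G p M (op_Ad \<Gamma>) \<alpha>' i)"

section \<open>Transfer maps\<close>

definition vhat :: "bit \<Rightarrow> (nat set \<Rightarrow> complex mat) \<Rightarrow> nat set \<Rightarrow> complex mat" where
  "vhat \<sigma>\<^sub>0 v \<mu> = kron (v \<mu>) (mat_bit_power pauli_z (\<sigma>\<^sub>0 + card_parity \<mu>))"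

definition transfer_map :: "nat \<Rightarrow> nat \<Rightarrow> (nat set \<Rightarrow> complex mat) \<Rightarrow> complex mat \<Rightarrow> complex mat" where
  "transfer_map n d w b = mat_sum n (\<lambda>\<mu>. w \<mu> * b * mat_adjoint (w \<mu>)) (Pow {..<d})"

definition graded_matrices :: "nat \<Rightarrow> complex mat set" where
  "graded_matrices m = {kron x (1\<^sub>m 2) + kron y pauli_x | x y. x \<in> carrier_mat m m \<and> y \<in> carrier_mat m m}"

end

(* Let pi, Om be the GNS data of the pure state and M = pi(A_R)''. Index kappa = 1 means that the even part of M is a
   type I factor j(B(K)) and that M contains a central odd self-adjoint unitary Z. Translation by one site induces an
   endomorphism rho of M whose range commutes with the matrix units of site 0 up to parity signs. Multiplying the odd
   matrix units by Z makes them even; pulled back to B(K), rho and these units yield isometries S_mu such that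
   j(S_mu A (S_nu)^* ) is the corrected matrix unit times rho(j A), and rho(Z) = +-Z Par, where Par is the parity
   operator of site 0, determines the sign sigma_0. The projection P onto the closure of M' Om lies in M and satisfies
   P <= pi(q) for every local support projection q, so the bound on the ranks makes P M P finite-dimensional, that is,
   P = j(p0) with p0 of finite rank m. As p0 S_mu = p0 S_mu p0, compression by p0 gives the matrices v_mu; the vector
   state of Om gives D. Purity makes translated observables cluster, which is the limit (i); (ii) is the relation for
   S_mu applied to words; for (iii), the implementer of alpha_g acts on B(K) as Ad V_g and carries the S_mu into one
   another up to a phase, because the sandwiches A -> S_mu A (S_nu)^* determine the family S up to a phase. *)

theory Submission
  imports Defs
begin

text \<open>\<open>car_aut\<close> and \<open>matrix_unit0\<close> are definite descriptions. Before
  anything can be computed, Bogoliubov automorphisms must be shown to exist and the matrix units of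
  a site must be identified with explicit products of creation operators around a vacuum projection;
  this is the first half of the development. The obstacle in the second half is fermionic: operators
  of the two half chains commute only up to parity signs, so an odd element of M becomes
  asymptotically central only after multiplication by the parity unitary \<open>Gm\<close>. This
  splits the limit (i) into an even component and a \<open>pauli_x\<close> component with separate
  limits. P is the support projection of the vector state of Om on M: an element of M is determined
  on the range of P by its value on Om, so weak approximation by local elements reduces to the
  approximation of one vector. The same property makes D faithful and makes P invariant under every
  symmetry that fixes Om. The class in (iii) is that of the index because W is the compression of
  the projective representation V0 by which the class of the index is defined.\<close>

notation scaleC (infixr "*c" 75)
notation LIMSEQ ("((_)/ ----> (_))" [60, 60] 60)
notation smult_mat (infixl "*m" 70) and scaleR (infixr "*r" 75) and mult_mat_vec (infixl "*mv" 70) and one_mat ("idm") and cinner ("ip")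

section \<open>Complex Hilbert spaces\<close>

global_interpretation cvs: vector_space "scaleC :: complex => 'a => 'a::complex_vector"
proof
 show "1 *c x = x" for x :: 'a using scaleC_of_real[of 1 x] by simp
qed (simp_all add: scaleC_add_right scaleC_add_left scaleC_scaleC)

lemma cinner_add_left: "ip (x + y) z = ip x z + ip y (z :: 'a::complex_hilbert)"
 by (metis cinner_add_right cinner_commute complex_cnj_add)

lemma cinner_scaleC_left: "ip (c *c x) y = cnj c * ip x (y :: 'a::complex_hilbert)"
 by (metis cinner_commute cinner_scaleC_right complex_cnj_mult)

lemma cinner_zero_left [simp]: "ip 0 (y :: 'a::complex_hilbert) = 0" using cinner_scaleC_left[of 0 0 y] by simp

lemma cinner_zero_right [simp]: "ip (y :: 'a::complex_hilbert) 0 = 0" using cinner_scaleC_right[of y 0 0] by simp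

lemma cinner_minus_left: "ip (- x) (y :: 'a::complex_hilbert) = - ip x y" using cinner_scaleC_left[of "-1" x y] by simp

lemma cinner_minus_right: "ip x (- y :: 'a::complex_hilbert) = - ip x y" using cinner_scaleC_right[of x "-1" y] by simp

lemma cinner_diff_left: "ip (x - y) z = ip x z - ip y (z :: 'a::complex_hilbert)"
 using cinner_add_left[of x "- y" z] by (simp add: cinner_minus_left)

lemma cinner_diff_right: "ip z (x - y) = ip z x - ip z (y :: 'a::complex_hilbert)"
 using cinner_add_right[of z x "- y"] by (simp add: cinner_minus_right)

lemma cinner_sum_left: "ip (sum f S) y = (SUM i:S. ip (f i) (y :: 'a::complex_hilbert))"
 by (induction S rule: infinite_finite_induct) (simp_all add: cinner_add_left)

lemma cinner_sum_right: "ip y (sum f S) = (SUM i:S. ip (y :: 'a::complex_hilbert) (f i))"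
 by (induction S rule: infinite_finite_induct) (simp_all add: cinner_add_right)

lemma cinner_self: "ip x x = of_real ((norm (x :: 'a::complex_hilbert))\<^sup>2)"
proof -
 have "Im (ip x x) = 0" using arg_cong[OF cinner_commute[of x x], of Im] by simp
 then show ?thesis by (simp add: complex_eq_iff Re_cinner power2_norm_eq_inner)
qed

lemma norm_scaleC_hilbert: "norm (c *c x) = cmod c * norm (x :: 'a::complex_hilbert)"
proof -
 have "of_real ((norm (c *c x))\<^sup>2) = cnj c * c * of_real ((norm x)\<^sup>2)"
  by (metis cinner_self cinner_scaleC_left cinner_scaleC_right mult.assoc)
 also have "cnj c * c = of_real ((cmod c)\<^sup>2)" by (metis complex_norm_square mult.commute)
 finally have "(norm (c *c x))\<^sup>2 = (cmod c * norm x)\<^sup>2"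
  by (simp only: of_real_mult[symmetric] of_real_eq_iff power_mult_distrib)
 then show ?thesis by (simp add: power2_eq_iff_nonneg)
qed

text \<open>Rotating \<open>y\<close> by a phase makes the inner product real and non-negative, and
  then the real Cauchy-Schwarz inequality applies.\<close>

lemma cinner_cauchy_schwarz: "cmod (ip x y) <= norm x * norm (y :: 'a::complex_hilbert)"
proof (cases "ip x y = 0")
 case False
 define u where "u = cnj (ip x y) / cmod (ip x y)"
 have u: "cmod u = 1" using False by (simp add: u_def norm_divide)
 have "u * ip x y = of_real (cmod (ip x y))"
  using False complex_norm_square[of "ip x y"] by (simp add: u_def field_simps power2_eq_square)
 then have "cmod (ip x y) = Re (ip x (u *c y))" by (simp add: cinner_scaleC_right)
 also have "... <= norm x * norm (u *c y)" by (simp add: Re_cinner norm_cauchy_schwarz)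
 finally show ?thesis by (simp add: norm_scaleC_hilbert u)
qed simp

lemma cinner_eq_zero_iff: "ip x x = 0 \<longleftrightarrow> x = (0 :: 'a::complex_hilbert)" by (simp add: cinner_self)

lemma cinner_eqI: "(!!z. ip z x = ip z y) ==> x = (y :: 'a::complex_hilbert)"
 using cinner_eq_zero_iff[of "x - y"] by (simp add: cinner_diff_right)

text \<open>Applied to subsets this carries stability under operations to the closure; applied to
  graphs it carries algebraic laws of a densely defined map to its continuous extension.\<close>

lemma closure_op1:
 fixes f :: "'a::topological_space => 'a"
 assumes "continuous_on UNIV f" "!!x. x : C ==> f x : C" "x : closure C"
 shows "f x : closure C" using image_closure_subset[of C f "closure C"] assms closure_subset continuous_on_subset by blast

lemma closure_op2:
 fixes h :: "'a::topological_space => 'a => 'a"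
 assumes "continuous_on UNIV (%p. h (fst p) (snd p))" "!!x y. x : C ==> y : C ==> h x y : C"
  and "x : closure C" "y : closure C"
 shows "h x y : closure C"
proof -
 have "(%p. h (fst p) (snd p)) ` closure (C \<times> C) <= closure C"
  by (rule image_closure_subset[OF continuous_on_subset[OF assms(1)]])
   (use assms(2) closure_subset[of C] in auto)
 moreover have "(x, y) : closure (C \<times> C)" using assms(3,4) by (simp add: closure_Times)
 ultimately show ?thesis by fastforce
qed

lemma bounded_linear_scaleC: "bounded_linear (%x :: 'a::complex_hilbert. c *c x)"
proof
 show "c *c (r *r x) = r *r (c *c x)" for r and x :: 'a by (metis mult.commute scaleC_of_real scaleC_scaleC)
 show "EX K. ALL x :: 'a. norm (c *c x) <= norm x * K"
  by (rule exI[of _ "cmod c"]) (simp add: norm_scaleC_hilbert mult.commute)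
qed (simp add: scaleC_add_right)

lemma bounded_bilinear_cinner: "bounded_bilinear (ip :: 'a::complex_hilbert => _)"
proof
 show "ip (r *r a) b = r *r ip a b" "ip a (r *r b) = r *r ip a b" for r and a b :: 'a
  by (simp_all add: scaleC_of_real[symmetric] cinner_scaleC_left cinner_scaleC_right
    scaleR_conv_of_real)
 show "EX K. ALL a b :: 'a. norm (ip a b) <= norm a * norm b * K" by (rule exI[of _ 1]) (simp add: cinner_cauchy_schwarz)
qed (simp_all add: cinner_add_left cinner_add_right)

lemmas continuous_cinner_scaleC [continuous_intros] = bounded_bilinear.continuous_on[OF bounded_bilinear_cinner]
 bounded_linear.continuous_on[OF bounded_linear_scaleC]

section \<open>Orthogonal projections, the Riesz representation and adjoints\<close>

text \<open>The parallelogram identity at the midpoint of two almost minimal points makes a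
  minimizing sequence Cauchy.\<close>

lemma nearest_point_exists:
 fixes C :: "'a::{real_inner,complete_space} set"
 assumes C: "Real_Vector_Spaces.subspace C" "closed C"
 shows "EX y:C. ALL z:C. norm (x - y) <= norm (x - z)"
proof -
 define I where "I = (INF z\<in>C. (norm (x - z))\<^sup>2)"
 have ne: "C ~= {}" using C(1) by (auto simp: Real_Vector_Spaces.subspace_def)
 have bdd: "bdd_below ((%z. (norm (x - z))\<^sup>2) ` C)" by (rule bdd_belowI2[of _ 0]) simp
 have low: "I <= (norm (x - z))\<^sup>2" if "z : C" for z unfolding I_def by (rule cINF_lower[OF bdd that])
 have "EX z:C. (norm (x - z))\<^sup>2 < I + 1 / real (Suc n)" for n
 proof -
  have "I < I + 1 / real (Suc n)" by simp
  then show ?thesis unfolding I_def using cINF_less_iff[OF ne bdd] by (metis I_def)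
 qed
 then obtain s where s: "!!n. s n : C" "!!n. (norm (x - s n))\<^sup>2 < I + 1 / real (Suc n)" by metis
 have close: "(norm (s m - s n))\<^sup>2 <= 2 / real (Suc m) + 2 / real (Suc n)" for m n
 proof -
  have mid: "(1/2) *r (s m + s n) : C" using C(1) s(1) by (auto simp: Real_Vector_Spaces.subspace_def)
  have "(norm (s m - s n))\<^sup>2 + 4 * (norm (x - (1/2) *r (s m + s n)))\<^sup>2
    = 2 * (norm (x - s m))\<^sup>2 + 2 * (norm (x - s n))\<^sup>2"
   by (simp add: power2_norm_eq_inner inner_simps inner_commute algebra_simps)
  with low[OF mid] s(2)[of m] s(2)[of n] show ?thesis by (simp add: algebra_simps)
 qed
 have "Cauchy s"
 proof (rule metric_CauchyI)
  fix e :: real assume "e > 0"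
  then obtain N where N: "real N > 4 / e\<^sup>2" using reals_Archimedean2 by blast
  have "dist (s m) (s n) < e" if "m >= N" "n >= N" for m n
  proof -
   have "0 < 4 / e\<^sup>2" using \<open>e > 0\<close> by simp
   then have N0: "real N > 0" using N by linarith
   have "2 / real (Suc m) < 2 / real N" "2 / real (Suc n) < 2 / real N"
    using that N0 by (auto intro!: divide_strict_left_mono)
   then have "(norm (s m - s n))\<^sup>2 < 4 / real N" using close[of m n] by linarith
   also have "... < e\<^sup>2" using N N0 \<open>e > 0\<close> by (simp add: field_simps)
   finally show ?thesis using \<open>e > 0\<close> by (simp add: dist_norm power_less_imp_less_base)
  qed
  then show "EX M. ALL m>=M. ALL n>=M. dist (s m) (s n) < e" by blast
 qed
 then obtain y where y: "s ----> y" using Cauchy_convergent_iff convergent_def by blast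
 have yC: "y : C" using C(2) s(1) y closed_sequentially by blast
 have "(%n. (norm (x - s n))\<^sup>2) ----> (norm (x - y))\<^sup>2" by (intro tendsto_intros y)
 moreover have "(%n. I + 1 / real (Suc n)) ----> I + 0" by (intro tendsto_intros LIMSEQ_Suc[OF lim_1_over_n])
 ultimately have le: "(norm (x - y))\<^sup>2 <= I + 0" by (rule LIMSEQ_le[where X = "%n. (norm (x - s n))\<^sup>2"])
   (rule exI[of _ 0], use s(2) in "auto intro: less_imp_le")
 have "norm (x - y) <= norm (x - z)" if "z : C" for z
  
 proof -
  have "(norm (x - y))\<^sup>2 <= (norm (x - z))\<^sup>2" using low[OF that] le by linarith
  then show ?thesis by (rule power2_le_imp_le) simp
 qed
 then show ?thesis using yC by blast
qed

lemma orthogonal_decomposition: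
 fixes C :: "'a::{real_inner,complete_space} set"
 assumes C: "Real_Vector_Spaces.subspace C" "closed C"
 shows "EX y:C. ALL z:C. inner (x - y) z = 0"
proof -
 obtain y where y: "y : C" "!!z. z : C ==> norm (x - y) <= norm (x - z)" using nearest_point_exists[OF C] by blast
 have "inner (x - y) z = 0" if z: "z : C" for z
 proof (cases "z = 0")
  case False
  \<comment> \<open>This \<open>t\<close> minimizes the distance from \<open>x\<close> to the line
    through \<open>y\<close> in direction \<open>z\<close>.\<close>
  define t where "t = inner (x - y) z / (norm z)\<^sup>2"
  have "y + t *r z : C" using C(1) y(1) z by (auto simp: Real_Vector_Spaces.subspace_def)
  then have "(norm (x - y))\<^sup>2 <= (norm (x - (y + t *r z)))\<^sup>2" using y(2) by (simp add: power_mono)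
  also have "... = (norm (x - y))\<^sup>2 - 2 * t * inner (x - y) z + t * t * (norm z)\<^sup>2"
   by (simp add: power2_norm_eq_inner inner_simps inner_commute algebra_simps)
  also have "t * t * (norm z)\<^sup>2 = t * inner (x - y) z" using False by (simp add: t_def power2_eq_square)
  finally have "t * inner (x - y) z <= 0" by simp
  then have "(inner (x - y) z)\<^sup>2 / (norm z)\<^sup>2 <= 0" by (simp add: t_def power2_eq_square)
  with False show ?thesis by (simp add: divide_le_0_iff)
 qed simp
 with y(1) show ?thesis by blast
qed

text \<open>The representing vector is a multiple of a non-zero vector orthogonal to the kernel of
  \<open>f\<close>.\<close>

lemma riesz_representation:
 fixes f :: "'a::{real_inner,complete_space} => real"
 assumes f: "bounded_linear f"
 shows "EX y. ALL x. f x = inner x y"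
proof (cases "ALL x. f x = 0")
 case True
 then show ?thesis by (intro exI[of _ 0]) simp
next
 case False
 then obtain a where a: "f a ~= 0" by blast
 interpret f: bounded_linear f by fact
 define C where "C = {x. f x = 0}"
 have "Real_Vector_Spaces.subspace C" by (auto simp: C_def Real_Vector_Spaces.subspace_def f.add f.zero f.scaleR)
 moreover have "closed C" unfolding C_def by (intro closed_Collect_eq f.continuous_on continuous_on_id continuous_on_const)
 ultimately obtain y where y: "y : C" "!!z. z : C ==> inner (a - y) z = 0" using orthogonal_decomposition by blast
 define b where "b = a - y"
 have fb: "f b = f a" using y(1) by (simp add: b_def f.diff C_def)
 then have b0: "inner b b ~= 0" using a f.zero by auto
 have "f x = inner x ((f b / inner b b) *r b)" for x
 proof -
  have "x - (f x / f b) *r b : C" using a fb by (simp add: C_def f.diff f.scaleR)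
  then have "inner b (x - (f x / f b) *r b) = 0" using y(2) b_def by blast
  then have "inner b x = (f x / f b) * inner b b" by (simp add: inner_simps)
  then show ?thesis using b0 a fb by (simp add: inner_commute)
 qed
 then show ?thesis by blast
qed

text \<open>\<open>adjoint\<close> is a choice operator, so its defining property has to be secured
  by the Riesz representation.\<close>

lemma adjoint_bounded:
 fixes T :: "'a::{real_inner,complete_space} => 'a"
 assumes T: "bounded_linear T"
 shows "inner (T x) y = inner x (adjoint T y)"
proof -
 have "EX z. ALL x. inner (T x) y = inner x z" for y
  by (rule riesz_representation) (rule bounded_linear_inner_left_comp[OF T])
 then have "EX f'. ALL x y. inner (T x) y = inner x (f' y)" by metis
 from someI_ex[OF this] show ?thesis unfolding adjoint_def by blast
qed

lemma adjoint_eqI: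
 fixes T :: "'a::{real_inner,complete_space} => 'a"
 assumes "bounded_linear T" "!!x y. inner (T x) y = inner x (S y)"
 shows "adjoint T = S"
proof
 show "adjoint T y = S y" for y by (metis adjoint_bounded assms vector_eq_ldot)
qed

lemma bounded_linear_adjoint:
 fixes T :: "'a::{real_inner,complete_space} => 'a"
 assumes T: "bounded_linear T"
 shows "bounded_linear (adjoint T)"
proof -
 note adj = adjoint_bounded[OF T]
 obtain K where K: "!!x. norm (T x) <= norm x * K" "K >= 0" using bounded_linear.nonneg_bounded[OF T] by blast
 show ?thesis
 proof
  show "adjoint T (x + y) = adjoint T x + adjoint T y" for x y
   by (rule vector_eq_ldot[THEN iffD1]) (simp add: adj[symmetric] inner_simps)
  show "adjoint T (r *r x) = r *r adjoint T x" for r x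
   by (rule vector_eq_ldot[THEN iffD1]) (simp add: adj[symmetric] inner_simps)
  have "norm (adjoint T x) <= norm x * K" for x
  proof (cases "adjoint T x = 0")
   case True then show ?thesis using K(2) by simp
  next
   case False
   have "(norm (adjoint T x))\<^sup>2 = inner (T (adjoint T x)) x" by (simp add: adj power2_norm_eq_inner)
   also have "... <= norm (T (adjoint T x)) * norm x" by (rule norm_cauchy_schwarz)
   also have "... <= norm (adjoint T x) * K * norm x" by (intro mult_right_mono K) simp
   finally show ?thesis using False by (simp add: power2_eq_square mult.commute)
  qed
  then show "EX K. ALL x. norm (adjoint T x) <= norm x * K" by blast
 qed
qed

lemma conj_bit_simps [simp]: "conj_bit 0 z = z" "conj_bit 1 z = cnj z" "conj_bit s (z + w) = conj_bit s z + conj_bit s w"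
 "conj_bit s (z * w) = conj_bit s z * conj_bit s w" "conj_bit s 0 = 0" "conj_bit s 1 = 1"
 "conj_bit s (conj_bit s z) = z" "cmod (conj_bit s z) = cmod z" "cnj (conj_bit s z) = conj_bit s (cnj z)"
 "conj_bit s (of_real r) = of_real r" "Re (conj_bit s z) = Re z" "conj_bit s (- z) = - conj_bit s z"
 "conj_bit s (z - w) = conj_bit s z - conj_bit s w" "conj_bit s (z / w) = conj_bit s z / conj_bit s w"
 by (simp_all add: conj_bit_def)

lemma adjoint_cinner:
 fixes T :: "'h::complex_hilbert => 'h"
 assumes T: "bounded_op s T"
 shows "ip (T x) y = conj_bit s (ip x (adjoint T y))"
proof -
 have lin: "bounded_linear T" using T by (simp add: bounded_op_def)
 have sc: "T (c *c x) = conj_bit s c *c T x" for c x using T by (simp add: bounded_op_def)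
 note adj = adjoint_bounded[OF lin]
 have 1: "Re (ip (T x) y) = Re (ip x (adjoint T y))" for x y by (simp add: Re_cinner adj)
 \<comment> \<open>The real adjoint controls real parts only; the imaginary part is a real part
   after inserting the imaginary unit, which \<open>T\<close> passes on as itself or as its
   conjugate.\<close>
 have "Im (ip (T x) y) = Re (ip (\<i> *c T x) y)" by (simp add: cinner_scaleC_left)
 also have "\<i> *c T x = T (conj_bit s \<i> *c x)" by (simp add: sc)
 also have "Re (ip (T (conj_bit s \<i> *c x)) y) = Im (conj_bit s (ip x (adjoint T y)))"
  unfolding 1 by (simp add: cinner_scaleC_left conj_bit_def)
 finally show ?thesis by (simp add: complex_eq_iff 1)
qed

lemma bounded_op_adjoint:
 assumes T: "bounded_op s (T :: 'h::complex_hilbert => 'h)"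
 shows "bounded_op s (adjoint T)" unfolding bounded_op_def
proof (intro conjI allI)
 show "bounded_linear (adjoint T)" by (rule bounded_linear_adjoint) (use T in "simp add: bounded_op_def")
 show "adjoint T (c *c x) = conj_bit s c *c adjoint T x" for c x
 proof (rule cinner_eqI)
  fix z
  have "conj_bit s (ip z (adjoint T (c *c x))) = conj_bit s (conj_bit s c * ip z (adjoint T x))"
   by (simp add: adjoint_cinner[OF T, symmetric] cinner_scaleC_right)
  then show "ip z (adjoint T (c *c x)) = ip z (conj_bit s c *c adjoint T x)" by (metis conj_bit_simps(7) cinner_scaleC_right)
 qed
qed

section \<open>The algebra of bounded operators\<close>

lemma bounded_op_add: "bounded_op s S ==> bounded_op s T ==> bounded_op s (%x. S x + T x)"
 by (simp add: bounded_op_def bounded_linear_add scaleC_add_right)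

lemma bounded_op_zero: "bounded_op s (%x. 0)" by (simp add: bounded_op_def)

lemma bounded_op_id: "bounded_op 0 id" by (simp add: bounded_op_def id_def bounded_linear_ident)

lemma bounded_op_scaleC: "bounded_op s T ==> bounded_op s (%x. c *c T x)"
 by (simp add: bounded_op_def bounded_linear_compose[OF bounded_linear_scaleC] scaleC_scaleC mult.commute)

lemma bounded_op_scaleR: "bounded_op s T ==> bounded_op s (%x. r *r T x)"
 using bounded_op_scaleC[of s T "of_real r"] by (simp add: scaleC_of_real)

lemma bounded_op_minus: "bounded_op s T ==> bounded_op s (%x. - T x)" using bounded_op_scaleC[of s T "-1"] by simp

lemma bounded_op_diff: "bounded_op s S ==> bounded_op s T ==> bounded_op s (%x. S x - T x)"
 using bounded_op_add[of s S "%x. - T x"] by (simp add: bounded_op_minus)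

lemma bounded_op_comp: "bounded_op s S ==> bounded_op t T ==> bounded_op (s + t) (S \<circ> T)"
 by (cases s; cases t) (simp_all add: bounded_op_def o_def bounded_linear_compose)

text \<open>The theorem is phrased with functions. A type of its own turns composition into ring
  multiplication, so operator identities become ring identities; \<open>app\<close> and
  \<open>Bop\<close> translate.\<close>

typedef (overloaded) 'h bop = "{T :: 'h::complex_hilbert => 'h. bounded_op 0 T}"
 morphisms app Bop using bounded_op_id by blast

setup_lifting type_definition_bop

instantiation bop :: (complex_hilbert) "{ring, monoid_mult, complex_vector}"
begin

lift_definition zero_bop :: "'a bop" is "%x. 0" by (rule bounded_op_zero)
lift_definition one_bop :: "'a bop" is id by (rule bounded_op_id)
lift_definition plus_bop :: "'a bop => 'a bop => 'a bop" is "%S T x. S x + T x" by (rule bounded_op_add)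
lift_definition minus_bop :: "'a bop => 'a bop => 'a bop" is "%S T x. S x - T x" by (rule bounded_op_diff)
lift_definition uminus_bop :: "'a bop => 'a bop" is "%T x. - T x" by (rule bounded_op_minus)
lift_definition times_bop :: "'a bop => 'a bop => 'a bop" is "%S T. S \<circ> T" using bounded_op_comp by fastforce
lift_definition scaleR_bop :: "real => 'a bop => 'a bop" is "%r T x. r *r T x" by (rule bounded_op_scaleR)
lift_definition scaleC_bop :: "complex => 'a bop => 'a bop" is "%c T x. c *c T x" by (rule bounded_op_scaleC)

instance
proof
 fix a b c :: "'a bop" and r s :: real and z w :: complex
 show "a * (b + c) = a * b + a * c" by transfer (auto simp: fun_eq_iff bounded_op_def linear_simps)
qed (transfer; auto simp: fun_eq_iff algebra_simps scaleC_add_right scaleC_add_left scaleC_of_real scaleC_scaleC)+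

end

lift_definition adj :: "'a::complex_hilbert bop => 'a bop" is adjoint by (rule bounded_op_adjoint)

lemma app_simps [simp]: "app 0 x = 0" "app 1 x = x" "app (S + T) x = app S x + app T x"
 "app (S - T) x = app S x - app T x" "app (- T) x = - app T x" "app (S * T) x = app S (app T x)"
 "app (c *c T) x = c *c app T x" "app (r *r T) x = r *r app T x" by (transfer; simp)+

lemma app_sum: "app (sum f A) x = (SUM i:A. app (f i) x)" by (induction A rule: infinite_finite_induct) simp_all

lemma app_linear [simp]: "app T 0 = 0" "app T (x + y) = app T x + app T y" "app T (x - y) = app T x - app T y"
 "app T (c *c x) = c *c app T x" "app T (r *r x) = r *r app T x" "app T (- x) = - app T x"
 by (transfer; auto simp: bounded_op_def linear_simps)+

lemma app_sum_right: "app T (sum f A) = (SUM i:A. app T (f i))" by (induction A rule: infinite_finite_induct) simp_all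

lemma bounded_op_app: "bounded_op 0 (app T)" using app by blast

lemma bounded_linear_app: "bounded_linear (app T)" using bounded_op_app bounded_op_def by blast

lemma bop_eqI: "(!!x. app S x = app T x) ==> S = T" by (metis app_inject ext)

lemma cinner_adj: "ip (app T x) y = ip x (app (adj T) y)" by transfer (simp add: adjoint_cinner[where s = 0])

lemma cinner_adj': "ip x (app T y) = ip (app (adj T) x) y" by (metis cinner_adj cinner_commute)

lemma adj_eqI: "(!!x y. ip (app T x) y = ip x (app S y)) ==> adj T = S"
 by (intro bop_eqI cinner_eqI) (simp add: cinner_adj[symmetric])

lemma adj_adj [simp]: "adj (adj T) = T" by (rule adj_eqI) (metis cinner_adj')

lemma adj_simps [simp]: "adj 0 = 0" "adj 1 = 1" "adj (S + T) = adj S + adj T"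
 "adj (S - T) = adj S - adj T" "adj (- T) = - adj T" "adj (S * T) = adj T * adj S"
 "adj (c *c T) = cnj c *c adj T"
 by (rule adj_eqI; simp add: cinner_add_left cinner_add_right cinner_diff_left cinner_diff_right
   cinner_minus_left cinner_minus_right cinner_scaleC_left cinner_scaleC_right cinner_adj)+

lemma adj_sum: "adj (sum f A) = (SUM i:A. adj (f i))" by (induction A rule: infinite_finite_induct) simp_all

lemma bop_mult_scaleC [simp]: "(c *c S) * T = c *c (S * T)" "S * (c *c T) = c *c (S * T :: 'a::complex_hilbert bop)"
 by (rule bop_eqI; simp)+

lemma norm_app_adj: "(norm (app T x))\<^sup>2 = Re (ip x (app (adj T * T) x))" by (simp add: cinner_adj' cinner_self)

lemma norm_app_bound: "EX K>=0. ALL x. norm (app T x) <= K * norm x"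
 using bounded_linear.nonneg_bounded[OF bounded_linear_app] by (metis mult.commute)

lemma tendsto_app: "(f \<longlongrightarrow> l) F ==> ((%x. app T (f x)) \<longlongrightarrow> app T l) F"
 by (rule bounded_linear.tendsto[OF bounded_linear_app])

lemmas continuous_on_app [continuous_intros] = bounded_linear.continuous_on[OF bounded_linear_app]

text \<open>The rank-one operator |x><y| of Dirac notation.\<close>

lift_definition ketbra :: "'a::complex_hilbert => 'a => 'a bop" is "%x y z. ip y z *c x"
proof -
 fix x y :: 'a
 show "bounded_op 0 (%z. ip y z *c x)" unfolding bounded_op_def
 proof (intro conjI allI)
  show "bounded_linear (%z. ip y z *c x)"
  proof
   show "ip y (r *r b) *c x = r *r ip y b *c x" for r b
    by (simp add: scaleC_of_real[symmetric] cinner_scaleC_right scaleC_scaleC)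
   have "norm (ip y z *c x) <= norm z * (norm x * norm y)" for z
    using mult_right_mono[OF cinner_cauchy_schwarz[of y z], of "norm x"] by (simp add: norm_scaleC_hilbert mult_ac)
   then show "EX K. ALL z. norm (ip y z *c x) <= norm z * K" by blast
  qed (simp add: cinner_add_right scaleC_add_left)
 qed (simp add: cinner_scaleC_right scaleC_scaleC)
qed

lemma app_ketbra [simp]: "app (ketbra x y) z = ip y z *c x" by transfer simp

lemma adj_ketbra [simp]: "adj (ketbra x y) = ketbra y x"
 by (rule adj_eqI) (simp add: cinner_scaleC_left cinner_scaleC_right, metis cinner_commute mult.commute)

lemma ketbra_mult_left: "T * ketbra x y = ketbra (app T x) y" by (rule bop_eqI) simp

lemma ketbra_mult_right: "ketbra x y * T = ketbra x (app (adj T) y)" by (rule bop_eqI) (simp add: cinner_adj')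

lemma ketbra_mult_ketbra: "ketbra x y * ketbra z w = ip y z *c ketbra x w"
 by (rule bop_eqI) (simp add: scaleC_scaleC cinner_scaleC_right mult.commute)

text \<open>Commutation with the rank-one operator from a fixed vector \<open>e\<close> to
  \<open>x\<close>, evaluated at \<open>e\<close>, shows that \<open>T x\<close> is a multiple of
  \<open>x\<close> by a factor independent of \<open>x\<close>.\<close>

lemma central_bop_scalar:
 fixes T :: "'a::complex_hilbert bop"
 assumes "!!S. T * S = S * T"
 shows "EX c. T = c *c 1"
proof (cases "ALL x :: 'a. x = 0")
 case True
 then show ?thesis by (metis bop_eqI)
next
 case False
 then obtain e :: 'a where e: "e ~= 0" by blast
 define c where "c = ip e (app T e) / ip e e"
 have "app T x = c *c x" for x
 proof -
  have "app (T * ketbra x e) e = app (ketbra x e * T) e" by (simp only: assms)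
  then have "ip e e *c app T x = ip e (app T e) *c x" by simp
  then have "(1 / ip e e) *c ip e e *c app T x = (1 / ip e e) *c ip e (app T e) *c x" by simp
  then show ?thesis using e by (simp add: scaleC_scaleC cinner_eq_zero_iff c_def)
 qed
 then show ?thesis by (intro exI[of _ c] bop_eqI) simp
qed

lemma projection_onto_closed_subspace:
 fixes C :: "'a::complex_hilbert set"
 assumes C: "closed C" "0 : C" "!!x y. x : C ==> y : C ==> x + y : C" "!!c x. x : C ==> c *c x : C"
 obtains P where "P * P = P" "adj P = P" "!!x. app P x : C" "!!x. x : C ==> app P x = x"
proof -
 have "Real_Vector_Spaces.subspace C" using C by (auto simp: Real_Vector_Spaces.subspace_def scaleC_of_real[symmetric])
 then have "EX y:C. ALL z:C. inner (x - y) z = 0" for x using orthogonal_decomposition C(1) by blast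
 then obtain p where p: "!!x. p x : C" "!!x z. z : C ==> inner (x - p x) z = 0" by metis
 \<comment> \<open>Real orthogonality to a complex subspace is complex orthogonality: test with
   \<open>z\<close> and with its multiple by \<open>- \<i>\<close>.\<close>
 have orth: "ip (x - p x) z = 0" if "z : C" for x z
 proof -
  have "Re (ip (x - p x) z) = 0" "Re (ip (x - p x) ((- \<i>) *c z)) = 0" using p(2) that C(4) by (simp_all only: Re_cinner)
  then show ?thesis by (simp add: complex_eq_iff cinner_scaleC_right cinner_minus_right)
 qed
 have uniq: "p x = y" if "y : C" "!!z. z : C ==> ip (x - y) z = 0" for x y
 proof -
  have d: "p x - y : C" using C(3)[OF p(1)[of x] C(4)[OF that(1), of "-1"]] by simp
  have "ip (p x - y) (p x - y) = ip (x - y) (p x - y) - ip (x - p x) (p x - y)" by (simp add: cinner_diff_left)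
  then have "ip (p x - y) (p x - y) = 0" using that(2) orth d by simp
  then show ?thesis by (simp add: cinner_eq_zero_iff)
 qed
 have p_add: "p (x + y) = p x + p y" for x y
 proof (rule uniq)
  fix z assume "z : C"
  then show "ip (x + y - (p x + p y)) z = 0"
   using orth[of z x] orth[of z y] by (simp add: cinner_diff_left cinner_add_left algebra_simps)
 qed (use p C in auto)
 have p_scale: "p (c *c x) = c *c p x" for c x
 proof (rule uniq)
  fix z assume "z : C"
  then show "ip (c *c x - c *c p x) z = 0"
   using orth[of z x] by (simp add: cvs.scale_right_diff_distrib[symmetric] cinner_scaleC_left)
 qed (use p C in auto)
 have p_norm: "norm (p x) <= norm x" for x
 proof (cases "p x = 0")
  case False
  have "ip (p x) (p x) = ip x (p x)" using orth[OF p(1), of x x] by (simp add: cinner_diff_left)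
  then have "(norm (p x))\<^sup>2 = Re (ip x (p x))" by (metis Re_complex_of_real cinner_self)
  also have "... <= norm x * norm (p x)" by (simp add: Re_cinner norm_cauchy_schwarz)
  finally show ?thesis using False by (simp add: power2_eq_square)
 qed simp
 have bnd: "bounded_op 0 p" unfolding bounded_op_def
 proof (intro conjI allI)
  show "bounded_linear p"
  proof
   show "p (r *r x) = r *r p x" for r x using p_scale[of "of_real r"] by (simp add: scaleC_of_real)
   show "EX K. ALL x. norm (p x) <= norm x * K" by (rule exI[of _ 1]) (simp add: p_norm)
  qed (rule p_add)
 qed (simp add: p_scale)
 have P: "app (Bop p) = p" using bnd by (simp add: Bop_inverse)
 have fixp: "p x = x" if "x : C" for x by (rule uniq) (use that in auto)
 have "adj (Bop p) = Bop p"
 proof (rule adj_eqI)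
  fix x y
  have "ip (p x) y = ip (p x) (p y)"
   using orth[OF p(1)[of x], of y] by (metis cinner_commute cinner_diff_left eq_iff_diff_eq_0 )
  also have "... = ip x (p y)" using orth[OF p(1)[of y], of x] by (simp add: cinner_diff_left)
  finally show "ip (app (Bop p) x) y = ip x (app (Bop p) y)" by (simp add: P)
 qed
 moreover have "Bop p * Bop p = Bop p" by (rule bop_eqI) (simp add: P fixp p)
 ultimately show thesis using that[of "Bop p"] p(1) fixp by (simp add: P)
qed

section \<open>Unitary and anti-unitary conjugation\<close>

lemma unitary_op_adjoint:
 assumes Y: "unitary_op s (Y :: 'a::complex_hilbert => 'a)"
 shows "adjoint Y (Y x) = x" "Y (adjoint Y x) = x"
proof -
 have b: "bounded_op s Y" and i: "!!x y. ip (Y x) (Y y) = conj_bit s (ip x y)" and "surj Y"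
  using Y by (auto simp: unitary_op_def)
 have *: "adjoint Y (Y x) = x" for x
 proof (rule cinner_eqI)
  fix z
  have "conj_bit s (ip z (adjoint Y (Y x))) = conj_bit s (ip z x)" by (metis adjoint_cinner[OF b] i)
  then show "ip z (adjoint Y (Y x)) = ip z x" by (metis conj_bit_simps(7))
 qed
 show "adjoint Y (Y x) = x" by (rule *)
 show "Y (adjoint Y x) = x" using \<open>surj Y\<close> * by (metis surjD)
qed

lemma unitary_op_inverse:
 assumes Y: "unitary_op s (Y :: 'a::complex_hilbert => 'a)"
 shows "unitary_op s (adjoint Y)" "adjoint (adjoint Y) = Y"
proof -
 have b: "bounded_op s Y" using Y by (simp add: unitary_op_def)
 have b': "bounded_op s (adjoint Y)" by (rule bounded_op_adjoint[OF b])
 note u = unitary_op_adjoint[OF Y]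
 show "unitary_op s (adjoint Y)" unfolding unitary_op_def
 proof (intro conjI allI)
  show "surj (adjoint Y)" using u(1) by (metis surjI)
  show "ip (adjoint Y x) (adjoint Y y) = conj_bit s (ip x y)" for x y
  proof -
   have "ip x y = conj_bit s (ip (adjoint Y x) (adjoint Y y))" using Y u(2) unfolding unitary_op_def by metis
   then show ?thesis by simp
  qed
 qed (rule b')
 have "bounded_linear (adjoint Y)" using b' by (simp add: bounded_op_def)
 moreover have "bounded_linear Y" using b by (simp add: bounded_op_def)
 moreover have "inner (adjoint Y x) y = inner x (Y y)" for x y
  using adjoint_bounded[OF \<open>bounded_linear Y\<close>, of y x] by (simp add: inner_commute)
 ultimately show "adjoint (adjoint Y) = Y" by (intro adjoint_eqI)
qed

text \<open>Also for an anti-unitary \<open>Y\<close> the conjugate of a linear operator is linear.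
  The lift must give a bounded operator for every function \<open>Y\<close>, hence the default
  \<open>T\<close>.\<close>

lift_definition conj_by :: "('a::complex_hilbert => 'a) => 'a bop => 'a bop" is
 "%Y T. if (EX s. unitary_op s Y) then op_Ad Y T else T"
proof -
 fix Y T :: "'a => 'a" assume T: "bounded_op 0 T"
 have "bounded_op 0 (op_Ad Y T)" if Y: "unitary_op s Y" for s
 proof -
  have b: "bounded_op s Y" using Y by (simp add: unitary_op_def)
  then have "bounded_op (s + 0 + s) (Y \<circ> T \<circ> adjoint Y)" by (intro bounded_op_comp bounded_op_adjoint T)
  then show ?thesis by (cases s) (simp_all add: op_Ad_def)
 qed
 with T show "bounded_op 0 (if (EX s. unitary_op s Y) then op_Ad Y T else T)" by auto
qed

lemma app_conj_by: "unitary_op s Y ==> app (conj_by Y T) x = Y (app T (adjoint Y x))" by transfer (auto simp: op_Ad_def)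

lemma unitary_op_linear:
 assumes "unitary_op s (Y :: 'a::complex_hilbert => 'a)"
 shows "Y (x + y) = Y x + Y y" "Y (x - y) = Y x - Y y" "Y 0 = 0" "Y (- x) = - Y x" "Y (c *c x) = conj_bit s c *c Y x"
  "ip (Y x) (Y y) = conj_bit s (ip x y)" "norm (Y x) = norm x"
proof -
 have i: "ip (Y x) (Y y) = conj_bit s (ip x y)" for x y using assms by (simp add: unitary_op_def)
 have "bounded_linear Y" using assms by (simp add: unitary_op_def bounded_op_def)
 then show "Y (x + y) = Y x + Y y" "Y (x - y) = Y x - Y y" "Y 0 = 0" "Y (- x) = - Y x" by (simp_all add: linear_simps)
 show "Y (c *c x) = conj_bit s c *c Y x" using assms by (simp add: unitary_op_def bounded_op_def)
 show "ip (Y x) (Y y) = conj_bit s (ip x y)" by (rule i)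
 show "norm (Y x) = norm x" using i[of x x] by (simp add: cinner_self del: of_real_power)
qed

lemma conj_by_simps:
 assumes "unitary_op s Y"
 shows "conj_by Y (S * T) = conj_by Y S * conj_by Y T" "conj_by Y (S + T) = conj_by Y S + conj_by Y T"
  "conj_by Y (S - T) = conj_by Y S - conj_by Y T" "conj_by Y 1 = 1" "conj_by Y 0 = 0"
  "conj_by Y (- T) = - conj_by Y T"
  "conj_by Y (c *c T) = conj_bit s c *c conj_by Y T" "adj (conj_by Y T) = conj_by Y (adj T)"
  "conj_by (adjoint Y) (conj_by Y T) = T" "conj_by Y (conj_by (adjoint Y) T) = T"
proof -
 note u = unitary_op_adjoint[OF assms] unitary_op_inverse[OF assms] unitary_op_linear[OF assms]
 note a = app_conj_by[OF assms] app_conj_by[OF u(3)]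
 show "conj_by Y (S * T) = conj_by Y S * conj_by Y T" "conj_by Y (S + T) = conj_by Y S + conj_by Y T"
  "conj_by Y (S - T) = conj_by Y S - conj_by Y T" "conj_by Y 1 = 1" "conj_by Y 0 = 0"
  "conj_by Y (- T) = - conj_by Y T"
  "conj_by Y (c *c T) = conj_bit s c *c conj_by Y T"
  "conj_by (adjoint Y) (conj_by Y T) = T" "conj_by Y (conj_by (adjoint Y) T) = T"
  by (rule bop_eqI; simp add: a u(1,2) u(4-))+
 show "adj (conj_by Y T) = conj_by Y (adj T)"
 proof (rule adj_eqI)
  fix x y
  have "ip (Y (app T (adjoint Y x))) y = conj_bit s (ip (app T (adjoint Y x)) (adjoint Y y))" by (metis u(2) u(10))
  also have "... = conj_bit s (ip (adjoint Y x) (app (adj T) (adjoint Y y)))" by (simp add: cinner_adj)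
  also have "... = ip x (Y (app (adj T) (adjoint Y y)))" by (metis u(2) u(10))
  finally show "ip (app (conj_by Y T) x) y = ip x (app (conj_by Y (adj T)) y)" by (simp add: a)
 qed
qed

lemma conj_by_sum: "unitary_op s Y ==> conj_by Y (sum f A) = (SUM i:A. conj_by Y (f i))"
 by (induction A rule: infinite_finite_induct) (simp_all add: conj_by_simps)

section \<open>C*-algebras\<close>

lemma cstar_zero [simp]: "cstar 0 = (0 :: 'a::cstar_algebra)" using cstar_scaleC[of 0 "0 :: 'a"] by simp

lemma cstar_one [simp]: "cstar 1 = (1 :: 'a::cstar_algebra)" by (metis cstar_cstar cstar_mult mult_1_left mult_1_right)

lemma cstar_minus: "cstar (- x) = - cstar (x :: 'a::cstar_algebra)" using cstar_scaleC[of "-1" x] by simp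

lemma cstar_diff: "cstar (x - y) = cstar x - cstar (y :: 'a::cstar_algebra)"
 using cstar_add[of x "- y"] by (simp add: cstar_minus)

lemma cstar_sum: "cstar (sum f A) = (SUM i:A. cstar (f i :: 'a::cstar_algebra))"
 by (induction A rule: infinite_finite_induct) (simp_all add: cstar_add)

lemma cstar_scaleR: "cstar (r *r x) = r *r cstar (x :: 'a::cstar_algebra)"
 by (simp add: scaleC_of_real[symmetric] cstar_scaleC)

lemmas cstar_simps = cstar_cstar cstar_add cstar_mult cstar_scaleC cstar_minus cstar_diff cstar_sum
 cstar_scaleR

lemma norm_cstar: "norm (cstar x) = norm (x :: 'a::cstar_algebra)"
proof -
 have "norm x <= norm (cstar x)" for x :: 'a
 proof (cases "x = 0")
  case False
  have "norm x * norm x <= norm (cstar x) * norm x"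
   using norm_mult_ineq[of "cstar x" x] by (simp add: norm_cstar_mult power2_eq_square)
  with False show ?thesis by simp
 qed simp
 from this[of x] this[of "cstar x"] show ?thesis by (simp add: cstar_cstar)
qed

lemma bounded_linear_cstar: "bounded_linear (cstar :: 'a::cstar_algebra => 'a)"
 by standard (auto simp: cstar_add cstar_scaleR norm_cstar intro: exI[of _ 1])

lemma bounded_linear_scaleC_cstar: "bounded_linear (%x :: 'a::cstar_algebra. c *c x)"
proof
 show "c *c (r *r x) = r *r (c *c x)" for r and x :: 'a by (metis mult.commute scaleC_of_real scaleC_scaleC)
 show "EX K. ALL x :: 'a. norm (c *c x) <= norm x * K" by (rule exI[of _ "cmod c"]) (simp add: norm_scaleC mult.commute)
qed (simp add: scaleC_add_right)

lemmas continuous_cstar_scaleC [continuous_intros] = bounded_linear.continuous_on[OF bounded_linear_cstar]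
 bounded_linear.continuous_on[OF bounded_linear_scaleC_cstar]

lemma bounded_linear_scaleC_left: "bounded_linear (%c. c *c (x :: 'a::cstar_algebra))"
proof
 show "(r *r c) *c x = r *r (c *c x)" for r c by (simp add: scaleC_of_real[symmetric] scaleC_scaleC scaleR_conv_of_real)
 show "EX K. ALL c. norm (c *c x) <= norm c * K" by (rule exI[of _ "norm x"]) (simp add: norm_scaleC)
qed (simp add: scaleC_add_left)

text \<open>The square root is the binomial series of \<open>(1 - h)\<^sup>1\<^sup>/\<^sup>2\<close>.\<close>

lemma sqrt_one_minus:
 fixes h :: "'a::cstar_algebra"
 assumes h: "cstar h = h" "norm h < 1"
 obtains k where "cstar k = k" "k * k = 1 - h" "!!y. h * y = y * h ==> k * y = y * k"
proof -
 define c :: "nat => real" where "c n = ((1/2) gchoose n) * (- 1) ^ n" for n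
 define f where "f n = c n *r h ^ n" for n
 obtain r where r: "norm h < r" "r < 1" using h(2) dense by blast
 then have r0: "0 < r" using norm_ge_zero[of h] by linarith
 have "summable (%n. ((1/2) gchoose n) * r ^ n)" using gen_binomial_real[of r "1/2"] r r0 by (auto simp: summable_def)
 then have "summable (%n. norm (((1/2) gchoose n) * norm h ^ n))" by (rule powser_insidea) (use r r0 in auto)
 then have sf: "summable (%n. norm (f n))"
 proof (rule summable_comparison_test'[where N = 0])
  fix n
  have "norm (h ^ n) <= norm h ^ n" by (rule norm_power_ineq)
  then show "norm (norm (f n)) <= norm (((1/2) gchoose n) * norm h ^ n)"
   by (simp add: f_def c_def abs_mult power_abs mult_left_mono)
 qed
 define k where "k = suminf f"
 have sums_k: "f sums k" using summable_norm_cancel[OF sf] by (simp add: k_def summable_sums)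
 have star: "cstar (f n) = f n" for n
 proof -
  have "cstar (h ^ n) = h ^ n" by (induction n) (simp_all add: cstar_mult h power_commutes)
  then show ?thesis by (simp add: f_def cstar_scaleR)
 qed
 have "(%n. cstar (f n)) sums cstar k" by (rule bounded_linear.sums[OF bounded_linear_cstar sums_k])
 then have k_star: "cstar k = k" using sums_k by (simp add: star sums_unique2)
 have "(%n. SUM i<=n. f i * f (n - i)) sums (k * k)" unfolding k_def by (rule Cauchy_product_sums[OF sf sf])
 moreover have "(SUM i<=n. f i * f (n - i)) = (if n = 0 then 1 else if n = 1 then - h else 0)" for n
 proof -
  have "(SUM i<=n. f i * f (n - i)) = (SUM i<=n. c i * c (n - i)) *r h ^ n" unfolding scaleR_sum_left
   by (rule sum.cong) (auto simp: f_def power_add[symmetric])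
  also have "(SUM i<=n. c i * c (n - i)) = (SUM i<=n. ((1/2) gchoose i) * ((1/2) gchoose (n - i))) * (- 1) ^ n"
   unfolding sum_distrib_right
  proof (rule sum.cong)
   fix i assume "i : {..n}"
   then have "(- 1 :: real) ^ i * (- 1) ^ (n - i) = (- 1) ^ n" by (simp add: power_add[symmetric])
   moreover have "c i * c (n - i) = ((1/2) gchoose i) * ((1/2) gchoose (n - i)) * ((- 1) ^ i * (- 1) ^ (n - i))"
    by (simp only: c_def mult_ac)
   ultimately show "c i * c (n - i) = ((1/2) gchoose i) * ((1/2) gchoose (n - i)) * (- 1) ^ n" by simp
  qed simp
  \<comment> \<open>Vandermonde: the coefficients of the squared series are those of the first power
    of \<open>1 - h\<close>.\<close>
  also have "(SUM i<=n. ((1/2) gchoose i) * ((1/2 :: real) gchoose (n - i))) = of_nat (1 choose n)"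
   using gbinomial_Vandermonde[of "1/2 :: real" "1/2" n] by (simp add: binomial_gbinomial atLeast0AtMost)
  finally show ?thesis by (auto simp: binomial_eq_0)
 qed
 ultimately have "(%n. if n = 0 then 1 else if n = 1 then - h else 0) sums (k * k)" by simp
 moreover have "(%n. if n = 0 then 1 else if n = 1 then - h else 0) sums (SUM n:{0, 1 :: nat}. if n = 0 then 1 else if n = 1 then - h else 0)"
  by (rule sums_finite) auto
 ultimately have kk: "k * k = 1 - h" using sums_unique2 by fastforce
 have comm: "k * y = y * k" if "h * y = y * h" for y
 proof -
  have "h ^ n * y = y * h ^ n" for n by (induction n) (simp_all add: that mult.assoc, metis mult.assoc that)
  then have "(%n. f n * y) = (%n. y * f n)" by (simp add: f_def)
  moreover have "(%n. f n * y) sums (k * y)" by (rule sums_mult2[OF sums_k])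
  moreover have "(%n. y * f n) sums (y * k)" by (rule sums_mult[OF sums_k])
  ultimately show ?thesis using sums_unique2 by metis
 qed
 from that[OF k_star kk comm] show thesis .
qed

text \<open>Exhibits t^2 - x*x as positive in the form k*k. A *-representation preserves this form,
  which bounds the image of \<open>x\<close>.\<close>

lemma positive_complement:
 fixes x :: "'a::cstar_algebra"
 assumes "norm x < t"
 obtains k where "cstar k * k = of_real (t\<^sup>2) *c 1 - cstar x * x"
proof -
 have t: "0 < t" using assms norm_ge_zero[of x] by linarith
 define h where "h = (1 / t\<^sup>2) *r (cstar x * x)"
 have "cstar h = h" by (simp add: h_def cstar_simps)
 moreover have "norm h < 1" using assms t by (simp add: h_def norm_cstar_mult power_strict_mono)
 ultimately obtain k where k: "cstar k = k" "k * k = 1 - h" using sqrt_one_minus by blast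
 have "cstar (t *r k) * (t *r k) = of_real (t\<^sup>2) *c 1 - cstar x * x"
  using k t by (simp add: cstar_scaleR h_def scaleR_right_diff_distrib power2_eq_square scaleC_of_real
   flip: of_real_mult)
 then show thesis using that by blast
qed

text \<open>A self-adjoint \<open>h\<close> of norm below 1 is the real part of the unitary \<open>h + \<i> (1 - h\<^sup>2)\<^sup>1\<^sup>/\<^sup>2\<close>,
 and unital *-homomorphisms preserve unitaries.\<close>

lemma star_hom_contractive:
 fixes f :: "'a::cstar_algebra => 'b::cstar_algebra"
 assumes f: "!!x y. f (x + y) = f x + f y" "!!x y. f (x * y) = f x * f y" "f 1 = 1"
  "!!x. f (cstar x) = cstar (f x)" "!!c x. f (c *c x) = conj_bit s c *c f x"
 shows "norm (f x) <= norm x"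
proof -
 have fd: "f (x - y) = f x - f y" for x y using f(1)[of "x - y" y] by simp
 have fR: "f (r *r x) = r *r f x" for r x using f(5)[of "of_real r" x] by (simp add: scaleC_of_real)
 have unit: "norm u <= 1" if "cstar u * u = 1" for u :: 'b using norm_cstar_mult[of u] that by (auto simp: power2_eq_1_iff)
 have sa: "norm (f h) <= 1" if h: "cstar h = h" "norm h < 1" for h
 proof -
  have "norm (h * h) < 1" using norm_cstar_mult[of h] h by (simp add: power_less_one_iff abs_square_less_1)
  then obtain k where k: "cstar k = k" "k * k = 1 - h * h" "!!y. h * h * y = y * (h * h) ==> k * y = y * k"
   using sqrt_one_minus[of "h * h"] h by (metis cstar_mult)
  have kh: "k * h = h * k" by (rule k(3)) (simp add: mult.assoc)
  define u where "u c = h + (c * \<i>) *c k" for c :: complex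
  have u: "cstar (u c) * u c = 1" if "c = 1 \<or> c = - 1" for c
   using that k(2) by (auto simp: u_def cstar_simps h k(1) algebra_simps mult_scaleC_left mult_scaleC_right scaleC_scaleC kh)
  have "norm (f (u c)) <= 1" if "c = 1 \<or> c = - 1" for c using u[OF that] f(2,3,4) by (intro unit) metis
  from this[of 1] this[of "- 1"] have "norm (f (u 1) + f (u (- 1))) <= 2" by (intro order_trans[OF norm_triangle_ineq]) simp
  moreover have "f (u 1) + f (u (- 1)) = 2 *r f h" by (simp add: u_def f(1)[symmetric] fR[symmetric] scaleR_2)
  ultimately show ?thesis by simp
 qed
 \<comment> \<open>The C*-identity reduces to the self-adjoint x*x, scaled by \<open>1 / t\<close>;
   the \<open>e\<close> in \<open>t\<close> keeps its norm strictly below 1.\<close>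
 have "(norm (f x))\<^sup>2 <= (norm x)\<^sup>2"
 proof (rule field_le_epsilon)
  fix e :: real assume e: "0 < e"
  define t where "t = (norm x)\<^sup>2 + e"
  have t: "0 < t" using e by (simp add: t_def add_nonneg_pos)
  have "norm (f ((1 / t) *r (cstar x * x))) <= 1"
   using e t by (intro sa) (simp_all add: cstar_simps norm_cstar_mult, simp add: t_def)
  then show "(norm (f x))\<^sup>2 <= (norm x)\<^sup>2 + e" using t by (simp add: fR f norm_cstar_mult t_def)
 qed
 then show ?thesis by simp
qed

text \<open>\<open>bop\<close> carries no norm, so contractivity is stated vectorwise. The operator
  of t^2 - x*x is positive for every \<open>t\<close> above the norm of \<open>x\<close>.\<close>

lemma hom_bop_bound:
 fixes pi :: "'a::cstar_algebra => 'h::complex_hilbert bop"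
 assumes pi: "!!x y. pi (x + y) = pi x + pi y" "!!x y. pi (x * y) = pi x * pi y" "pi 1 = 1"
  "!!x. pi (cstar x) = adj (pi x)" "!!c x. pi (c *c x) = c *c pi x"
 shows "norm (app (pi x) xi) <= norm x * norm xi"
proof -
 have pid: "pi (x - y) = pi x - pi y" for x y using pi(1)[of "x - y" y] by simp
 have *: "norm (app (pi x) xi) <= t * norm xi" if t: "norm x < t" for t
 proof -
  have t0: "0 < t" using t norm_ge_zero[of x] by linarith
  obtain k where k: "cstar k * k = of_real (t\<^sup>2) *c 1 - cstar x * x" using positive_complement[OF t] .
  have "(norm (app (pi k) xi))\<^sup>2 = Re (ip xi (app (pi (cstar k * k)) xi))" by (simp only: norm_app_adj pi)
  also have "... = t\<^sup>2 * (norm xi)\<^sup>2 - (norm (app (pi x) xi))\<^sup>2"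
   unfolding k by (simp add: pid pi norm_app_adj cinner_diff_right cinner_scaleC_right cinner_self
     flip: of_real_power of_real_mult)
  finally have "(norm (app (pi x) xi))\<^sup>2 <= (t * norm xi)\<^sup>2"
   by (simp add: power_mult_distrib) (metis diff_ge_0_iff_ge zero_le_power2)
  then show ?thesis by (rule power2_le_imp_le) (use t0 in simp)
 qed
 show ?thesis
 proof (cases "norm xi = 0")
  case False
  show ?thesis
  proof (rule field_le_epsilon)
   fix e :: real assume "0 < e"
   then have "norm x < norm x + e / norm xi" using False by simp
   from *[OF this] show "norm (app (pi x) xi) <= norm x * norm xi + e" using False by (simp add: distrib_right)
  qed
 qed simp
qed

text \<open>Carrying \<open>Q\<close> for an element and its adjoint together removes the adjoint
  step from the induction.\<close>

lemma star_alg_gen_sym_induct [consumes 1, case_names base one add scaleC mult]: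
 assumes A: "A : star_alg_gen S" and Q: "!!x. x : S ==> Q x & Q (cstar x)" "Q 1" "!!x y. Q x ==> Q y ==> Q (x + y)"
  "!!x c. Q x ==> Q (c *c x)" "!!x y. Q x ==> Q y ==> Q (x * y)"
 shows "Q A"
proof -
 have "Q A & Q (cstar A)" using A by induction (simp_all add: Q cstar_simps)
 then show ?thesis ..
qed

lemma closure_star_alg_gen:
 fixes S :: "'a::cstar_algebra set"
 defines "B \<equiv> closure (star_alg_gen S)"
 shows "x : S ==> x : B" "1 : B" "x : B ==> y : B ==> x + y : B" "x : B ==> c *c x : B"
  "x : B ==> y : B ==> x * y : B" "x : B ==> cstar x : B"
proof -
 show "x : S ==> x : B" "1 : B" unfolding B_def using closure_subset star_alg_gen.base star_alg_gen.one by blast+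
qed (unfold B_def, (rule closure_op2[where h = "(+)"] closure_op1[where f = "%x. c *c x"]
  closure_op2[where h = "(*)"] closure_op1[where f = cstar]; auto intro!: continuous_intros intro: star_alg_gen.intros)+)

lemma closure_star_alg_gen_subset:
 fixes S :: "'a::cstar_algebra set"
 assumes "S <= closure (star_alg_gen T)"
 shows "closure (star_alg_gen S) <= closure (star_alg_gen T)"
proof (rule closure_minimal)
 show "star_alg_gen S <= closure (star_alg_gen T)"
 proof
  fix x assume "x : star_alg_gen S"
  then show "x : closure (star_alg_gen T)" by induction (use assms in "auto intro: closure_star_alg_gen(2-6)")
 qed
qed simp

section \<open>Finitely many fermionic modes\<close>

text \<open>\<open>crea c k mu\<close> is the ordered product of the creation operators of the modes in \<open>mu\<close> below \<open>k\<close>, and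
 \<open>vac c k\<close> is the projection onto the vacuum of the first \<open>k\<close> modes.\<close>

fun crea :: "(nat => 'a::cstar_algebra) => nat => nat set => 'a" where
 "crea c 0 mu = 1"
| "crea c (Suc k) mu = crea c k mu * (if k : mu then cstar (c k) else 1)"

fun vac :: "(nat => 'a::cstar_algebra) => nat => 'a" where
 "vac c 0 = 1"
| "vac c (Suc k) = vac c k * (c k * cstar (c k))"

text \<open>Abstract form of |mu><nu|: empty the modes in \<open>nu\<close>, project onto the
  vacuum, fill the modes in \<open>mu\<close>.\<close>

definition munit :: "(nat => 'a::cstar_algebra) => nat => nat set => nat set => 'a" where
 "munit c k mu nu = crea c k mu * vac c k * cstar (crea c k nu)"

text \<open>The Jordan-Wigner sign for moving mode \<open>i\<close> past the occupied modes below
  it.\<close>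

definition sg :: "nat => nat set => complex" where
 "sg i mu = (- 1) ^ card {j : mu. j < i}"

lemma sg_simps [simp]: "cnj (sg i mu) = sg i mu" "sg i mu * sg i mu = 1" "sg i mu ~= 0" "cmod (sg i mu) = 1"
 "conj_bit s (sg i mu) = sg i mu" by (simp_all add: sg_def conj_bit_def norm_power flip: power_mult_distrib)

lemma sg_Suc: "sg (Suc i) mu = (if i : mu then - sg i mu else sg i mu)"
proof -
 have "{j : mu. j < Suc i} = (if i : mu then insert i {j : mu. j < i} else {j : mu. j < i})" by (auto simp: less_Suc_eq)
 then show ?thesis by (simp add: sg_def)
qed

lemma crea_cong: "mu \<inter> {..<k} = nu \<inter> {..<k} ==> crea c k mu = crea c k nu"
proof (induction k)
 case (Suc k)
 have *: "x : mu \<longleftrightarrow> x : nu" if "x < Suc k" for x using Suc.prems that by blast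
 have "mu \<inter> {..<k} = nu \<inter> {..<k}" using * less_SucI by blast
 then show ?case using Suc.IH *[of k] by simp
qed simp

lemma crea_empty [simp]: "crea c k {} = 1" by (induction k) auto

lemma crea_insert [simp]: "k <= i ==> crea c k (insert i mu) = crea c k mu" by (rule crea_cong) auto

lemma crea_diff [simp]: "k <= i ==> crea c k (mu - {i}) = crea c k mu" by (rule crea_cong) auto

text \<open>Kept abstract because it is used for several families: the modes of one site, those of a
  block of sites, and their images under a Bogoliubov map.\<close>

locale car_modes =
 fixes c :: "nat => 'a::cstar_algebra" and n :: nat
 assumes anti: "i < n ==> j < n ==> c i * c j = - (c j * c i)"
  and anti_star: "i < n ==> j < n ==> c i * cstar (c j) = (if i = j then 1 else 0) - cstar (c j) * c i"
begin

abbreviation PN where "PN \<equiv> Pow {..<n}"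
abbreviation mun where "mun \<equiv> munit c n"

lemma sq_zero: "i < n ==> c i * c i = 0"
 using anti[of i i] by (metis eq_neg_iff_add_eq_0 scaleR_2 scaleR_eq_0_iff zero_neq_numeral)

lemma anti_cstar: "i < n ==> j < n ==> cstar (c i) * cstar (c j) = - (cstar (c j) * cstar (c i))"
 using arg_cong[OF anti[of j i], of cstar] by (simp add: cstar_simps)

lemma sq_zero_cstar: "i < n ==> cstar (c i) * cstar (c i) = 0"
 using arg_cong[OF sq_zero[of i], of cstar] by (simp add: cstar_simps)

lemma crea_anti_gen:
 assumes "k <= i" "i < n" "x = c i \<or> x = cstar (c i)"
 shows "x * crea c k mu = sg k mu *c (crea c k mu * x)" using assms
proof (induction k)
 case 0
 show ?case by (simp add: sg_def)
next
 case (Suc k)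
 have k: "k < n" "i ~= k" using Suc.prems by auto
 have x: "x * cstar (c k) = - (cstar (c k) * x)" using Suc.prems(2,3) k anti_star[of i k] anti_cstar[of i k] by auto
 have "x * crea c (Suc k) mu = (x * crea c k mu) * (if k : mu then cstar (c k) else 1)" by (simp add: mult.assoc)
 also have "... = sg k mu *c (crea c k mu * (x * (if k : mu then cstar (c k) else 1)))"
  using Suc by (simp add: mult.assoc mult_scaleC_left)
 also have "... = sg (Suc k) mu *c (crea c (Suc k) mu * x)" by (simp add: sg_Suc x mult.assoc)
 finally show ?case .
qed

lemmas crea_anti = crea_anti_gen[OF _ _ disjI1[OF refl]] crea_anti_gen[OF _ _ disjI2[OF refl]]

lemma cstar_crea:
 assumes "i < k" "k <= n"
 shows "cstar (c i) * crea c k mu = (if i : mu then 0 else sg i mu *c crea c k (insert i mu))" using assms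
proof (induction k)
 case (Suc k)
 show ?case
 proof (cases "i = k")
  case True
  then show ?thesis using Suc.prems crea_anti(2)[of k i mu] sq_zero_cstar[of k]
   by (simp add: mult.assoc[symmetric] mult_scaleC_left) (simp add: mult.assoc)
 next
  case False
  then show ?thesis using Suc by (simp add: mult.assoc[symmetric] mult_scaleC_left)
 qed
qed simp

text \<open>Wick expansion: the annihilator is contracted with the creator of its own mode, or it
  passes to the right with a sign.\<close>

lemma annihilate_crea:
 assumes "i < k" "k <= n"
 shows "c i * crea c k mu = (if i : mu then sg i mu *c crea c k (mu - {i}) else 0) + sg k mu *c (crea c k mu * c i)"
 using assms
proof (induction k)
 case (Suc k)
 show ?case
 proof (cases "i = k")
  case True
  have "c i * crea c (Suc k) mu = sg k mu *c (crea c k mu * (c k * (if k : mu then cstar (c k) else 1)))"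
   using Suc.prems crea_anti(1)[of k i mu] True by (simp add: mult.assoc[symmetric] mult_scaleC_left)
  then show ?thesis using Suc.prems True
   by (simp add: sg_Suc anti_star right_diff_distrib cvs.scale_right_diff_distrib mult.assoc)
 next
  case False
  let ?X = "if k : mu then cstar (c k) else 1"
  have "c i * crea c (Suc k) mu = (c i * crea c k mu) * ?X" by (simp add: mult.assoc)
  also have "... = (if i : mu then sg i mu *c crea c k (mu - {i}) else 0) * ?X + sg k mu *c (crea c k mu * (c i * ?X))"
   using Suc False by (simp add: distrib_right mult_scaleC_left mult.assoc)
  finally show ?thesis using Suc.prems False by (simp add: sg_Suc anti_star mult_scaleC_left mult.assoc)
 qed
qed simp

lemma vac_commute_gen:
 assumes "k <= i" "i < n" "x = c i \<or> x = cstar (c i)"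
 shows "x * vac c k = vac c k * x" using assms
proof (induction k)
 case (Suc k)
 have k: "k < n" "i ~= k" using Suc.prems by auto
 have x: "x * cstar (c k) = - (cstar (c k) * x)" "x * c k = - (c k * x)"
  using Suc.prems(2,3) k anti_star[of i k] anti_cstar[of i k] anti[of i k] anti_star[of k i] by auto
 have "x * vac c (Suc k) = vac c k * (x * c k) * cstar (c k)" using Suc by (simp add: mult.assoc[symmetric])
 also have "... = - (vac c k * c k * (x * cstar (c k)))" by (simp add: x(2) mult.assoc)
 also have "... = vac c (Suc k) * x" by (simp add: x(1) mult.assoc)
 finally show ?case .
qed simp

lemmas vac_commute = vac_commute_gen[OF _ _ disjI1[OF refl]] vac_commute_gen[OF _ _ disjI2[OF refl]]

lemma annihilate_vac: "i < k ==> k <= n ==> c i * vac c k = 0"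
proof (induction k)
 case (Suc k)
 show ?case
 proof (cases "i = k")
  case True
  have "c i * vac c (Suc k) = vac c k * (c k * c k) * cstar (c k)"
   using vac_commute(1)[of k k] Suc.prems True by (simp add: mult.assoc[symmetric])
  then show ?thesis using sq_zero[of k] Suc.prems by simp
 next
  case False
  then show ?thesis using Suc by (simp add: mult.assoc[symmetric])
 qed
qed simp

lemma cstar_vac: "k <= n ==> cstar (vac c k) = vac c k"
proof (induction k)
 case (Suc k)
 have "cstar (vac c (Suc k)) = c k * (cstar (c k) * vac c k)" using Suc by (simp add: cstar_simps mult.assoc)
 also have "... = vac c (Suc k)" using vac_commute[of k k] Suc.prems by (simp add: mult.assoc[symmetric])
 finally show ?case .
qed simp

lemma number_idem: "k < n ==> c k * cstar (c k) * (c k * cstar (c k)) = c k * cstar (c k)"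
proof -
 assume k: "k < n"
 have "c k * cstar (c k) * (c k * cstar (c k)) = c k * (cstar (c k) * c k) * cstar (c k)" by (simp add: mult.assoc)
 also have "cstar (c k) * c k = 1 - c k * cstar (c k)" using anti_star[of k k] k by simp
 also have "c k * (1 - c k * cstar (c k)) * cstar (c k) = c k * cstar (c k) - (c k * c k) * cstar (c k) * cstar (c k)"
  by (simp add: algebra_simps)
 finally show ?thesis using sq_zero[OF k] by simp
qed

lemma vac_idem: "k <= n ==> vac c k * vac c k = vac c k"
proof (induction k)
 case (Suc k)
 have "vac c (Suc k) * vac c (Suc k) = vac c k * (c k * (cstar (c k) * vac c k)) * (c k * cstar (c k))"
  by (simp add: mult.assoc)
 also have "cstar (c k) * vac c k = vac c k * cstar (c k)" using vac_commute(2)[of k k] Suc.prems by simp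
 also have "c k * (vac c k * cstar (c k)) = vac c k * (c k * cstar (c k))"
  using vac_commute(1)[of k k] Suc.prems by (simp add: mult.assoc[symmetric])
 also have "vac c k * (vac c k * (c k * cstar (c k))) * (c k * cstar (c k)) =
   (vac c k * vac c k) * (c k * cstar (c k) * (c k * cstar (c k)))" by (simp only: mult.assoc)
 also have "... = vac c (Suc k)" using Suc number_idem[of k] by simp
 finally show ?case .
qed simp

text \<open>Resolution of the identity by induction on the modes: the units with mode
  \<open>k\<close> empty and with mode \<open>k\<close> filled recombine by c c* + c* c = 1.\<close>

lemma sum_munit: "k <= n ==> (SUM mu:Pow {..<k}. munit c k mu mu) = 1"
proof (induction k)
 case 0 then show ?case by (simp add: munit_def)
next
 case (Suc k)
 then have k: "k < n" by simp
 have split: "Pow {..<Suc k} = Pow {..<k} \<union> insert k ` Pow {..<k}" by (simp add: lessThan_Suc Pow_insert)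
 have inj: "inj_on (insert k) (Pow {..<k})" by (auto simp: inj_on_def)
 have "(SUM mu:Pow {..<Suc k}. munit c (Suc k) mu mu) =
   (SUM mu:Pow {..<k}. munit c (Suc k) mu mu) + (SUM mu:Pow {..<k}. munit c (Suc k) (insert k mu) (insert k mu))"
  unfolding split by (subst sum.union_disjoint) (auto simp: sum.reindex[OF inj])
 also have "... = (SUM mu:Pow {..<k}. munit c k mu mu)" unfolding sum.distrib[symmetric]
 proof (rule sum.cong)
  fix mu assume mu: "mu : Pow {..<k}"
  then have kmu: "k ~: mu" by auto
  have nn: "cstar (c k) * c k * (cstar (c k) * c k) = cstar (c k) * c k"
  proof -
   have "cstar (c k) * c k = 1 - c k * cstar (c k)" using anti_star[of k k] k by simp
   moreover have "(1 - c k * cstar (c k)) * (1 - c k * cstar (c k)) = 1 - c k * cstar (c k)"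
    using number_idem[OF k] by (simp add: left_diff_distrib right_diff_distrib)
   ultimately show ?thesis by simp
  qed
  have "munit c (Suc k) mu mu = crea c k mu * vac c k * (c k * cstar (c k)) * cstar (crea c k mu)"
   using kmu by (simp add: munit_def mult.assoc)
  moreover have "munit c (Suc k) (insert k mu) (insert k mu) =
    crea c k mu * vac c k * (cstar (c k) * c k) * cstar (crea c k mu)"
  proof -
   have "munit c (Suc k) (insert k mu) (insert k mu) =
     crea c k mu * (cstar (c k) * vac c k) * (c k * cstar (c k) * c k) * cstar (crea c k mu)"
    by (simp add: munit_def cstar_simps mult.assoc)
   also have "... = crea c k mu * vac c k * (cstar (c k) * c k * (cstar (c k) * c k)) * cstar (crea c k mu)"
    using vac_commute(2)[of k k] k by (simp add: mult.assoc)
   finally show ?thesis by (simp only: nn)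
  qed
  ultimately have "munit c (Suc k) mu mu + munit c (Suc k) (insert k mu) (insert k mu) =
    crea c k mu * vac c k * (c k * cstar (c k) + cstar (c k) * c k) * cstar (crea c k mu)" by (simp add: algebra_simps)
  also have "c k * cstar (c k) + cstar (c k) * c k = 1" using anti_star[of k k] k by simp
  finally show "munit c (Suc k) mu mu + munit c (Suc k) (insert k mu) (insert k mu) = munit c k mu mu"
   by (simp add: munit_def)
 qed simp
 finally show ?case using Suc by simp
qed

lemma vac_nonzero: "vac c n ~= 0" using sum_munit[of n] by (auto simp: munit_def)

lemma annihilate_crea_vac:
 assumes "i < n"
 shows "c i * (crea c n mu * vac c n) = (if i : mu then sg i mu *c (crea c n (mu - {i}) * vac c n) else 0)"
proof -
 have "c i * (crea c n mu * vac c n) = (if i : mu then sg i mu *c crea c n (mu - {i}) else 0) * vac c n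
   + sg n mu *c (crea c n mu * (c i * vac c n))"
  using annihilate_crea[OF assms, of mu] by (simp add: mult.assoc[symmetric] distrib_right mult_scaleC_left)
 then show ?thesis by (simp add: annihilate_vac[OF assms] mult_scaleC_left)
qed

text \<open>Orthonormality of the occupation number basis in algebraic form: a mode taken from
  \<open>mu\<close> either removes itself from \<open>nu\<close> or yields zero.\<close>

lemma vac_crea_vac:
 assumes "mu <= {..<n}" "nu <= {..<n}"
 shows "vac c n * cstar (crea c n mu) * (crea c n nu * vac c n) = (if mu = nu then vac c n else 0)"
proof -
 have "finite mu" using assms(1) finite_subset by blast
 then show ?thesis using assms
 proof (induction "card mu" arbitrary: mu nu)
  case 0
  then have mu: "mu = {}" by simp
  show ?case
  proof (cases "nu = {}")
   case True then show ?thesis by (simp add: mu vac_idem)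
  next
   case False
   then obtain i where i: "i : nu" by blast
   have iN: "i < n" using i 0 by auto
   have "crea c n nu = sg i (nu - {i}) *c (cstar (c i) * crea c n (nu - {i}))"
    using cstar_crea[of i n "nu - {i}"] iN i by (simp add: scaleC_scaleC insert_absorb)
   moreover have "vac c n * cstar (c i) = 0"
    using arg_cong[OF annihilate_vac[OF iN order_refl], of cstar] by (simp add: cstar_simps cstar_vac)
   ultimately show ?thesis using False by (simp add: mu mult_scaleC_right mult_scaleC_left mult.assoc[symmetric])
  qed
 next
  case (Suc m)
  then have "mu ~= {}" by auto
  then obtain i where i: "i : mu" by blast
  have iN: "i < n" using i Suc by auto
  let ?m = "mu - {i}"
  have cm: "crea c n mu = sg i ?m *c (cstar (c i) * crea c n ?m)"
   using cstar_crea[of i n ?m] iN i by (simp add: scaleC_scaleC insert_absorb)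
  have IH: "vac c n * cstar (crea c n ?m) * (crea c n (nu - {i}) * vac c n) = (if ?m = nu - {i} then vac c n else 0)"
   using Suc i by (intro Suc.hyps(1)) auto
  have "vac c n * cstar (crea c n mu) * (crea c n nu * vac c n) =
    sg i ?m *c (vac c n * cstar (crea c n ?m) * (c i * (crea c n nu * vac c n)))"
   by (simp add: cm cstar_simps mult_scaleC_right mult_scaleC_left mult.assoc)
  also have "... = (if i : nu then (sg i ?m * sg i nu) *c (if ?m = nu - {i} then vac c n else 0) else 0)"
   by (simp add: annihilate_crea_vac[OF iN] mult_scaleC_right IH scaleC_scaleC)
  also have "... = (if mu = nu then vac c n else 0)"
  proof -
   have "sg i ?m = sg i mu" "sg i (nu - {i}) = sg i nu"
    unfolding sg_def by (rule arg_cong[where f = "%S. (- 1) ^ card S"]; auto)+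
   then show ?thesis using i by auto
  qed
  finally show ?case .
 qed
qed

lemma munit_mult:
 assumes "nu <= {..<n}" "si <= {..<n}"
 shows "mun mu nu * mun si tau = (if nu = si then mun mu tau else 0)"
proof -
 have "mun mu nu * mun si tau =
   crea c n mu * (vac c n * (vac c n * cstar (crea c n nu) * (crea c n si * vac c n))) * cstar (crea c n tau)"
  using vac_idem[of n] unfolding munit_def by (metis (no_types, lifting) mult.assoc order_refl)
 also have "... = crea c n mu * (vac c n * (if nu = si then vac c n else 0)) * cstar (crea c n tau)"
  by (simp only: vac_crea_vac[OF assms])
 finally show ?thesis by (simp add: vac_idem munit_def)
qed

lemma cstar_munit: "cstar (mun mu nu) = mun nu mu" by (simp add: munit_def cstar_simps cstar_vac mult.assoc)

lemma munit_nonzero: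
 assumes "mu <= {..<n}" "nu <= {..<n}"
 shows "mun mu nu ~= 0"
proof
 assume "mun mu nu = 0"
 then have "mun {} mu * mun mu nu * mun nu {} = 0" by simp
 then show False using assms vac_nonzero by (simp add: munit_mult) (simp add: munit_def)
qed

lemma annihilate_munit:
 "i < n ==> c i * mun mu nu = (if i : mu then sg i mu *c mun (mu - {i}) nu else 0)"
 using annihilate_crea_vac[of i mu] by (simp add: munit_def mult.assoc[symmetric] mult_scaleC_left)

lemma annihilate_expand:
 assumes "i < n"
 shows "c i = (SUM mu:PN. SUM nu:PN. (if i : nu & mu = nu - {i} then sg i nu else 0) *c mun mu nu)"
proof -
 have "c i = c i * (SUM nu:PN. mun nu nu)" by (simp add: sum_munit)
 also have "... = (SUM nu:PN. if i : nu then sg i nu *c mun (nu - {i}) nu else 0)"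
  by (simp add: sum_distrib_left annihilate_munit[OF assms])
 also have "... = (SUM nu:PN. SUM mu:PN. (if i : nu & mu = nu - {i} then sg i nu else 0) *c mun mu nu)"
 proof (rule sum.cong)
  fix nu assume nu: "nu : PN"
  have "(SUM mu:PN. (if i : nu & mu = nu - {i} then sg i nu else 0) *c mun mu nu) =
    (SUM mu:PN. if mu = nu - {i} then (if i : nu then sg i nu *c mun mu nu else 0) else 0)" by (rule sum.cong) auto
  also have "... = (if i : nu then sg i nu *c mun (nu - {i}) nu else 0)" using nu by (subst sum.delta) auto
  finally show "(if i : nu then sg i nu *c mun (nu - {i}) nu else 0) =
    (SUM mu:PN. (if i : nu & mu = nu - {i} then sg i nu else 0) *c mun mu nu)" by simp
 qed simp
 also have "... = (SUM mu:PN. SUM nu:PN. (if i : nu & mu = nu - {i} then sg i nu else 0) *c mun mu nu)" by (rule sum.swap)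
 finally show ?thesis .
qed

text \<open>Elements are handled through coefficient arrays, which multiply like matrices.\<close>

definition comb :: "(nat set => nat set => complex) => 'a" where
 "comb k = (SUM mu:PN. SUM nu:PN. k mu nu *c mun mu nu)"

lemma comb_one: "comb (%mu nu. if mu = nu then 1 else 0) = 1"
proof -
 have "comb (%mu nu. if mu = nu then 1 else 0) = (SUM mu:PN. mun mu mu)" unfolding comb_def
 proof (rule sum.cong)
  fix mu assume mu: "mu : PN"
  have "(SUM nu:PN. (if mu = nu then 1 else 0) *c mun mu nu) =
    (SUM nu:PN. if mu = nu then mun mu nu else 0)" by (rule sum.cong) auto
  then show "(SUM nu:PN. (if mu = nu then 1 else 0) *c mun mu nu) = mun mu mu" using mu by (simp add: sum.delta')
 qed simp
 then show ?thesis by (simp add: sum_munit)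
qed

lemma comb_add: "comb k + comb l = comb (%mu nu. k mu nu + l mu nu)" by (simp add: comb_def sum.distrib scaleC_add_left)

lemma comb_scaleC: "z *c comb k = comb (%mu nu. z * k mu nu)" by (simp add: comb_def cvs.scale_sum_right scaleC_scaleC)

lemma comb_cstar: "cstar (comb k) = comb (%mu nu. cnj (k nu mu))"
 unfolding comb_def by (simp add: cstar_simps cstar_munit) (rule sum.swap)

lemma munit_comb:
 assumes mu: "mu <= {..<n}" and nu: "nu <= {..<n}"
 shows "mun rho mu * comb k * mun nu tau = k mu nu *c mun rho tau"
proof -
 have "mun rho mu * comb k = (SUM si:PN. if si = mu then SUM ka:PN. k si ka *c mun rho ka else 0)"
  unfolding comb_def sum_distrib_left by (rule sum.cong) (use mu in "auto simp: mult_scaleC_right munit_mult")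
 also have "... = (SUM ka:PN. k mu ka *c mun rho ka)" using mu by simp
 finally have "mun rho mu * comb k * mun nu tau =
   (SUM ka:PN. k mu ka *c mun rho ka) * mun nu tau" by simp
 also have "... = (SUM ka:PN. if ka = nu then k mu ka *c mun rho tau else 0)" unfolding sum_distrib_right
  by (rule sum.cong) (use nu in "auto simp: mult_scaleC_left munit_mult")
 finally show ?thesis using nu by simp
qed

lemma expand:
 "x = (SUM mu:PN. SUM nu:PN. mun mu mu * x * mun nu nu)"
proof -
 have "x = (SUM mu:PN. mun mu mu) * x * (SUM nu:PN. mun nu nu)" by (simp add: sum_munit)
 also have "... = (SUM mu:PN. SUM nu:PN. mun mu mu * x * mun nu nu)"
  by (simp add: sum_distrib_left sum_distrib_right) (rule sum.swap)
 finally show ?thesis .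
qed

lemma comb_mult: "comb k * comb l = comb (%mu nu. SUM rho:PN. k mu rho * l rho nu)"
proof -
 have "mun mu mu * (comb k * comb l) * mun nu nu =
   (SUM rho:PN. k mu rho * l rho nu) *c mun mu nu"
  if "mu : PN" "nu : PN" for mu nu
 proof -
  have "mun mu mu * (comb k * comb l) * mun nu nu =
    mun mu mu * (comb k * (SUM rho:PN. mun rho rho) * comb l) * mun nu nu" by (simp add: sum_munit)
  also have "... = (SUM rho:PN. (mun mu mu * comb k * mun rho rho) * (mun rho rho * comb l * mun nu nu))"
  proof -
   have "mun rho rho = mun rho rho * mun rho rho" if "rho : PN" for rho using that by (simp add: munit_mult)
   then have "(SUM rho:PN. mun rho rho) = (SUM rho:PN. mun rho rho * mun rho rho)" by (intro sum.cong) auto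
   then show ?thesis by (simp add: sum_distrib_left sum_distrib_right mult.assoc)
  qed
  also have "... = (SUM rho:PN. (k mu rho * l rho nu) *c mun mu nu)"
   using that by (intro sum.cong refl) (simp add: munit_comb munit_mult mult_scaleC_left mult_scaleC_right scaleC_scaleC)
  finally show ?thesis by (simp add: cvs.scale_sum_left)
 qed
 then show ?thesis by (subst expand) (simp add: comb_def)
qed

lemma comb_annihilate:
 "i < n ==> c i = comb (%mu nu. if i : nu & mu = nu - {i} then sg i nu else 0)"
 unfolding comb_def by (rule annihilate_expand)

lemma comb_exists:
 assumes "x : star_alg_gen (c ` {..<n})"
 shows "EX k. x = comb k" using assms
proof induction
 case (base x)
 then show ?case using comb_annihilate by auto
next
 case one
 then show ?case using comb_one by metis
next
 case (add x y) then show ?case by (auto simp: comb_add)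
next
 case (scaleC x z) then show ?case by (auto simp: comb_scaleC)
next
 case (mult x y) then show ?case by (auto simp: comb_mult)
next
 case (cstar x) then show ?case by (auto simp: comb_cstar)
qed

text \<open>A coefficient is recovered by sandwiching with \<open>mun {} mu\<close> and
  \<open>mun nu {}\<close>, so the norm controls it; the summand 1 keeps \<open>B\<close>
  positive.\<close>

lemma comb_bound: "EX B>0. ALL k. (ALL mu:PN. ALL nu:PN. cmod (k mu nu) <= B * norm (comb k))"
proof -
 define B where "B = (SUM mu:PN. SUM nu:PN. norm (mun {} mu) * norm (mun nu {})) / norm (vac c n) + 1"
 have v: "norm (vac c n) > 0" using vac_nonzero by simp
 have "B > 0" unfolding B_def using v by (intro add_nonneg_pos divide_nonneg_pos sum_nonneg) auto
 moreover have "cmod (k mu nu) <= B * norm (comb k)" if "mu : PN" "nu : PN" for k mu nu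
 proof -
  have "cmod (k mu nu) * norm (vac c n) = norm (mun {} mu * comb k * mun nu {})"
   using that by (simp add: munit_comb norm_scaleC) (simp add: munit_def)
  also have "... <= norm (mun {} mu) * norm (comb k) * norm (mun nu {})"
   by (meson norm_mult_ineq mult_right_mono norm_ge_zero order_trans)
  also have "... = (norm (mun {} mu) * norm (mun nu {})) * norm (comb k)" by simp
  also have "... <= (SUM mu:PN. SUM nu:PN. norm (mun {} mu) * norm (mun nu {})) * norm (comb k)"
  proof (rule mult_right_mono)
   have "norm (mun {} mu) * norm (mun nu {}) <= (SUM nu:PN. norm (mun {} mu) * norm (mun nu {}))"
    using that by (intro member_le_sum) auto
   also have "... <= (SUM mu:PN. SUM nu:PN. norm (mun {} mu) * norm (mun nu {}))"
    using that by (intro member_le_sum[where f = "%mu. SUM nu:PN. norm (mun {} mu) * norm (mun nu {})"] sum_nonneg) auto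
   finally show "norm (mun {} mu) * norm (mun nu {}) <= (SUM mu:PN. SUM nu:PN. norm (mun {} mu) * norm (mun nu {}))" .
  qed simp
  finally have "cmod (k mu nu) <= (SUM mu:PN. SUM nu:PN. norm (mun {} mu) * norm (mun nu {})) / norm (vac c n) * norm (comb k)"
   using v by (simp add: field_simps)
  also have "... <= B * norm (comb k)" by (simp add: B_def distrib_right)
  finally show ?thesis .
 qed
 ultimately show ?thesis by blast
qed

end

section \<open>Isometric extension of relations between generators\<close>

text \<open>The *-subalgebra of a product generated by \<open>S\<close>, with scalars conjugated in
  the second component if \<open>s = 1\<close>. It is the graph of the homomorphism to be
  constructed, before it is known to be single-valued.\<close>

inductive pair_gen :: "bit => ('a::cstar_algebra \<times> 'b::cstar_algebra) set => 'a => 'b => bool" for s S where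
 base: "(x, y) : S ==> pair_gen s S x y"
| one: "pair_gen s S 1 1"
| add: "pair_gen s S x y ==> pair_gen s S x' y' ==> pair_gen s S (x + x') (y + y')"
| scaleC: "pair_gen s S x y ==> pair_gen s S (z *c x) (conj_bit s z *c y)"
| mult: "pair_gen s S x y ==> pair_gen s S x' y' ==> pair_gen s S (x * x') (y * y')"
| cstar: "pair_gen s S x y ==> pair_gen s S (cstar x) (cstar y)"

lemma pair_gen_mono: "pair_gen s S x y ==> S <= T ==> pair_gen s T x y"
 by (induction rule: pair_gen.induct) (auto intro: pair_gen.intros)

lemma pair_gen_converse: "pair_gen s S x y ==> pair_gen s (S\<inverse>) y x"
proof (induction rule: pair_gen.induct)
 case (scaleC x y z)
 then show ?case using pair_gen.scaleC[of s "S\<inverse>" y x "conj_bit s z"] by simp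
qed (auto intro: pair_gen.intros)

lemma pair_gen_total: "x : star_alg_gen (fst ` S) ==> EX y. pair_gen s S x y"
proof (induction rule: star_alg_gen.induct)
 case (base x)
 then obtain y where "(x, y) : S" by force
 then show ?case by (blast intro: pair_gen.base)
qed (auto intro: pair_gen.intros)

lemma pair_gen_onto: "y : star_alg_gen (snd ` S) ==> EX x. pair_gen s S x y"
proof -
 have "snd ` S = fst ` (S\<inverse>)" by force
 then show "y : star_alg_gen (snd ` S) ==> EX x. pair_gen s S x y"
  using pair_gen_total[of y "S\<inverse>" s] pair_gen_converse by (metis converse_converse)
qed

lemma pair_gen_diff: "pair_gen s S x y ==> pair_gen s S x' y' ==> pair_gen s S (x - x') (y - y')"
 using pair_gen.add[of s S x y "(-1) *c x'" "conj_bit s (-1) *c y'"] pair_gen.scaleC[of s S x' y' "-1"] by simp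

lemma power_two_compare:
 fixes a b C :: real
 assumes "0 <= a" "0 <= b" "!!j. b ^ (2 ^ j) <= C * a ^ (2 ^ j)"
 shows "b <= a"
proof (rule ccontr)
 assume "\<not> b <= a"
 then have ab: "a < b" by simp
 show False
 proof (cases "a = 0")
  case True
  have "b ^ (2 ^ 0) <= C * a ^ (2 ^ 0)" by (rule assms(3))
  then show False using True ab by simp
 next
  case False
  then have a: "0 < a" using assms(1) by simp
  have "1 < b / a" using ab a by simp
  then obtain m where m: "C < (b / a) ^ m" using real_arch_pow by blast
  have "(b / a) ^ m <= (b / a) ^ (2 ^ m)"
   using \<open>1 < b / a\<close> by (intro power_increasing) (auto simp: less_imp_le[OF less_exp])
  also have "... <= C" using assms(3)[of m] a by (simp add: power_divide field_simps)
  finally show False using m by simp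
 qed
qed

lemma norm_power_self_adjoint:
 fixes h :: "'a::cstar_algebra"
 assumes "cstar h = h"
 shows "norm (h ^ (2 ^ j)) = norm h ^ (2 ^ j)"
proof -
 have star: "cstar (h ^ m) = h ^ m" for m by (induction m) (simp_all add: cstar_mult assms power_commutes)
 show ?thesis
 proof (induction j)
  case (Suc j)
  have "norm (h ^ (2 ^ Suc j)) = norm (cstar (h ^ (2 ^ j)) * h ^ (2 ^ j))" by (simp add: star mult_2 power_add)
  also have "... = norm h ^ (2 ^ Suc j)" by (simp add: norm_cstar_mult Suc power_mult[symmetric] mult.commute)
  finally show ?case .
 qed simp
qed

text \<open>Power trick: applied to the powers of x*x and y*y with exponent \<open>2 ^ j\<close>,
  whose norms are powers by the C*-identity, a bound with any constant improves to the constant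
  1.\<close>

lemma pair_gen_norm_le:
 assumes C: "!!x y. pair_gen s S x y ==> norm y <= C * norm x" and xy: "pair_gen s S x y"
 shows "norm y <= norm x"
proof -
 have "pair_gen s S ((cstar x * x) ^ m) ((cstar y * y) ^ m)" for m by (induction m) (auto intro: pair_gen.intros xy)
 then have "norm ((cstar y * y) ^ m) <= C * norm ((cstar x * x) ^ m)" for m by (rule C)
 then have "norm (cstar y * y) ^ (2 ^ j) <= C * norm (cstar x * x) ^ (2 ^ j)" for j
  by (metis norm_power_self_adjoint cstar_cstar cstar_mult)
 then have "norm (cstar y * y) <= norm (cstar x * x)" by (rule power_two_compare[rotated 2]) auto
 then show ?thesis by (simp add: norm_cstar_mult)
qed

text \<open>Related elements have the same coefficients up to conjugation in the two systems of
  matrix units. This compares norms with a constant depending on \<open>n\<close>, which the power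
  trick removes.\<close>

lemma car_modes_pair_norm_le:
 assumes "car_modes c n" "car_modes c' n" and xy: "pair_gen s ((%i. (c i, c' i)) ` {..<n}) x y"
 shows "norm y <= norm x"
proof -
 interpret A: car_modes c n by fact
 interpret B: car_modes c' n by fact
 have rep: "EX k. x = A.comb k & y = B.comb (%mu nu. conj_bit s (k mu nu))"
  if "pair_gen s ((%i. (c i, c' i)) ` {..<n}) x y" for x y using that
 proof (induction rule: pair_gen.induct)
  case (base x y)
  then obtain i where i: "i < n" "x = c i" "y = c' i" by auto
  define k where "k = (%mu nu. if i : nu & mu = nu - {i} then sg i nu else 0)"
  have "(%mu nu. conj_bit s (k mu nu)) = k" by (simp add: k_def fun_eq_iff)
  moreover have "x = A.comb k" "y = B.comb k"
   using A.comb_annihilate[OF i(1)] B.comb_annihilate[OF i(1)] i(2,3) by (simp_all add: k_def)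
  ultimately show ?case by (intro exI[of _ k]) simp
 next
  case one
  define k where "k = (%mu nu :: nat set. if mu = nu then 1 else 0 :: complex)"
  have "(%mu nu. conj_bit s (k mu nu)) = k" by (simp add: k_def fun_eq_iff)
  moreover have "1 = A.comb k" "1 = B.comb k" using A.comb_one B.comb_one by (simp_all add: k_def)
  ultimately show ?case by (intro exI[of _ k]) simp
 next
  case (add x y x' y')
  then obtain k l where kl: "x = A.comb k" "y = B.comb (%mu nu. conj_bit s (k mu nu))"
   "x' = A.comb l" "y' = B.comb (%mu nu. conj_bit s (l mu nu))" by blast
  show ?case by (rule exI[of _ "%mu nu. k mu nu + l mu nu"]) (simp add: kl A.comb_add B.comb_add)
 next
  case (scaleC x y z)
  then obtain k where kl: "x = A.comb k" "y = B.comb (%mu nu. conj_bit s (k mu nu))" by blast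
  show ?case by (rule exI[of _ "%mu nu. z * k mu nu"]) (simp add: kl A.comb_scaleC B.comb_scaleC)
 next
  case (mult x y x' y')
  then obtain k l where kl: "x = A.comb k" "y = B.comb (%mu nu. conj_bit s (k mu nu))"
   "x' = A.comb l" "y' = B.comb (%mu nu. conj_bit s (l mu nu))" by blast
  have cs: "conj_bit s (sum f M) = (SUM i:M. conj_bit s (f i))" for f :: "nat set => complex" and M
   by (simp add: conj_bit_def)
  show ?case by (rule exI[of _ "%mu nu. SUM rho:Pow {..<n}. k mu rho * l rho nu"])
    (simp add: kl A.comb_mult B.comb_mult cs)
 next
  case (cstar x y)
  then obtain k where kl: "x = A.comb k" "y = B.comb (%mu nu. conj_bit s (k mu nu))" by blast
  show ?case by (rule exI[of _ "%mu nu. cnj (k nu mu)"]) (simp add: kl A.comb_cstar B.comb_cstar)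
 qed
 obtain B where B: "B > 0" "!!k mu nu. mu : Pow {..<n} ==> nu : Pow {..<n} ==> cmod (k mu nu) <= B * norm (A.comb k)"
  using A.comb_bound by blast
 define K where "K = B * (SUM mu:Pow {..<n}. SUM nu:Pow {..<n}. norm (munit c' n mu nu))"
 have "norm y <= K * norm x" if xy: "pair_gen s ((%i. (c i, c' i)) ` {..<n}) x y" for x y
 proof -
  obtain k where k: "x = A.comb k" "y = B.comb (%mu nu. conj_bit s (k mu nu))" using rep[OF xy] by blast
  have "norm y <= (SUM mu:Pow {..<n}. SUM nu:Pow {..<n}. B * norm x * norm (munit c' n mu nu))" unfolding k(2) B.comb_def
  proof (intro order_trans[OF norm_sum] sum_mono)
   fix mu nu assume "mu : Pow {..<n}" "nu : Pow {..<n}"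
   then show "norm (conj_bit s (k mu nu) *c munit c' n mu nu) <= B * norm x * norm (munit c' n mu nu)"
    using B(2)[of mu nu k] k(1) by (simp add: norm_scaleC mult_right_mono)
  qed
  also have "... = K * norm x" by (simp add: K_def sum_distrib_left mult_ac)
  finally show ?thesis .
 qed
 then show ?thesis using xy by (rule pair_gen_norm_le)
qed

lemma car_modes_pair_norm:
 assumes c: "!!n. car_modes c n" "!!n. car_modes c' n" and xy: "pair_gen s (range (%i. (c i, c' i))) x y"
 shows "norm y = norm x"
proof -
 have "EX n. pair_gen s ((%i. (c i, c' i)) ` {..<n}) x y" using xy
 proof (induction rule: pair_gen.induct)
  case (base x y)
  then obtain i where "x = c i" "y = c' i" by auto
  then have "(x, y) : (%i. (c i, c' i)) ` {..<Suc i}" by auto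
  then show ?case by (auto intro: pair_gen.base)
 next
  case (add x y x' y')
  then obtain m n where "pair_gen s ((%i. (c i, c' i)) ` {..<m}) x y" "pair_gen s ((%i. (c i, c' i)) ` {..<n}) x' y'" by blast
  then show ?case by (intro exI[of _ "max m n"] pair_gen.add) (auto elim!: pair_gen_mono)
 next
  case (mult x y x' y')
  then obtain m n where "pair_gen s ((%i. (c i, c' i)) ` {..<m}) x y" "pair_gen s ((%i. (c i, c' i)) ` {..<n}) x' y'" by blast
  then show ?case by (intro exI[of _ "max m n"] pair_gen.mult) (auto elim!: pair_gen_mono)
 qed (auto intro: pair_gen.intros)
 then obtain n where n: "pair_gen s ((%i. (c i, c' i)) ` {..<n}) x y" by blast
 have "((%i. (c i, c' i)) ` {..<n})\<inverse> = (%i. (c' i, c i)) ` {..<n}" by auto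
 then have "pair_gen s ((%i. (c' i, c i)) ` {..<n}) y x" using pair_gen_converse[OF n] by simp
 then show ?thesis using car_modes_pair_norm_le[OF c(1) c(2) n] car_modes_pair_norm_le[OF c(2) c(1)] by (simp add: antisym)
qed

lemma isometric_graph_total:
 fixes G :: "('a::metric_space \<times> 'b::complete_space) set"
 assumes iso: "!!p q. p : G ==> q : G ==> dist (snd p) (snd q) = dist (fst p) (fst q)"
  and x: "x : closure (fst ` G)"
 shows "EX y. (x, y) : closure G"
proof -
 obtain X where X: "!!n. X n : fst ` G" "X ----> x" using x unfolding closure_sequential by blast
 have "ALL n. EX p. p : G & X n = fst p" using X(1) by blast
 from choice[OF this] obtain P where P: "!!n. P n : G" "X = (%n. fst (P n))" by blast
 have "Cauchy (%n. snd (P n))" using LIMSEQ_imp_Cauchy[OF X(2)] by (simp add: Cauchy_def P(2) iso[OF P(1) P(1)])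
 then obtain y where "(%n. snd (P n)) ----> y" using Cauchy_convergent_iff convergent_def by blast
 then have "P ----> (x, y)" using tendsto_Pair[OF X(2), of "%n. snd (P n)" y] by (simp add: P(2))
 then show ?thesis unfolding closure_sequential using P(1) by blast
qed

text \<open>The closure of a densely defined isometric relation is the graph of an isometry; the
  statement on the range is totality of the relation with swapped coordinates.\<close>

lemma isometric_extension:
 fixes G :: "('a::complete_space \<times> 'b::complete_space) set"
 assumes iso: "!!p q. p : G ==> q : G ==> dist (snd p) (snd q) = dist (fst p) (fst q)"
  and dense: "closure (fst ` G) = UNIV"
 obtains f where "!!x y. (x, y) : closure G \<longleftrightarrow> f x = y" "!!x y. dist (f x) (f y) = dist x y"
  "closure (snd ` G) <= range f"
proof -
 have "closure (G \<times> G) <= {r. dist (snd (fst r)) (snd (snd r)) = dist (fst (fst r)) (fst (snd r))}"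
  by (intro closure_minimal closed_Collect_eq continuous_intros) (use iso in auto)
 then have iso': "dist (snd p) (snd q) = dist (fst p) (fst q)" if "p : closure G" "q : closure G" for p q
  using that by (auto simp: closure_Times)
 have "EX y. (x, y) : closure G" for x using isometric_graph_total[OF iso, of G x] dense by simp
 then obtain f where f: "!!x. (x, f x) : closure G" by metis
 have eq: "(x, y) : closure G \<longleftrightarrow> f x = y" for x y using iso'[of "(x, y)" "(x, f x)"] f by auto
 have "y : range f" if y: "y : closure (snd ` G)" for y
 proof -
  have "fst ` prod.swap ` G = snd ` G" by force
  with y obtain x where "(y, x) : closure (prod.swap ` G)" using isometric_graph_total[of "prod.swap ` G" y] iso by force
  moreover have "prod.swap ` closure (prod.swap ` G) <= closure (prod.swap ` prod.swap ` G)"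
   by (intro closure_bounded_linear_image_subset image_closure_subset continuous_intros closure_subset continuous_on_swap) auto
  ultimately have "(x, y) : closure G" by (force simp: image_image)
  then show ?thesis unfolding eq by blast
 qed
 then show thesis using that[OF eq] iso'[OF f f] by auto
qed

definition isometric_hom :: "bit => ('a::cstar_algebra => 'b::cstar_algebra) => bool" where
 "isometric_hom s be \<longleftrightarrow> (ALL x y. be (x + y) = be x + be y) & (ALL x y. be (x * y) = be x * be y) &
   (ALL z x. be (z *c x) = conj_bit s z *c be x) & (ALL x. be (cstar x) = cstar (be x)) & be 1 = 1 &
   (ALL x. norm (be x) = norm x)"

text \<open>Each algebraic law holds on the generated graph and survives its closure. Isometry on
  generated pairs also makes the relation single-valued, since differences of pairs are again
  pairs.\<close>

lemma pair_extension:
 fixes S :: "('a::cstar_algebra \<times> 'b::cstar_algebra) set"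
 assumes iso: "!!x y. pair_gen s S x y ==> norm y = norm x"
  and dense: "closure (star_alg_gen (fst ` S)) = UNIV"
 obtains be :: "'a => 'b" where "isometric_hom s be" "ALL x y. pair_gen s S x y --> be x = y"
  "closure (star_alg_gen (snd ` S)) <= range be"
proof -
 define G where "G = {(x, y). pair_gen s S x y}"
 have G: "(x, y) : G \<longleftrightarrow> pair_gen s S x y" for x y by (simp add: G_def)
 have sub: "star_alg_gen (fst ` S) <= fst ` G" "star_alg_gen (snd ` S) <= snd ` G"
  by (fastforce simp: G image_iff Bex_def dest: pair_gen_total[where s = s] pair_gen_onto[where s = s])+
 have "dist (snd p) (snd q) = dist (fst p) (fst q)" if "p : G" "q : G" for p q
  using iso[OF pair_gen_diff] that by (auto simp: G_def dist_norm)
 moreover have "closure (fst ` G) = UNIV" using closure_mono[OF sub(1)] dense by auto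
 ultimately obtain be where be: "!!x y. (x, y) : closure G \<longleftrightarrow> be x = y"
   "!!x y. dist (be x) (be y) = dist x y" "closure (snd ` G) <= range be"
  by (rule isometric_extension) (assumption | rule that)+
 have cl: "(x, be x) : closure G" for x by (simp add: be(1))
 have base: "be x = y" if "pair_gen s S x y" for x y using that closure_subset[of G] by (auto simp: be(1)[symmetric] G)
 show thesis
 proof (rule that)
  have "be (x + y) = be x + be y" for x y using closure_op2[of "(+)", OF _ _ cl[of x] cl[of y]]
   by (auto simp: be(1)[symmetric] G continuous_intros pair_gen.add)
  moreover have "be (x * y) = be x * be y" for x y
   using closure_op2[of "%p q. (fst p * fst q, snd p * snd q)", OF _ _ cl[of x] cl[of y]]
   by (auto simp: be(1)[symmetric] G continuous_intros pair_gen.mult)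
  moreover have "be (z *c x) = conj_bit s z *c be x" for z x
   using closure_op1[of "%p. (z *c fst p, conj_bit s z *c snd p)", OF _ _ cl[of x]]
   by (auto simp: be(1)[symmetric] G continuous_intros pair_gen.scaleC)
  moreover have "be (cstar x) = cstar (be x)" for x
   using closure_op1[of "%p. (cstar (fst p), cstar (snd p))", OF _ _ cl[of x]]
   by (auto simp: be(1)[symmetric] G continuous_intros pair_gen.cstar)
  moreover have "be 0 = 0" "be 1 = 1" using pair_gen.scaleC[OF pair_gen.one, of s S 0] by (auto intro: base pair_gen.one)
  moreover from this have "norm (be x) = norm x" for x using be(2)[of x 0] by simp
  ultimately show "isometric_hom s be" by (simp add: isometric_hom_def)
  show "ALL x y. pair_gen s S x y --> be x = y" by (simp add: base)
  show "closure (star_alg_gen (snd ` S)) <= range be" using closure_mono[OF sub(2)] be(3) by (rule subset_trans)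
 qed
qed

lemma star_hom_unique:
 fixes f g :: "'a::cstar_algebra => 'b::cstar_algebra"
 assumes f: "!!x y. f (x + y) = f x + f y" "!!x y. f (x * y) = f x * f y" "f 1 = 1"
  "!!x. f (cstar x) = cstar (f x)" "!!c x. f (c *c x) = conj_bit s c *c f x"
  and g: "!!x y. g (x + y) = g x + g y" "!!x y. g (x * y) = g x * g y" "g 1 = 1"
  "!!x. g (cstar x) = cstar (g x)" "!!c x. g (c *c x) = conj_bit s c *c g x"
  and eq: "!!x. x : S ==> f x = g x" and x: "x : closure (star_alg_gen S)"
 shows "f x = g x"
proof -
 have cont: "continuous_on UNIV h" if h: "!!x y. h (x + y) = h x + h y" "!!x y. h (x * y) = h x * h y" "h 1 = 1"
  "!!x. h (cstar x) = cstar (h x)" "!!c x. h (c *c x) = conj_bit s c *c h x" for h :: "'a => 'b"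
 proof -
  have "bounded_linear h"
  proof
   show "h (r *r x) = r *r h x" for r x using h(5)[of "of_real r" x] by (simp add: scaleC_of_real)
   show "EX K. ALL x. norm (h x) <= norm x * K" by (rule exI[of _ 1]) (use star_hom_contractive[OF h] in auto)
  qed (rule h)
  then show ?thesis by (rule linear_continuous_on)
 qed
 have "closed {x. f x = g x}" using cont[OF f] cont[OF g] by (rule closed_Collect_eq)
 moreover have "star_alg_gen S <= {x. f x = g x}"
 proof
  fix y assume "y : star_alg_gen S"
  then show "y : {x. f x = g x}" by induction (simp_all add: eq f g)
 qed
 ultimately show ?thesis using x closure_minimal by blast
qed

section \<open>Square-summable chains and the generators of the CAR algebra\<close>

lemma cdot_sum: "u : carrier_vec n ==> v : carrier_vec n ==> u \<bullet>c v = (SUM i<n. u $ i * cnj (v $ i))"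
 by (simp add: scalar_prod_def atLeast0LessThan)

lemma cdot_self: "v \<bullet>c v = complex_of_real (Re (v \<bullet>c v))" "0 <= Re (v \<bullet>c (v :: complex vec))"
proof -
 have "v \<bullet>c v = of_real (SUM i<dim_vec v. (cmod (v $ i))\<^sup>2)"
  by (simp add: cdot_sum[of v "dim_vec v"] complex_norm_square[symmetric])
 then show "v \<bullet>c v = complex_of_real (Re (v \<bullet>c v))" "0 <= Re (v \<bullet>c v)" by (simp_all add: sum_nonneg)
qed

definition cut :: "nat => int set => (int => complex vec) => int => complex vec" where
 "cut d X f = (%x. if x : X then f x else 0\<^sub>v d)"

definition site :: "nat => int => complex vec => int => complex vec" where
 "site d x u = (%y. if y = x then u else 0\<^sub>v d)"

abbreviation mode :: "nat => int => nat => int => complex vec" where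
 "mode d x i \<equiv> site d x (unit_vec d i)"

text \<open>For \<open>s = 1\<close> these are the relations of f -> a (w f) with an anti-unitary
  \<open>w\<close>. One notion for both cases lets the same norm and approximation lemmas serve the
  source and the target of a Bogoliubov map.\<close>

definition car_family :: "nat => bit => ((int => complex vec) => 'a::cstar_algebra) => bool" where
 "car_family d s a \<longleftrightarrow>
   (ALL f:l2_chain d. ALL g:l2_chain d.
    a (%x. f x + g x) = a f + a g &
    a f * a g + a g * a f = 0 &
    a f * cstar (a g) + cstar (a g) * a f = conj_bit s (l2_inner f g) *c 1) &
   (ALL f:l2_chain d. ALL c. a (%x. c \<cdot>\<^sub>v f x) = conj_bit s (cnj c) *c a f)"

lemma l2_chain_carrier: "f : l2_chain d ==> f x : carrier_vec d" by (simp add: l2_chain_def)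

lemma l2_chain_cut: "f : l2_chain d ==> cut d X f : l2_chain d"
proof -
 assume f: "f : l2_chain d"
 have "(%x. Re (f x \<bullet>c f x)) summable_on X"
  by (rule summable_on_subset_banach[where A = UNIV]) (use f in "simp_all add: l2_chain_def")
 then have "(%x. Re (cut d X f x \<bullet>c cut d X f x)) summable_on UNIV"
  by (subst summable_on_cong_neutral[where T = X and g = "%x. Re (f x \<bullet>c f x)"]) (auto simp: cut_def)
 then show ?thesis using f by (auto simp: l2_chain_def cut_def)
qed

lemma l2_chain_site: "u : carrier_vec d ==> site d x u : l2_chain d"
proof -
 assume u: "u : carrier_vec d"
 have "(%y. Re (site d x u y \<bullet>c site d x u y)) summable_on UNIV"
  by (subst summable_on_cong_neutral[where T = "{x}" and g = "%y. Re (u \<bullet>c u)"]) (auto simp: site_def)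
 then show ?thesis using u by (auto simp: l2_chain_def site_def)
qed

lemma l2_chain_zero: "(%x. 0\<^sub>v d) : l2_chain d" by (simp add: l2_chain_def)

lemma l2_inner_self:
 assumes "f : l2_chain d"
 shows "l2_inner f f = of_real (infsum (%x. Re (f x \<bullet>c f x)) UNIV)"
proof -
 have "((%x. Re (f x \<bullet>c f x)) has_sum infsum (%x. Re (f x \<bullet>c f x)) UNIV) UNIV"
  using assms by (intro has_sum_infsum) (simp add: l2_chain_def)
 from has_sum_of_real[OF this, where 'a = complex] show ?thesis
  unfolding l2_inner_def using cdot_self(1) by (metis (no_types, lifting) infsumI infsum_cong)
qed

lemma l2_inner_site:
 assumes "u : carrier_vec d" "v : carrier_vec d"
 shows "l2_inner (site d x u) (site d y v) = (if x = y then v \<bullet>c u else 0)"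
proof -
 have "l2_inner (site d x u) (site d y v) = infsum (%z. if x = y then v \<bullet>c u else 0) {x}"
  unfolding l2_inner_def by (rule infsum_cong_neutral) (use assms in "auto simp: site_def")
 then show ?thesis by simp
qed

lemma cut_approximation:
 assumes f: "f : l2_chain d"
 obtains F :: "nat => int set" where "!!n. finite (F n)"
  "(%n. infsum (%x. Re (f x \<bullet>c f x)) (- F n)) ----> 0"
proof -
 let ?q = "%x. Re (f x \<bullet>c f x)"
 have summ: "?q summable_on UNIV" using f by (simp add: l2_chain_def)
 have "EX F. finite F & infsum ?q (- F) < e" if e: "e > 0" for e
 proof -
  obtain F where F: "finite F" "dist (sum ?q F) (infsum ?q UNIV) <= e / 2"
   using has_sum_finite_approximation[OF has_sum_infsum[OF summ] half_gt_zero[OF e]] by metis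
  have "infsum ?q UNIV = sum ?q F + infsum ?q (- F)"
   using infsum_Un_disjoint[of ?q F "- F"] F(1) summable_on_subset_banach[OF summ, of "- F"] by simp
  then have "infsum ?q (- F) <= e / 2" using F(2) by (simp add: dist_norm)
  then show ?thesis using F(1) e by (intro exI[of _ F]) auto
 qed
 then have "EX F. finite F & infsum ?q (- F) < 1 / real (Suc n)" for n by simp
 then obtain F where F: "!!n. finite (F n)" "!!n. infsum ?q (- F n) < 1 / real (Suc n)" by metis
 have "(%n. infsum ?q (- F n)) ----> 0"
 proof (rule tendsto_sandwich[of "%n. 0" _ _ "%n. 1 / real (Suc n)"])
  show "(%n. 1 / real (Suc n)) ----> 0" by (rule LIMSEQ_Suc[OF lim_1_over_n])
  show "\<forall>\<^sub>F n in sequentially. 0 <= infsum ?q (- F n)"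
   by (intro always_eventually allI infsum_nonneg cdot_self(2))
  show "\<forall>\<^sub>F n in sequentially. infsum ?q (- F n) <= 1 / real (Suc n)"
   by (intro always_eventually allI less_imp_le F(2))
 qed simp
 from that[OF F(1) this] show thesis .
qed

lemma car_familyD:
 assumes "car_family d s a" "f : l2_chain d"
 shows "g : l2_chain d ==> a (%x. f x + g x) = a f + a g"
  "g : l2_chain d ==> a f * a g = - (a g * a f)"
  "g : l2_chain d ==> a f * cstar (a g) + cstar (a g) * a f = conj_bit s (l2_inner f g) *c 1"
  "a (%x. c \<cdot>\<^sub>v f x) = conj_bit s (cnj c) *c a f"
 using assms by (simp_all add: car_family_def eq_neg_iff_add_eq_0)

lemma car_family_zero:
 assumes "car_family d s a"
 shows "a (%x. 0\<^sub>v d) = 0"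
proof -
 have "a (%x. 0 \<cdot>\<^sub>v 0\<^sub>v d) = conj_bit s (cnj 0) *c a (%x. 0\<^sub>v d)"
  by (rule car_familyD(4)[OF assms l2_chain_zero])
 moreover have "(%x :: int. 0 \<cdot>\<^sub>v 0\<^sub>v d) = (%x. 0\<^sub>v d :: complex vec)" by (auto simp: fun_eq_iff)
 ultimately show ?thesis by simp
qed

text \<open>With S the squared norm of \<open>f\<close>, the relations give
  \<open>y * y = S *r y\<close> for the self-adjoint \<open>y = cstar (a f) * a f\<close>, so the
  norm of \<open>y\<close> is 0 or S. This is the continuity of \<open>a\<close>.\<close>

lemma car_family_norm:
 assumes a: "car_family d s a" and f: "f : l2_chain d"
 shows "(norm (a f))\<^sup>2 <= infsum (%x. Re (f x \<bullet>c f x)) UNIV"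
proof -
 define S where "S = infsum (%x. Re (f x \<bullet>c f x)) UNIV"
 have S: "0 <= S" unfolding S_def by (intro infsum_nonneg cdot_self(2))
 define y where "y = cstar (a f) * a f"
 have "a f * a f + a f * a f = 0" using car_familyD(2)[OF a f f] by (metis add.left_inverse)
 then have sq: "a f * a f = 0" by (metis scaleR_2 scaleR_eq_0_iff zero_neq_numeral)
 have ac: "a f * cstar (a f) + y = of_real S *c 1"
  using car_familyD(3)[OF a f f] by (simp add: l2_inner_self[OF f] S_def y_def)
 have "y * y = cstar (a f) * (a f * cstar (a f)) * a f" by (simp add: y_def mult.assoc)
 also have "a f * cstar (a f) = of_real S *c 1 - y" using ac by (simp add: eq_diff_eq)
 also have "cstar (a f) * (of_real S *c 1 - y) * a f = S *r y - cstar (a f) * cstar (a f) * (a f * a f)"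
  by (simp add: y_def right_diff_distrib left_diff_distrib mult_scaleC_left mult_scaleC_right mult.assoc scaleC_of_real)
 finally have "y * y = S *r y" using sq by simp
 moreover have "cstar y = y" by (simp add: y_def cstar_simps)
 ultimately have "(norm y)\<^sup>2 = S * norm y" using norm_cstar_mult[of y] S by simp
 then have "norm y <= S" using S by (cases "norm y = 0") (auto simp: power2_eq_square)
 then show ?thesis by (simp add: y_def norm_cstar_mult S_def)
qed

lemma car_family_cut_limit:
 assumes a: "car_family d s a" and f: "f : l2_chain d"
  and F: "(%n. infsum (%x. Re (f x \<bullet>c f x)) (- F n)) ----> 0"
 shows "(%n. a (cut d (F n) f)) ----> a f"
proof -
 have "(norm (a f - a (cut d X f)))\<^sup>2 <= infsum (%x. Re (f x \<bullet>c f x)) (- X)" for X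
 proof -
  have "f = (%x. cut d X f x + cut d (- X) f x)" using l2_chain_carrier[OF f] by (auto simp: cut_def fun_eq_iff)
  then have "a f = a (cut d X f) + a (cut d (- X) f)"
   using car_familyD(1)[OF a l2_chain_cut[OF f] l2_chain_cut[OF f], of X "- X"] by simp
  then have "(norm (a f - a (cut d X f)))\<^sup>2 <= infsum (%x. Re (cut d (- X) f x \<bullet>c cut d (- X) f x)) UNIV"
   using car_family_norm[OF a l2_chain_cut[OF f]] by simp
  also have "... = infsum (%x. Re (f x \<bullet>c f x)) (- X)" by (rule infsum_cong_neutral) (auto simp: cut_def)
  finally show ?thesis .
 qed
 then have "(%n. (norm (a f - a (cut d (F n) f)))\<^sup>2) ----> 0" by (intro tendsto_sandwich[OF _ _ tendsto_const F]) auto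
 then have "(%n. sqrt ((norm (a f - a (cut d (F n) f)))\<^sup>2)) ----> sqrt 0" by (rule tendsto_real_sqrt)
 then have "(%n. norm (a (cut d (F n) f) - a f)) ----> 0" by (simp add: norm_minus_commute)
 from LIM_zero_cancel[OF tendsto_norm_zero_cancel[OF this]] show ?thesis .
qed

lemma car_family_site:
 assumes a: "car_family d s a" and u: "u : carrier_vec d"
 shows "a (site d x u) = (SUM i<d. conj_bit s (cnj (u $ i)) *c a (mode d x i))"
proof -
 \<comment> \<open>Truncations of \<open>u\<close>, so that additivity of \<open>a\<close> can be
   applied one coordinate at a time.\<close>
 define w where "w k = vec d (%i. if i < k then u $ i else 0)" for k
 have "a (site d x (w k)) = (SUM i<k. conj_bit s (cnj (u $ i)) *c a (mode d x i))" if "k <= d" for k using that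
 proof (induction k)
  case 0
  have "site d x (w 0) = (%x. 0\<^sub>v d)" by (auto simp: site_def w_def fun_eq_iff)
  then show ?case using car_family_zero[OF a] by simp
 next
  case (Suc k)
  let ?m = "%y. u $ k \<cdot>\<^sub>v mode d x k y"
  have m: "?m = site d x (u $ k \<cdot>\<^sub>v unit_vec d k)" by (auto simp: site_def fun_eq_iff)
  have eq: "site d x (w (Suc k)) = (%y. site d x (w k) y + ?m y)"
   using Suc.prems by (auto simp: site_def fun_eq_iff w_def less_Suc_eq)
  have 1: "site d x (w k) : l2_chain d" "?m : l2_chain d" "mode d x k : l2_chain d"
   unfolding m by (rule l2_chain_site; simp add: w_def)+
  have "a (site d x (w (Suc k))) = a (site d x (w k)) + a ?m" unfolding eq by (rule car_familyD(1)[OF a 1(1,2)])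
  also have "a ?m = conj_bit s (cnj (u $ k)) *c a (mode d x k)" by (rule car_familyD(4)[OF a 1(3)])
  finally show ?case using Suc by simp
 qed
 moreover have "w d = u" using u by (auto simp: w_def)
 ultimately show ?thesis by (metis order_refl)
qed

lemma car_family_cut:
 assumes a: "car_family d s a" and f: "f : l2_chain d" and F: "finite F"
 shows "a (cut d F f) = (SUM x:F. SUM i<d. conj_bit s (cnj (f x $ i)) *c a (mode d x i))" using F
proof induction
 case empty
 then show ?case using car_family_zero[OF a] by (simp add: cut_def)
next
 case (insert x F)
 have fx: "f x : carrier_vec d" by (rule l2_chain_carrier[OF f])
 have "cut d (insert x F) f = (%y. site d x (f x) y + cut d F f y)"
  using insert.hyps l2_chain_carrier[OF f] by (auto simp: cut_def site_def fun_eq_iff)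
 then have "a (cut d (insert x F) f) = a (site d x (f x)) + a (cut d F f)"
  using car_familyD(1)[OF a l2_chain_site[OF fx] l2_chain_cut[OF f], of x F] by simp
 then show ?case using insert by (simp add: car_family_site[OF a fx])
qed

lemma car_family_in_closure:
 assumes a: "car_family d s a" and f: "f : l2_chain d" and X: "!!x. x ~: X ==> f x = 0\<^sub>v d"
 shows "a f : closure (star_alg_gen {a (mode d x i) | x i. x : X & i < d})"
  (is "_ : ?C")
proof -
 obtain F :: "nat => int set" where F: "!!n. finite (F n)"
  "(%n. infsum (%x. Re (f x \<bullet>c f x)) (- F n)) ----> 0" using cut_approximation[OF f] by blast
 have sum_C: "sum g I : ?C" if "!!i. i : I ==> g i : ?C" for g and I :: "'i set"
 proof -
  have "0 : ?C" using closure_star_alg_gen(4)[OF closure_star_alg_gen(2), of 0] by simp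
  then show ?thesis using that by (induction I rule: infinite_finite_induct) (auto intro: closure_star_alg_gen(3))
 qed
 have "a (cut d (F n) f) : ?C" for n unfolding car_family_cut[OF a f F(1)]
 proof (intro sum_C)
  fix x i assume "x : F n" "i : {..<d}"
  show "conj_bit s (cnj (f x $ i)) *c a (mode d x i) : ?C"
  proof (cases "x : X")
   case True
   then have "a (mode d x i) : ?C" using \<open>i : {..<d}\<close> by (intro closure_star_alg_gen(1)) auto
   then show ?thesis by (rule closure_star_alg_gen(4))
  next
   case False
   then have "f x $ i = 0" using X \<open>i : {..<d}\<close> by simp
   then show ?thesis using closure_star_alg_gen(4)[OF closure_star_alg_gen(2), of 0] by simp
  qed
 qed
 from closed_sequentially[OF closed_closure this car_family_cut_limit[OF a f F(2)]] show ?thesis .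
qed

lemma l2_inner_mode:
 "i < d ==> j < d ==> l2_inner (mode d x i) (mode d y j) = (if x = y & i = j then 1 else 0)" by (subst l2_inner_site) auto

lemma car_family_modes:
 assumes a: "car_family d s a" and e: "inj_on e {..<n}" "!!k. k < n ==> snd (e k) < d"
 shows "car_modes (%k. a (mode d (fst (e k)) (snd (e k)))) n"
proof
 fix i j assume ij: "i < n" "j < n"
 let ?m = "%k. mode d (fst (e k)) (snd (e k))"
 have m: "?m k : l2_chain d" for k by (rule l2_chain_site) simp
 show "a (?m i) * a (?m j) = - (a (?m j) * a (?m i))" by (rule car_familyD(2)[OF a m m])
 have "a (?m i) * cstar (a (?m j)) + cstar (a (?m j)) * a (?m i) = conj_bit s (l2_inner (?m i) (?m j)) *c 1"
  by (rule car_familyD(3)[OF a m m])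
 also have "l2_inner (?m i) (?m j) = (if i = j then 1 else 0)"
  using e(2) ij inj_on_eq_iff[OF e(1), of i j] by (subst l2_inner_mode) (auto simp: prod_eq_iff)
 finally show "a (?m i) * cstar (a (?m j)) = (if i = j then 1 else 0) - cstar (a (?m j)) * a (?m i)"
  by (simp add: eq_diff_eq split: if_splits)
qed

lemma car_algebra_family: "car_algebra d a ==> car_family d 0 a" unfolding car_algebra_def car_family_def by simp

lemma car_sub_modes:
 assumes "car_algebra d a"
 shows "car_sub d a X = closure (star_alg_gen {a (mode d x i) | x i. x : X & i < d})"
proof (rule antisym)
 show "car_sub d a X <= closure (star_alg_gen {a (mode d x i) | x i. x : X & i < d})" unfolding car_sub_def
  by (rule closure_star_alg_gen_subset)
   (auto intro!: car_family_in_closure[OF car_algebra_family[OF assms]])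
 show "closure (star_alg_gen {a (mode d x i) | x i. x : X & i < d}) <= car_sub d a X" unfolding car_sub_def
 proof (rule closure_star_alg_gen_subset, clarify)
  fix x i assume "x : X" "i < d"
  then show "a (mode d x i) : closure (star_alg_gen (a ` {f : l2_chain d. ALL x. x ~: X --> f x = 0\<^sub>v d}))"
   by (intro closure_star_alg_gen(1) imageI CollectI conjI l2_chain_site) (auto simp: site_def)
 qed
qed

section \<open>Bogoliubov automorphisms\<close>

definition l2_unitary :: "nat => bit => ((int => complex vec) => (int => complex vec)) => bool" where
 "l2_unitary d s w \<longleftrightarrow>
   (ALL f:l2_chain d. w f : l2_chain d & (ALL c. w (%x. c \<cdot>\<^sub>v f x) = (%x. conj_bit s c \<cdot>\<^sub>v w f x)) &
    (EX g:l2_chain d. w g = f) &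
    (ALL g:l2_chain d. w (%x. f x + g x) = (%x. w f x + w g x) & l2_inner (w f) (w g) = conj_bit s (l2_inner f g)))"

lemma car_family_comp:
 assumes "car_algebra d a" "l2_unitary d s w"
 shows "car_family d s (%f. a (w f))" using assms unfolding car_family_def l2_unitary_def car_algebra_def by simp

lemma star_automorphism_ext:
 assumes "star_automorphism s f" "star_automorphism s g" "!!x. x : S ==> f x = g x"
  "x : closure (star_alg_gen S)"
 shows "f x = g x"
proof -
 have one: "h 1 = 1" if "star_automorphism s h" for h :: "'a => 'a"
 proof -
  have "surj h" using that unfolding star_automorphism_def bij_def by blast
  then obtain y where "h y = 1" by (metis surjD)
  then show ?thesis using that unfolding star_automorphism_def by (metis mult_1_left mult_1_right)
 qed
 show ?thesis by (rule star_hom_unique[where S = S and s = s])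
   (use assms one in "auto simp: star_automorphism_def")
qed

text \<open>Both \<open>a\<close> and its composition with \<open>w\<close> are CAR families over
  the same modes, so the correspondence of modes generates an isometric graph; surjectivity of its
  extension comes from that of \<open>w\<close>.\<close>

lemma bogoliubov_exists:
 assumes d: "0 < d" and a: "car_algebra d a" and w: "l2_unitary d s w"
 shows "EX be. star_automorphism s be & (ALL f:l2_chain d. be (a f) = a (w f))"
proof -
 \<comment> \<open>Enumerates all modes: the quotient by \<open>d\<close> codes the site, the
   remainder is the component.\<close>
 define e where "e k = (int_decode (k div d), k mod d)" for k
 have e_inj: "inj e"
 proof (rule injI)
  fix k l assume "e k = e l"
  then have "k div d = l div d" "k mod d = l mod d" using inj_int_decode[of UNIV] by (auto simp: e_def inj_def)
  then show "k = l" by (metis div_mult_mod_eq)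
 qed
 have e_snd: "snd (e k) < d" for k using d by (simp add: e_def)
 have e_surj: "EX k. e k = (x, i)" if "i < d" for x i
  using that by (intro exI[of _ "int_encode x * d + i"]) (simp add: e_def)
 define c where "c k = a (mode d (fst (e k)) (snd (e k)))" for k
 define c' where "c' k = a (w (mode d (fst (e k)) (snd (e k))))" for k
 note fam = car_algebra_family[OF a] car_family_comp[OF a w]
 have c: "car_modes c n" "car_modes c' n" for n unfolding c_def c'_def using e_inj e_snd
  by (auto intro!: car_family_modes[OF fam(1)] car_family_modes[OF fam(2)] intro: inj_on_subset)
 define S where "S = range (%k. (c k, c' k))"
 have S_mode: "(a (mode d x i), a (w (mode d x i))) : S" if i: "i < d" for x i
 proof -
  obtain k where "e k = (x, i)" using e_surj[OF i] by blast
  then have "(a (mode d x i), a (w (mode d x i))) = (c k, c' k)" by (simp add: c_def c'_def)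
  then show ?thesis by (simp add: S_def)
 qed
 have iso: "norm y = norm x" if "pair_gen s S x y" for x y
  using car_modes_pair_norm[OF c, of s x y] that by (simp add: S_def)
 have gen: "{a (mode d x i) | x i. x : UNIV & i < d} <= fst ` S"
  "{a (w (mode d x i)) | x i. x : UNIV & i < d} <= snd ` S" using S_mode by force+
 have mono: "closure (star_alg_gen A) <= closure (star_alg_gen B)" if "A <= B" for A B :: "'a set"
  using that by (intro closure_star_alg_gen_subset) (auto intro: closure_star_alg_gen(1))
 have "car_sub d a UNIV = UNIV" using a by (simp add: car_algebra_def)
 then have dense: "closure (star_alg_gen (fst ` S)) = UNIV" using mono[OF gen(1)] car_sub_modes[OF a, of UNIV] by auto
 obtain be where hom: "isometric_hom s be" and gen_eq: "ALL x y. pair_gen s S x y --> be x = y"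
  and range: "closure (star_alg_gen (snd ` S)) <= range be" using pair_extension[of s S, OF iso dense] by blast
 have be: "!!x y. be (x + y) = be x + be y" "!!x y. be (x * y) = be x * be y"
  "!!z x. be (z *c x) = conj_bit s z *c be x" "!!x. be (cstar x) = cstar (be x)" "be 1 = 1"
  "!!x. norm (be x) = norm x" "!!x y. pair_gen s S x y ==> be x = y"
  "closure (star_alg_gen (snd ` S)) <= range be" using hom gen_eq range by (auto simp: isometric_hom_def)
 have diff: "be (x - y) = be x - be y" for x y using be(1)[of "x - y" y] by simp
 have "inj be" by (rule injI) (metis be(6) diff eq_iff_diff_eq_0 norm_eq_zero)
 moreover have "surj be"
 proof -
  have "a f : closure (star_alg_gen (snd ` S))" if f: "f : l2_chain d" for f
  proof -
   obtain g where g: "g : l2_chain d" "w g = f" using w f unfolding l2_unitary_def by blast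
   have "a (w g) : closure (star_alg_gen {a (w (mode d x i)) | x i. x : UNIV & i < d})"
    by (rule car_family_in_closure[OF fam(2) g(1)]) simp
   then show ?thesis using mono[OF gen(2)] g(2) by auto
  qed
  then have "closure (star_alg_gen (a ` {f : l2_chain d. ALL x. x ~: UNIV --> f x = 0\<^sub>v d})) <= closure (star_alg_gen (snd ` S))"
   by (intro closure_star_alg_gen_subset) auto
  then have "UNIV <= closure (star_alg_gen (snd ` S))"
   using \<open>car_sub d a UNIV = UNIV\<close> by (simp add: car_sub_def)
  then show ?thesis using be(8) by blast
 qed
 moreover have "be (a f) = a (w f)" if f: "f : l2_chain d" for f
 proof -
  obtain F :: "nat => int set" where F: "!!n. finite (F n)"
   "(%n. infsum (%x. Re (f x \<bullet>c f x)) (- F n)) ----> 0" using cut_approximation[OF f] by blast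
  have bem: "be (a (mode d x i)) = a (w (mode d x i))" if "i < d" for x i by (intro be(7) pair_gen.base S_mode that)
  have bes: "be (sum g I) = (SUM i:I. be (g i))" for g and I :: "'i set"
   using be(1)[of 0 0] by (induction I rule: infinite_finite_induct) (simp_all add: be(1))
  have eq: "be (a (cut d (F n) f)) = a (w (cut d (F n) f))" for n
   unfolding car_family_cut[OF fam(1) f F(1)] car_family_cut[OF fam(2) f F(1)] by (simp add: bes be(3) bem)
  have "bounded_linear be"
  proof
   show "be (r *r x) = r *r be x" for r x using be(3)[of "of_real r" x] by (simp add: scaleC_of_real)
   show "EX K. ALL x. norm (be x) <= norm x * K" by (rule exI[of _ 1]) (simp add: be(6))
  qed (rule be(1))
  then have "(%n. be (a (cut d (F n) f))) ----> be (a f)"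
   by (rule bounded_linear.tendsto) (rule car_family_cut_limit[OF fam(1) f F(2)])
  moreover have "(%n. a (w (cut d (F n) f))) ----> a (w f)" by (rule car_family_cut_limit[OF fam(2) f F(2)])
  ultimately show ?thesis unfolding eq using LIMSEQ_unique by blast
 qed
 ultimately have "star_automorphism s be & (ALL f:l2_chain d. be (a f) = a (w f))"
  unfolding star_automorphism_def bij_def using be by simp
 then show ?thesis by blast
qed

lemma car_aut:
 assumes d: "0 < d" and a: "car_algebra d a" and w: "l2_unitary d s w"
 shows "star_automorphism s (car_aut d a s w)" "f : l2_chain d ==> car_aut d a s w (a f) = a (w f)"
proof -
 have "EX! be. star_automorphism s be & (ALL f:l2_chain d. be (a f) = a (w f))"
 proof (rule ex_ex1I[OF bogoliubov_exists[OF assms]])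
  fix be be' assume b: "star_automorphism s be & (ALL f:l2_chain d. be (a f) = a (w f))"
   "star_automorphism s be' & (ALL f:l2_chain d. be' (a f) = a (w f))"
  show "be = be'"
  proof
   fix x
   have "x : car_sub d a UNIV" using a by (simp add: car_algebra_def)
   then show "be x = be' x" unfolding car_sub_def by (rule star_automorphism_ext[of s be be', rotated 3]) (use b in auto)
  qed
 qed
 from theI'[OF this] show "star_automorphism s (car_aut d a s w)" "f : l2_chain d ==> car_aut d a s w (a f) = a (w f)"
  unfolding car_aut_def by auto
qed

lemma l2_unitary_shift: "l2_unitary d 0 (%f x. f (x - y))"
proof -
 have bij: "bij_betw (%x. x - y) UNIV (UNIV :: int set)" by (rule bij_betwI[where g = "%x. x + y"]) auto
 have l2: "(%x. f (x - y)) : l2_chain d" if "f : l2_chain d" for f and y :: int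
 proof -
  have "bij_betw (%x. x - y) UNIV (UNIV :: int set)" by (rule bij_betwI[where g = "%x. x + y"]) auto
  then show ?thesis using that summable_on_reindex_bij_betw[of "%x. x - y" UNIV UNIV "%x. Re (f x \<bullet>c f x)"]
   by (simp add: l2_chain_def)
 qed
 show ?thesis unfolding l2_unitary_def
 proof (intro ballI conjI allI)
  fix f assume f: "f : l2_chain d"
  show "(%x. f (x - y)) : l2_chain d" by (rule l2[OF f])
  show "EX g:l2_chain d. (%x. g (x - y)) = f" by (rule bexI[of _ "%x. f (x - (- y))"]) (use l2[OF f, of "- y"] in auto)
  fix g
  show "l2_inner (%x. f (x - y)) (%x. g (x - y)) = conj_bit 0 (l2_inner f g)"
   unfolding l2_inner_def using infsum_reindex_bij_betw[OF bij, of "%x. g x \<bullet>c f x"] by simp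
 qed simp_all
qed

lemma l2_unitary_pointwise:
 assumes W: "!!u. u : carrier_vec d ==> W u : carrier_vec d & (EX v:carrier_vec d. W v = u)"
  "!!u c. u : carrier_vec d ==> W (c \<cdot>\<^sub>v u) = conj_bit s c \<cdot>\<^sub>v W u"
  "!!u v. u : carrier_vec d ==> v : carrier_vec d ==> W (u + v) = W u + W v"
  "!!u v. u : carrier_vec d ==> v : carrier_vec d ==> W u \<bullet>c W v = conj_bit s (u \<bullet>c v)"
 shows "l2_unitary d s (%f x. W (f x))" unfolding l2_unitary_def
proof (intro ballI conjI allI)
 fix f assume f: "f : l2_chain d"
 note fc = l2_chain_carrier[OF f]
 show "(%x. W (f x)) : l2_chain d" using f W(1) W(4) unfolding l2_chain_def by simp
 show "(%x. W (c \<cdot>\<^sub>v f x)) = (%x. conj_bit s c \<cdot>\<^sub>v W (f x))" for c by (simp add: W(2) fc)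
 show "EX g:l2_chain d. (%x. W (g x)) = f"
 proof -
  have "EX v:carrier_vec d. W v = f x" for x using W(1)[OF fc] by blast
  then obtain g where g: "!!x. g x : carrier_vec d" "!!x. W (g x) = f x" by metis
  have "Re (g x \<bullet>c g x) = Re (f x \<bullet>c f x)" for x using W(4)[OF g(1) g(1), of x x] by (simp add: g(2))
  then have "g : l2_chain d" using f g(1) by (simp add: l2_chain_def)
  then show ?thesis using g(2) by auto
 qed
 fix g assume g: "g : l2_chain d"
 show "(%x. W (f x + g x)) = (%x. W (f x) + W (g x))" by (simp add: W(3) fc l2_chain_carrier[OF g])
 show "l2_inner (%x. W (f x)) (%x. W (g x)) = conj_bit s (l2_inner f g)"
  by (cases s) (simp_all add: l2_inner_def W(4) fc l2_chain_carrier[OF g])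
qed

lemma mat_adjoint_dim [simp]: "dim_row (mat_adjoint A) = dim_col A" "dim_col (mat_adjoint A) = dim_row A"
 by (simp_all add: mat_adjoint_def)

lemma mat_adjoint_index [simp]:
 "i < dim_col A ==> j < dim_row A ==> mat_adjoint A $$ (i, j) = cnj (A $$ (j, i))" for A :: "complex mat"
 by (simp add: mat_adjoint_def mat_of_rows_def)

lemma mat_adjoint_carrier [simp]: "A : carrier_mat n m ==> mat_adjoint A : carrier_mat m n" by auto

lemma mat_adjoint_cdot:
 assumes A: "(A :: complex mat) : carrier_mat n m" and u: "u : carrier_vec m" and v: "v : carrier_vec n"
 shows "(A *mv u) \<bullet>c v = u \<bullet>c (mat_adjoint A *mv v)"
proof -
 have "(A *mv u) \<bullet>c v = (SUM i<n. SUM j<m. A $$ (i, j) * u $ j * cnj (v $ i))"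
  using A u v by (subst cdot_sum[of _ n]) (auto simp: scalar_prod_def sum_distrib_right atLeast0LessThan)
 also have "... = (SUM j<m. SUM i<n. A $$ (i, j) * u $ j * cnj (v $ i))" by (rule sum.swap)
 also have "... = u \<bullet>c (mat_adjoint A *mv v)" using A u v mult_mat_vec_carrier[OF mat_adjoint_carrier[OF A] v]
  by (subst cdot_sum[of _ m]) (auto simp: scalar_prod_def sum_distrib_left atLeast0LessThan mult_ac)
 finally show ?thesis .
qed

lemma unitary_mat_left_inverse:
 assumes "(M :: complex mat) : carrier_mat n n" "M * mat_adjoint M = idm n"
 shows "mat_adjoint M * M = idm n" using assms mat_mult_left_right_inverse by (metis mat_adjoint_carrier)

lemma vec_conj_simps:
 "u : carrier_vec n ==> vec_conj s u : carrier_vec n"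
 "u : carrier_vec n ==> v : carrier_vec n ==> vec_conj s (u + v) = vec_conj s u + vec_conj s v"
 "u : carrier_vec n ==> vec_conj s (c \<cdot>\<^sub>v u) = conj_bit s c \<cdot>\<^sub>v vec_conj s u"
 "vec_conj s (vec_conj s u) = u"
 "u : carrier_vec n ==> v : carrier_vec n ==> vec_conj s u \<bullet>c vec_conj s v = conj_bit s (u \<bullet>c v)"
 by (auto simp: vec_conj_def cdot_sum[of _ n] conj_bit_def intro!: eq_vecI)

lemma l2_unitary_onsite:
 assumes M: "M : carrier_mat d d" "M * mat_adjoint M = idm d"
 shows "l2_unitary d s (%f x. mat_apply s M (f x))"
proof (rule l2_unitary_pointwise)
 note M' = unitary_mat_left_inverse[OF M]
 fix u v :: "complex vec" and c assume u: "u : carrier_vec d"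
 show "mat_apply s M u : carrier_vec d & (EX v:carrier_vec d. mat_apply s M v = u)"
 proof (intro conjI bexI)
  let ?v = "vec_conj s (mat_adjoint M *mv u)"
  have Mu: "mat_adjoint M *mv u : carrier_vec d" by (rule mult_mat_vec_carrier[OF mat_adjoint_carrier[OF M(1)] u])
  then show "?v : carrier_vec d" by (rule vec_conj_simps(1))
  have "M *mv (mat_adjoint M *mv u) = (M * mat_adjoint M) *mv u"
   using assoc_mult_mat_vec[OF M(1) mat_adjoint_carrier[OF M(1)] u] by simp
  then show "mat_apply s M ?v = u" using u by (simp add: mat_apply_def vec_conj_simps(4) M(2))
  show "mat_apply s M u : carrier_vec d"
   unfolding mat_apply_def by (rule mult_mat_vec_carrier[OF M(1) vec_conj_simps(1)[OF u]])
 qed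
 show "mat_apply s M (c \<cdot>\<^sub>v u) = conj_bit s c \<cdot>\<^sub>v mat_apply s M u"
  using M u vec_conj_simps(1)[OF u] by (simp add: mat_apply_def vec_conj_simps(3)[OF u] mult_mat_vec)
 assume v: "v : carrier_vec d"
 show "mat_apply s M (u + v) = mat_apply s M u + mat_apply s M v" using M vec_conj_simps(1)[OF u] vec_conj_simps(1)[OF v]
  by (simp add: mat_apply_def vec_conj_simps(2)[OF u v] mult_add_distrib_mat_vec)
 have "mat_apply s M u \<bullet>c mat_apply s M v = vec_conj s u \<bullet>c (mat_adjoint M *mv (M *mv vec_conj s v))"
  unfolding mat_apply_def using M vec_conj_simps(1)[OF u] vec_conj_simps(1)[OF v] by (intro mat_adjoint_cdot[of M d d]) auto
 also have "mat_adjoint M *mv (M *mv vec_conj s v) = vec_conj s v"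
  using M vec_conj_simps(1)[OF v] M' by (simp add: assoc_mult_mat_vec[symmetric, of _ d d M d])
 finally show "mat_apply s M u \<bullet>c mat_apply s M v = conj_bit s (u \<bullet>c v)"
  using vec_conj_simps(5)[OF u v] by simp
qed

lemma l2_unitary_parity: "l2_unitary d 0 (%f x. - f x)"
proof (rule l2_unitary_pointwise)
 fix u v :: "complex vec" and c assume u: "u : carrier_vec d"
 show "- u : carrier_vec d & (EX v:carrier_vec d. - v = u)" using u by (auto intro!: bexI[of _ "- u"])
 show "- (c \<cdot>\<^sub>v u) = conj_bit 0 c \<cdot>\<^sub>v - u" using u by auto
 assume v: "v : carrier_vec d"
 show "- (u + v) = - u + - v" using u v by auto
 show "- u \<bullet>c - v = conj_bit 0 (u \<bullet>c v)" using u v by (simp add: cdot_sum[of _ d])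
qed

section \<open>The algebra of finitely many modes is a full matrix algebra\<close>

definition mpar :: "nat set => complex" where
 "mpar mu = (- 1) ^ card mu"

lemma mpar_simps [simp]: "cnj (mpar mu) = mpar mu" "mpar mu * mpar mu = 1" "mpar mu ~= 0" "cmod (mpar mu) = 1"
 "mpar {} = 1" by (simp_all add: mpar_def norm_power flip: power_mult_distrib)

lemma sg_eq_mpar: "mu <= {..<k} ==> sg k mu = mpar mu"
 unfolding sg_def mpar_def by (rule arg_cong[where f = "%S. (- 1) ^ card S"]) auto

lemma mpar_bit_sign: "bit_sign (card_parity mu) = mpar mu"
proof -
 have "bit_sign (of_nat n) = (- 1) ^ n" for n by (induction n) (auto simp: bit_sign_def)
 then show ?thesis by (simp add: card_parity_def mpar_def)
qed

context car_modes
begin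

lemma comb_cong: "(!!mu nu. mu : PN ==> nu : PN ==> k mu nu = l mu nu) ==> comb k = comb l"
 unfolding comb_def by (intro sum.cong refl) simp

lemma comb_inject:
 assumes "comb k = comb l" "mu : PN" "nu : PN"
 shows "k mu nu = l mu nu" by (metis PowD assms(1,2,3) cvs.scale_cancel_right munit_comb munit_nonzero)

lemma vac_in_alg: "k <= n ==> vac c k : star_alg_gen (c ` {..<n})"
 by (induction k) (auto intro!: star_alg_gen.mult star_alg_gen.cstar star_alg_gen.one star_alg_gen.base[OF imageI])

lemma crea_in_alg: "k <= n ==> crea c k mu : star_alg_gen (c ` {..<n})"
 by (induction k) (auto intro!: star_alg_gen.mult star_alg_gen.cstar star_alg_gen.one star_alg_gen.base[OF imageI])

lemma munit_in_alg: "mun mu nu : star_alg_gen (c ` {..<n})"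
 unfolding munit_def by (intro star_alg_gen.mult star_alg_gen.cstar vac_in_alg crea_in_alg order_refl)

lemma star_alg_gen_sum: "(!!i. i : I ==> f i : star_alg_gen S) ==> sum f I : star_alg_gen S"
 using star_alg_gen.scaleC[OF star_alg_gen.one, of 0 S]
 by (induction I rule: infinite_finite_induct) (auto intro: star_alg_gen.add)

lemma comb_in_alg: "comb k : star_alg_gen (c ` {..<n})"
 unfolding comb_def by (intro star_alg_gen_sum star_alg_gen.scaleC munit_in_alg)

text \<open>Coefficients are bounded by the norm, so those of a norm-convergent sequence converge,
  and the limit is again a combination of matrix units.\<close>

lemma closure_alg: "closure (star_alg_gen (c ` {..<n})) = star_alg_gen (c ` {..<n})"
proof (rule antisym[OF _ closure_subset], rule subsetI)
 fix x assume "x : closure (star_alg_gen (c ` {..<n}))"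
 then obtain X where X: "!!j. X j : star_alg_gen (c ` {..<n})" "X ----> x" unfolding closure_sequential by blast
 obtain k where k: "!!j. X j = comb (k j)" using comb_exists[OF X(1)] by metis
 obtain B where B: "B > 0" "!!k mu nu. mu : PN ==> nu : PN ==> cmod (k mu nu) <= B * norm (comb k)" using comb_bound by blast
 have "EX l. (%j. k j mu nu) ----> l" if munu: "mu : PN" "nu : PN" for mu nu
 proof -
  have le: "dist (k i mu nu) (k j mu nu) <= B * dist (X i) (X j)" for i j
  proof -
   have "comb (k i) - comb (k j) = comb (%mu nu. k i mu nu - k j mu nu)"
    by (simp add: comb_def sum_subtractf[symmetric] cvs.scale_left_diff_distrib)
   then show ?thesis using B(2)[OF munu, of "%mu nu. k i mu nu - k j mu nu"] by (simp add: dist_norm k)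
  qed
  have "Cauchy (%j. k j mu nu)"
  proof (rule metric_CauchyI)
   fix e :: real assume "e > 0"
   then have "e / B > 0" using B(1) by simp
   then obtain M where M: "!!i j. i >= M ==> j >= M ==> dist (X i) (X j) < e / B"
    using LIMSEQ_imp_Cauchy[OF X(2)] metric_CauchyD by blast
   have "dist (k i mu nu) (k j mu nu) < e" if "i >= M" "j >= M" for i j
    using le[of i j] M[OF that] B(1) by (simp add: field_simps)
   then show "EX M. ALL i>=M. ALL j>=M. dist (k i mu nu) (k j mu nu) < e" by blast
  qed
  then show ?thesis using Cauchy_convergent_iff convergent_def by blast
 qed
 then obtain l where l: "!!mu nu. mu : PN ==> nu : PN ==> (%j. k j mu nu) ----> l mu nu" by metis
 have "(%j. comb (k j)) ----> comb l" unfolding comb_def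
  by (intro tendsto_sum bounded_linear.tendsto[OF bounded_linear_scaleC_left] l) auto
 then have "x = comb l" using X(2) k LIMSEQ_unique by (metis (no_types, lifting) ext)
 then show "x : star_alg_gen (c ` {..<n})" using comb_in_alg by simp
qed

text \<open>Meant for generators of other sites: passing one through a matrix unit costs only the
  product of the two parities.\<close>

lemma anti_munit:
 assumes y: "!!i. i < n ==> y * c i = - (c i * y)" "!!i. i < n ==> y * cstar (c i) = - (cstar (c i) * y)"
  and mu: "mu <= {..<n}" "nu <= {..<n}"
 shows "y * mun mu nu = (mpar mu * mpar nu) *c (mun mu nu * y)"
proof -
 have crea: "k <= n ==> y * crea c k mu = sg k mu *c (crea c k mu * y)" for k mu
 proof (induction k)
  case (Suc k)
  have "y * crea c (Suc k) mu = sg k mu *c (crea c k mu * (y * (if k : mu then cstar (c k) else 1)))"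
   using Suc by (simp add: mult.assoc[symmetric] mult_scaleC_left)
  then show ?case using y(2)[of k] Suc.prems by (simp add: sg_Suc mult.assoc)
 qed (simp add: sg_def)
 have crea': "k <= n ==> y * cstar (crea c k mu) = sg k mu *c (cstar (crea c k mu) * y)" for k mu
 proof (induction k)
  case (Suc k)
  have "y * cstar (crea c (Suc k) mu) = (if k : mu then - (c k * y) else y) * cstar (crea c k mu)"
   using y(1)[of k] Suc.prems by (auto simp: cstar_simps mult.assoc[symmetric])
  also have "... = (if k : mu then - c k else 1) * (y * cstar (crea c k mu))" by (simp add: mult.assoc)
  finally show ?case using Suc by (simp add: sg_Suc mult_scaleC_right cstar_simps mult.assoc)
 qed (simp add: sg_def)
 have vac: "k <= n ==> y * vac c k = vac c k * y" for k
 proof (induction k)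
  case (Suc k)
  have "y * vac c (Suc k) = vac c k * (y * c k) * cstar (c k)" using Suc by (simp add: mult.assoc[symmetric])
  also have "... = - (vac c k * c k * (y * cstar (c k)))" using y(1)[of k] Suc.prems by (simp add: mult.assoc)
  also have "... = vac c (Suc k) * y" using y(2)[of k] Suc.prems by (simp add: mult.assoc)
  finally show ?case .
 qed simp
 have "y * mun mu nu = (y * crea c n mu) * vac c n * cstar (crea c n nu)" by (simp add: munit_def mult.assoc)
 also have "... = sg n mu *c (crea c n mu * (y * vac c n) * cstar (crea c n nu))"
  by (simp add: crea mult_scaleC_left mult.assoc)
 also have "... = sg n mu *c (crea c n mu * vac c n * (y * cstar (crea c n nu)))" by (simp add: vac mult.assoc)
 also have "... = (sg n mu * sg n nu) *c (mun mu nu * y)"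
  by (simp add: crea' mult_scaleC_right scaleC_scaleC munit_def mult.assoc)
 finally show ?thesis using mu by (simp add: sg_eq_mpar)
qed

lemma parity_munit:
 assumes "star_automorphism 0 th" and th: "!!i. i < n ==> th (c i) = - c i" and "mu <= {..<n}" "nu <= {..<n}"
 shows "th (mun mu nu) = (mpar mu * mpar nu) *c mun mu nu"
proof -
 have h: "th (x * y) = th x * th y" "th (cstar x) = cstar (th x)" for x y
  using assms(1) by (auto simp: star_automorphism_def)
 have "surj th" using assms(1) by (auto simp: star_automorphism_def bij_def)
 then have one: "th 1 = 1" by (metis h(1) mult_1_left mult_1_right surjD)
 have crea: "k <= n ==> th (crea c k mu) = sg k mu *c crea c k mu" for k mu
 proof (induction k)
  case (Suc k)
  then show ?case using th[of k] by (simp add: h one sg_Suc mult_scaleC_left cstar_minus)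
 qed (simp add: one sg_def)
 have vac: "k <= n ==> th (vac c k) = vac c k" for k by (induction k) (use th in "simp_all add: h one cstar_minus")
 show ?thesis using assms(3,4)
  by (simp add: munit_def h crea vac cstar_simps mult_scaleC_left mult_scaleC_right scaleC_scaleC sg_eq_mpar mult.commute)
qed

text \<open>In the resolution of the identity by diagonal units, every unit except the vacuum one
  can be written with an annihilator at its right end, which kills \<open>y\<close>.\<close>

lemma vac_absorb:
 assumes "!!i. i < n ==> c i * y = 0"
 shows "vac c n * y = y"
proof -
 have "mun mu mu * y = (if mu = {} then vac c n * y else 0)" if "mu : PN" for mu
 proof (cases "mu = {}")
  case False
  then obtain i where i: "i : mu" by blast
  then have iN: "i < n" using that by auto
  have "crea c n mu = sg i (mu - {i}) *c (cstar (c i) * crea c n (mu - {i}))"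
   using cstar_crea[of i n "mu - {i}"] iN i by (simp add: scaleC_scaleC insert_absorb)
  then have "cstar (crea c n mu) * y = 0" using assms[OF iN] by (simp add: cstar_simps mult_scaleC_left mult.assoc)
  then show ?thesis using False by (simp add: munit_def mult.assoc)
 qed (simp add: munit_def)
 then have "(SUM mu:PN. mun mu mu) * y = (SUM mu:PN. if mu = {} then vac c n * y else 0)" by (simp add: sum_distrib_right)
 then show ?thesis by (simp add: sum_munit)
qed

section \<open>The Fock representation\<close>

text \<open>\<open>fvec psi\<close> realises the Fock vector \<open>psi\<close> in the left ideal generated by the vacuum projection.\<close>

definition fvec :: "fock => 'a" where
 "fvec psi = (SUM mu:PN. psi mu *c (crea c n mu * vac c n))"

lemma fvec_add: "fvec (%tau. phi tau + psi tau) = fvec phi + fvec psi" by (simp add: fvec_def scaleC_add_left sum.distrib)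

lemma fvec_scale: "fvec (%tau. z * psi tau) = z *c fvec psi" by (simp add: fvec_def scaleC_scaleC cvs.scale_sum_right)

lemma fvec_inner: "cstar (fvec phi) * fvec psi = fock_inner n phi psi *c vac c n"
proof -
 have "cstar (fvec phi) * fvec psi = (SUM nu:PN. SUM mu:PN.
   (cnj (phi mu) * psi nu) *c (vac c n * cstar (crea c n mu) * (crea c n nu * vac c n)))" unfolding fvec_def
  by (simp add: cstar_simps cstar_vac sum_distrib_left sum_distrib_right mult_scaleC_left mult_scaleC_right
    scaleC_scaleC cvs.scale_sum_right mult.assoc mult.commute)
 also have "... = (SUM nu:PN. SUM mu:PN. if mu = nu then (cnj (phi mu) * psi nu) *c vac c n else 0)"
  by (intro sum.cong refl) (simp add: vac_crea_vac)
 also have "... = fock_inner n phi psi *c vac c n" by (simp add: fock_inner_def cvs.scale_sum_left)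
 finally show ?thesis .
qed

lemma fock_inner_eqI:
 assumes "phi : fock_space n" "psi : fock_space n" "!!eta. eta : fock_space n ==> fock_inner n eta phi = fock_inner n eta psi"
 shows "phi = psi"
proof
 fix mu
 show "phi mu = psi mu"
 proof (cases "mu <= {..<n}")
  case True
  have *: "fock_inner n (%tau. if tau = mu then 1 else 0) eta = eta mu" for eta
  proof -
   have "fock_inner n (%tau. if tau = mu then 1 else 0) eta = (SUM tau:PN. if tau = mu then eta mu else 0)"
    unfolding fock_inner_def by (rule sum.cong) auto
   then show ?thesis using True by simp
  qed
  have "(%tau. if tau = mu then 1 else 0) : fock_space n" using True by (auto simp: fock_space_def)
  from assms(3)[OF this] show ?thesis unfolding * .
 qed (use assms in "auto simp: fock_space_def")
qed

lemma fvec_inject: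
 assumes "phi : fock_space n" "psi : fock_space n" "fvec phi = fvec psi"
 shows "phi = psi" by (metis assms(1,2,3) cvs.scale_cancel_right fock_inner_eqI fvec_inner vac_nonzero)

lemma comb_fvec: "EX phi:fock_space n. comb k * fvec psi = fvec phi"
proof -
 have "mun mu nu * fvec psi = psi nu *c (crea c n mu * vac c n)" if "mu : PN" "nu : PN" for mu nu
 proof -
  have "mun mu nu * fvec psi = (SUM tau:PN. psi tau *c (crea c n mu * (vac c n * cstar (crea c n nu) * (crea c n tau * vac c n))))"
   by (simp add: fvec_def munit_def sum_distrib_left mult_scaleC_right mult.assoc)
  also have "... = (SUM tau:PN. if tau = nu then psi tau *c (crea c n mu * vac c n) else 0)"
   using that by (intro sum.cong refl) (auto simp: vac_crea_vac)
  finally show ?thesis using that by simp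
 qed
 then have "comb k * fvec psi = fvec (%mu. if mu <= {..<n} then SUM nu:PN. k mu nu * psi nu else 0)"
  unfolding comb_def by (simp add: fvec_def sum_distrib_right mult_scaleC_left scaleC_scaleC cvs.scale_sum_left)
 moreover have "(%mu. if mu <= {..<n} then SUM nu:PN. k mu nu * psi nu else 0) : fock_space n" by (simp add: fock_space_def)
 ultimately show ?thesis by blast
qed

lemma sg_diff_self: "sg i (tau - {i}) = sg i tau" unfolding sg_def by (rule arg_cong[where f = "%S. (- 1) ^ card S"]) auto

text \<open>Links the sign in \<open>fock_create\<close> to the abstract \<open>sg\<close>: the sum
  over \<open>mu\<close> without \<open>i\<close> becomes one over
  \<open>tau = insert i mu\<close>.\<close>

lemma fvec_create:
 assumes u: "u : carrier_vec n"
 shows "(SUM i<n. u $ i *c cstar (c i)) * fvec psi = fvec (fock_create n u psi)"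
proof -
 have one: "cstar (c i) * fvec psi = (SUM tau:PN. (if i : tau then sg i tau * psi (tau - {i}) else 0) *c (crea c n tau * vac c n))"
  if i: "i < n" for i
 proof -
  have "cstar (c i) * fvec psi = (SUM mu:PN. psi mu *c (cstar (c i) * crea c n mu * vac c n))"
   by (simp add: fvec_def sum_distrib_left mult_scaleC_right mult.assoc)
  also have "... = (SUM mu:PN. if i : mu then 0 else (sg i mu * psi mu) *c (crea c n (insert i mu) * vac c n))"
   by (intro sum.cong refl) (simp add: cstar_crea i mult_scaleC_left scaleC_scaleC mult.commute)
  also have "... = (SUM mu:{mu : PN. i ~: mu}. (sg i mu * psi mu) *c (crea c n (insert i mu) * vac c n))"
   by (subst sum.inter_filter) (auto intro!: sum.cong)
  also have "... = (SUM tau:{tau : PN. i : tau}. (sg i tau * psi (tau - {i})) *c (crea c n tau * vac c n))"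
   by (rule sum.reindex_bij_witness[where i = "%tau. tau - {i}" and j = "insert i"])
    (use i in \<open>auto simp: insert_absorb sg_diff_self[symmetric, of _ "insert _ _"]\<close>)
  also have "... = (SUM tau:PN. (if i : tau then sg i tau * psi (tau - {i}) else 0) *c (crea c n tau * vac c n))"
   by (subst sum.inter_filter) (auto intro!: sum.cong)
  finally show ?thesis .
 qed
 have "(SUM i<n. u $ i *c cstar (c i)) * fvec psi = (SUM i<n. SUM tau:PN.
   (if i : tau then sg i tau * u $ i * psi (tau - {i}) else 0) *c (crea c n tau * vac c n))" unfolding sum_distrib_right
  by (intro sum.cong refl) (simp add: one mult_scaleC_left cvs.scale_sum_right scaleC_scaleC, intro sum.cong refl, simp)
 also have "... = (SUM tau:PN. (SUM i<n. (if i : tau then sg i tau * u $ i * psi (tau - {i}) else 0)) *c (crea c n tau * vac c n))"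
  by (subst sum.swap) (simp add: cvs.scale_sum_left)
 also have "... = fvec (fock_create n u psi)" unfolding fvec_def
 proof (intro sum.cong refl)
  fix tau assume tau: "tau : PN"
  then have f: "finite tau" "tau <= {..<n}" using finite_subset by auto
  have "(SUM i<n. (if i : tau then sg i tau * u $ i * psi (tau - {i}) else 0)) = (SUM i:{..<n} \<inter> tau. sg i tau * u $ i * psi (tau - {i}))"
   by (simp add: sum.inter_restrict)
  also have "{..<n} \<inter> tau = tau" using f by auto
  finally have "(SUM i<n. (if i : tau then sg i tau * u $ i * psi (tau - {i}) else 0)) = fock_create n u psi tau"
   using f by (simp add: fock_create_def sg_def)
  then show "(SUM i<n. (if i : tau then sg i tau * u $ i * psi (tau - {i}) else 0)) *c (crea c n tau * vac c n) =
    fock_create n u psi tau *c (crea c n tau * vac c n)" by simp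
 qed
 finally show ?thesis .
qed

lemma fvec_vacuum: "fvec fock_vacuum = vac c n"
proof -
 have "fvec fock_vacuum = (SUM mu:PN. if mu = {} then vac c n else 0)"
  unfolding fvec_def fock_vacuum_def by (rule sum.cong) auto
 then show ?thesis by simp
qed

lemma fvec_create_list:
 assumes "!!i. i : set xs ==> u i : carrier_vec n"
 shows "foldr (%i x. (SUM j<n. u i $ j *c cstar (c j)) * x) xs (vac c n) = fvec (foldr (%i. fock_create n (u i)) xs fock_vacuum)"
 using assms by (induction xs) (simp_all add: fvec_vacuum fvec_create)

end

lemma fock_create_space: "fock_create d u psi : fock_space d" by (simp add: fock_create_def fock_space_def)

definition fket :: "nat set => fock" where
 "fket mu = (%tau. if tau = mu then 1 else 0)"

lemma fock_create_fket:
 assumes "i < d" "i ~: mu" "mu <= {..<d}" "!!j. j : mu ==> i < j"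
 shows "fock_create d (unit_vec d i) (fket mu) = fket (insert i mu)"
proof
 fix tau
 show "fock_create d (unit_vec d i) (fket mu) tau = fket (insert i mu) tau"
 proof (cases "tau <= {..<d}")
  case True
  then have fin: "finite tau" using finite_subset by auto
  have "fock_create d (unit_vec d i) (fket mu) tau =
    (SUM k:tau. if k = i then (if tau = insert i mu then 1 else 0) else 0)" unfolding fock_create_def fket_def if_P[OF True]
  proof (intro sum.cong refl)
   fix k assume k: "k : tau"
   have "{j. j : tau & j < i} = {}" if "tau = insert i mu" using that assms(4) by (auto dest: less_asym)
   then have card0: "card {j : tau. j < i} = 0" if "tau = insert i mu" using that by simp
   show "(- 1) ^ card {j : tau. j < k} * unit_vec d i $ k * (if tau - {k} = mu then 1 else 0) =
    (if k = i then (if tau = insert i mu then 1 else 0) else 0 :: complex)"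
   proof (cases "k = i")
    case True
    then have iff: "tau - {k} = mu \<longleftrightarrow> tau = insert i mu" using k assms(2) by blast
    have unit: "unit_vec d i $ k = (1 :: complex)" using True assms(1) by simp
    show ?thesis by (smt (verit, best) Collect_empty_eq True \<open>tau = insert i mu ==> {j : tau.
      j < i} = {}\<close> arith_extra_simps(19) card0 iff more_arith_simps(6) power_0 unit)
   next
    case False
    have "k < d" using k \<open>tau <= {..<d}\<close> by auto
    then show ?thesis using False assms(1) by simp
   qed
  qed
  then show ?thesis using fin by (auto simp: fket_def)
 next
  case False
  then show ?thesis using assms by (auto simp: fock_create_def fket_def)
 qed
qed

lemma fock_create_list_fket:
 assumes "sorted xs" "distinct xs" "set xs <= {..<d}"
 shows "foldr (%i. fock_create d (unit_vec d i)) xs fock_vacuum = fket (set xs)" using assms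
proof (induction xs)
 case Nil
 then show ?case by (simp add: fock_vacuum_def fket_def)
next
 case (Cons i xs)
 then show ?case by (simp, subst fock_create_fket) (auto simp: order.strict_iff_order)
qed

lemma fock_basis_fket: "mu <= {..<d} ==> fock_basis d mu = fket mu"
 unfolding fock_basis_def using finite_subset[of mu "{..<d}"] by (subst fock_create_list_fket) auto

lemma fock_inner_fket: "mu <= {..<d} ==> fock_inner d (fket mu) psi = psi mu"
proof -
 assume mu: "mu <= {..<d}"
 have "fock_inner d (fket mu) psi = (SUM tau:Pow {..<d}. if tau = mu then psi mu else 0)"
  unfolding fock_inner_def fket_def by (rule sum.cong) auto
 then show ?thesis using mu by simp
qed

lemma fock_create_card:
 assumes "!!tau. psi tau ~= 0 ==> card tau = l" "fock_create d u psi tau ~= 0"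
 shows "card tau = Suc l"
proof -
 have tau: "tau <= {..<d}" using assms(2) by (auto simp: fock_create_def split: if_splits)
 then have "finite tau" using finite_subset by auto
 have "EX i:tau. psi (tau - {i}) ~= 0"
 proof (rule ccontr)
  assume "\<not> ?thesis"
  then have "fock_create d u psi tau = 0" using tau by (simp add: fock_create_def)
  then show False using assms(2) by simp
 qed
 then obtain i where "i : tau" "card (tau - {i}) = l" using assms(1) by blast
 then show ?thesis using \<open>finite tau\<close> by (metis card_Suc_Diff1)
qed

lemma second_quant_basis:
 assumes "nu <= {..<d}"
 shows "fock_second_quant d s M (fock_basis d nu) =
   foldr (%i. fock_create d (mat_apply s M (unit_vec d i))) (sorted_list_of_set nu) fock_vacuum"
proof
 fix tau
 let ?f = "%nu. foldr (%i. fock_create d (mat_apply s M (unit_vec d i))) (sorted_list_of_set nu) fock_vacuum tau"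
 have "fock_second_quant d s M (fock_basis d nu) tau = (SUM nu':Pow {..<d}. if nu' = nu then ?f nu else 0)"
  unfolding fock_second_quant_def
 proof (rule sum.cong)
  fix nu' assume "nu' : Pow {..<d}"
  then have "fock_inner d (fock_basis d nu') (fock_basis d nu) = fket nu nu'"
   using assms by (simp add: fock_basis_fket fock_inner_fket)
  then show "conj_bit s (fock_inner d (fock_basis d nu') (fock_basis d nu)) * ?f nu' = (if nu' = nu then ?f nu else 0)"
   by (simp add: fket_def)
 qed simp
 then show "fock_second_quant d s M (fock_basis d nu) tau = ?f nu" using assms by simp
qed

text \<open>Products of creation operators on the vacuum live on sets whose size is the number of
  factors, so second quantization preserves particle number and hence parity.\<close>

lemma second_quant_parity:
 assumes "nu <= {..<d}" "fock_second_quant d s M (fock_basis d nu) tau ~= 0"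
 shows "mpar tau = mpar nu"
proof -
 have "foldr (%i. fock_create d (u i)) xs fock_vacuum tau ~= 0 ==> card tau = length xs" for u :: "nat => complex vec" and xs tau
 proof (induction xs arbitrary: tau)
  case Nil then show ?case by (auto simp: fock_vacuum_def split: if_splits)
 next
  case (Cons i xs)
  then show ?case by (auto dest: fock_create_card[rotated])
 qed
 from this[of "%i. mat_apply s M (unit_vec d i)" "sorted_list_of_set nu" tau]
 have "card tau = card nu" using assms by (simp add: second_quant_basis)
 then show ?thesis by (simp add: mpar_def)
qed

section \<open>Matrix units of a single site\<close>

locale car_system =
 fixes d :: nat and a :: "(int => complex vec) => 'a::cstar_algebra"
 assumes d_pos: "0 < d" and car: "car_algebra d a"
begin

definition gen :: "int => nat => 'a" where
 "gen x i = a (mode d x i)"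

abbreviation gens where "gens X \<equiv> {gen x i | x i. x : X & i < d}"

lemma mode_l2: "mode d x i : l2_chain d" by (rule l2_chain_site) simp

lemma gen_anti: "i < d ==> j < d ==> gen x i * gen y j = - (gen y j * gen x i)" unfolding gen_def
 by (rule car_familyD(2)[OF car_algebra_family[OF car] mode_l2 mode_l2])

lemma gen_anti_star:
 "i < d ==> j < d ==> gen x i * cstar (gen y j) = (if x = y & i = j then 1 else 0) - cstar (gen y j) * gen x i"
 using car_familyD(3)[OF car_algebra_family[OF car], of "mode d x i" "mode d y j"]
 by (simp add: gen_def l2_chain_site l2_inner_mode eq_diff_eq)

lemma car_sub_gen: "car_sub d a X = closure (star_alg_gen (gens X))" unfolding car_sub_modes[OF car] gen_def ..

lemma a_site: "u : carrier_vec d ==> a (site d x u) = (SUM i<d. cnj (u $ i) *c gen x i)"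
 using car_family_site[OF car_algebra_family[OF car], of u x] by (simp add: gen_def)

sublocale site0: car_modes "gen 0" d
proof
 fix i j assume ij: "i < d" "j < d"
 show "gen 0 i * gen 0 j = - (gen 0 j * gen 0 i)" by (rule gen_anti[OF ij])
 show "gen 0 i * cstar (gen 0 j) = (if i = j then 1 else 0) - cstar (gen 0 j) * gen 0 i"
  using gen_anti_star[OF ij, of 0 0] by simp
qed

lemma car_sub_site0: "car_sub d a {0} = star_alg_gen (gen 0 ` {..<d})"
proof -
 have "(gens {0}) = gen 0 ` {..<d}" by auto
 then show ?thesis unfolding car_sub_gen by (simp add: site0.closure_alg)
qed

lemma car_sub_ops:
 "x : car_sub d a X ==> y : car_sub d a X ==> x + y : car_sub d a X" "1 : car_sub d a X"
 "x : car_sub d a X ==> z *c x : car_sub d a X"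
 "x : car_sub d a X ==> y : car_sub d a X ==> x * y : car_sub d a X" "x : car_sub d a X ==> cstar x : car_sub d a X"
 unfolding car_sub_gen by (auto intro: closure_star_alg_gen(2-6))

lemma gen_in_sub: "x : X ==> i < d ==> gen x i : car_sub d a X" unfolding car_sub_gen by (rule closure_star_alg_gen(1)) auto

abbreviation E :: "nat set => nat set => 'a" where
 "E mu nu \<equiv> munit (gen 0) d mu nu"

abbreviation fvec :: "fock => 'a" where "fvec \<equiv> site0.fvec"

text \<open>A concrete Fock representation by left multiplication on the vacuum ideal. Its existence
  keeps the quantifier over \<open>fock_rep\<close> in \<open>matrix_unit0\<close> from being
  vacuous.\<close>

definition frep :: "'a => fock => fock" where
 "frep A psi = (THE phi. phi : fock_space d & A * fvec psi = fvec phi)"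

lemma frep:
 assumes "A : car_sub d a {0}"
 shows "frep A psi : fock_space d" "A * fvec psi = fvec (frep A psi)"
proof -
 obtain k where "A = site0.comb k" using assms site0.comb_exists by (auto simp: car_sub_site0)
 then have "EX! phi. phi : fock_space d & A * fvec psi = fvec phi" using site0.comb_fvec[of k psi] site0.fvec_inject by metis
 from theI'[OF this] show "frep A psi : fock_space d" "A * fvec psi = fvec (frep A psi)" unfolding frep_def by auto
qed

lemma frep_eqI: "phi : fock_space d ==> A : car_sub d a {0} ==> A * fvec psi = fvec phi ==> frep A psi = phi"
 using frep[of A psi] site0.fvec_inject by metis

lemma cstar_a_site: "u : carrier_vec d ==> cstar (a (site d x u)) = (SUM i<d. u $ i *c cstar (gen x i))"
 by (simp add: a_site cstar_simps)

lemma site_vec_site: "site_vec d u = site d 0 u" by (simp add: site_vec_def site_def)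

lemma a_site_in_sub: "u : carrier_vec d ==> a (site d x u) : car_sub d a {x}" unfolding car_sub_def
 using l2_chain_site[of u d x] by (intro closure_star_alg_gen(1) imageI) (simp add: site_def)

lemma fock_space_ops:
 "phi : fock_space d ==> psi : fock_space d ==> (%tau. phi tau + psi tau) : fock_space d"
 "phi : fock_space d ==> (%tau. z * phi tau) : fock_space d" by (auto simp: fock_space_def)

lemma fock_rep_frep: "fock_rep d a frep" unfolding fock_rep_def
proof (intro conjI ballI allI)
 fix A psi assume A: "A : car_sub d a {0}"
 note fA = frep[OF A]
 show "frep A psi : fock_space d" by (rule fA)
 show "frep A (%tau. z * psi tau) = (%tau. z * frep A psi tau)" for z by (intro frep_eqI fock_space_ops fA(1) A)
   (simp add: site0.fvec_scale mult_scaleC_right fA(2)[symmetric])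
 show "frep (z *c A) psi = (%tau. z * frep A psi tau)" for z by (intro frep_eqI fock_space_ops fA(1) car_sub_ops A)
   (simp add: site0.fvec_scale mult_scaleC_left fA(2)[symmetric])
 show "frep A (%tau. phi tau + psi tau) = (%tau. frep A phi tau + frep A psi tau)" for phi
  by (intro frep_eqI fock_space_ops fA(1) A)
   (simp add: site0.fvec_add distrib_left fA(2)[symmetric])
 show "fock_inner d phi (frep (cstar A) psi) = fock_inner d (frep A phi) psi" for phi
 proof -
  have "fock_inner d phi (frep (cstar A) psi) *c vac (gen 0) d = cstar (fvec phi) * (cstar A * fvec psi)"
   using frep(2)[OF car_sub_ops(5)[OF A], of psi] by (simp add: site0.fvec_inner)
  also have "... = cstar (A * fvec phi) * fvec psi" by (simp add: cstar_simps mult.assoc)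
  also have "... = fock_inner d (frep A phi) psi *c vac (gen 0) d" by (simp add: fA(2) site0.fvec_inner)
  finally show ?thesis using site0.vac_nonzero by (metis cvs.scale_cancel_right)
 qed
 fix B assume B: "B : car_sub d a {0}"
 note fB = frep[OF B]
 show "frep (A + B) psi = (%tau. frep A psi tau + frep B psi tau)"
  by (intro frep_eqI fock_space_ops fA(1) fB(1) car_sub_ops A B)
   (simp add: site0.fvec_add distrib_right fA(2)[symmetric] fB(2)[symmetric])
 show "frep (A * B) psi = frep A (frep B psi)" by (intro frep_eqI fA(1) car_sub_ops A B)
   (simp add: fA(2)[symmetric] fB(2)[symmetric] mult.assoc)
next
 fix psi assume psi: "psi : fock_space d"
 show "frep 1 psi = psi" by (intro frep_eqI psi car_sub_ops) simp
 fix u assume u: "(u :: complex vec) : carrier_vec d"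
 show "frep (cstar (a (site_vec d u))) psi = fock_create d u psi" unfolding site_vec_site
  by (intro frep_eqI fock_create_space car_sub_ops a_site_in_sub u)
   (simp add: cstar_a_site[OF u] site0.fvec_create[OF u])
qed

lemma a_mode: "a (site_vec d (unit_vec d i)) = gen 0 i" by (simp add: gen_def site_vec_site)

text \<open>All Fock representations agree on creation operators by definition; the inner product
  clause transfers agreement from an element to its adjoint, and these elements generate the algebra
  of the site.\<close>

lemma fock_rep_unique:
 assumes rho: "fock_rep d a rho" and A: "A : car_sub d a {0}" and psi: "psi : fock_space d"
 shows "rho A psi = frep A psi"
proof -
 have R: "rho A psi : fock_space d" "rho (z *c A) psi = (%tau. z * rho A psi tau)"
   "phi : fock_space d ==> fock_inner d phi (rho (cstar A) psi) = fock_inner d (rho A phi) psi"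
   "B : car_sub d a {0} ==> rho (A + B) psi = (%tau. rho A psi tau + rho B psi tau)"
   "B : car_sub d a {0} ==> rho (A * B) psi = rho A (rho B psi)"
   "rho 1 psi = psi" "u : carrier_vec d ==> rho (cstar (a (site_vec d u))) psi = fock_create d u psi"
  if "fock_rep d a rho" "A : car_sub d a {0}" "psi : fock_space d" for rho A B phi psi z u
  using that unfolding fock_rep_def by auto
 note R1 = R[OF rho] and R2 = R[OF fock_rep_frep]
 have star: "rho (cstar A) psi = frep (cstar A) psi"
  if A: "A : car_sub d a {0}" and psi: "psi : fock_space d"
   and eq: "!!phi. phi : fock_space d ==> rho A phi = frep A phi" for A psi by (rule site0.fock_inner_eqI)
   (use R1(1)[OF car_sub_ops(5)[OF A] psi] R2(1)[OF car_sub_ops(5)[OF A] psi] R1(3)[OF A psi] R2(3)[OF A psi] eq in auto)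
 have "A : star_alg_gen (gen 0 ` {..<d})" using A by (simp add: car_sub_site0)
 then have "ALL psi:fock_space d. rho A psi = frep A psi"
 proof (induction rule: star_alg_gen.induct)
  case (base x)
  then obtain i where i: "i < d" "x = gen 0 i" by auto
  have x: "x : car_sub d a {0}" using i by (auto intro: gen_in_sub)
  have "rho (cstar x) phi = frep (cstar x) phi" if "phi : fock_space d" for phi
   using R1(7)[OF x that, of "unit_vec d i"] R2(7)[OF x that, of "unit_vec d i"] i by (simp add: a_mode)
  then show ?case using star[OF car_sub_ops(5)[OF x]] by (simp add: cstar_cstar)
 next
  case one
  then show ?case using R1(6)[OF car_sub_ops(2)] R2(6)[OF car_sub_ops(2)] by simp
 next
  case (add x y)
  then have "x : car_sub d a {0}" "y : car_sub d a {0}" by (simp_all add: car_sub_site0)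
  then show ?case using R1(4) R2(4) add by simp
 next
  case (scaleC x z)
  then have "x : car_sub d a {0}" by (simp add: car_sub_site0)
  then show ?case using R1(2) R2(2) scaleC by simp
 next
  case (mult x y)
  then have "x : car_sub d a {0}" "y : car_sub d a {0}" by (simp_all add: car_sub_site0)
  then show ?case using R1(5) R2(5) R2(1) mult by simp
 next
  case (cstar x)
  then have "x : car_sub d a {0}" by (simp add: car_sub_site0)
  then show ?case using star cstar by blast
 qed
 then show ?thesis using psi by blast
qed

lemma E_in_sub: "E mu nu : car_sub d a {0}" unfolding car_sub_site0 by (rule site0.munit_in_alg)

lemma fvec_fket: "mu <= {..<d} ==> fvec (fket mu) = crea (gen 0) d mu * vac (gen 0) d"
proof -
 assume mu: "mu <= {..<d}"
 have "fvec (fket mu) = (SUM tau:Pow {..<d}. if tau = mu then crea (gen 0) d mu * vac (gen 0) d else 0)"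
  unfolding site0.fvec_def fket_def by (rule sum.cong) auto
 then show ?thesis using mu by simp
qed

lemma E_fvec:
 assumes "mu <= {..<d}" "nu <= {..<d}"
 shows "E mu nu * fvec psi = fvec (%tau. fock_inner d (fock_basis d nu) psi * fock_basis d mu tau)"
proof -
 have "E mu nu * fvec psi = crea (gen 0) d mu * (cstar (fvec (fket nu)) * fvec psi)"
  using assms by (simp add: fvec_fket munit_def cstar_simps site0.cstar_vac mult.assoc)
 also have "... = fock_inner d (fket nu) psi *c fvec (fket mu)"
  unfolding site0.fvec_inner using assms by (simp add: mult_scaleC_right fvec_fket)
 finally show ?thesis using assms by (simp add: site0.fvec_scale fock_basis_fket)
qed

text \<open>For uniqueness, two candidates agree on the vacuum ideal, hence after multiplication by
  each diagonal unit, and the diagonal units sum to 1.\<close>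

lemma matrix_unit0:
 assumes "mu <= {..<d}" "nu <= {..<d}"
 shows "matrix_unit0 d a mu nu = E mu nu" unfolding matrix_unit0_def
proof (rule the_equality)
 let ?t = "%psi tau. fock_inner d (fock_basis d nu) psi * fock_basis d mu tau"
 have t: "?t psi : fock_space d" for psi using assms by (auto simp: fock_basis_fket fock_space_def fket_def)
 have "frep (E mu nu) psi = ?t psi" for psi by (intro frep_eqI t E_in_sub E_fvec assms)
 then show "E mu nu : car_sub d a {0} & (ALL rho. fock_rep d a rho --> (ALL psi:fock_space d. rho (E mu nu) psi = ?t psi))"
  using fock_rep_unique E_in_sub by simp
next
 fix F assume F: "F : car_sub d a {0} & (ALL rho. fock_rep d a rho --> (ALL psi:fock_space d. rho F psi =
   (%tau. fock_inner d (fock_basis d nu) psi * fock_basis d mu tau)))"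
 have eq: "F * fvec psi = E mu nu * fvec psi" if "psi : fock_space d" for psi
  using frep(2)[of F psi] F fock_rep_frep that by (simp add: E_fvec[OF assms])
 have "F * E tau tau = E mu nu * E tau tau" if "tau : Pow {..<d}" for tau
 proof -
  have "E tau tau = fvec (fket tau) * cstar (crea (gen 0) d tau)" using that by (simp add: fvec_fket munit_def)
  moreover have "fket tau : fock_space d" using that by (auto simp: fock_space_def fket_def)
  ultimately show ?thesis using eq[of "fket tau"] by (simp add: mult.assoc[symmetric])
 qed
 then have "F * (SUM tau:Pow {..<d}. E tau tau) = E mu nu * (SUM tau:Pow {..<d}. E tau tau)" by (simp add: sum_distrib_left)
 then show "F = E mu nu" by (simp add: site0.sum_munit)
qed

section \<open>Translation, parity and on-site symmetries\<close>

abbreviation shift :: "int => 'a => 'a" where "shift \<equiv> car_shift d a"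
abbreviation parity :: "'a => 'a" where "parity \<equiv> car_parity d a"

lemma shift_aut: "star_automorphism 0 (shift y)" unfolding car_shift_def by (rule car_aut(1)[OF d_pos car l2_unitary_shift])

lemma shift_gen: "shift y (gen x i) = gen (x + y) i"
proof -
 have "shift y (gen x i) = a (%z. mode d x i (z - y))"
  unfolding car_shift_def gen_def by (rule car_aut(2)[OF d_pos car l2_unitary_shift mode_l2])
 also have "(%z. mode d x i (z - y)) = mode d (x + y) i" by (auto simp: site_def fun_eq_iff)
 finally show ?thesis by (simp add: gen_def)
qed

lemma parity_aut: "star_automorphism 0 parity" unfolding car_parity_def by (rule car_aut(1)[OF d_pos car l2_unitary_parity])

lemma parity_gen: "i < d ==> parity (gen x i) = - gen x i"
proof -
 assume i: "i < d"
 have "parity (gen x i) = a (%z. - mode d x i z)"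
  unfolding car_parity_def gen_def by (rule car_aut(2)[OF d_pos car l2_unitary_parity mode_l2])
 also have "(%z. - mode d x i z) = site d x (- unit_vec d i)" by (auto simp: site_def fun_eq_iff)
 also have "a ... = (SUM j<d. cnj ((- unit_vec d i) $ j) *c gen x j)" by (rule a_site) simp
 also have "... = (SUM j<d. if j = i then - gen x i else 0)" by (rule sum.cong) (use i in auto)
 finally show ?thesis using i by simp
qed

lemma onsite_gen:
 fixes M :: "complex mat" and s :: bit
 assumes M: "M : carrier_mat d d" "M * mat_adjoint M = idm d" and i: "i < d"
 defines "al \<equiv> car_aut d a s (%f x. mat_apply s M (f x))"
 shows "al (gen x i) = a (site d x (mat_apply s M (unit_vec d i)))"
  "mat_apply s M (unit_vec d i) = vec d (%j. M $$ (j, i))"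
proof -
 have "al (gen x i) = a (%z. mat_apply s M (mode d x i z))"
  unfolding gen_def al_def by (rule car_aut(2)[OF d_pos car l2_unitary_onsite[OF M] mode_l2])
 moreover have "mat_apply s M (0\<^sub>v d) = 0\<^sub>v d"
 proof -
  have "vec_conj s (0\<^sub>v d) = 0\<^sub>v d" by (auto simp: vec_conj_def intro!: eq_vecI)
  then show ?thesis using M by (auto simp: mat_apply_def intro!: eq_vecI)
 qed
 ultimately show "al (gen x i) = a (site d x (mat_apply s M (unit_vec d i)))"
  by (simp add: site_def if_distrib[of "mat_apply s M"] cong: if_cong)
 have "vec_conj s (unit_vec d i) = unit_vec d i" using i by (auto simp: vec_conj_def intro!: eq_vecI)
 moreover have "M *mv unit_vec d i = vec d (%j. M $$ (j, i))"
  using M i by (auto intro!: eq_vecI simp: scalar_prod_right_unit)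
 ultimately show "mat_apply s M (unit_vec d i) = vec d (%j. M $$ (j, i))" by (simp add: mat_apply_def)
qed

text \<open>A matrix unit is a product of two creation words around the vacuum projection. The
  symmetry fixes that projection and acts on each word as second quantization acts on the
  corresponding Fock vector.\<close>

lemma onsite_E:
 fixes M :: "complex mat" and s :: bit
 assumes M: "M : carrier_mat d d" "M * mat_adjoint M = idm d"
  and munu: "mu <= {..<d}" "nu <= {..<d}"
 defines "al \<equiv> car_aut d a s (%f x. mat_apply s M (f x))"
  and "G \<equiv> %si mu. fock_inner d (fock_basis d si) (fock_second_quant d s M (fock_basis d mu))"
 shows "al (E mu nu) = (SUM si:Pow {..<d}. SUM tau:Pow {..<d}. (G si mu * cnj (G tau nu)) *c E si tau)"
proof -
 have aut: "star_automorphism s al" unfolding al_def by (rule car_aut(1)[OF d_pos car l2_unitary_onsite[OF M]])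
 have h: "al (x * y) = al x * al y" "al (cstar x) = cstar (al x)" for x y using aut by (auto simp: star_automorphism_def)
 have "surj al" using aut by (auto simp: star_automorphism_def bij_def)
 then have one: "al 1 = 1" by (metis h(1) mult_1_left mult_1_right surjD)
 let ?c = "gen 0" and ?v = "vac (gen 0) d"
 let ?u = "%i. mat_apply s M (unit_vec d i)"
 have u: "?u i : carrier_vec d" if "i < d" for i using onsite_gen(2)[OF M that] by simp
 define c' where "c' i = a (site d 0 (?u i))" for i
 have alc: "al (?c i) = c' i" if "i < d" for i unfolding c'_def al_def by (rule onsite_gen(1)[OF M that])
 have c'_sum: "c' i = (SUM j<d. cnj (M $$ (j, i)) *c ?c j)" if "i < d" for i
  unfolding c'_def using onsite_gen(2)[OF M that, of s] by (subst a_site) simp_all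
 \<comment> \<open>Unitarity of \<open>M\<close> inverts the relation between the old and the
   rotated modes.\<close>
 have c_sum: "?c i = (SUM j<d. M $$ (i, j) *c c' j)" if i: "i < d" for i
 proof -
  have "(SUM j<d. M $$ (i, j) *c c' j) = (SUM j<d. SUM k<d. (M $$ (i, j) * cnj (M $$ (k, j))) *c ?c k)"
   by (simp add: c'_sum cvs.scale_sum_right scaleC_scaleC)
  also have "... = (SUM k<d. (SUM j<d. M $$ (i, j) * cnj (M $$ (k, j))) *c ?c k)"
   by (subst sum.swap) (simp add: cvs.scale_sum_left)
  also have "... = (SUM k<d. if k = i then ?c k else 0)"
  proof (intro sum.cong refl)
   fix k assume k: "k : {..<d}"
   have "(SUM j<d. M $$ (i, j) * cnj (M $$ (k, j))) = (M * mat_adjoint M) $$ (i, k)"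
    using M(1) i k by (simp add: scalar_prod_def atLeast0LessThan)
   also have "... = (if k = i then 1 else 0)" using M(2) i k by simp
   finally show "(SUM j<d. M $$ (i, j) * cnj (M $$ (k, j))) *c ?c k = (if k = i then ?c k else 0)" by simp
  qed
  finally show ?thesis using i by simp
 qed
 \<comment> \<open>Each of the two vacuum projections is annihilated by the modes of the other, so
   each absorbs the other; being self-adjoint they coincide.\<close>
 have alv: "al ?v = ?v"
 proof -
  have "c' i * al ?v = 0" if "i < d" for i using site0.annihilate_vac[OF that order_refl] aut that
   by (simp add: alc[symmetric] h(1)[symmetric]) (metis add_cancel_right_right star_automorphism_def)
  then have "?c i * al ?v = 0" if "i < d" for i using that by (simp add: c_sum[OF that] sum_distrib_right mult_scaleC_left)
  then have v1: "?v * al ?v = al ?v" by (rule site0.vac_absorb)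
  have am: "al (x - y) = al x - al y" for x y
  proof -
   have "al (x - y + y) = al (x - y) + al y" using aut by (simp only: star_automorphism_def)
   then show ?thesis by (simp add: eq_diff_eq)
  qed
  have al0: "al 0 = 0" using am[of 0 0] by simp
  have alm: "al (- x) = - al x" for x using am[of 0 x] al0 by simp
  have modes': "car_modes c' d"
  proof
   fix i j assume ij: "i < d" "j < d"
   show "c' i * c' j = - (c' j * c' i)" using arg_cong[OF site0.anti[OF ij], of al] ij by (simp add: alc h alm)
   show "c' i * cstar (c' j) = (if i = j then 1 else 0) - cstar (c' j) * c' i"
    using arg_cong[OF site0.anti_star[OF ij], of al] ij by (auto simp: alc h am one al0 alm)
  qed
  interpret m': car_modes c' d by (rule modes')
  have "al (vac ?c k) = vac c' k" if "k <= d" for k using that by (induction k) (simp_all add: one h alc)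
  then have av: "al ?v = vac c' d" by simp
  have "c' i * ?v = 0" if "i < d" for i
   using that site0.annihilate_vac by (simp add: c'_sum sum_distrib_right mult_scaleC_left)
  then have v2: "al ?v * ?v = ?v" unfolding av by (rule m'.vac_absorb)
  have "cstar (al ?v) = al ?v" by (simp add: h(2)[symmetric] site0.cstar_vac)
  then show ?thesis using v1 v2 by (metis cstar_mult order_refl site0.cstar_vac)
 qed
 have alcrea: "al (crea ?c d mu * ?v) = (SUM si:Pow {..<d}. G si mu *c (crea ?c d si * ?v))" if mu: "mu <= {..<d}" for mu
 proof -
  have fin: "finite mu" using mu finite_subset by auto
  let ?xs = "sorted_list_of_set mu"
  have xs: "i < d" if "i : set ?xs" for i using that mu fin by auto
  have "crea ?c d mu * ?v = fvec (fket mu)" using mu by (simp add: fvec_fket)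
  also have "... = foldr (%i x. (SUM j<d. unit_vec d i $ j *c cstar (?c j)) * x) ?xs ?v"
   using mu fin by (subst site0.fvec_create_list) (auto simp: fock_basis_fket[symmetric] fock_basis_def)
  finally have cr: "crea ?c d mu * ?v = foldr (%i x. (SUM j<d. unit_vec d i $ j *c cstar (?c j)) * x) ?xs ?v" .
  have "(SUM j<d. unit_vec d i $ j *c cstar (?c j)) = cstar (?c i)" if "i < d" for i
  proof -
   have "(SUM j<d. unit_vec d i $ j *c cstar (?c j)) = (SUM j<d. if j = i then cstar (?c i) else 0)"
    using that by (intro sum.cong) auto
   then show ?thesis using that by simp
  qed
  then have "al (foldr (%i x. (SUM j<d. unit_vec d i $ j *c cstar (?c j)) * x) ys ?v) =
    foldr (%i x. (SUM j<d. ?u i $ j *c cstar (?c j)) * x) ys ?v" if "!!i. i : set ys ==> i < d" for ys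
   using that by (induction ys) (simp_all add: alv h alc c'_def cstar_a_site[OF u])
  then have "al (crea ?c d mu * ?v) = foldr (%i x. (SUM j<d. ?u i $ j *c cstar (?c j)) * x) ?xs ?v" using cr xs by simp
  also have "... = fvec (foldr (%i. fock_create d (?u i)) ?xs fock_vacuum)"
   by (rule site0.fvec_create_list) (use u xs in blast)
  also have "... = fvec (fock_second_quant d s M (fock_basis d mu))" by (simp add: second_quant_basis[OF mu])
  also have "... = (SUM si:Pow {..<d}. G si mu *c (crea ?c d si * ?v))" unfolding site0.fvec_def G_def
   by (intro sum.cong refl) (simp add: fock_basis_fket fock_inner_fket)
  finally show ?thesis .
 qed
 have Emn: "E si tau = (crea ?c d si * ?v) * cstar (crea ?c d tau * ?v)" for si tau
 proof -
  have "(crea ?c d si * ?v) * cstar (crea ?c d tau * ?v) = crea ?c d si * (?v * ?v) * cstar (crea ?c d tau)"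
   by (simp add: cstar_simps site0.cstar_vac mult.assoc)
  then show ?thesis by (simp add: site0.vac_idem munit_def)
 qed
 have "al (E mu nu) = al (crea ?c d mu * ?v) * cstar (al (crea ?c d nu * ?v))" unfolding Emn by (simp only: h)
 also have "... = (SUM tau:Pow {..<d}. SUM si:Pow {..<d}. (G si mu * cnj (G tau nu)) *c E si tau)"
  unfolding alcrea[OF munu(1)] alcrea[OF munu(2)] Emn cstar_sum
  by (simp add: cstar_scaleC sum_distrib_left sum_distrib_right mult_scaleC_left mult_scaleC_right
    scaleC_scaleC cvs.scale_sum_right mult.commute)
 also have "... = (SUM si:Pow {..<d}. SUM tau:Pow {..<d}. (G si mu * cnj (G tau nu)) *c E si tau)" by (rule sum.swap)
 finally show ?thesis .
qed

end

section \<open>Matrices of bounded rank\<close>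

text \<open>Gaussian elimination: the equation \<open>i\<close> is used to eliminate the unknown
  \<open>p\<close> with pivot \<open>f p i\<close>.\<close>

lemma homogeneous_system:
 fixes f :: "'k => 'i => complex"
 assumes "finite I" "finite K" "card I < card K"
 shows "EX l. (EX k:K. l k ~= 0) & (ALL i:I. (SUM k:K. l k * f k i) = 0)" using assms
proof (induction I arbitrary: K f rule: finite_induct)
 case empty
 then obtain k where "k : K" by fastforce
 then show ?case by (intro exI[of _ "%_. 1"]) auto
next
 case (insert i I)
 show ?case
 proof (cases "ALL k:K. f k i = 0")
  case True
  have "card I < card K" using insert by simp
  then obtain l where "EX k:K. l k ~= 0" "ALL i:I. (SUM k:K. l k * f k i) = 0"
   using insert.IH[OF insert.prems(1), of f] by blast
  then show ?thesis using True by (intro exI[of _ l]) auto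
 next
  case False
  then obtain p where p: "p : K" "f p i ~= 0" by blast
  define K' where "K' = K - {p}"
  define f' where "f' k j = f k j - f k i / f p i * f p j" for k j
  have K': "finite K'" "card I < card K'" using insert p by (auto simp: K'_def)
  from insert.IH[OF K', of f'] obtain l where l: "EX k:K'. l k ~= 0" "ALL j:I. (SUM k:K'. l k * f' k j) = 0" by blast
  define l' where "l' k = (if k = p then - (SUM k:K'. l k * f k i) / f p i else l k)" for k
  have sum: "(SUM k:K. l' k * f k j) = (SUM k:K'. l k * f' k j)" for j
  proof -
   have "(SUM k:K. l' k * f k j) = l' p * f p j + (SUM k:K'. l' k * f k j)"
    using p insert.prems by (simp add: sum.remove K'_def)
   also have "(SUM k:K'. l' k * f k j) = (SUM k:K'. l k * f k j)" by (rule sum.cong) (auto simp: l'_def K'_def)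
   also have "l' p * f p j = - (SUM k:K'. l k * (f k i / f p i * f p j))"
    by (simp add: l'_def sum_distrib_left sum_distrib_right sum_divide_distrib sum_negf mult_ac)
   finally show ?thesis by (simp add: f'_def right_diff_distrib sum_subtractf)
  qed
  have "(SUM k:K'. l k * f' k i) = 0" using p by (simp add: f'_def)
  then have "ALL j:insert i I. (SUM k:K. l' k * f k j) = 0" using l(2) sum by auto
  moreover have "EX k:K. l' k ~= 0" using l(1) by (auto simp: l'_def K'_def)
  ultimately show ?thesis by blast
 qed
qed

text \<open>\<open>B\<close> collects a maximal independent set of columns, \<open>C\<close> the
  coordinates of all columns with respect to it.\<close>

lemma (in vec_space) rank_factorization:
 assumes A: "A : carrier_mat n n"
 obtains B C where "B : carrier_mat n (rank A)" "C : carrier_mat (rank A) n" "A = B * C"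
proof -
 have cols: "set (cols A) <= carrier_vec n" using A cols_dim by blast
 obtain S where max: "maximal S (%T. T <= set (cols A) & lin_indpt T)"
  using maximal_exists[of "(%T. T <= set (cols A) & lin_indpt T)" "card (set (cols A))" "{}"]
  by (meson List.finite_set card_mono empty_iff empty_subsetI finite_lin_indpt2 rev_finite_subset)
 then have Sc: "S <= set (cols A)" "lin_indpt S" by (auto simp: maximal_def)
 then have S: "finite S" "S <= carrier_vec n" using cols by (auto intro: finite_subset)
 have "col A j : span S" if j: "j < n" for j
 proof (cases "col A j : S")
  case True
  then show ?thesis using in_own_span[of S] S by auto
 next
  case False
  have cj: "col A j : set (cols A)" using A j by (auto simp: cols_def)
  show ?thesis
  proof (rule ccontr)
   assume "col A j ~: span S"
   then have "lin_indpt (S \<union> {col A j})" using lin_dep_iff_in_span[of S "col A j"] Sc cols cj False by auto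
   then have "S \<union> {col A j} = S" using max Sc cj unfolding maximal_def by blast
   then show False using False by blast
  qed
 qed
 then have "ALL j. EX c. j < n --> lincomb c S = col A j" using finite_in_span[OF S] by metis
 from choice[OF this] obtain c where c: "!!j. j < n ==> lincomb (c j) S = col A j" by blast
 obtain b where b: "bij_betw b {..<rank A} S"
  using ex_bij_betw_nat_finite[OF S(1)] rank_card_indpt[OF A max] by (auto simp: atLeast0LessThan)
 show thesis
 proof (rule that)
  show "A = mat n (rank A) (%(i, k). b k $ i) * mat (rank A) n (%(k, j). c j (b k))"
  proof (rule eq_matI)
   fix i j assume "i < dim_row (mat n (rank A) (%(i, k). b k $ i) * mat (rank A) n (%(k, j). c j (b k)))"
    "j < dim_col (mat n (rank A) (%(i, k). b k $ i) * mat (rank A) n (%(k, j). c j (b k)))"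
   then have ij: "i < n" "j < n" by auto
   have "A $$ (i, j) = lincomb (c j) S $ i" using A ij by (simp add: c)
   also have "... = (SUM s:S. c j s * s $ i)" by (rule lincomb_index[OF ij(1) S(2)])
   also have "... = (SUM k<rank A. c j (b k) * b k $ i)" by (rule sum.reindex_bij_betw[OF b, symmetric])
   finally show "A $$ (i, j) = (mat n (rank A) (%(i, k). b k $ i) * mat (rank A) n (%(k, j). c j (b k))) $$ (i, j)"
    using ij by (simp add: scalar_prod_def atLeast0LessThan mult.commute)
  qed (use A in auto)
 qed auto
qed

text \<open>With \<open>Q = B * C\<close> each sandwich is determined by \<open>C * M k * B\<close>,
  a square matrix of size at most \<open>R\<close>. This is the origin of the number
  \<open>Suc (R * R)\<close> in all later linear relations.\<close>

lemma low_rank_sandwich_dependent: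
 fixes Q :: "complex mat"
 assumes Q: "Q : carrier_mat n n" "vec_space.rank n Q <= R"
  and M: "!!k. k < Suc (R * R) ==> M k : carrier_mat n n"
 shows "EX l. (EX k<Suc (R * R). l k ~= 0) &
  (ALL i<n. ALL j<n. (SUM k<Suc (R * R). l k * (Q * M k * Q) $$ (i, j)) = 0)"
proof -
 let ?r = "vec_space.rank n Q" and ?K = "Suc (R * R)"
 obtain B C where BC: "B : carrier_mat n ?r" "C : carrier_mat ?r n" "Q = B * C"
  by (rule vec_space.rank_factorization[OF Q(1)])
 define G where "G k = C * M k * B" for k
 have "card ({..<?r} \<times> {..<?r}) < card {..<?K}" using mult_le_mono[OF Q(2) Q(2)] by (simp add: card_cartesian_product)
 then obtain l where l: "EX k:{..<?K}. l k ~= 0" "ALL ab:{..<?r} \<times> {..<?r}. (SUM k<?K. l k * G k $$ ab) = 0"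
  using homogeneous_system[of "{..<?r} \<times> {..<?r}" "{..<?K}" "%k ab. G k $$ ab"] by blast
 have "(SUM k<?K. l k * (Q * M k * Q) $$ (i, j)) = 0" if ij: "i < n" "j < n" for i j
 proof -
  have "(Q * M k * Q) $$ (i, j) = (SUM a<?r. SUM b<?r. B $$ (i, a) * C $$ (b, j) * G k $$ (a, b))" if "k < ?K" for k
  proof -
   note M = M[OF that]
   have CM: "C * M k : carrier_mat ?r n" and G: "G k : carrier_mat ?r ?r" using BC M by (auto simp: G_def)
   have "Q * M k * Q = B * (G k * C)" unfolding BC(3) G_def assoc_mult_mat[OF BC(1,2) M] assoc_mult_mat[OF CM BC(1,2)]
    by (rule assoc_mult_mat[OF BC(1) CM]) (use BC in auto)
   then show ?thesis using ij BC G by (simp add: scalar_prod_def atLeast0LessThan sum_distrib_left mult_ac)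
  qed
  then have "(SUM k<?K. l k * (Q * M k * Q) $$ (i, j)) =
    (SUM k<?K. SUM a<?r. SUM b<?r. B $$ (i, a) * C $$ (b, j) * (l k * G k $$ (a, b)))"
   by (intro sum.cong refl) (simp add: sum_distrib_left mult_ac)
  also have "... = (SUM a<?r. SUM b<?r. SUM k<?K. B $$ (i, a) * C $$ (b, j) * (l k * G k $$ (a, b)))"
   by (simp only: sum.swap[where A = "{..<?r}" and B = "{..<?K}"])
  also have "... = 0" unfolding sum_distrib_left[symmetric] using l(2) by (intro sum.neutral ballI) auto
  finally show ?thesis .
 qed
 then show ?thesis using l(1) by (intro exI[of _ l]) auto
qed

lemma mat_adjoint_simps:
 "A : carrier_mat n m ==> B : carrier_mat m k ==> mat_adjoint (A * B) = mat_adjoint B * mat_adjoint (A :: complex mat)"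
 "A : carrier_mat n m ==> B : carrier_mat n m ==> mat_adjoint (A + B) = mat_adjoint A + mat_adjoint (B :: complex mat)"
 "mat_adjoint (mat_adjoint A) = (A :: complex mat)"
 "mat_adjoint (c *m A) = cnj c *m mat_adjoint (A :: complex mat)"
 "mat_adjoint (idm n) = (idm n :: complex mat)"
 "A : carrier_mat n m ==> B : carrier_mat n m ==> mat_adjoint (A - B) = mat_adjoint A - mat_adjoint (B :: complex mat)"
 by (rule eq_matI; auto simp: scalar_prod_def mult.commute)+

lemma rank_one_projection:
 assumes w: "w : carrier_vec n" "w ~= 0\<^sub>v n"
 obtains T :: "complex mat" where "mat_projection n T" "mat_trace T = 1"
  "!!A. A : carrier_mat n n ==> A *mv w = w ==> A * T = T"
  "!!A. A : carrier_mat n n ==> A *mv w = 0\<^sub>v n ==> A * T = 0\<^sub>m n n"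
proof -
 define b where "b = w \<bullet>c w"
 have b: "b ~= 0" "cnj b = b" using w cdot_self(1)[of w] by (simp add: b_def, metis b_def complex_cnj_complex_of_real)
 have b_sum: "(SUM j<n. w $ j * cnj (w $ j)) = b" using cdot_sum[OF w(1) w(1)] by (simp add: b_def)
 define T where "T = mat n n (%(i, j). w $ i * cnj (w $ j) / b)"
 have T: "T : carrier_mat n n" by (simp add: T_def)
 have AT: "A * T = mat n n (%(i, j). (A *mv w) $ i * cnj (w $ j) / b)" if "A : carrier_mat n n" for A
  using that w by (auto simp: T_def scalar_prod_def sum_distrib_left sum_distrib_right sum_divide_distrib mult_ac intro!: eq_matI)
 have "T *mv w = w"
 proof (rule eq_vecI)
  fix i assume "i < dim_vec w"
  then have "(T *mv w) $ i = w $ i * (SUM j<n. w $ j * cnj (w $ j)) / b"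
   using w by (simp add: T_def scalar_prod_def atLeast0LessThan sum_distrib_left sum_divide_distrib mult_ac)
  then show "(T *mv w) $ i = w $ i" using b b_sum by simp
 qed (use w T in auto)
 moreover have "A * T = T" if "A : carrier_mat n n" "A *mv w = w" for A using AT[OF that(1)] that(2) by (simp add: T_def)
 moreover have "mat_adjoint T = T" using b(2) by (auto simp: T_def intro!: eq_matI)
 moreover have "mat_trace T = 1" using b b_sum by (simp add: mat_trace_def T_def sum_divide_distrib[symmetric])
 moreover have "A * T = 0\<^sub>m n n" if "A : carrier_mat n n" "A *mv w = 0\<^sub>v n" for A
  using AT[OF that(1)] that(2) by (auto intro!: eq_matI)
 ultimately show thesis using T by (intro that[of T]) (simp_all add: mat_projection_def)
qed

lemma projection_trace_nonneg:
 assumes P: "mat_projection n P"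
 shows "0 <= Re (mat_trace P)"
proof -
 have P: "P : carrier_mat n n" "P * mat_adjoint P = P" using assms by (auto simp: mat_projection_def)
 have "Re (P $$ (i, i)) = (SUM j<n. (cmod (P $$ (i, j)))\<^sup>2)" if "i < n" for i
  using arg_cong[OF P(2), of "%M. Re (M $$ (i, i))"] P(1) that
  by (simp add: scalar_prod_def atLeast0LessThan cmod_power2 sum.distrib power2_eq_square[symmetric])
 then show ?thesis using P(1) by (simp add: mat_trace_def sum_nonneg)
qed

text \<open>A projection \<open>P\<close> of minimal trace with \<open>P * D = D\<close> is the support projection: otherwise one could
 subtract a rank-one projection from it.\<close>

lemma support_projection_exists:
 assumes D: "(D :: complex mat) : carrier_mat n n"
 shows "EX Q. support_projection n D Q"
proof -
 have "mat_projection n (idm n) & idm n * D = D" using D by (simp add: mat_projection_def mat_adjoint_simps)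
 \<comment> \<open>The trace is real, so its floor serves as the well-founded measure; removing a
   projection of trace 1 lowers it by exactly one.\<close>
 then obtain P where P: "mat_projection n P" "P * D = D"
  and min: "!!P'. mat_projection n P' ==> P' * D = D ==> nat \<lfloor>Re (mat_trace P)\<rfloor> <= nat \<lfloor>Re (mat_trace P')\<rfloor>"
  using ex_has_least_nat[of "%P. mat_projection n P & P * D = D" "idm n" "%P. nat \<lfloor>Re (mat_trace P)\<rfloor>"] by blast
 have "P' * P = P" if P': "mat_projection n P'" "P' * D = D" for P'
 proof (rule ccontr)
  assume ne: "P' * P ~= P"
  have c: "P : carrier_mat n n" "P' : carrier_mat n n" "P * P = P" "P' * P' = P'" "mat_adjoint P = P" "mat_adjoint P' = P'"
   using P P' by (auto simp: mat_projection_def)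
  obtain j where j: "j < n" "col (P' * P) j ~= col P j" using ne c by (metis carrier_matD mat_col_eqI index_mult_mat(2,3))
  define v where "v = col P j"
  have v: "v : carrier_vec n" "P *mv v = v" using c j col_mult2[OF c(1) c(1) j(1)] by (auto simp: v_def)
  have Pv: "P' *mv v : carrier_vec n" "P' *mv v ~= v" using c v j col_mult2[OF c(2) c(1) j(1)] by (auto simp: v_def)
  \<comment> \<open>\<open>v\<close> is fixed by \<open>P\<close> but not by \<open>P'\<close>. Its
    component \<open>u\<close> off the range of \<open>P'\<close>, pushed back by \<open>P\<close>,
    is a non-zero direction in the range of \<open>P\<close> that the adjoint of \<open>D\<close>
    annihilates.\<close>
  define u where "u = v - P' *mv v"
  have u: "u : carrier_vec n" using v Pv by (auto simp: u_def)
  have P'u: "P' *mv u = 0\<^sub>v n"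
   unfolding u_def mult_minus_distrib_mat_vec[OF c(2) v(1) Pv(1)] assoc_mult_mat_vec[OF c(2) c(2) v(1), symmetric] c(4)
   using Pv by simp
  have uv: "u + P' *mv v = v" using v c by (auto simp: u_def intro!: eq_vecI)
  then have u0: "u ~= 0\<^sub>v n" using Pv by auto
  define w where "w = P *mv u"
  have w: "w : carrier_vec n" unfolding w_def by (rule mult_mat_vec_carrier[OF c(1) u])
  have "w \<bullet>c v = u \<bullet>c (u + P' *mv v)" using mat_adjoint_cdot[OF c(1) u v(1)] c v by (simp add: w_def uv)
  also have "... = u \<bullet>c u + (P' *mv u) \<bullet>c v"
   using mat_adjoint_cdot[OF c(2) u v(1)] c u Pv by (simp add: conjugate_add_vec[of _ n] scalar_prod_add_distrib[of _ n])
  finally have "w ~= 0\<^sub>v n" using u u0 v by (auto simp: P'u)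
  then obtain T where T: "mat_projection n T" "mat_trace T = 1"
    "!!A. A : carrier_mat n n ==> A *mv w = w ==> A * T = T"
    "!!A. A : carrier_mat n n ==> A *mv w = 0\<^sub>v n ==> A * T = 0\<^sub>m n n" using rank_one_projection[OF w] by blast
  have Tc: "T : carrier_mat n n" "T * T = T" "mat_adjoint T = T" using T(1) by (auto simp: mat_projection_def)
  have Da: "mat_adjoint D : carrier_mat n n" "mat_adjoint D * P = mat_adjoint D" "mat_adjoint D * P' = mat_adjoint D"
   using D mat_adjoint_simps(1)[OF c(1) D] mat_adjoint_simps(1)[OF c(2) D] P(2) P'(2) c by auto
  have PT: "P * T = T" by (rule T(3)[OF c(1)]) (simp add: w_def assoc_mult_mat_vec[OF c(1) c(1) u, symmetric] c(3))
  then have TP: "T * P = T" using mat_adjoint_simps(1)[OF c(1) Tc(1)] c Tc by simp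
  have "mat_adjoint D *mv w = (mat_adjoint D * P') *mv u"
   unfolding w_def assoc_mult_mat_vec[OF Da(1) c(1) u, symmetric] Da(2,3) ..
  also have "... = 0\<^sub>v n"
   unfolding assoc_mult_mat_vec[OF Da(1) c(2) u] P'u using Da(1) by (auto simp: scalar_prod_def intro!: eq_vecI)
  finally have "mat_adjoint (mat_adjoint D * T) = mat_adjoint (0\<^sub>m n n)" using T(4)[OF Da(1)] by simp
  then have TD: "T * D = 0\<^sub>m n n"
   using mat_adjoint_simps(1)[OF Da(1) Tc(1)] Tc by (auto simp: mat_adjoint_simps(3) intro!: eq_matI)
  have PTc: "P - T : carrier_mat n n" using Tc by auto
  have "(P - T) * (P - T) = P - T"
   unfolding minus_mult_distrib_mat[OF c(1) Tc(1) PTc] mult_minus_distrib_mat[OF c(1) c(1) Tc(1)]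
    mult_minus_distrib_mat[OF Tc(1) c(1) Tc(1)] c(3) PT TP Tc(2) using c Tc by (auto intro!: eq_matI)
  then have proj: "mat_projection n (P - T)"
   unfolding mat_projection_def using PTc mat_adjoint_simps(6)[OF c(1) Tc(1)] c Tc by simp
  have "(P - T) * D = D" using minus_mult_distrib_mat[OF c(1) Tc(1) D] P(2) TD D by (auto intro!: eq_matI)
  from min[OF proj this] have "nat \<lfloor>Re (mat_trace P)\<rfloor> <= nat \<lfloor>Re (mat_trace (P - T))\<rfloor>" .
  moreover have "Re (mat_trace P) = Re (mat_trace (P - T)) + 1" using c Tc T(2) by (auto simp: mat_trace_def sum_subtractf)
  moreover note projection_trace_nonneg[OF proj]
  ultimately show False by (simp add: nat_add_distrib)
 qed
 then show ?thesis using P unfolding support_projection_def by blast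
qed

section \<open>Local density matrices and their supports\<close>

context car_modes
begin

definition enum :: "nat => nat set" where
 "enum = (SOME b. bij_betw b {..<2 ^ n} (PN))"

lemma bij_enum: "bij_betw enum {..<2 ^ n} (PN)"
proof -
 have "card {..<2 ^ n :: nat} = card (PN)" by (simp add: card_Pow)
 then have "EX b. bij_betw b {..<2 ^ n :: nat} (PN)" by (intro finite_same_card_bij) auto
 then show ?thesis unfolding enum_def by (rule someI_ex)
qed

lemma enum_in: "i < 2 ^ n ==> enum i : PN" using bij_enum by (auto simp: bij_betw_def)

lemma sum_enum: "(SUM mu:PN. f mu) = (SUM i<2 ^ n. f (enum i))" using sum.reindex_bij_betw[OF bij_enum, of f] by simp

text \<open>Coefficients are unique on the index set by \<open>comb_inject\<close>, so the chosen
  \<open>k\<close> does not influence the entries.\<close>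

definition cmat :: "'a => complex mat" where
 "cmat x = mat (2 ^ n) (2 ^ n) (%(i, j). (SOME k. x = comb k) (enum i) (enum j))"

lemma cmat_carrier [simp]: "cmat x : carrier_mat (2 ^ n) (2 ^ n)" by (simp add: cmat_def)

lemma cmat_comb: "cmat (comb k) = mat (2 ^ n) (2 ^ n) (%(i, j). k (enum i) (enum j))"
proof -
 have "comb k = comb (SOME l. comb k = comb l)" by (rule someI[of "%l. comb k = comb l" k]) simp
 then have "(SOME l. comb k = comb l) (enum i) (enum j) = k (enum i) (enum j)" if "i < 2 ^ n" "j < 2 ^ n" for i j
  using comb_inject[of k "SOME l. comb k = comb l"] enum_in that by simp
 then show ?thesis by (auto simp: cmat_def intro!: eq_matI)
qed

lemma cmat_ops:
 assumes x: "x : star_alg_gen (c ` {..<n})" and y: "y : star_alg_gen (c ` {..<n})"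
 shows "cmat (x + y) = cmat x + cmat y" "cmat (x * y) = cmat x * cmat y" "cmat (z *c x) = z *m cmat x"
  "cmat (cstar x) = mat_adjoint (cmat x)"
proof -
 obtain k l where kl: "x = comb k" "y = comb l" using comb_exists[OF x] comb_exists[OF y] by blast
 show "cmat (x + y) = cmat x + cmat y" "cmat (z *c x) = z *m cmat x" "cmat (cstar x) = mat_adjoint (cmat x)"
  unfolding kl comb_add comb_scaleC comb_cstar cmat_comb by (auto intro!: eq_matI)
 show "cmat (x * y) = cmat x * cmat y" unfolding kl comb_mult cmat_comb
  by (rule eq_matI) (auto simp: scalar_prod_def sum_enum atLeast0LessThan)
qed

lemma bij_cmat: "bij_betw cmat (star_alg_gen (c ` {..<n})) (carrier_mat (2 ^ n) (2 ^ n))"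
proof (rule bij_betw_imageI)
 show "inj_on cmat (star_alg_gen (c ` {..<n}))"
 proof (rule inj_onI)
  fix x y assume xy: "x : star_alg_gen (c ` {..<n})" "y : star_alg_gen (c ` {..<n})" "cmat x = cmat y"
  obtain k l where kl: "x = comb k" "y = comb l" using comb_exists[OF xy(1)] comb_exists[OF xy(2)] by blast
  have "k mu nu = l mu nu" if mn: "mu : PN" "nu : PN" for mu nu
  proof -
   have img: "enum ` {..<2 ^ n} = PN" using bij_enum by (simp add: bij_betw_def)
   obtain i j where ij: "i < 2 ^ n" "enum i = mu" "j < 2 ^ n" "enum j = nu" using mn unfolding img[symmetric] by blast
   have "cmat (comb k) $$ (i, j) = cmat (comb l) $$ (i, j)" using xy(3) kl by simp
   then show ?thesis using ij by (simp add: cmat_comb)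
  qed
  then show "x = y" unfolding kl by (rule comb_cong)
 qed
 show "cmat ` star_alg_gen (c ` {..<n}) = carrier_mat (2 ^ n) (2 ^ n)"
 proof (intro antisym subsetI)
  fix A :: "complex mat" assume A: "A : carrier_mat (2 ^ n) (2 ^ n)"
  define k where "k mu nu = A $$ (the_inv_into {..<2 ^ n} enum mu, the_inv_into {..<2 ^ n} enum nu)" for mu nu
  have "the_inv_into {..<2 ^ n} enum (enum i) = i" if "i < 2 ^ n" for i
   using bij_enum that by (intro the_inv_into_f_f) (auto simp: bij_betw_def)
  then have "cmat (comb k) = A" using A unfolding cmat_comb k_def by (auto intro!: eq_matI)
  then show "A : cmat ` star_alg_gen (c ` {..<n})" using comb_in_alg by blast
 qed auto
qed

lemma state_local_density:
 assumes phi: "is_state phi"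
 defines "D \<equiv> mat (2 ^ n) (2 ^ n) (%(i, j). phi (mun (enum j) (enum i)))"
 shows "density_matrix (2 ^ n) D" "x : star_alg_gen (c ` {..<n}) ==> phi x = mat_trace (D * cmat x)"
proof -
 have phia: "phi (x + y) = phi x + phi y" "phi (z *c x) = z * phi x" "phi (cstar x * x) : \<real>\<^sub>\<ge>\<^sub>0" "phi 1 = 1" for x y z
  using phi by (auto simp: is_state_def)
 have phis: "phi (sum f I) = (SUM i:I. phi (f i))" for f and I :: "'i set"
  using phia(1)[of 0 0] by (induction I rule: infinite_finite_induct) (simp_all add: phia(1))
 have D: "D : carrier_mat (2 ^ n) (2 ^ n)" by (simp add: D_def)
 show tr: "phi x = mat_trace (D * cmat x)" if x: "x : star_alg_gen (c ` {..<n})" for x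
 proof -
  obtain k where k: "x = comb k" using comb_exists[OF x] by blast
  have "phi x = (SUM i<2 ^ n. SUM j<2 ^ n. k (enum i) (enum j) * phi (mun (enum i) (enum j)))"
   unfolding k comb_def by (simp add: phis phia(2) sum_enum)
  also have "... = (SUM j<2 ^ n. SUM i<2 ^ n. k (enum i) (enum j) * phi (mun (enum i) (enum j)))" by (rule sum.swap)
  also have "... = mat_trace (D * cmat x)" unfolding mat_trace_def k cmat_comb
   by (simp add: D_def scalar_prod_def atLeast0LessThan mult.commute)
  finally show ?thesis .
 qed
 have "mat_trace D = 1"
 proof -
  have "mat_trace D = phi (SUM mu:PN. mun mu mu)" by (simp add: mat_trace_def D_def phis sum_enum)
  then show ?thesis by (simp add: sum_munit phia(4))
 qed
 moreover have "(D *mv v) \<bullet>c v : \<real>\<^sub>\<ge>\<^sub>0" if v: "v : carrier_vec (2 ^ n)" for v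
 proof -
  \<comment> \<open>A single row of matrix units: \<open>cstar y * y\<close> reproduces the
    quadratic form of \<open>D\<close> at \<open>v\<close>, so positivity of the state becomes
    positivity of \<open>D\<close>.\<close>
  define y where "y = (SUM i<2 ^ n. cnj (v $ i) *c mun {} (enum i))"
  have "cstar y * y = (SUM i<2 ^ n. SUM j<2 ^ n. (v $ j * cnj (v $ i)) *c mun (enum j) (enum i))" unfolding y_def
   by (simp add: cstar_simps cstar_munit sum_distrib_left sum_distrib_right mult_scaleC_left
     mult_scaleC_right scaleC_scaleC cvs.scale_sum_right munit_mult mult.commute)
  then have "phi (cstar y * y) = (SUM i<2 ^ n. SUM j<2 ^ n. v $ j * cnj (v $ i) * phi (mun (enum j) (enum i)))"
   by (simp add: phis phia(2))
  also have "... = (D *mv v) \<bullet>c v" unfolding cdot_sum[OF mult_mat_vec_carrier[OF D v] v] using v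
   by (auto simp: D_def scalar_prod_def atLeast0LessThan sum_distrib_right sum_distrib_left mult_ac)
  finally show ?thesis using phia(3)[of y] by simp
 qed
 ultimately show "density_matrix (2 ^ n) D" using D by (simp add: density_matrix_def)
qed

end

context car_system
begin

text \<open>Carries the rank hypothesis, a statement about matrices, back into the algebra:
  \<open>q\<close> is the element whose matrix is the support projection.\<close>

lemma local_rank_bound:
 assumes phi: "is_state phi"
  and R: "!!Q. local_support d a phi N Q ==> vec_space.rank (2 ^ (d * N)) Q <= R"
 shows "EX q:car_sub d a {0..<int N}. q * q = q & cstar q = q & phi q = 1 &
  (ALL A. (ALL k<Suc (R * R). A k : car_sub d a {0..<int N}) -->
    (EX l. (EX k<Suc (R * R). l k ~= 0) & (SUM k<Suc (R * R). l k *c (q * A k * q)) = 0))"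
proof -
 define n where "n = d * N"
 define e where "e k = (int (k div d), k mod d)" for k
 define c where "c k = gen (fst (e k)) (snd (e k))" for k
 have e_inj: "inj_on e {..<n}"
 proof (rule inj_onI)
  fix k l assume "e k = e l"
  then have "k div d = l div d" "k mod d = l mod d" by (auto simp: e_def)
  then show "k = l" by (metis div_mult_mod_eq)
 qed
 interpret m: car_modes c n unfolding c_def gen_def
  by (rule car_family_modes[OF car_algebra_family[OF car] e_inj]) (simp add: e_def d_pos)
 have "(gens {0..<int N}) = c ` {..<n}"
 proof (intro antisym subsetI)
  fix g assume "g : (gens {0..<int N})"
  then obtain x i where g: "g = gen x i" "0 <= x" "x < int N" "i < d" by auto
  define k where "k = nat x * d + i"
  have "k div d = nat x" "k mod d = i" using g(4) by (simp_all add: k_def)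
  then have "g = c k" using g by (simp add: c_def e_def)
  moreover have "k < n"
  proof -
   have "nat x + 1 <= N" using g by linarith
   then have "(nat x + 1) * d <= N * d" by (rule mult_right_mono) simp
   then show ?thesis using g(4) by (simp add: k_def n_def mult.commute)
  qed
  ultimately show "g : c ` {..<n}" by blast
 next
  fix g assume "g : c ` {..<n}"
  then obtain k where k: "k < n" "g = c k" by auto
  then have "k div d < N" using d_pos by (simp add: n_def less_mult_imp_div_less mult.commute)
  then show "g : (gens {0..<int N})" using k d_pos
   by (intro CollectI exI[of _ "int (k div d)"] exI[of _ "k mod d"]) (auto simp: c_def e_def)
 qed
 then have sub: "car_sub d a {0..<int N} = star_alg_gen (c ` {..<n})" unfolding car_sub_gen by (simp add: m.closure_alg)
 define D where "D = mat (2 ^ n) (2 ^ n) (%(i, j). phi (munit c n (m.enum j) (m.enum i)))"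
 note D = m.state_local_density[OF phi, folded D_def]
 have Dc: "D : carrier_mat (2 ^ n) (2 ^ n)" by (simp add: D_def)
 obtain Q where Q: "support_projection (2 ^ n) D Q" using support_projection_exists[OF Dc] by blast
 have iso: "local_matrix_iso d a N m.cmat"
  unfolding local_matrix_iso_def sub n_def[symmetric] using m.bij_cmat m.cmat_ops by blast
 have "local_support d a phi N Q" unfolding local_support_def sub n_def[symmetric] using iso D Q by blast
 then have rank: "vec_space.rank (2 ^ n) Q <= R" using R by (simp add: n_def)
 have Qp: "Q : carrier_mat (2 ^ n) (2 ^ n)" "Q * Q = Q" "mat_adjoint Q = Q" "Q * D = D"
  using Q by (auto simp: support_projection_def mat_projection_def)
 obtain q where q: "q : star_alg_gen (c ` {..<n})" "m.cmat q = Q"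
  using m.bij_cmat Qp(1) by (metis bij_betw_imp_surj_on image_iff)
 have inj: "x = y" if "x : star_alg_gen (c ` {..<n})" "y : star_alg_gen (c ` {..<n})" "m.cmat x = m.cmat y" for x y
  using m.bij_cmat that by (metis bij_betw_imp_inj_on inj_onD)
 have "q * q = q" by (rule inj) (use q Qp in "auto intro: star_alg_gen.mult simp: m.cmat_ops")
 moreover have "cstar q = q" by (rule inj) (use q Qp in "auto intro: star_alg_gen.cstar simp: m.cmat_ops")
 moreover have "phi q = 1"
 proof -
  have "phi q = mat_trace (D * Q)" using D(2)[OF q(1)] q(2) by simp
  also have "... = mat_trace (Q * D)"
  proof -
   have "mat_trace (D * Q) = (SUM i<2 ^ n. SUM j<2 ^ n. D $$ (i, j) * Q $$ (j, i))"
    using Dc Qp(1) by (simp add: mat_trace_def scalar_prod_def atLeast0LessThan)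
   also have "... = (SUM j<2 ^ n. SUM i<2 ^ n. D $$ (i, j) * Q $$ (j, i))" by (rule sum.swap)
   also have "... = mat_trace (Q * D)"
    using Dc Qp(1) by (simp add: mat_trace_def scalar_prod_def atLeast0LessThan mult.commute)
   finally show ?thesis .
  qed
  also have "... = 1" using D(1) Qp(4) by (simp add: density_matrix_def)
  finally show ?thesis .
 qed
 moreover have "EX l. (EX k<Suc (R * R). l k ~= 0) & (SUM k<Suc (R * R). l k *c (q * A k * q)) = 0"
  if A: "ALL k<Suc (R * R). A k : car_sub d a {0..<int N}" for A
 proof -
  have A': "A k : star_alg_gen (c ` {..<n})" if "k < Suc (R * R)" for k using A that sub by simp
  define W where "W k = Q * m.cmat (A k) * Q" for k
  have W: "W k : carrier_mat (2 ^ n) (2 ^ n)" for k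
   unfolding W_def by (intro mult_carrier_mat[of _ _ "2 ^ n"] Qp(1) m.cmat_carrier)
  have "EX l. (EX k<Suc (R * R). l k ~= 0) &
    (ALL i<2 ^ n. ALL j<2 ^ n. (SUM k<Suc (R * R). l k * W k $$ (i, j)) = 0)"
   unfolding W_def by (rule low_rank_sandwich_dependent[OF Qp(1) rank]) simp
  then obtain l where l: "EX k<Suc (R * R). l k ~= 0"
   "ALL i<2 ^ n. ALL j<2 ^ n. (SUM k<Suc (R * R). l k * W k $$ (i, j)) = 0" by blast
  have mem: "q * A k * q : star_alg_gen (c ` {..<n})" if "k < Suc (R * R)" for k by (intro star_alg_gen.mult q A' that)
  have cm: "m.cmat (SUM k<K. l k *c (q * A k * q)) = mat (2 ^ n) (2 ^ n) (%(i, j). SUM k<K. l k * W k $$ (i, j))"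
   if "K <= Suc (R * R)" for K using that
  proof (induction K)
   case 0
   show ?case using m.cmat_comb[of "%mu nu. 0"] by (auto simp: m.comb_def intro!: eq_matI)
  next
   case (Suc K)
   have k: "K < Suc (R * R)" using Suc by simp
   have s: "(SUM k<K. l k *c (q * A k * q)) : star_alg_gen (c ` {..<n})"
    using Suc by (intro m.star_alg_gen_sum star_alg_gen.scaleC mem) auto
   have "m.cmat (SUM k<Suc K. l k *c (q * A k * q)) =
     m.cmat (SUM k<K. l k *c (q * A k * q)) + l K *m W K"
    using m.cmat_ops(1)[OF s star_alg_gen.scaleC[OF mem[OF k]], of "l K"] m.cmat_ops(3)[OF mem[OF k] mem[OF k], of "l K"]
     m.cmat_ops(2)[OF star_alg_gen.mult[OF q(1) A'[OF k]] q(1)] m.cmat_ops(2)[OF q(1) A'[OF k]] q(2) by (simp add: W_def)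
   moreover have "m.cmat (SUM k<K. l k *c (q * A k * q)) = mat (2 ^ n) (2 ^ n) (%(i, j). SUM k<K. l k * W k $$ (i, j))"
    by (rule Suc.IH) (use k in simp)
   ultimately show ?case using W[of K] by (auto intro!: eq_matI)
  qed
  have "(SUM k<Suc (R * R). l k *c (q * A k * q)) = 0"
  proof (rule inj)
   show "(SUM k<Suc (R * R). l k *c (q * A k * q)) : star_alg_gen (c ` {..<n})"
    by (intro m.star_alg_gen_sum star_alg_gen.scaleC mem) auto
   show z: "0 : star_alg_gen (c ` {..<n})" using star_alg_gen.scaleC[OF star_alg_gen.one, of 0] by simp
   show "m.cmat (SUM k<Suc (R * R). l k *c (q * A k * q)) = m.cmat 0"
    unfolding cm[OF order_refl] using cm[of 0] l(2) by (auto intro!: eq_matI)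
  qed
  then show ?thesis using l(1) by blast
 qed
 ultimately show ?thesis using q(1) sub by blast
qed

end

section \<open>Cyclic representations of pure states\<close>

text \<open>Uniform Lipschitz bounds make the set of points of convergence closed, so limits need
  only be checked on a dense set.\<close>

lemma closed_tendsto:
 fixes f :: "nat => 'a::metric_space => 'b::metric_space"
 assumes f: "!!n x y. dist (f n x) (f n y) <= K * dist x y" and l: "!!x y. dist (l x) (l y) <= L * dist x y"
 shows "closed {x. (%n. f n x) ----> l x}"
proof -
 have "(%n. f n x) ----> l x" if X: "!!k. (%n. f n (X k)) ----> l (X k)" "X ----> x" for X x
 proof (rule metric_LIMSEQ_I)
  fix e :: real assume e: "0 < e"
  have "(%k. K * dist (X k) x + L * dist (X k) x) ----> K * dist x x + L * dist x x" by (intro tendsto_intros X(2))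
  then have "(%k. K * dist (X k) x + L * dist (X k) x) ----> 0" by simp
  from LIMSEQ_D[OF this, of "e / 2"] e obtain k where "norm (K * dist (X k) x + L * dist (X k) x - 0) < e / 2" by auto
  then have k: "K * dist (X k) x + L * dist (X k) x < e / 2" unfolding real_norm_def by linarith
  obtain m where m: "!!n. n >= m ==> dist (f n (X k)) (l (X k)) < e / 2" using metric_LIMSEQ_D[OF X(1), of "e / 2"] e by auto
  have le: "dist (f n x) (l x) <= K * dist (X k) x + dist (f n (X k)) (l (X k)) + L * dist (X k) x" for n
   using dist_triangle[of "f n x" "l x" "f n (X k)"] dist_triangle[of "f n (X k)" "l x" "l (X k)"]
    f[of n x "X k"] l[of "X k" x] by (simp add: dist_commute)
  have "dist (f n x) (l x) < e" if "n >= m" for n using le[of n] m[OF that] k by linarith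
  then show "EX m. ALL n>=m. dist (f n x) (l x) < e" by blast
 qed
 then show ?thesis unfolding closed_sequential_limits by auto
qed

text \<open>Tychonoff: the functions lie in a compact product of discs. The cluster point is
  described by the closed conditions that hold eventually along \<open>I\<close>, the only form in
  which it is used.\<close>

lemma pointwise_cluster_point:
 fixes f :: "nat => 'a => complex"
 assumes bd: "!!n x. cmod (f n x) <= B x" and I: "infinite I"
 obtains g where "!!C m. closed C ==> (!!n. n : I ==> n >= m ==> f n : C) ==> g : C"
proof -
 define K where "K = PiE UNIV (%x. cball (0 :: complex) (B x))"
 have "compactin (product_topology (%i. euclidean) UNIV) K" unfolding K_def by (simp add: compactin_PiE)
 then have K: "compact K" by (simp add: euclidean_product_topology)
 define F where "F = {C. closed C & (EX m. ALL n:I. n >= m --> f n : C)}"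
 have fK: "f n : K" for n using bd by (auto simp: K_def)
 have fin: "EX m. ALL n:I. n >= m --> f n : \<Inter>F'" if "finite F'" "F' <= F" for F' using that
 proof (induction F')
  case (insert C F')
  then obtain m m' where "ALL n:I. n >= m --> f n : \<Inter>F'" "ALL n:I. n >= m' --> f n : C" by (auto simp: F_def)
  then show ?case by (intro exI[of _ "max m m'"]) auto
 qed auto
 have "K \<inter> \<Inter>F' ~= {}" if F': "finite F'" "F' <= F" for F'
 proof -
  obtain m where m: "ALL n:I. n >= m --> f n : \<Inter>F'" using fin[OF F'] by blast
  obtain n where "n : I" "n >= m" using I by (meson finite_nat_set_iff_bounded not_less)
  then show ?thesis using m fK by blast
 qed
 then have "K \<inter> \<Inter>F ~= {}" using compact_imp_fip[OF K, of F] by (auto simp: F_def)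
 then obtain g where "g : \<Inter>F" by blast
 then show thesis using that[of g] by (auto simp: F_def)
qed

locale cyclic_rep =
 fixes om :: "'a::cstar_algebra => complex" and pi :: "'a => 'h::complex_hilbert bop" and Om :: 'h
 assumes pi_add: "pi (x + y) = pi x + pi y" and pi_mult: "pi (x * y) = pi x * pi y" and pi_one: "pi 1 = 1"
  and pi_cstar: "pi (cstar x) = adj (pi x)" and pi_scaleC: "pi (z *c x) = z *c pi x"
  and vector_state: "om x = ip Om (app (pi x) Om)"
  and cyclic: "closure (range (%x. app (pi x) Om)) = UNIV"
  and pure: "pure_state om"
begin

lemma state: "is_state om" using pure by (simp add: pure_state_def)

lemma norm_Omega: "ip Om Om = 1" "norm Om = 1"
proof -
 show 1: "ip Om Om = 1" using vector_state[of 1] state by (simp add: is_state_def pi_one)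
 then have "complex_of_real ((norm Om)\<^sup>2) = 1" by (simp only: cinner_self)
 then have "(norm Om)\<^sup>2 = 1" by (simp only: of_real_eq_1_iff)
 then show "norm Om = 1" using abs_square_eq_1[of "norm Om"] by simp
qed

lemma pi_zero [simp]: "pi 0 = 0" using pi_add[of 0 0] by simp

lemma pi_minus: "pi (- x) = - pi x" using pi_scaleC[of "-1" x] by simp

lemma pi_diff: "pi (x - y) = pi x - pi y" using pi_add[of x "- y"] by (simp add: pi_minus)

lemma pi_sum: "pi (sum f A) = (SUM i:A. pi (f i))" by (induction A rule: infinite_finite_induct) (simp_all add: pi_add)

lemma pi_bound: "norm (app (pi x) xi) <= norm x * norm xi"
 by (rule hom_bop_bound[of pi]) (rule pi_add pi_mult pi_one pi_cstar pi_scaleC)+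

lemma bounded_linear_pi: "bounded_linear (%x. app (pi x) xi)"
proof
 show "app (pi (r *r x)) xi = r *r app (pi x) xi" for r x using pi_scaleC[of "of_real r" x] by (simp add: scaleC_of_real)
 show "EX K. ALL x. norm (app (pi x) xi) <= norm x * K" using pi_bound by blast
qed (simp add: pi_add)

lemmas continuous_on_pi [continuous_intros] = bounded_linear.continuous_on[OF bounded_linear_pi]

lemma cyclic_dense:
 assumes S: "closed S" and D: "closure D = UNIV" "!!x. x : D ==> app (pi x) Om : S"
 shows "xi : S"
proof -
 have "closed ((%x. app (pi x) Om) -` S)" by (intro closed_vimage S continuous_intros)
 then have "closure D <= (%x. app (pi x) Om) -` S" using D(2) by (intro closure_minimal) auto
 then have "closure (range (%x. app (pi x) Om)) <= S" using D(1) S by (intro closure_minimal) auto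
 then show ?thesis using cyclic by auto
qed

lemma bop_cyclic_eqI:
 assumes "!!x. app S (app (pi x) Om) = app T (app (pi x) Om)"
 shows "S = T"
proof (rule bop_eqI)
 show "app S xi = app T xi" for xi
  using cyclic_dense[of "{xi. app S xi = app T xi}" UNIV xi] by (simp add: assms closed_Collect_eq continuous_intros)
qed

text \<open>A weak cluster point of \<open>\<omega>(A Z\<^sub>n)\<close>, with \<open>0 < Z\<^sub>n < 1\<close> asymptotically central, splits \<open>\<omega>\<close> into a convex
 combination of two states, so purity forces it to be a multiple of \<open>\<omega>\<close>.\<close>

lemma pure_clustering:
 assumes Z: "!!n. adj (Z n) = Z n" "!!n xi. 0 <= Re (ip xi (app (Z n) xi))" "!!n xi. Re (ip xi (app (Z n) xi)) <= (norm xi)\<^sup>2"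
  "!!n xi. norm (app (Z n) xi) <= norm xi"
  and t: "!!n. ip Om (app (Z n) Om) = of_real t" "0 < t" "t < 1"
  and D: "closure D = UNIV" "!!A. A : D ==> EX m. ALL n>=m. Z n * pi A = pi A * Z n"
 shows "(%n. ip Om (app (pi A) (app (Z n) Om))) ----> of_real t * om A"
proof (rule ccontr)
 define f where "f n A = ip Om (app (pi A) (app (Z n) Om))" for n A
 assume "\<not> ?thesis"
 then obtain e where e: "e > 0" "!!m. EX n>=m. e <= dist (f n A) (of_real t * om A)"
  unfolding f_def lim_sequentially by (metis not_less)
 define I where "I = {n. e <= dist (f n A) (of_real t * om A)}"
 have I: "infinite I" unfolding I_def infinite_nat_iff_unbounded_le using e(2) by blast
 have f_bound: "cmod (f n x) <= norm x" for n x
 proof -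
  have "cmod (f n x) <= norm Om * norm (app (pi x) (app (Z n) Om))" unfolding f_def by (rule cinner_cauchy_schwarz)
  also have "... <= norm x * norm (app (Z n) Om)" using pi_bound norm_Omega by simp
  also have "... <= norm x" using Z(4)[of n Om] norm_Omega by (simp add: mult_left_le)
  finally show ?thesis .
 qed
 obtain g where g: "!!C m. closed C ==> (!!n. n : I ==> n >= m ==> f n : C) ==> g : C"
  using pointwise_cluster_point[of f norm I] f_bound I by metis
 have cont: "continuous_on UNIV (%h :: 'a => complex. h x)" for x by simp
 have g_add: "g (x + y) = g x + g y" for x y using g[of "{h. h (x + y) = h x + h y}" 0]
  by (simp add: f_def pi_add cinner_add_right closed_Collect_eq continuous_on_add)
 have g_scale: "g (z *c x) = z * g x" for z x using g[of "{h. h (z *c x) = z * h x}" 0]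
  by (simp add: f_def pi_scaleC cinner_scaleC_right closed_Collect_eq continuous_on_mult)
 have g_one: "g 1 = of_real t" using g[of "{h. h 1 = of_real t}" 0] by (simp add: f_def pi_one t(1) closed_Collect_eq)
 have g_bound: "cmod (g x) <= norm x" for x
  using g[of "{h. cmod (h x) <= norm x}" 0] f_bound by (simp add: closed_Collect_le continuous_on_norm)
 \<comment> \<open>Positivity of \<open>h\<close> and of \<open>om - h\<close> in one closed
   condition. For \<open>f n\<close> it holds once \<open>Z n\<close> commutes with
   \<open>pi x\<close>: then \<open>Z n\<close> sits in the middle of the inner product and lies
   between 0 and 1.\<close>
 define pos where "pos h x \<longleftrightarrow> Im (h (cstar x * x)) = 0 & 0 <= Re (h (cstar x * x)) &
  Re (h (cstar x * x)) <= Re (om (cstar x * x))" for h x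
 have g_pos_D: "pos g x" if x: "x : D" for x
 proof -
  obtain m where m: "ALL n>=m. Z n * pi x = pi x * Z n" using D(2)[OF x] by blast
  have "pos (f n) x" if n: "n >= m" for n
  proof -
   have comm: "app (Z n) (app (pi x) Om) = app (pi x) (app (Z n) Om)" using m n by (metis app_simps(6))
   have eq: "f n (cstar x * x) = ip (app (pi x) Om) (app (Z n) (app (pi x) Om))"
    by (simp add: f_def pi_mult pi_cstar cinner_adj comm)
   have "cnj (f n (cstar x * x)) = f n (cstar x * x)"
    unfolding eq using cinner_adj[of "Z n" "app (pi x) Om" "app (pi x) Om"] Z(1) by (metis cinner_commute)
   moreover have "om (cstar x * x) = of_real ((norm (app (pi x) Om))\<^sup>2)"
    by (simp add: vector_state pi_mult pi_cstar cinner_adj' cinner_self)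
   ultimately show ?thesis unfolding pos_def using Z(2,3) by (simp add: complex_eq_iff eq)
  qed
  moreover have "closed {h :: 'a => complex. pos h x}"
   unfolding pos_def by (intro closed_Collect_conj closed_Collect_eq closed_Collect_le continuous_intros cont)
  ultimately show ?thesis using g[of "{h. pos h x}" m] by simp
 qed
 have "bounded_linear g"
  by standard (use g_scale[of "of_real _"] g_add g_bound in "auto simp: scaleC_of_real scaleR_conv_of_real intro!: exI[of _ 1]")
 note g_cont = bounded_linear.continuous_on[OF this]
 have "closed {x. pos g x}" unfolding pos_def vector_state
  by (intro closed_Collect_conj closed_Collect_eq closed_Collect_le continuous_intros g_cont)
 then have g_pos: "pos g x" for x using closure_minimal[of D "{x. pos g x}"] g_pos_D D(1) by auto
 \<comment> \<open>Normalization by \<open>t\<close> and \<open>1 - t\<close> makes states of the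
   two positive functionals whose sum is \<open>om\<close>.\<close>
 define phi1 where "phi1 x = g x / of_real t" for x
 define phi2 where "phi2 x = (om x - g x) / of_real (1 - t)" for x
 have oms: "om (x + y) = om x + om y" "om (z *c x) = z * om x" "om (cstar x * x) : \<real>\<^sub>\<ge>\<^sub>0" "om 1 = 1" for x y z
  using state by (auto simp: is_state_def)
 have "is_state phi1" unfolding is_state_def phi1_def using g_pos[unfolded pos_def] t
  by (auto simp: g_add g_scale g_one add_divide_distrib complex_nonneg_Reals_iff)
 moreover have "is_state phi2" unfolding is_state_def
 proof (intro conjI allI)
  show "phi2 (x + y) = phi2 x + phi2 y" "phi2 (z *c x) = z * phi2 x" for x y z
   by (simp_all add: phi2_def oms g_add g_scale add_divide_distrib[symmetric] right_diff_distrib)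
  show "phi2 1 = 1" using t by (simp add: phi2_def oms g_one)
  show "phi2 (cstar x * x) : \<real>\<^sub>\<ge>\<^sub>0" for x
  proof -
   have im: "Im (om (cstar x * x)) = 0" using oms(3)[of x] by (simp add: complex_nonneg_Reals_iff)
   have "phi2 (cstar x * x) = of_real ((Re (om (cstar x * x)) - Re (g (cstar x * x))) / (1 - t))"
    using im g_pos[of x] by (simp add: pos_def phi2_def complex_eq_iff)
   then show ?thesis using g_pos[of x] t by (simp add: pos_def complex_nonneg_Reals_iff)
  qed
 qed
 moreover have "om x = of_real t * phi1 x + of_real (1 - t) * phi2 x" for x
 proof -
  have "of_real t ~= (0 :: complex)" "of_real (1 - t) ~= (0 :: complex)" using t by auto
  then show ?thesis by (simp add: phi1_def phi2_def del: of_real_diff)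
 qed
 ultimately have "phi1 = om" using pure t unfolding pure_state_def by blast
 then have "g A = of_real t * om A" using t by (auto simp: phi1_def fun_eq_iff field_simps)
 moreover have "e <= dist (g A) (of_real t * om A)" using g[of "{h. e <= dist (h A) (of_real t * om A)}" 0]
  by (simp add: I_def closed_Collect_le continuous_on_dist)
 ultimately show False using e(1) by simp
qed

text \<open>An affine rescaling puts the sequence between 0 and 1, where clustering applies. This
  yields the limit against Om; asymptotic centrality moves \<open>pi B\<close> across and density
  extends it to all vectors.\<close>

lemma weak_limit_of_asymptotically_central:
 assumes Y: "!!n. adj (Y n) = Y n" "!!n xi. norm (app (Y n) xi) <= C * norm xi" and C: "0 < C"
  and c: "!!n. ip Om (app (Y n) Om) = of_real c"
  and D: "closure D = UNIV" "!!A. A : D ==> EX m. ALL n>=m. Y n * pi A = pi A * Y n"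
 shows "(%n. ip xi (app (Y n) eta)) ----> of_real c * ip xi eta"
proof -
 \<comment> \<open>With this \<open>e\<close> the rescaled operators lie between 1/4 and 3/4, so
   that \<open>0 < t < 1\<close> holds strictly.\<close>
 define e where "e = 1 / (4 * C)"
 have e: "e > 0" "e * C = 1 / 4" using C by (simp_all add: e_def)
 define Z where "Z n = (1 / 2) *r 1 + e *r Y n" for n
 have ZC: "Z n = of_real (1 / 2) *c 1 + of_real e *c Y n" for n by (simp only: Z_def scaleC_of_real)
 have appZ: "app (Z n) xi = (1 / 2) *r xi + e *r app (Y n) xi" for n xi by (simp add: Z_def)
 have Re_Y: "\<bar>Re (ip xi (app (Y n) xi))\<bar> <= C * (norm xi)\<^sup>2" for n xi
 proof -
  have "\<bar>Re (ip xi (app (Y n) xi))\<bar> <= norm xi * norm (app (Y n) xi)"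
   using abs_Re_le_cmod cinner_cauchy_schwarz order_trans by blast
  also have "... <= norm xi * (C * norm xi)" by (intro mult_left_mono Y) simp
  finally show ?thesis by (simp add: power2_eq_square mult_ac)
 qed
 have Re_Z: "Re (ip xi (app (Z n) xi)) = (norm xi)\<^sup>2 / 2 + e * Re (ip xi (app (Y n) xi))" for n xi
  by (simp add: appZ Re_cinner inner_simps power2_norm_eq_inner)
 have eY: "\<bar>e * Re (ip xi (app (Y n) xi))\<bar> <= (norm xi)\<^sup>2 / 4" for n xi
 proof -
  have "\<bar>e * Re (ip xi (app (Y n) xi))\<bar> <= e * (C * (norm xi)\<^sup>2)"
   unfolding abs_mult using e(1) Re_Y by (simp add: mult_left_mono)
  also have "... = (e * C) * (norm xi)\<^sup>2" by simp
  finally show ?thesis by (simp add: e(2))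
 qed
 define t where "t = 1 / 2 + e * c"
 have cY: "\<bar>e * c\<bar> <= 1 / 4" using eY[of Om 0] c[of 0] norm_Omega by simp
 have lim: "(%n. ip Om (app (pi A) (app (Z n) Om))) ----> of_real t * om A" for A
 proof (rule pure_clustering)
  show "adj (Z n) = Z n" for n by (simp add: ZC Y(1))
  show "0 <= Re (ip xi (app (Z n) xi))" "Re (ip xi (app (Z n) xi)) <= (norm xi)\<^sup>2" for n xi
   using eY[of xi n] by (auto simp: Re_Z abs_le_iff)
  show "norm (app (Z n) xi) <= norm xi" for n xi
  proof -
   have "norm (app (Z n) xi) <= norm xi / 2 + e * norm (app (Y n) xi)"
    unfolding appZ using e(1) by (intro order_trans[OF norm_triangle_ineq]) simp
   also have "e * norm (app (Y n) xi) <= e * (C * norm xi)" using e(1) Y(2) by (simp add: mult_left_mono)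
   also have "e * (C * norm xi) = norm xi / 4" using e(2) by (simp add: mult.assoc[symmetric])
   finally show ?thesis using norm_ge_zero[of xi] by linarith
  qed
  show "ip Om (app (Z n) Om) = of_real t" for n by (simp add: ZC cinner_add_right cinner_scaleC_right c norm_Omega t_def)
  show "0 < t" "t < 1" using cY by (auto simp: t_def abs_le_iff)
  show "EX m. ALL n>=m. Z n * pi A = pi A * Z n" if "A : D" for A
   using D(2)[OF that] by (auto simp: ZC distrib_right distrib_left)
 qed (rule D)
 have lim2: "(%n. ip (app (pi A) Om) (app (Y n) Om)) ----> of_real c * ip (app (pi A) Om) Om" for A
 proof -
  let ?g = "%n. ip (app (pi A) Om) (app (Y n) Om)"
  have "(%n. of_real (1 / 2) * ip (app (pi A) Om) Om + of_real e * ?g n) ----> of_real t * ip (app (pi A) Om) Om"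
   using lim[of "cstar A"] by (simp add: vector_state pi_cstar cinner_adj' ZC cinner_add_right cinner_scaleC_right)
  from tendsto_diff[OF this tendsto_const[of "of_real (1 / 2) * ip (app (pi A) Om) Om"]]
  have "(%n. of_real e * ?g n) ----> of_real e * (of_real c * ip (app (pi A) Om) Om)" by (simp add: t_def algebra_simps)
  from tendsto_mult[OF tendsto_const[of "of_real (1 / e)"] this] show ?thesis using e(1) by simp
 qed
 have cb: "cmod (ip ze (app (Y n) ze')) <= (norm ze * C) * norm ze'" "cmod (of_real c * ip ze ze') <= (norm ze * \<bar>c\<bar>) * norm ze'"
  for n ze ze'
 proof -
  have "cmod (ip ze (app (Y n) ze')) <= norm ze * norm (app (Y n) ze')" by (rule cinner_cauchy_schwarz)
  also have "... <= norm ze * (C * norm ze')" by (intro mult_left_mono Y) simp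
  finally show "cmod (ip ze (app (Y n) ze')) <= (norm ze * C) * norm ze'" by simp
  show "cmod (of_real c * ip ze ze') <= (norm ze * \<bar>c\<bar>) * norm ze'"
   using mult_left_mono[OF cinner_cauchy_schwarz[of ze ze'], of "\<bar>c\<bar>"] by (simp add: norm_mult mult_ac)
 qed
 have lim3: "(%n. ip xi (app (Y n) Om)) ----> of_real c * ip xi Om" for xi
 proof -
  have "closed {xi. (%n. ip xi (app (Y n) Om)) ----> of_real c * ip xi Om}"
  proof (rule closed_tendsto)
   show "dist (ip x (app (Y n) Om)) (ip y (app (Y n) Om)) <= C * dist x y" for n x y
    using cb(1)[of "x - y" n Om] norm_Omega by (simp add: dist_norm cinner_diff_left mult.commute)
   show "dist (of_real c * ip x Om) (of_real c * ip y Om) <= \<bar>c\<bar> * dist x y" for x y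
    using cb(2)[of "x - y" Om] norm_Omega by (simp add: dist_norm cinner_diff_left right_diff_distrib mult.commute)
  qed
  from cyclic_dense[OF this closure_UNIV] show ?thesis using lim2 by simp
 qed
 have "closed {eta. (%n. ip xi (app (Y n) eta)) ----> of_real c * ip xi eta}"
 proof (rule closed_tendsto)
  show "dist (ip xi (app (Y n) x)) (ip xi (app (Y n) y)) <= (norm xi * C) * dist x y" for n x y
   using cb(1)[of xi n "x - y"] by (simp add: dist_norm cinner_diff_right)
  show "dist (of_real c * ip xi x) (of_real c * ip xi y) <= (norm xi * \<bar>c\<bar>) * dist x y" for x y
   using cb(2)[of xi "x - y"] by (simp add: dist_norm cinner_diff_right right_diff_distrib)
 qed
 moreover have "(%n. ip xi (app (Y n) (app (pi B) Om))) ----> of_real c * ip xi (app (pi B) Om)" if "B : D" for B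
 proof -
  obtain m where m: "ALL n>=m. Y n * pi B = pi B * Y n" using D(2)[OF \<open>B : D\<close>] by blast
  have "ip (app (adj (pi B)) xi) (app (Y n) Om) = ip xi (app (Y n) (app (pi B) Om))" if "n >= m" for n
   using m that app_simps(6)[of "Y n" "pi B" Om] app_simps(6)[of "pi B" "Y n" Om] by (simp add: cinner_adj)
  then have "\<forall>\<^sub>F n in sequentially. ip (app (adj (pi B)) xi) (app (Y n) Om) = ip xi (app (Y n) (app (pi B) Om))"
   unfolding eventually_sequentially by blast
  from Lim_transform_eventually[OF lim3 this] show ?thesis by (simp add: cinner_adj)
 qed
 ultimately show ?thesis using cyclic_dense[OF _ D(1)] by blast
qed

text \<open>A constant sequence in the commutant is asymptotically central, so it equals its own
  scalar weak limit; the general case follows from the real and imaginary parts.\<close>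

lemma irreducible:
 assumes comm: "!!x. T * pi x = pi x * T"
 obtains z where "T = z *c 1"
proof -
 have sa: "EX z. T = z *c 1" if T: "adj T = T" and comm: "!!x. T * pi x = pi x * T" for T
 proof -
  obtain K where K: "K >= 0" "!!xi. norm (app T xi) <= K * norm xi" using norm_app_bound by blast
  have cnj: "cnj (ip Om (app T Om)) = ip Om (app T Om)" using cinner_adj[of T Om Om] T by (metis cinner_commute)
  define c where "c = Re (ip Om (app T Om))"
  have c: "ip Om (app T Om) = of_real c" using cnj by (simp add: c_def complex_eq_iff)
  have "(%n. ip xi (app T eta)) ----> of_real c * ip xi eta" for xi eta
  proof (rule weak_limit_of_asymptotically_central[of "%n. T" "K + 1" c UNIV])
   show "norm (app T xi) <= (K + 1) * norm xi" for xi using K(2)[of xi] by (simp add: distrib_right add_increasing2)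
  qed (use T K c comm in auto)
  then have "ip xi (app T eta) = of_real c * ip xi eta" for xi eta using LIMSEQ_unique tendsto_const by blast
  then have "T = of_real c *c 1" by (intro bop_eqI cinner_eqI) (simp add: cinner_scaleC_right)
  then show ?thesis by blast
 qed
 have comm': "adj T * pi x = pi x * adj T" for x using arg_cong[OF comm[of "cstar x"], of adj] by (simp add: pi_cstar)
 obtain z where z: "T + adj T = z *c 1"
  using sa[of "T + adj T"] comm comm' by (auto simp: distrib_left distrib_right add.commute)
 obtain w where w: "\<i> *c (T - adj T) = w *c 1" using sa[of "\<i> *c (T - adj T)"] comm comm'
  by (auto simp: left_diff_distrib right_diff_distrib cvs.scale_right_diff_distrib)
 have "(- \<i>) *c \<i> *c (T - adj T) = (- \<i>) *c w *c 1" by (simp only: w)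
 then have "T - adj T = (- \<i> * w) *c 1" by (simp add: scaleC_scaleC)
 then have "2 *r T = (z - \<i> * w) *c 1"
  using z by (simp add: scaleR_2 cvs.scale_left_diff_distrib) (metis (no_types, lifting) add.commute add_diff_cancel_left' diff_add_cancel add.assoc uminus_add_conv_diff diff_conv_add_uminus)
 then have "(1 / 2) *r 2 *r T = (1 / 2) *r (z - \<i> * w) *c 1" by simp
 then have "T = (of_real (1 / 2) * (z - \<i> * w)) *c 1"
  by (simp only: scaleC_of_real[symmetric] scaleC_scaleC) (simp add: scaleC_of_real[symmetric] scaleC_scaleC)
 then show thesis using that by blast
qed

end

lemma commute_mult: "(r :: 'z::semigroup_mult) * a = a * r ==> r * b = b * r ==> r * (a * b) = (a * b) * r"
 by (metis mult.assoc)

context cyclic_rep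
begin

text \<open>By invariance the assignment of \<open>pi (be x)\<close> to \<open>pi x\<close>, both
  applied to Om, is isometric; it extends to the closure of the cyclic orbit and is onto because
  \<open>be\<close> is.\<close>

lemma implement:
 assumes be: "star_automorphism s be" and inv: "!!x. om (be x) = conj_bit s (om x)"
 obtains Y where "unitary_op s Y" "!!x. Y (app (pi x) Om) = app (pi (be x)) Om"
proof -
 have h: "be (x + y) = be x + be y" "be (x * y) = be x * be y" "be (z *c x) = conj_bit s z *c be x"
  "be (cstar x) = cstar (be x)" "bij be" for x y z using be by (auto simp: star_automorphism_def)
 have hd: "be (x - y) = be x - be y" for x y using h(1)[of "x - y" y] by (simp add: eq_diff_eq)
 have inner: "ip (app (pi (be x)) Om) (app (pi (be y)) Om) = conj_bit s (ip (app (pi x) Om) (app (pi y) Om))" for x y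
 by (metis app_simps(6) assms(2) cinner_adj h(2,4) pi_cstar pi_mult vector_state)
 have norm: "norm (app (pi (be x)) Om) = norm (app (pi x) Om)" for x
 proof -
  have "complex_of_real ((norm (app (pi (be x)) Om))\<^sup>2) = of_real ((norm (app (pi x) Om))\<^sup>2)"
   using inner[of x x] by (simp only: cinner_self conj_bit_simps)
  then have "(norm (app (pi (be x)) Om))\<^sup>2 = (norm (app (pi x) Om))\<^sup>2" by (simp only: of_real_eq_iff)
  then show ?thesis by (simp add: power2_eq_iff_nonneg)
 qed
 define G where "G = range (%x. (app (pi x) Om, app (pi (be x)) Om))"
 have "dist (snd p) (snd q) = dist (fst p) (fst q)" if "p : G" "q : G" for p q
  using that norm by (auto simp: G_def dist_norm hd[symmetric] simp flip: pi_diff app_simps)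
 moreover have "closure (fst ` G) = UNIV" using cyclic by (simp add: G_def image_image)
 ultimately obtain Y where Y: "!!x y. (x, y) : closure G \<longleftrightarrow> Y x = y"
   "!!x y. dist (Y x) (Y y) = dist x y" "closure (snd ` G) <= range Y"
  by (rule isometric_extension) (assumption | rule that)+
 have cl: "(x, Y x) : closure G" for x by (simp add: Y(1))
 have Gs: "(z *c a, conj_bit s z *c b) : G" if ab: "(a, b) : G" for z a b
 proof -
  obtain x where "a = app (pi x) Om" "b = app (pi (be x)) Om" using ab by (auto simp: G_def)
  then show ?thesis unfolding G_def by (intro image_eqI[of _ _ "z *c x"]) (simp_all add: pi_scaleC h)
 qed
 have Ga: "(a + a', b + b') : G" if ab: "(a, b) : G" "(a', b') : G" for a a' b b'
 proof -
  obtain x y where "a = app (pi x) Om" "b = app (pi (be x)) Om" "a' = app (pi y) Om" "b' = app (pi (be y)) Om"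
   using ab by (auto simp: G_def)
  then show ?thesis unfolding G_def by (intro image_eqI[of _ _ "x + y"]) (simp_all add: pi_add h)
 qed
 have Y_scale: "Y (z *c x) = conj_bit s z *c Y x" for z x
  using closure_op1[of "%p. (z *c fst p, conj_bit s z *c snd p)", OF _ _ cl[of x]]
  by (auto simp: Y(1)[symmetric] continuous_intros Gs)
 have "bounded_linear Y"
 proof
  show "Y (x + y) = Y x + Y y" for x y using closure_op2[of "(+)", OF _ _ cl[of x] cl[of y]]
   by (auto simp: Y(1)[symmetric] continuous_intros Ga)
  show "Y (r *r x) = r *r Y x" for r x using Y_scale[of "of_real r"] by (simp add: scaleC_of_real)
  have "Y 0 = 0" using Y_scale[of 0 0] by simp
  then show "EX K. ALL x. norm (Y x) <= norm x * K" using Y(2)[of _ 0] by (intro exI[of _ 1]) simp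
 qed
 moreover have "surj Y"
 proof -
  have "snd ` G = (%x. app (pi x) Om) ` range be" by (simp add: G_def image_image)
  then have "snd ` G = range (%x. app (pi x) Om)" using h(5) by (simp add: bij_def)
  then show ?thesis using Y(3) cyclic by auto
 qed
 moreover have "ip (Y x) (Y y) = conj_bit s (ip x y)" for x y
 proof -
  have "closure (G \<times> G) <= {r. ip (snd (fst r)) (snd (snd r)) = conj_bit s (ip (fst (fst r)) (fst (snd r)))}"
   by (cases s; intro closure_minimal closed_Collect_eq) (auto intro!: continuous_intros simp: G_def inner)
  then show ?thesis using cl[of x] cl[of y] by (auto simp: closure_Times)
 qed
 ultimately have "unitary_op s Y" using Y_scale by (simp add: unitary_op_def bounded_op_def)
 moreover have "Y (app (pi x) Om) = app (pi (be x)) Om" for x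
  using closure_subset[of G] by (auto simp: Y(1)[symmetric] G_def)
 ultimately show thesis using that by blast
qed

lemma implementer:
 assumes be: "star_automorphism s be" and Y: "unitary_op s Y" "!!x. Y (app (pi x) Om) = app (pi (be x)) Om"
 shows "Y Om = Om" "adjoint Y Om = Om" "conj_by Y (pi x) = pi (be x)" "conj_by (adjoint Y) (pi (be x)) = pi x"
proof -
 have "be (x * y) = be x * be y" "surj be" for x y using be by (auto simp: star_automorphism_def bij_def)
 note h = this
 have "be 1 = 1" using h by (metis mult_1_left mult_1_right surjD)
 then show *: "Y Om = Om" using Y(2)[of 1] by (simp add: pi_one)
 then show "adjoint Y Om = Om" using unitary_op_adjoint(1)[OF Y(1), of Om] by simp
 show c: "conj_by Y (pi x) = pi (be x)"
 proof (rule bop_cyclic_eqI)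
  fix y
  obtain z where z: "y = be z" using h(2) by (metis surjD)
  have "adjoint Y (app (pi (be z)) Om) = app (pi z) Om"
   using unitary_op_adjoint(1)[OF Y(1), of "app (pi z) Om"] by (simp add: Y(2))
  then show "app (conj_by Y (pi x)) (app (pi y) Om) = app (pi (be x)) (app (pi y) Om)"
   using Y(2)[of "x * z"] by (simp add: z app_conj_by[OF Y(1)] pi_mult h(1))
 qed
 show "conj_by (adjoint Y) (pi (be x)) = pi x" unfolding c[symmetric] by (rule conj_by_simps(9)[OF Y(1)])
qed

end

section \<open>Commutants, the translation-invariant chain and its half-chain algebra\<close>

definition comm :: "'h::complex_hilbert bop set => 'h bop set" where
 "comm S = {T. ALL A:S. A * T = T * A}"

lemma comm_ops:
 "1 : comm S" "0 : comm S" "A : comm S ==> B : comm S ==> A * B : comm S"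
 "A : comm S ==> B : comm S ==> A + B : comm S" "A : comm S ==> B : comm S ==> A - B : comm S"
 "A : comm S ==> z *c A : comm S" "A : comm S ==> - A : comm S"
 by (auto simp: comm_def distrib_left distrib_right left_diff_distrib right_diff_distrib)
  (metis mult.assoc)+

lemma comm_adj: "(!!A. A : S ==> adj A : S) ==> T : comm S ==> adj T : comm S"
by (smt (verit, ccfv_threshold) adj_adj adj_simps(6) comm_def mem_Collect_eq)

lemma comm_antimono: "S <= T ==> comm T <= comm S" by (auto simp: comm_def)

lemma comm_comm: "S <= comm (comm S)" by (auto simp: comm_def)

locale chain_rep = car_system d a + cyclic_rep om pi Om
 for d :: nat and a :: "(int => complex vec) => 'a::cstar_algebra" and om and pi :: "'a => 'h::complex_hilbert bop" and Om +
 fixes Gm :: "'h bop"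
 assumes trans: "translation_invariant d a om"
  and Gamma: "app Gm (app (pi x) Om) = app (pi (car_parity d a x)) Om"
begin

lemma all_generated: "x : closure (star_alg_gen (gens UNIV))"
 using car unfolding car_algebra_def car_sub_gen[symmetric] by blast

lemma aut_ext:
 assumes "star_automorphism s f" "star_automorphism s g" "!!x i. i < d ==> f (gen x i) = g (gen x i)"
 shows "f x = g x" by (rule star_automorphism_ext[OF assms(1,2) _ all_generated]) (use assms(3) in auto)

lemma aut_comp:
 assumes "star_automorphism s (f :: 'a => 'a)" "star_automorphism 0 g"
 shows "star_automorphism s (%x. f (g x))" "star_automorphism s (%x. g (f x))"
 using assms bij_comp[of g f] bij_comp[of f g] by (simp_all add: star_automorphism_def o_def)

lemma aut_minus: "star_automorphism 0 (f :: 'a => 'a) ==> f (- x) = - f x"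
proof -
 assume "star_automorphism 0 f"
 then have "f ((-1) *c x) = conj_bit 0 (-1) *c f x" unfolding star_automorphism_def by blast
 then show ?thesis by simp
qed

lemma parity_parity: "parity (parity x) = x"
proof -
 have id: "star_automorphism 0 (%x :: 'a. x)" using bij_id by (simp add: star_automorphism_def id_def)
 show ?thesis by (rule aut_ext[OF aut_comp(1)[OF parity_aut parity_aut] id]) (simp add: parity_gen aut_minus[OF parity_aut])
qed

lemma parity_shift: "parity (shift y x) = shift y (parity x)"
 by (rule aut_ext[OF aut_comp(1)[OF parity_aut shift_aut] aut_comp(1)[OF shift_aut parity_aut]])
  (simp add: parity_gen shift_gen aut_minus[OF shift_aut])

lemma Gamma_sq: "Gm * Gm = 1" by (rule bop_cyclic_eqI) (simp add: Gamma parity_parity)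

lemma Gamma_pi: "Gm * pi x = pi (parity x) * Gm"
proof (rule bop_cyclic_eqI)
 fix y
 have "parity (x * y) = parity x * parity y" using parity_aut by (simp add: star_automorphism_def)
 then show "app (Gm * pi x) (app (pi y) Om) = app (pi (parity x) * Gm) (app (pi y) Om)"
  using Gamma[of "x * y"] by (simp add: pi_mult Gamma)
qed

lemma Gamma_Omega: "app Gm Om = Om" by (metis (no_types, lifting) Gamma Gamma_pi Gamma_sq app_simps(2,6) pi_one)

text \<open>\<open>Gm\<^sup>* Gm\<close> commutes with the irreducible \<open>\<pi>(\<A>)\<close>; hence \<open>Gm\<close> is unitary and \<open>\<omega>\<close> is even.\<close>

lemma adj_Gamma: "adj Gm = Gm"
proof -
 have star: "parity (cstar x) = cstar (parity x)" for x using parity_aut by (simp add: star_automorphism_def)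
 have 1: "pi x * adj Gm = adj Gm * pi (parity x)" for x
  using arg_cong[OF Gamma_pi[of "cstar x"], of adj] by (simp add: star pi_cstar)
 have "(adj Gm * Gm) * pi x = pi x * (adj Gm * Gm)" for x by (metis (no_types, lifting) "1" Gamma_pi Groups.mult_ac(1))
 then obtain z where z: "adj Gm * Gm = z *c 1" using irreducible by blast
 have "z = ip Om (app (adj Gm * Gm) Om)" unfolding z by (simp add: cinner_scaleC_right norm_Omega)
 also have "... = 1" by (simp add: cinner_adj[symmetric] Gamma_Omega norm_Omega)
 finally have "adj Gm * Gm = 1" using z by simp
 then have "adj Gm * Gm * Gm = Gm" by simp
 then show ?thesis by (simp add: mult.assoc Gamma_sq)
qed

lemma Gamma_unitary: "unitary_op 0 (app Gm)" "adjoint (app Gm) = app Gm" "conj_by (app Gm) T = Gm * T * Gm"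
proof -
 have sq: "app Gm (app Gm xi) = xi" for xi using arg_cong[OF Gamma_sq, of "%T. app T xi"] by simp
 have "ip (app Gm xi) (app Gm eta) = ip xi eta" for xi eta by (simp add: cinner_adj adj_Gamma sq)
 then show 1: "unitary_op 0 (app Gm)"
  using bounded_op_app[of Gm] surjI[of "app Gm" "app Gm", OF sq] by (simp add: unitary_op_def)
 show 2: "adjoint (app Gm) = app Gm" using adj.rep_eq[of Gm] adj_Gamma by simp
 show "conj_by (app Gm) T = Gm * T * Gm" by (rule bop_eqI) (simp add: app_conj_by[OF 1] 2)
qed

definition cg :: "int => nat => 'h bop" where "cg x i = pi (gen x i)"

definition Gens :: "int set => 'h bop set" where
 "Gens X = {T. EX x i. x : X & i < d & (T = cg x i \<or> T = adj (cg x i))}"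

lemma cg_Gens: "x : X ==> i < d ==> cg x i : Gens X" "x : X ==> i < d ==> adj (cg x i) : Gens X" unfolding Gens_def by blast+

lemma Gens_adj: "A : Gens X ==> adj A : Gens X" unfolding Gens_def by force

lemma Gens_mono: "X <= Y ==> Gens X <= Gens Y" by (auto simp: Gens_def)

lemma Gens_anti: "A : Gens X ==> B : Gens Y ==> X \<inter> Y = {} ==> A * B = - (B * A)"
proof -
 assume A: "A : Gens X" and B: "B : Gens Y" and XY: "X \<inter> Y = {}"
 obtain x i where xi: "x : X" "i < d" "A = cg x i \<or> A = adj (cg x i)" using A by (auto simp: Gens_def)
 obtain y j where yj: "y : Y" "j < d" "B = cg y j \<or> B = adj (cg y j)" using B by (auto simp: Gens_def)
 have ne: "x ~= y" using xi yj XY by auto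
 have 1: "cg x i * cg y j = - (cg y j * cg x i)" if "i < d" "j < d" for x i y j
  using gen_anti[OF that, of x y] by (simp add: cg_def pi_mult[symmetric] pi_minus[symmetric])
 have 2: "cg x i * adj (cg y j) = - (adj (cg y j) * cg x i)" if "i < d" "j < d" "x ~= y" for x i y j
  using gen_anti_star[OF that(1,2), of x y] that(3)
  by (simp add: cg_def pi_mult[symmetric] pi_minus[symmetric] pi_cstar[symmetric])
 have 3: "adj (cg x i) * adj (cg y j) = - (adj (cg y j) * adj (cg x i))"
  using arg_cong[OF 1[OF yj(2) xi(2), of y x], of adj] by simp
 show ?thesis using xi(3) yj(3) 1[OF xi(2) yj(2), of x y] 2[OF xi(2) yj(2) ne] 2[OF yj(2) xi(2) ne[symmetric]] 3 by auto
qed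

lemma Gens_Gamma: "A : Gens X ==> Gm * A = - (A * Gm)"
proof -
 have 1: "Gm * cg x i = - (cg x i * Gm)" if "i < d" for x i
  using Gamma_pi[of "gen x i"] that by (simp add: cg_def parity_gen pi_minus)
 have 2: "Gm * adj (cg x i) = - (adj (cg x i) * Gm)" if "i < d" for x i
  using arg_cong[OF 1[OF that, of x], of adj] by (simp add: adj_Gamma)
 assume "A : Gens X" then show ?thesis using 1 2 by (auto simp: Gens_def)
qed

definition U :: "'h => 'h" where
 "U = (SOME Y. unitary_op 0 Y & (ALL x. Y (app (pi x) Om) = app (pi (shift 1 x)) Om))"

lemma U: "unitary_op 0 U" "U (app (pi x) Om) = app (pi (shift 1 x)) Om"
proof -
 have "om (shift 1 x) = conj_bit 0 (om x)" for x using trans by (simp add: translation_invariant_def)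
 then obtain Y where "unitary_op 0 Y" "!!x. Y (app (pi x) Om) = app (pi (shift 1 x)) Om"
  using implement[OF shift_aut[of 1]] by metis
 then have "EX Y. unitary_op 0 Y & (ALL x. Y (app (pi x) Om) = app (pi (shift 1 x)) Om)" by blast
 from someI_ex[OF this] show "unitary_op 0 U" "U (app (pi x) Om) = app (pi (shift 1 x)) Om" unfolding U_def by auto
qed

text \<open>An automorphism of all bounded operators whose restriction to \<open>M\<close> is an
  endomorphism.\<close>

definition rho :: "'h bop => 'h bop" where "rho = conj_by U"
definition rhoi :: "'h bop => 'h bop" where "rhoi = conj_by (adjoint U)"

lemma rho_simps [simp]: "rho (S * T) = rho S * rho T" "rho (S + T) = rho S + rho T" "rho (S - T) = rho S - rho T"
 "rho 1 = 1" "rho 0 = 0" "rho (- T) = - rho T" "rho (z *c T) = z *c rho T" "adj (rho T) = rho (adj T)"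
 "rhoi (rho T) = T" "rho (rhoi T) = T" using conj_by_simps[OF U(1)] by (simp_all add: rho_def rhoi_def)

lemma rhoi_simps [simp]: "rhoi (S * T) = rhoi S * rhoi T" "adj (rhoi T) = rhoi (adj T)"
 using conj_by_simps[OF unitary_op_inverse(1)[OF U(1)]] by (simp_all add: rhoi_def)

lemma rho_pi: "rho (pi x) = pi (shift 1 x)" unfolding rho_def by (rule implementer(3)[OF shift_aut U])

lemma rho_cg: "rho (cg x i) = cg (x + 1) i" by (simp add: cg_def rho_pi shift_gen)

lemma rho_Gens: "A : Gens X ==> rho A : Gens ((%x. x + 1) ` X)" by (auto simp: Gens_def rho_cg simp flip: rho_simps(8))
  (metis (no_types, lifting) rho_cg rho_simps(8) )+

lemma Gens_rho: "A : Gens X ==> rhoi A : Gens ((%x. x - 1) ` X)"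
proof -
 have 1: "rhoi (cg x i) = cg (x - 1) i" for x i using rho_cg[of "x - 1" i] rho_simps(9)[of "cg (x - 1) i"] by simp
 have 2: "rhoi (adj (cg x i)) = adj (cg (x - 1) i)" for x i using 1[of x i] rhoi_simps(2)[of "cg x i"] by simp
 assume "A : Gens X"
 then obtain x i where "x : X" "i < d" "A = cg x i \<or> A = adj (cg x i)" by (auto simp: Gens_def)
 then show ?thesis unfolding Gens_def using 1 2 by blast
qed

lemma rho_Gamma: "rho Gm = Gm"
proof (rule bop_cyclic_eqI)
 fix x
 have "surj (shift 1)" using shift_aut[of 1] by (simp add: star_automorphism_def bij_def)
 then obtain y where y: "x = shift 1 y" by (metis surjD)
 have "adjoint U (app (pi (shift 1 y)) Om) = app (pi y) Om"
  using unitary_op_adjoint(1)[OF U(1), of "app (pi y) Om"] by (simp add: U(2))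
 then show "app (rho Gm) (app (pi x) Om) = app Gm (app (pi x) Om)"
  by (simp add: y rho_def app_conj_by[OF U(1)] Gamma U(2) parity_shift)
qed

lemma rho_vector: "ip Om (app (rho T) Om) = ip Om (app T Om)"
proof -
 have UOm: "U Om = Om" "adjoint U Om = Om" by (rule implementer[OF shift_aut U])+
 have "ip (U Om) (U (app T Om)) = ip Om (app T Om)" using unitary_op_linear(6)[OF U(1)] by simp
 then show ?thesis by (simp add: rho_def app_conj_by[OF U(1)] UOm)
qed

text \<open>Built from generators instead of all of pi(A_R), so that commutation is checked on
  generators only; \<open>M_eq\<close> identifies it with the bicommutant of the index.\<close>

definition M :: "'h bop set" where "M = comm (comm (Gens {0..}))"

lemma M_ops: "1 : M" "0 : M" "A : M ==> B : M ==> A * B : M"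
 "A : M ==> B : M ==> A + B : M" "A : M ==> B : M ==> A - B : M"
 "A : M ==> z *c A : M" "A : M ==> - A : M" "A : M ==> adj A : M" unfolding M_def by (auto intro: comm_ops comm_adj Gens_adj)

lemma M_sum: "(!!i. i : I ==> f i : M) ==> sum f I : M" by (induction I rule: infinite_finite_induct) (auto intro: M_ops)

lemma Gens_M: "A : Gens {0..} ==> A : M" unfolding M_def using comm_comm by blast

lemma M_commD: "A : M ==> T : comm (Gens {0..}) ==> A * T = T * A" unfolding M_def comm_def by fastforce

lemma M_I: "(!!T. T : comm (Gens {0..}) ==> A * T = T * A) ==> A : M" unfolding M_def by (subst comm_def) auto

text \<open>Together with \<open>rho_M'\<close> this identifies the image of \<open>M\<close> under
  \<open>rho\<close> with the bicommutant of the generators at sites 1 and beyond.\<close>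

lemma rho_M: "A : M ==> rho A : comm (comm (Gens {1..}))"
proof -
 assume A: "A : M"
 have "T * rho A = rho A * T" if T: "T : comm (Gens {1..})" for T
 proof -
  have "rhoi T : comm (Gens {0..})"
  proof -
   have "B * rhoi T = rhoi T * B" if B: "B : Gens {0..}" for B
   proof -
    have "(%x. x + 1) ` {0..} <= {1 :: int..}" by auto
    then have "rho B : Gens {1..}" using rho_Gens[OF B] Gens_mono by blast
    then have "rho B * T = T * rho B" using T by (simp add: comm_def)
    from arg_cong[OF this, of rhoi] show ?thesis by simp
   qed
   then show ?thesis by (simp add: comm_def)
  qed
  from arg_cong[OF M_commD[OF A this], of rho] show ?thesis by simp
 qed
 then show ?thesis by (subst comm_def) auto
qed

lemma rho_M': "A : comm (comm (Gens {1..})) ==> rhoi A : M"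
proof -
 assume A: "A : comm (comm (Gens {1..}))"
 show ?thesis
 proof (rule M_I)
  fix T assume T: "T : comm (Gens {0..})"
  have "B * rho T = rho T * B" if B: "B : Gens {1..}" for B
  proof -
   have "(%x. x - 1) ` {1..} <= {0 :: int..}" by auto
   then have "rhoi B : Gens {0..}" using Gens_rho[OF B] Gens_mono by blast
   then have "rhoi B * T = T * rhoi B" using T by (simp add: comm_def)
   from arg_cong[OF this, of rho] show ?thesis by simp
  qed
  then have "rho T : comm (Gens {1..})" by (simp add: comm_def)
  then have "rho T * A = A * rho T" using A unfolding comm_def by blast
  from arg_cong[OF this, of rhoi] show "rhoi A * T = T * rhoi A" by simp
 qed
qed

lemma rho_in_M: "A : M ==> rho A : M"
proof -
 assume "A : M"
 have "Gens {1..} <= Gens {0..}" by (rule Gens_mono) auto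
 then have "comm (comm (Gens {1..})) <= M" unfolding M_def by (intro comm_antimono)
 then show ?thesis using rho_M[OF \<open>A : M\<close>] by blast
qed

lemma Gamma_M: "A : M ==> Gm * A * Gm : M"
proof (rule M_I)
 fix T assume A: "A : M" and T: "T : comm (Gens {0..})"
 have "Gm * T * Gm : comm (Gens {0..})"
 proof -
  have "B * (Gm * T * Gm) = (Gm * T * Gm) * B" if B: "B : Gens {0..}" for B
  proof -
   have "B * T = T * B" using T B by (simp add: comm_def)
   have "B * (Gm * T * Gm) = (B * Gm) * T * Gm" by (simp add: mult.assoc)
   also have "B * Gm = - (Gm * B)" using Gens_Gamma[OF B] by simp
   also have "- (Gm * B) * T * Gm = - (Gm * T * (B * Gm))" by (simp add: mult.assoc \<open>B * T = T * B\<close>[symmetric]) (simp add: mult.assoc[symmetric] \<open>B * T = T * B\<close>)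
   also have "B * Gm = - (Gm * B)" using Gens_Gamma[OF B] by simp
   finally show ?thesis by (simp add: mult.assoc)
  qed
  then show ?thesis by (simp add: comm_def)
 qed
 from M_commD[OF A this] have "Gm * (A * (Gm * T * Gm)) * Gm = Gm * ((Gm * T * Gm) * A) * Gm" by simp
 moreover have "Gm * (A * (Gm * T * Gm)) * Gm = Gm * A * Gm * T * (Gm * Gm)" by (simp only: mult.assoc)
 moreover have "Gm * ((Gm * T * Gm) * A) * Gm = (Gm * Gm) * T * (Gm * A * Gm)" by (simp only: mult.assoc)
 ultimately show "Gm * A * Gm * T = T * (Gm * A * Gm)" by (simp add: Gamma_sq)
qed

section \<open>Clustering\<close>

text \<open>A generator of the left half chain anticommutes with those of the right one, and so does
  \<open>Gm\<close>; the two signs cancel in the product.\<close>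

lemma twisted_left:
 assumes g: "g : Gens {..<0}" and T: "T : M"
 shows "T * (g * Gm) = (g * Gm) * T"
proof (rule M_commD[OF T])
 have "B * (g * Gm) = (g * Gm) * B" if B: "B : Gens {0..}" for B
 proof -
  have "B * (g * Gm) = (B * g) * Gm" by (simp add: mult.assoc)
  also have "B * g = - (g * B)" by (rule Gens_anti[OF B g]) auto
  also have "- (g * B) * Gm = g * - (B * Gm)" by (simp add: mult.assoc)
  also have "- (B * Gm) = Gm * B" using Gens_Gamma[OF B] by simp
  finally show ?thesis by (simp add: mult.assoc)
 qed
 then show "g * Gm : comm (Gens {0..})" by (simp add: comm_def)
qed

lemma even_commutes_left:
 assumes g: "g : Gens {..<0}" and T: "T : M" "Gm * T = T * Gm"
 shows "T * g = g * T" by (metis (no_types, lifting) ext Gamma_sq Groups.mult_ac(1) T(2) assms(1,2) chain_rep.twisted_left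
  chain_rep_axioms more_arith_simps(6))

text \<open>For odd \<open>T\<close> the twist is moved from the generator to \<open>T\<close>: this
  is the form in which odd elements become asymptotically central.\<close>

lemma odd_commutes_left:
 assumes g: "g : Gens {..<0}" and T: "T : M" "Gm * T = - (T * Gm)"
 shows "(T * Gm) * g = g * (T * Gm)"
by (smt (verit, best) Gamma_sq Gens_Gamma Groups.mult_ac(1) T(2) assms(1,2) chain_rep.twisted_left
  chain_rep_axioms mult.right_neutral mult_1 mult_minus_left mult_minus_right)

lemma rho_pow_hom: "(rho ^^ n) (S * T) = (rho ^^ n) S * (rho ^^ n) T" "(rho ^^ n) (z *c T) = z *c (rho ^^ n) T"
 "(rho ^^ n) (S + T) = (rho ^^ n) S + (rho ^^ n) T"
 "adj ((rho ^^ n) T) = (rho ^^ n) (adj T)" "(rho ^^ n) Gm = Gm" "(rho ^^ n) (cg x i) = cg (x + int n) i"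
 "ip Om (app ((rho ^^ n) T) Om) = ip Om (app T Om)" by (induction n) (simp_all add: rho_Gamma rho_cg rho_vector add_ac)

lemma rho_pow_bound: "(!!xi. norm (app T xi) <= K * norm xi) ==> norm (app ((rho ^^ n) T) xi) <= K * norm xi"
proof (induction n arbitrary: xi)
 case (Suc n)
 have "norm (app ((rho ^^ Suc n) T) xi) = norm (app ((rho ^^ n) T) (adjoint U xi))"
  by (simp add: rho_def app_conj_by[OF U(1)] unitary_op_linear(7)[OF U(1)])
 also have "... <= K * norm (adjoint U xi)" using Suc by blast
 finally show ?case by (simp add: unitary_op_linear(7)[OF unitary_op_inverse(1)[OF U(1)]])
qed simp

lemma rho_pow_Gens: "g : Gens {x} ==> EX g':Gens {x - int n}. g = (rho ^^ n) g'"
proof -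
 assume "g : Gens {x}"
 then obtain i where i: "i < d" "g = cg x i \<or> g = adj (cg x i)" by (auto simp: Gens_def)
 have "(rho ^^ n) (cg (x - int n) i) = cg x i" by (simp add: rho_pow_hom)
 moreover have "(rho ^^ n) (adj (cg (x - int n) i)) = adj (cg x i)" by (simp add: rho_pow_hom flip: rho_pow_hom(4))
 moreover have "cg (x - int n) i : Gens {x - int n}" "adj (cg (x - int n) i) : Gens {x - int n}"
  using i(1) by (auto simp: Gens_def)
 ultimately show ?thesis using i(2) by metis
qed

text \<open>Shifting \<open>T\<close> by \<open>n\<close> is the same as shifting \<open>A\<close>
  back by \<open>n\<close>, and only finitely many sites occur in \<open>A\<close>.\<close>

lemma asymptotically_central:
 assumes T: "!!g. g : Gens {..<0} ==> T * g = g * T" and A: "A : star_alg_gen (gens UNIV)"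
 shows "EX m. ALL n>=m. (rho ^^ n) T * pi A = pi A * (rho ^^ n) T"
proof -
 have gens: "\<forall>\<^sub>F n in sequentially. (rho ^^ n) T * g = g * (rho ^^ n) T" if g: "g : Gens {x}" for g x
 proof (rule eventually_sequentiallyI)
  \<comment> \<open>From this \<open>n\<close> on the site \<open>x - int n\<close> is
    negative.\<close>
  fix n assume n: "nat (x + 1) <= n"
  obtain g' where g': "g' : Gens {x - int n}" "g = (rho ^^ n) g'" using rho_pow_Gens[OF g] by blast
  have "{x - int n} <= {..<0}" using n by auto
  then have "g' : Gens {..<0}" using g'(1) Gens_mono by blast
  from arg_cong[OF T[OF this], of "rho ^^ n"] show "(rho ^^ n) T * g = g * (rho ^^ n) T" by (simp add: rho_pow_hom g'(2))
 qed
 have "\<forall>\<^sub>F n in sequentially. (rho ^^ n) T * pi A = pi A * (rho ^^ n) T" using A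
 proof (induction rule: star_alg_gen_sym_induct)
  case (base A)
  then obtain x i where xi: "A = gen x i" "i < d" by auto
  show ?case using gens[OF cg_Gens(1)[OF _ xi(2), of x]] gens[OF cg_Gens(2)[OF _ xi(2), of x]]
   by (simp add: xi(1) cg_def pi_cstar)
 next
  case (add A B)
  then show ?case by eventually_elim (simp add: pi_add distrib_left distrib_right)
 next
  case (scaleC A z)
  then show ?case by eventually_elim (simp add: pi_scaleC)
 next
  case (mult A B)
  then show ?case by eventually_elim (simp only: pi_mult commute_mult)
 qed (simp add: pi_one)
 then show ?thesis unfolding eventually_sequentially .
qed

text \<open>Clustering is available for self-adjoint sequences; since the sign \<open>z\<close> is
  real, the real and imaginary parts keep the parity of \<open>T\<close>.\<close>

lemma cartesian_decomposition:
 assumes T: "T : M" "Gm * T = z *c (T * Gm)" and z: "cnj z = z" "z * z = 1"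
 shows "EX S1 S2. T = S1 + \<i> *c S2 & (ALL S:{S1, S2}. S : M & Gm * S = z *c (S * Gm) & adj S = S)"
proof -
 define S1 where "S1 = (1 / 2) *c (T + adj T)"
 define S2 where "S2 = (\<i> / 2) *c (adj T - T)"
 have "(1 / 2) *c T + (1 / 2) *c T = T" by (simp add: scaleC_add_left[symmetric])
 then have "S1 + \<i> *c S2 = T" by (simp add: S1_def S2_def scaleC_scaleC scaleC_add_right cvs.scale_right_diff_distrib)
 moreover have "adj T * Gm = z *c (Gm * adj T)" using arg_cong[OF T(2), of adj] by (simp add: adj_Gamma z)
 then have "Gm * adj T = z *c (adj T * Gm)" by (simp add: scaleC_scaleC z)
 then have "ALL S:{S1, S2}. S : M & Gm * S = z *c (S * Gm) & adj S = S"
  using T by (auto simp: S1_def S2_def scaleC_scaleC scaleC_add_right cvs.scale_right_diff_distrib distrib_left distrib_right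
   left_diff_distrib right_diff_distrib mult.commute intro!: M_ops)
 ultimately show ?thesis by (intro exI[of _ S1] exI[of _ S2]) simp
qed

lemma weak_limit_even:
 assumes T: "T : M" "Gm * T = T * Gm"
 shows "(%n. ip xi (app ((rho ^^ n) T) eta)) ----> ip Om (app T Om) * ip xi eta"
proof -
 have dense: "closure (star_alg_gen (gens UNIV)) = UNIV" using all_generated by blast
 have sa: "(%n. ip xi (app ((rho ^^ n) S) eta)) ----> ip Om (app S Om) * ip xi eta"
  if S: "S : M" "Gm * S = S * Gm" "adj S = S" for S
 proof -
  obtain K where K: "K >= 0" "!!xi. norm (app S xi) <= K * norm xi" using norm_app_bound by blast
  have K1: "norm (app S xi) <= (K + 1) * norm xi" for xi using K(2)[of xi] by (simp add: distrib_right add_increasing2)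
  have "cnj (ip Om (app S Om)) = ip Om (app S Om)" using cinner_adj[of S Om Om] S(3) by (metis cinner_commute)
  then have c: "ip Om (app S Om) = of_real (Re (ip Om (app S Om)))" by (simp add: complex_eq_iff)
  have "(%n. ip xi (app ((rho ^^ n) S) eta)) ----> of_real (Re (ip Om (app S Om))) * ip xi eta"
  proof (rule weak_limit_of_asymptotically_central[OF _ _ _ _ dense])
   show "adj ((rho ^^ n) S) = (rho ^^ n) S" for n by (simp add: rho_pow_hom S(3))
   show "norm (app ((rho ^^ n) S) xi) <= (K + 1) * norm xi" for n xi by (rule rho_pow_bound[OF K1])
   show "0 < K + 1" using K(1) by simp
   show "ip Om (app ((rho ^^ n) S) Om) = of_real (Re (ip Om (app S Om)))" for n using c by (simp add: rho_pow_hom(7))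
   show "EX m. ALL n>=m. (rho ^^ n) S * pi A = pi A * (rho ^^ n) S"
    if "A : star_alg_gen (gens UNIV)" for A by (rule asymptotically_central[OF even_commutes_left that]) (use S in auto)
  qed
  then show ?thesis using c by simp
 qed
 obtain S1 S2 where TT: "T = S1 + \<i> *c S2"
  and "ALL S:{S1, S2}. S : M & Gm * S = (1) *c (S * Gm) & adj S = S"
  using cartesian_decomposition[OF T(1), of "1"] T(2) by auto
 then have S: "S1 : M" "Gm * S1 = S1 * Gm" "adj S1 = S1" "S2 : M" "Gm * S2 = S2 * Gm" "adj S2 = S2" by simp_all
 have "(%n. ip xi (app ((rho ^^ n) S1) eta) + \<i> * ip xi (app ((rho ^^ n) S2) eta)) ---->
   ip Om (app S1 Om) * ip xi eta + \<i> * (ip Om (app S2 Om) * ip xi eta)" by (intro tendsto_intros sa S)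
 then show ?thesis unfolding TT by (simp add: rho_pow_hom cinner_add_right cinner_scaleC_right distrib_right mult.assoc)
qed

lemma odd_vector_zero: "Gm * T = - (T * Gm) ==> ip Om (app T Om) = 0"
proof -
 assume T: "Gm * T = - (T * Gm)"
 have "ip Om (app T Om) = ip Om (app (Gm * T) Om)" by (simp add: cinner_adj' adj_Gamma Gamma_Omega)
 also have "... = - ip Om (app T Om)" unfolding T by (simp add: Gamma_Omega cinner_minus_right)
 finally show ?thesis by simp
qed

text \<open>For odd self-adjoint \<open>S\<close> the operator \<open>\<i> *c (S * Gm)\<close> is
  self-adjoint, asymptotically central and of expectation zero. The shift fixes \<open>Gm\<close>,
  which can therefore be absorbed into the vector.\<close>

lemma weak_limit_odd:
 assumes T: "T : M" "Gm * T = - (T * Gm)"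
 shows "(%n. ip xi (app ((rho ^^ n) T) eta)) ----> 0"
proof -
 have dense: "closure (star_alg_gen (gens UNIV)) = UNIV" using all_generated by blast
 have sa: "(%n. ip xi (app ((rho ^^ n) S) eta)) ----> 0"
  if S: "S : M" "Gm * S = - (S * Gm)" "adj S = S" for S and eta
 proof -
  define Y where "Y = \<i> *c (S * Gm)"
  have Y_adj: "adj Y = Y" by (simp add: Y_def S(3) adj_Gamma S(2))
  obtain K where K: "K >= 0" "!!xi. norm (app Y xi) <= K * norm xi" using norm_app_bound by blast
  have K1: "norm (app Y xi) <= (K + 1) * norm xi" for xi using K(2)[of xi] by (simp add: distrib_right add_increasing2)
  have "(%n. ip xi (app ((rho ^^ n) Y) (app Gm eta))) ----> of_real 0 * ip xi (app Gm eta)"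
  proof (rule weak_limit_of_asymptotically_central[OF _ _ _ _ dense])
   show "adj ((rho ^^ n) Y) = (rho ^^ n) Y" for n by (simp add: rho_pow_hom Y_adj)
   show "norm (app ((rho ^^ n) Y) xi) <= (K + 1) * norm xi" for n xi by (rule rho_pow_bound[OF K1])
   show "0 < K + 1" using K(1) by simp
   show "ip Om (app ((rho ^^ n) Y) Om) = of_real 0" for n
    using odd_vector_zero[OF S(2)] by (simp add: rho_pow_hom(7) Y_def cinner_scaleC_right Gamma_Omega)
   have "Y * g = g * Y" if "g : Gens {..<0}" for g using odd_commutes_left[OF that S(1,2)] by (simp add: Y_def)
   then show "EX m. ALL n>=m. (rho ^^ n) Y * pi A = pi A * (rho ^^ n) Y"
    if "A : star_alg_gen (gens UNIV)" for A by (rule asymptotically_central[OF _ that])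
  qed
  moreover have "app ((rho ^^ n) Y) (app Gm eta) = \<i> *c app ((rho ^^ n) S) eta" for n
   using arg_cong[OF Gamma_sq, of "%T. app T eta"] by (simp add: Y_def rho_pow_hom)
  ultimately have "(%n. (- \<i>) * (\<i> * ip xi (app ((rho ^^ n) S) eta))) ----> (- \<i>) * 0"
   by (intro tendsto_mult tendsto_const) (simp add: cinner_scaleC_right)
  then show ?thesis by (simp flip: mult.assoc)
 qed
 obtain S1 S2 where TT: "T = S1 + \<i> *c S2"
  and "ALL S:{S1, S2}. S : M & Gm * S = (- 1) *c (S * Gm) & adj S = S"
  using cartesian_decomposition[OF T(1), of "- 1"] T(2) by auto
 then have S: "S1 : M" "Gm * S1 = - (S1 * Gm)" "adj S1 = S1" "S2 : M" "Gm * S2 = - (S2 * Gm)" "adj S2 = S2" by simp_all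
 have "(%n. ip xi (app ((rho ^^ n) S1) eta) + \<i> * ip xi (app ((rho ^^ n) S2) eta)) ----> 0 + \<i> * 0"
  by (intro tendsto_intros sa S)
 then show ?thesis unfolding TT by (simp add: rho_pow_hom cinner_add_right cinner_scaleC_right)
qed

end

section \<open>The support projection of the vector state and its finite-dimensional corner\<close>

lemma closure_vector_ops:
 fixes C :: "'h::complex_hilbert set"
 assumes "0 : C" "!!x y. x : C ==> y : C ==> x + y : C" "!!c x. x : C ==> c *c x : C"
 shows "0 : closure C" "x : closure C ==> y : closure C ==> x + y : closure C"
  "x : closure C ==> c *c x : closure C"
proof -
 show "0 : closure C" using assms(1) closure_subset by blast
qed (rule closure_op2[where h = "(+)"] closure_op1[where f = "%x. c *c x"]; auto intro!: continuous_intros assms)+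

lemma projection_commutes:
 assumes P: "P * P = P" "adj P = P" "!!x. app P x : C" "!!x. x : C ==> app P x = x"
  and T: "!!x. x : C ==> app T x : C" "!!x. x : C ==> app (adj T) x : C"
 shows "T * P = P * T"
proof -
 have 1: "P * T * P = T * P" by (rule bop_eqI) (simp add: P(3,4) T(1))
 have "P * adj T * P = adj T * P" by (rule bop_eqI) (simp add: P(3,4) T(2))
 from arg_cong[OF this, of adj] have "P * T * P = P * T" by (simp add: P(2) mult.assoc)
 with 1 show ?thesis by simp
qed

text \<open>The closed cyclic subspace of a *-algebra is invariant under it and under adjoints, so
  its projection lies in the commutant.\<close>

lemma orbit_projection:
 fixes F :: "'h::complex_hilbert bop set" and xi :: 'h
 defines "C \<equiv> closure ((%T. app T xi) ` F)"
 assumes F: "1 : F" "!!S T. S : F ==> T : F ==> S + T : F" "!!c T. T : F ==> c *c T : F"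
  "!!S T. S : F ==> T : F ==> S * T : F" "!!T. T : F ==> adj T : F"
 obtains Q where "Q * Q = Q" "adj Q = Q" "!!x. app Q x : C" "!!x. x : C ==> app Q x = x"
  "!!T. T : F ==> T * Q = Q * T"
proof -
 let ?V = "(%T. app T xi) ` F"
 have mem: "app T xi : ?V" if "T : F" for T using that by (rule imageI)
 have V: "0 : ?V" "x : ?V ==> y : ?V ==> x + y : ?V" "x : ?V ==> c *c x : ?V" for x y c
  using mem[OF F(3)[OF F(1), of 0]] mem[OF F(2)] mem[OF F(3)] by auto
 obtain Q where Q: "Q * Q = Q" "adj Q = Q" "!!x. app Q x : C" "!!x. x : C ==> app Q x = x"
  by (rule projection_onto_closed_subspace[of C])
   (use closure_vector_ops[of ?V] V in "auto simp: C_def")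
 have "app T x : C" if T: "T : F" and x: "x : C" for T x unfolding C_def
 proof (rule closure_op1[of "app T"])
  show "x : closure ?V" using x by (simp add: C_def)
  show "app T y : ?V" if "y : ?V" for y using that mem[OF F(4)[OF T]] by auto
 qed (intro continuous_intros)
 then have "T * Q = Q * T" if "T : F" for T using that F(5) by (intro projection_commutes[OF Q]) auto
 with Q show thesis by (rule that)
qed

context chain_rep
begin

lemma car_sub_mono: "X <= Y ==> car_sub d a X <= car_sub d a Y"
 unfolding car_sub_gen by (rule closure_star_alg_gen_subset) (auto intro!: closure_star_alg_gen(1))

lemma comm_Gens_pi:
 assumes T: "T : comm (Gens X)" and A: "A : car_sub d a X"
 shows "T * pi A = pi A * T"
proof -
 have *: "T * pi A = pi A * T" if "A : star_alg_gen (gens X)" for A using that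
 proof (induction rule: star_alg_gen_sym_induct)
  case (base A)
  then obtain x i where "A = gen x i" "x : X" "i < d" by auto
  then show ?case using T cg_Gens[of x X i] by (simp add: cg_def pi_cstar comm_def)
 next
  case (mult A B)
  then show ?case by (metis pi_mult mult.assoc)
 qed (simp_all add: pi_one pi_add pi_scaleC distrib_left distrib_right)
 show ?thesis
 proof (rule bop_eqI)
  fix xi
  have "closed {A. app (T * pi A) xi = app (pi A * T) xi}" by (simp, intro closed_Collect_eq continuous_intros)
  then have "closure (star_alg_gen (gens X)) <= {A. app (T * pi A) xi = app (pi A * T) xi}"
   by (rule closure_minimal[rotated]) (intro subsetI CollectI, simp only: *)
  then show "app (T * pi A) xi = app (pi A * T) xi" using A unfolding car_sub_gen by blast
 qed
qed

lemma pi_in_M: "A : car_sub d a {0..} ==> pi A : M" by (rule M_I) (simp add: comm_Gens_pi)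

definition orbit :: "'h set" where "orbit = (%T. app T Om) ` comm (Gens {0..})"

lemma comm_Gens_adj: "T : comm (Gens X) ==> adj T : comm (Gens X)" by (rule comm_adj[OF Gens_adj])

definition P :: "'h bop" where
 "P = (SOME P. P * P = P & adj P = P & (ALL x. app P x : closure orbit) & (ALL x:closure orbit. app P x = x) &
   (ALL T:comm (Gens {0..}). T * P = P * T))"

lemma P: "P * P = P" "adj P = P" "app P x : closure orbit" "x : closure orbit ==> app P x = x"
 "T : comm (Gens {0..}) ==> T * P = P * T"
proof -
 obtain Q where "Q * Q = Q" "adj Q = Q" "!!x. app Q x : closure orbit" "!!x. x : closure orbit ==> app Q x = x"
   "!!T. T : comm (Gens {0..}) ==> T * Q = Q * T"
  unfolding orbit_def by (rule orbit_projection[of "comm (Gens {0..})" Om]) (auto intro: comm_ops comm_Gens_adj)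
 then have "EX P. P * P = P & adj P = P & (ALL x. app P x : closure orbit) & (ALL x:closure orbit. app P x = x) &
   (ALL T:comm (Gens {0..}). T * P = P * T)" by blast
 from someI_ex[OF this] show "P * P = P" "adj P = P" "app P x : closure orbit" "x : closure orbit ==> app P x = x"
  "T : comm (Gens {0..}) ==> T * P = P * T" unfolding P_def by auto
qed

lemma P_in_M: "P : M" by (rule M_I) (simp add: P(5))

lemma P_Omega: "app P Om = Om"
proof -
 have "Om : orbit" unfolding orbit_def by (rule image_eqI[of _ _ 1]) (simp_all add: comm_ops)
 then show ?thesis using P(4) closure_subset by blast
qed

text \<open>\<open>x\<close> commutes with the commutant, so vanishing on Om spreads to the whole
  orbit and by continuity to the range of \<open>P\<close>.\<close>

lemma M_separating:
 assumes x: "x : M" "app x Om = 0"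
 shows "x * P = 0"
proof (rule bop_eqI)
 fix xi
 have "app x (app S Om) = 0" if "S : comm (Gens {0..})" for S
  using arg_cong[OF M_commD[OF x(1) that], of "%T. app T Om"] by (simp add: x(2))
 moreover have "closed {y. app x y = 0}" by (intro closed_Collect_eq continuous_intros)
 ultimately have "closure orbit <= {y. app x y = 0}" by (intro closure_minimal) (auto simp: orbit_def)
 then show "app (x * P) xi = app 0 xi" using P(3)[of xi] by auto
qed

lemma M_absorb: "q : M ==> app q Om = Om ==> q * P = P" using M_separating[of "q - 1"] by (simp add: M_ops left_diff_distrib)

text \<open>The conjugates of \<open>P\<close> by \<open>Y\<close> and by its inverse lie in
  \<open>M\<close> and fix Om, so both dominate \<open>P\<close>.\<close>

lemma P_invariant:
 assumes Y: "unitary_op s Y" "Y Om = Om" "adjoint Y Om = Om"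
  and M: "!!A. A : M ==> conj_by Y A : M" "!!A. A : M ==> conj_by (adjoint Y) A : M"
 shows "conj_by Y P = P"
proof -
 note Y' = unitary_op_inverse(1)[OF Y(1)]
 have "conj_by Y P * P = P" by (rule M_absorb[OF M(1)[OF P_in_M]]) (simp add: app_conj_by[OF Y(1)] Y P_Omega)
 then have 1: "P * conj_by Y P = P" using P(2) conj_by_simps(8)[OF Y(1), of P] by (metis adj_simps(6))
 have "conj_by (adjoint Y) P * P = P"
  by (rule M_absorb[OF M(2)[OF P_in_M]]) (simp add: app_conj_by[OF Y'] Y P_Omega unitary_op_inverse(2)[OF Y(1)])
 from arg_cong[OF this, of "conj_by Y"] have "P * conj_by Y P = conj_by Y P" by (simp add: conj_by_simps[OF Y(1)])
 with 1 show ?thesis by simp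
qed

lemma Gamma_P: "Gm * P = P * Gm"
by (smt (verit, ccfv_SIG) Gamma_M Gamma_Omega Groups.mult_ac(1) M_absorb P(2) P_Omega P_in_M adj_Gamma
  adj_simps(6) app_simps(6))

text \<open>\<open>rho P\<close> dominates \<open>P\<close>. Only an inequality results, since
  \<open>rho\<close> is merely an endomorphism of \<open>M\<close>; it later becomes the invariance
  relation \<open>Sm_p0\<close>.\<close>

lemma rho_P: "rho P * P = P"
proof (rule M_absorb[OF rho_in_M[OF P_in_M]])
 have "U Om = Om" "adjoint U Om = Om" by (rule implementer[OF shift_aut U])+
 then show "app (rho P) Om = Om" by (simp add: rho_def app_conj_by[OF U(1)] P_Omega)
qed

lemma car_sub_join:
 assumes "EX N. A : car_sub d a {0..<int N}" "EX N. B : car_sub d a {0..<int N}"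
 shows "EX N. A : car_sub d a {0..<int N} & B : car_sub d a {0..<int N}"
proof -
 obtain N N' where "A : car_sub d a {0..<int N}" "B : car_sub d a {0..<int N'}" using assms by blast
 moreover have "{0..<int N} <= {0..<int (max N N')}" "{0..<int N'} <= {0..<int (max N N')}" by auto
 ultimately show ?thesis using car_sub_mono by blast
qed

lemma half_chain_local:
 "A : star_alg_gen (gens {0..}) ==> EX N. A : car_sub d a {0..<int N}"
proof (induction rule: star_alg_gen_sym_induct)
 case (base A)
 then obtain x i where "A = gen x i" "x >= 0" "i < d" by auto
 then have "A : car_sub d a {0..<int (nat (x + 1))}" using gen_in_sub[of x "{0..<int (nat (x + 1))}" i] by simp
 then show ?case using car_sub_ops(5) by blast
next
 case (add A B)
 then show ?case using car_sub_join car_sub_ops(1) by meson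
next
 case (mult A B)
 then show ?case using car_sub_join car_sub_ops(4) by meson
qed (use car_sub_ops in blast)+

text \<open>The projection \<open>Q\<close> onto the closure of the vectors of local elements
  commutes with the generators, hence with \<open>T\<close>. As \<open>Q\<close> fixes Om,
  \<open>T\<close> applied to Om stays in that closure.\<close>

lemma M_vector_approx:
 assumes T: "T : M"
 shows "EX X. (ALL n. X n : star_alg_gen (gens {0..})) & (%n. app (pi (X n)) Om) ----> app T Om"
proof -
 define B where "B = star_alg_gen (gens {0::int..})"
 define V where "V = (%T. app T Om) ` pi ` B"
 have one: "1 : B" unfolding B_def by (rule star_alg_gen.one)
 have pi_B: "pi A : pi ` B" if "A : B" for A using that by (rule imageI)
 obtain Q where Q: "!!x. app Q x : closure V" "!!x. x : closure V ==> app Q x = x" "!!A. A : pi ` B ==> A * Q = Q * A"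
  unfolding V_def
 proof (rule orbit_projection[of "pi ` B" Om])
  show "1 : pi ` B" using pi_B[OF one] by (simp add: pi_one)
  fix S T z assume "S : pi ` B"
  then obtain A where A: "A : B" "S = pi A" by blast
  show "z *c S : pi ` B" "adj S : pi ` B"
   using pi_B[of "z *c A"] pi_B[of "cstar A"] A unfolding B_def by (auto simp: pi_scaleC pi_cstar intro: star_alg_gen.intros)
  assume "T : pi ` B"
  then obtain A' where A': "A' : B" "T = pi A'" by blast
  show "S + T : pi ` B" "S * T : pi ` B"
   using pi_B[of "A + A'"] pi_B[of "A * A'"] A A' unfolding B_def by (auto simp: pi_add pi_mult intro: star_alg_gen.intros)
 qed (rule that, simp_all only: V_def)
 have OmV: "Om : V" unfolding V_def using imageI[OF pi_B[OF one], of "%T. app T Om"] by (simp add: pi_one)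
 have "Q : comm (Gens {0..})" unfolding comm_def
 proof (intro CollectI ballI)
  fix g assume "g : Gens {0..}"
  then obtain x i where xi: "x >= 0" "i < d" "g = cg x i \<or> g = adj (cg x i)" by (auto simp: Gens_def)
  have "gen x i : B" unfolding B_def by (rule star_alg_gen.base) (use xi in blast)
  moreover from this have "cstar (gen x i) : B" unfolding B_def by (rule star_alg_gen.cstar)
  ultimately show "g * Q = Q * g" using xi(3) Q(3) pi_B by (auto simp: cg_def simp flip: pi_cstar)
 qed
 from M_commD[OF T this] have "app Q (app T Om) = app T (app Q Om)" by (metis app_simps(6))
 also have "app Q Om = Om" using Q(2) OmV closure_subset by blast
 finally have "app T Om : closure V" using Q(1)[of "app T Om"] by simp
 then obtain f where f: "!!n. f n : V" "f ----> app T Om" unfolding closure_sequential by blast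
 have "ALL n. EX A. A : B & f n = app (pi A) Om" using f(1) unfolding V_def by blast
 from choice[OF this] obtain X where "ALL n. X n : B & f n = app (pi (X n)) Om" by (rule exE)
 then have X: "ALL n. X n : B" "f = (%n. app (pi (X n)) Om)" by auto
 show ?thesis by (rule exI[of _ X]) (use X(1) f(2) in "simp add: X(2) B_def")
qed

text \<open>Expectation one forces the projection \<open>pi q\<close> to fix Om, and an element of
  \<open>M\<close> fixing Om absorbs \<open>P\<close>.\<close>

lemma local_support_projection:
 assumes "q : car_sub d a {0..<int N}" "q * q = q" "cstar q = q" "om q = 1"
 shows "P * pi q = P" "pi q * P = P"
proof -
 have "car_sub d a {0..<int N} <= car_sub d a {0..}" by (rule car_sub_mono) auto
 then have qM: "pi q : M" using assms(1) pi_in_M by blast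
 have q: "pi q * pi q = pi q" "adj (pi q) = pi q" by (simp_all flip: pi_mult pi_cstar add: assms)
 have c1: "ip Om (app (pi q) Om) = 1" using vector_state[of q] assms(4) by simp
 have c2: "ip (app (pi q) Om) Om = 1" using c1 cinner_adj[of "pi q" Om Om] by (simp add: q(2))
 have "ip (app (pi q) Om) (app (pi q) Om) = ip Om (app (pi q * pi q) Om)" by (simp add: cinner_adj q(2))
 then have c3: "ip (app (pi q) Om) (app (pi q) Om) = 1" by (simp only: q(1) c1)
 have "ip (app (pi q) Om - Om) (app (pi q) Om - Om) = 0"
  by (simp add: cinner_diff_left cinner_diff_right c1 c2 c3 norm_Omega)
 then have "app (pi q) Om = Om" by (simp add: cinner_self)
 then show 1: "pi q * P = P" by (rule M_absorb[OF qM])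
 from arg_cong[OF 1, of adj] show "P * pi q = P" by (simp add: P(2) q(2))
qed

text \<open>Since \<open>P \<le> \<pi>(q)\<close> for the local support projections \<open>q\<close>, the corner \<open>P \<pi>(\<A>\<^sub>R) P\<close> has
 dimension at most \<open>R\<^sup>2\<close>; compactness of the unit sphere of coefficients carries a linear relation
 over to \<open>P M P\<close>.\<close>

lemma finite_corner:
 assumes R: "!!N Q. 1 <= N ==> local_support d a om N Q ==> vec_space.rank (2 ^ (d * N)) Q <= R"
  and T: "!!k. k < Suc (R * R) ==> T k : M"
 shows "EX l. (EX k<Suc (R * R). l k ~= 0) & (SUM k<Suc (R * R). l k *c (P * T k * P)) = 0"
proof -
 let ?K = "Suc (R * R)"
 have "ALL k. EX X. k < ?K --> (ALL n. X n : star_alg_gen (gens {0..})) & (%n. app (pi (X n)) Om) ----> app (T k) Om"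
  using M_vector_approx[OF T] by blast
 from choice[OF this] obtain X where
  X: "!!k n. k < ?K ==> X k n : star_alg_gen (gens {0..})"
   "!!k. k < ?K ==> (%n. app (pi (X k n)) Om) ----> app (T k) Om" by blast
 have rel: "EX l. (SUM k<?K. cmod (l k)) = 1 & (SUM k<?K. l k *c (P * pi (X k n) * P)) = 0 & (ALL k. cmod (l k) <= 1)" for n
 proof -
  have "ALL k. EX N. k < ?K --> X k n : car_sub d a {0..<int N}" using half_chain_local[OF X(1)] by blast
  from choice[OF this] obtain N where N: "!!k. k < ?K ==> X k n : car_sub d a {0..<int (N k)}" by blast
  define N0 where "N0 = Suc (SUM k<?K. N k)"
  have XN: "X k n : car_sub d a {0..<int N0}" if k: "k < ?K" for k
  proof -
   have "N k <= (SUM k<?K. N k)" using k by (intro member_le_sum) auto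
   then have "N k <= N0" by (simp only: N0_def le_SucI)
   then have "{0..<int (N k)} <= {0..<int N0}" by auto
   then show ?thesis using N[OF k] car_sub_mono by blast
  qed
  have "1 <= N0" by (simp add: N0_def)
  from local_rank_bound[OF state R[OF this]] obtain q where
   q: "q : car_sub d a {0..<int N0}" "q * q = q" "cstar q = q" "om q = 1"
   and qA: "!!A. (ALL k<?K. A k : car_sub d a {0..<int N0}) ==> EX l. (EX k<?K. l k ~= 0) & (SUM k<?K. l k *c (q * A k * q)) = 0"
   by blast
  have "EX l. (EX k<?K. l k ~= 0) & (SUM k<?K. l k *c (q * X k n * q)) = 0" by (rule qA[of "%k. X k n"]) (use XN in blast)
  then obtain l where l: "EX k<?K. l k ~= 0" "(SUM k<?K. l k *c (q * X k n * q)) = 0" by blast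
  note Pq = local_support_projection[OF q]
  have PX: "P * pi (q * X k n * q) * P = P * pi (X k n) * P" for k
  by (metis (no_types, opaque_lifting) Pq(1,2) more_arith_simps(11) pi_mult)
  have "(SUM k<?K. l k *c (P * pi (X k n) * P)) = P * pi (SUM k<?K. l k *c (q * X k n * q)) * P"
   by (simp only: PX[symmetric] pi_sum pi_scaleC sum_distrib_left sum_distrib_right bop_mult_scaleC)
  then have 0: "(SUM k<?K. l k *c (P * pi (X k n) * P)) = 0" unfolding l(2) by simp
  define s where "s = (SUM k<?K. cmod (l k))"
  obtain k0 where k0: "k0 < ?K" "l k0 ~= 0" using l(1) by blast
  have "cmod (l k0) <= s" unfolding s_def using k0 by (intro member_le_sum) auto
  then have s: "s > 0" using k0(2) zero_less_norm_iff[of "l k0"] by linarith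
  \<comment> \<open>Padding by 0 beyond \<open>?K\<close> keeps every coordinate in the unit disc,
    as the compactness argument requires.\<close>
  define l' where "l' k = (if k < ?K then l k / of_real s else 0)" for k
  have "cmod (l' k) <= 1" for k
  proof (cases "k < ?K")
   case True
   then have "cmod (l k) <= s" unfolding s_def by (intro member_le_sum) auto
   then show ?thesis using s True by (simp add: l'_def norm_divide)
  qed (simp add: l'_def)
  moreover have "(SUM k<?K. cmod (l' k)) = 1"
  proof -
   have "(SUM k<?K. cmod (l' k)) = (SUM k<?K. cmod (l k) / s)"
    by (rule sum.cong[OF refl]) (use s in "simp add: l'_def norm_divide")
   also have "... = s / s" unfolding s_def by (simp only: sum_divide_distrib)
   finally show ?thesis using s by simp
  qed
  moreover have "(SUM k<?K. l' k *c (P * pi (X k n) * P)) = 0"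
  proof -
   have "(SUM k<?K. l' k *c (P * pi (X k n) * P)) = (SUM k<?K. (1 / of_real s) *c l k *c (P * pi (X k n) * P))"
    by (rule sum.cong[OF refl]) (simp add: l'_def scaleC_scaleC)
   also have "... = (1 / of_real s) *c (SUM k<?K. l k *c (P * pi (X k n) * P))" by (simp only: cvs.scale_sum_right)
   finally show ?thesis by (simp only: 0 cvs.scale_zero_right)
  qed
  ultimately show ?thesis by blast
 qed
 have "ALL n. EX l. (SUM k<?K. cmod (l k)) = 1 & (SUM k<?K. l k *c (P * pi (X k n) * P)) = 0 & (ALL k. cmod (l k) <= 1)"
  by (rule allI[OF rel])
 from choice[OF this] obtain f where
  f: "!!n. (SUM k<?K. cmod (f n k)) = 1" "!!n. (SUM k<?K. f n k *c (P * pi (X k n) * P)) = 0" "!!n k. cmod (f n k) <= 1"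
  by blast
 obtain g where g: "!!C m. closed C ==> (!!n. n : UNIV ==> n >= m ==> f n : C) ==> g : C"
  by (rule pointwise_cluster_point[of f "%k. 1" UNIV]) (use f(3) in auto)
 have coord: "continuous_on UNIV (%h :: nat => complex. h k)" for k by (rule continuous_on_product_coordinates)
 have "closed {h :: nat => complex. (SUM k<?K. cmod (h k)) = 1}"
  by (intro closed_Collect_eq continuous_on_sum continuous_on_norm coord continuous_on_const)
 from g[OF this, of 0] have g1: "(SUM k<?K. cmod (g k)) = 1" using f(1) by blast
 define w where "w k = app (P * T k * P) Om" for k
 have small: "norm (SUM k<?K. g k *c w k) <= e" if e: "e > 0" for e
 proof -
  have bl: "bounded_linear (%z :: complex. z *c (v :: 'h))" for v
   by (rule bounded_linear_intro[of _ "norm v"]) (simp_all add: scaleC_add_left norm_scaleC_hilbert scaleC_of_real[symmetric] scaleC_scaleC scaleR_conv_of_real)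
  have cl: "closed {h :: nat => complex. norm (SUM k<?K. h k *c w k) <= e}"
   by (intro closed_Collect_le continuous_on_norm continuous_on_sum bounded_linear.continuous_on[OF bl] coord continuous_on_const)
  define u where "u k n = app P (app (T k) Om - app (pi (X k n)) Om)" for k n
  have "(%n. SUM k<?K. norm (u k n)) ----> (SUM k<?K. norm (app P (app (T k) Om - app (T k) Om)))"
   unfolding u_def by (intro tendsto_sum tendsto_norm tendsto_app tendsto_diff tendsto_const X) auto
  then have "(%n. SUM k<?K. norm (u k n)) ----> 0" by simp
  from LIMSEQ_D[OF this e] obtain m where m: "!!n. n >= m ==> norm ((SUM k<?K. norm (u k n)) - 0) < e" by blast
  have "f n : {h. norm (SUM k<?K. h k *c w k) <= e}" if n: "n >= m" for n
  proof -
   have "app (SUM k<?K. f n k *c (P * pi (X k n) * P)) Om = 0" by (simp only: f(2) app_simps)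
   then have z: "(SUM k<?K. f n k *c app P (app (pi (X k n)) Om)) = 0" by (simp add: app_sum P_Omega del: sum.lessThan_Suc)
   have "(SUM k<?K. f n k *c w k) = (SUM k<?K. f n k *c w k) - (SUM k<?K. f n k *c app P (app (pi (X k n)) Om))"
    by (simp only: z diff_zero)
   also have "... = (SUM k<?K. f n k *c u k n)" unfolding sum_subtractf[symmetric] u_def w_def
    by (rule sum.cong[OF refl]) (simp add: P_Omega cvs.scale_right_diff_distrib)
   also have "norm ... <= (SUM k<?K. norm (f n k *c u k n))" by (rule norm_sum)
   also have "... <= (SUM k<?K. norm (u k n))"
    by (rule sum_mono) (use f(3) in "simp add: norm_scaleC_hilbert mult_left_le_one_le")
   also have "... <= e" using m[OF n] by (simp del: sum.lessThan_Suc)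
   finally show ?thesis by blast
  qed
  from g[OF cl this] show ?thesis by blast
 qed
 have "norm (SUM k<?K. g k *c w k) <= 0" using small field_le_epsilon[of "norm (SUM k<?K. g k *c w k)" 0] by simp
 then have w0: "(SUM k<?K. g k *c w k) = 0" by simp
 \<comment> \<open>The limit relation says only that \<open>y\<close> kills Om; the separating
   property turns this into \<open>y * P = 0\<close>, and \<open>y * P\<close> is \<open>y\<close>
   itself.\<close>
 define y where "y = (SUM k<?K. g k *c (P * T k * P))"
 have "y : M" unfolding y_def by (intro M_sum M_ops P_in_M T) auto
 moreover have "app y Om = 0" using w0 by (simp add: y_def app_sum w_def del: sum.lessThan_Suc)
 ultimately have "y * P = 0" by (rule M_separating)
 moreover have "y * P = y" unfolding y_def by (simp add: sum_distrib_right mult.assoc P(1) del: sum.lessThan_Suc)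
 ultimately have "y = 0" by simp
 moreover have "EX k<?K. g k ~= 0"
 proof (rule ccontr)
  assume "\<not> ?thesis"
  then have "(SUM k<?K. cmod (g k)) = 0" by (intro sum.neutral) auto
  then show False using g1 by simp
 qed
 ultimately show ?thesis unfolding y_def by blast
qed

end

section \<open>Matrix units of site 0 and the range of the shift endomorphism\<close>

lemma mpar_cancel: "mpar mu * (mpar mu * z) = z" by (simp flip: mult.assoc)

context chain_rep
begin

definition I :: "nat set set" where "I = Pow {..<d}"

lemma I: "finite I" "{} : I" "mu : I ==> mu <= {..<d}" by (auto simp: I_def)

definition eu :: "nat set => nat set => 'h bop" where "eu mu nu = pi (E mu nu)"

lemma eu_mult: "nu : I ==> si : I ==> eu mu nu * eu si tau = (if nu = si then eu mu tau else 0)"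
 unfolding eu_def pi_mult[symmetric] using site0.munit_mult[of nu si mu tau] I(3) by auto

lemma adj_eu: "adj (eu mu nu) = eu nu mu" unfolding eu_def pi_cstar[symmetric] site0.cstar_munit ..

lemma sum_eu: "(SUM mu:I. eu mu mu) = 1"
 unfolding eu_def pi_sum[symmetric] I_def using site0.sum_munit[of d] by (simp add: pi_one)

lemma eu_in_M: "eu mu nu : M"
 unfolding eu_def by (rule pi_in_M) (use E_in_sub[of mu nu] car_sub_mono[of "{0}" "{0..}"] in auto)

lemma Gens_eu:
 assumes g: "g : Gens X" "0 ~: X" and mu: "mu : I" "nu : I"
 shows "g * eu mu nu = (mpar mu * mpar nu) *c (eu mu nu * g)"
proof -
 obtain x i where xi: "x : X" "i < d" "g = cg x i \<or> g = adj (cg x i)" using g(1) by (auto simp: Gens_def)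
 have x: "x ~= 0" using xi(1) g(2) by auto
 have star: "cstar (gen x i) * gen 0 j = - (gen 0 j * cstar (gen x i))" if "j < d" for j
  using gen_anti_star[OF that xi(2), of 0 x] x by simp
 have star2: "gen x i * cstar (gen 0 j) = - (cstar (gen 0 j) * gen x i)" if "j < d" for j
  using gen_anti_star[OF xi(2) that, of x 0] x by simp
 have star3: "cstar (gen x i) * cstar (gen 0 j) = - (cstar (gen 0 j) * cstar (gen x i))" if "j < d" for j
  using arg_cong[OF gen_anti[OF that xi(2), of 0 x], of cstar] by (simp add: cstar_mult cstar_simps)
 have 1: "gen x i * E mu nu = (mpar mu * mpar nu) *c (E mu nu * gen x i)"
  by (rule site0.anti_munit[OF gen_anti[OF xi(2)] star2 I(3)[OF mu(1)] I(3)[OF mu(2)]])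
 have 2: "cstar (gen x i) * E mu nu = (mpar mu * mpar nu) *c (E mu nu * cstar (gen x i))"
  by (rule site0.anti_munit[OF star star3 I(3)[OF mu(1)] I(3)[OF mu(2)]])
 show ?thesis using xi(3) arg_cong[OF 1, of pi] arg_cong[OF 2, of pi]
  by (auto simp: cg_def eu_def pi_mult pi_scaleC pi_cstar)
qed

lemma Gamma_eu: "mu : I ==> nu : I ==> Gm * eu mu nu = (mpar mu * mpar nu) *c (eu mu nu * Gm)"
 unfolding eu_def Gamma_pi by (simp add: site0.parity_munit[OF parity_aut parity_gen] I(3) pi_scaleC)

lemma comm_Gens0_eu: "T : comm (Gens {0}) ==> T * eu mu nu = eu mu nu * T"
 unfolding eu_def by (rule comm_Gens_pi[OF _ E_in_sub])

lemma comm_eu_Gens0: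
 assumes "!!mu nu. mu : I ==> nu : I ==> T * eu mu nu = eu mu nu * T"
 shows "T : comm (Gens {0})"
proof -
 have comb: "T * pi (site0.comb k) = pi (site0.comb k) * T" for k
 proof -
  have "pi (site0.comb k) = (SUM mu:I. SUM nu:I. k mu nu *c eu mu nu)"
   by (simp add: site0.comb_def pi_sum pi_scaleC eu_def I_def)
  then show ?thesis by (simp add: sum_distrib_left sum_distrib_right assms cong: sum.cong)
 qed
 have "g * T = T * g" if g: "g : Gens {0}" for g
 proof -
  obtain i where i: "i < d" "g = cg 0 i \<or> g = adj (cg 0 i)" using g by (auto simp: Gens_def)
  obtain k where k: "gen 0 i = site0.comb k" using site0.comb_annihilate[OF i(1)] by blast
  have "g = pi (site0.comb k) \<or> g = pi (site0.comb (%mu nu. cnj (k nu mu)))"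
   using i(2) unfolding cg_def pi_cstar[symmetric] k site0.comb_cstar .
  then show ?thesis using comb by auto
 qed
 then show ?thesis by (simp add: comm_def)
qed

definition Par :: "'h bop" where "Par = (SUM mu:I. mpar mu *c eu mu mu)"

lemma Par_eu: "mu : I ==> Par * eu mu nu = mpar mu *c eu mu nu" "nu : I ==> eu mu nu * Par = mpar nu *c eu mu nu"
proof -
 assume mu: "mu : I"
 have "Par * eu mu nu = (SUM si:I. if si = mu then mpar mu *c eu mu nu else 0)"
  unfolding Par_def sum_distrib_right by (rule sum.cong[OF refl]) (auto simp: eu_mult mu)
 then show "Par * eu mu nu = mpar mu *c eu mu nu" using mu I(1) by (simp add: sum.delta)
next
 assume nu: "nu : I"
 have "eu mu nu * Par = (SUM si:I. if si = nu then mpar nu *c eu mu nu else 0)"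
  unfolding Par_def sum_distrib_left by (rule sum.cong[OF refl]) (auto simp: eu_mult nu)
 then show "eu mu nu * Par = mpar nu *c eu mu nu" using nu I(1) by (simp add: sum.delta)
qed

lemma Par_props: "Par * Par = 1" "adj Par = Par" "Gm * Par = Par * Gm" "Par : M"
 "g : Gens X ==> 0 ~: X ==> g * Par = Par * g"
proof -
 have "Par * Par = (SUM mu:I. eu mu mu)"
  by (subst (2) Par_def) (simp add: sum_distrib_left Par_eu scaleC_scaleC cong: sum.cong)
 then show "Par * Par = 1" by (simp add: sum_eu)
 show "adj Par = Par" by (simp add: Par_def adj_sum adj_eu)
 show "Gm * Par = Par * Gm" unfolding Par_def sum_distrib_left sum_distrib_right
  by (rule sum.cong[OF refl]) (simp add: Gamma_eu)
 show "Par : M" unfolding Par_def by (intro M_sum M_ops eu_in_M)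
 show "g * Par = Par * g" if "g : Gens X" "0 ~: X" unfolding Par_def sum_distrib_left sum_distrib_right
  by (rule sum.cong[OF refl]) (simp add: Gens_eu[OF that])
qed

lemma Par_commutes:
 assumes "!!mu. mu : I ==> T * eu mu mu = eu mu mu * T"
 shows "T * Par = Par * T" unfolding Par_def sum_distrib_left sum_distrib_right by (rule sum.cong[OF refl]) (simp add: assms)

lemma rho_comm_Gens0:
 assumes "!!g. g : Gens {..<0} ==> T * g = g * T"
 shows "rho T : comm (Gens {0})"
proof -
 have "g * rho T = rho T * g" if "g : Gens {0}" for g
 proof -
  have "rhoi g : Gens {-1}" using Gens_rho[OF that] by simp
  then have "rhoi g : Gens {..<0}" using Gens_mono[of "{-1}" "{..<0}"] by auto
  from arg_cong[OF assms[OF this], of rho] show ?thesis by simp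
 qed
 then show ?thesis by (simp add: comm_def)
qed

lemma rho_even_eu: "T : M ==> Gm * T = T * Gm ==> rho T * eu mu nu = eu mu nu * rho T"
 by (rule comm_Gens0_eu[OF rho_comm_Gens0[OF even_commutes_left]])

text \<open>A shifted odd element commutes with site 0 only together with \<open>Gm\<close>; moving
  \<open>Gm\<close> across the matrix unit leaves the parity sign.\<close>

lemma rho_odd_eu:
 assumes T: "T : M" "Gm * T = - (T * Gm)" and mu: "mu : I" "nu : I"
 shows "rho T * eu mu nu = (mpar mu * mpar nu) *c (eu mu nu * rho T)"
proof -
 have "rho (T * Gm) * eu mu nu = eu mu nu * rho (T * Gm)"
  by (rule comm_Gens0_eu[OF rho_comm_Gens0[OF odd_commutes_left[OF _ T]]])
 then have "rho T * (Gm * eu mu nu) = eu mu nu * rho T * Gm" by (simp add: rho_Gamma mult.assoc)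
 then have "(mpar mu * mpar nu) *c (rho T * eu mu nu * Gm) = eu mu nu * rho T * Gm" by (simp add: Gamma_eu mu mult.assoc)
 from arg_cong[OF this, of "%S. (mpar mu * mpar nu) *c (S * Gm)"]
 have *: "(mpar mu * mpar nu) *c ((mpar mu * mpar nu) *c (rho T * eu mu nu * (Gm * Gm))) =
   (mpar mu * mpar nu) *c (eu mu nu * rho T * (Gm * Gm))" by (simp only: bop_mult_scaleC mult.assoc)
 have "mpar mu * mpar nu * (mpar mu * mpar nu) = 1" by (simp add: mult_ac mpar_cancel)
 with * show ?thesis by (simp only: Gamma_sq scaleC_scaleC mult_1_right cvs.scale_one)
qed

text \<open>Relative to the matrix units at site 0 an operator commuting with the chain on \<open>[1, \<infinity>)\<close> has
 coefficients that commute with the whole half chain, up to the twist by \<open>Par\<close> and \<open>Gm\<close>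
 when the matrix unit is odd.\<close>

lemma coefficient_commutes:
 assumes y: "y : M" "Gm * y = y * Gm" "!!mu nu. y * eu mu nu = eu mu nu * y"
  and T: "T : comm (Gens {1..})" and mu: "mu : I" "nu : I"
 shows "y * (SUM ka:I. eu ka mu * T * eu nu ka) = (SUM ka:I. eu ka mu * T * eu nu ka) * y"
proof -
 define C where "C = (SUM ka:I. eu ka mu * T * eu nu ka)"
 have C_eu: "C * eu si tau = eu si tau * C" if "si : I" "tau : I" for si tau
 proof -
  have "C * eu si tau = (SUM ka:I. if ka = si then eu si mu * T * eu nu tau else 0)"
   unfolding C_def sum_distrib_right by (rule sum.cong[OF refl]) (auto simp: eu_mult that mult.assoc)
  also have "... = (SUM ka:I. if ka = tau then eu si mu * T * eu nu tau else 0)" using that I(1) by simp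
  also have "... = eu si tau * C" unfolding C_def sum_distrib_left
   by (rule sum.cong[OF refl]) (auto simp: eu_mult that mult.assoc[symmetric])
  finally show ?thesis .
 qed
 have C_Gens: "g * C = (mpar mu * mpar nu) *c (C * g)" if g: "g : Gens {1..}" for g
 proof -
  have gT: "g * T = T * g" using T g by (simp add: comm_def)
  have "g * (eu ka mu * T * eu nu ka) = (mpar mu * mpar nu) *c (eu ka mu * T * eu nu ka * g)" if ka: "ka : I" for ka
  proof -
   have "g * (eu ka mu * T * eu nu ka) = (g * eu ka mu) * T * eu nu ka" by (simp add: mult.assoc)
   also have "... = (mpar ka * mpar mu) *c (eu ka mu * (g * T) * eu nu ka)"
    by (simp add: Gens_eu[OF g _ ka mu(1)] mult.assoc)
   also have "eu ka mu * (g * T) * eu nu ka = eu ka mu * T * (g * eu nu ka)" unfolding gT by (simp add: mult.assoc)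
   also have "... = (mpar nu * mpar ka) *c (eu ka mu * T * eu nu ka * g)" by (simp add: Gens_eu[OF g _ mu(2) ka] mult.assoc)
   also have "(mpar ka * mpar mu) *c ... = (mpar mu * mpar nu) *c (eu ka mu * T * eu nu ka * g)"
    unfolding scaleC_scaleC by (rule arg_cong[of _ _ "%z. z *c _"]) (simp add: mult_ac mpar_cancel)
   finally show ?thesis .
  qed
  then show ?thesis unfolding C_def sum_distrib_left sum_distrib_right cvs.scale_sum_right by (rule sum.cong[OF refl])
 qed
 have "{0..} = {0} \<union> {1::int..}" by auto
 then have Gens_split: "g : Gens {0} \<or> g : Gens {1..}" if "g : Gens {0..}" for g using that by (auto simp: Gens_def)
 have whole: "W : comm (Gens {0..})" if "!!si tau. si : I ==> tau : I ==> W * eu si tau = eu si tau * W"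
   "!!g. g : Gens {1..} ==> g * W = W * g" for W
  using Gens_split comm_eu_Gens0[OF that(1)] that(2) unfolding comm_def by blast
 have "mpar mu * mpar nu = 1 \<or> mpar mu * mpar nu = - 1"
  unfolding mpar_def by (metis power_add neg_one_even_power neg_one_odd_power)
 then have "y * C = C * y"
 proof
  assume p: "mpar mu * mpar nu = 1"
  have "C : comm (Gens {0..})" by (rule whole[OF C_eu]) (simp_all add: C_Gens p)
  then show ?thesis by (rule M_commD[OF y(1)])
 next
  assume p: "mpar mu * mpar nu = - 1"
  \<comment> \<open>\<open>C\<close> anticommutes with the chain from site 1 on, which
    \<open>Gm\<close> repairs; \<open>Gm\<close> spoils the commutation with the units of site 0,
    which \<open>Par\<close> repairs.\<close>
  have "Par * C * Gm : comm (Gens {0..})"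
  proof (rule whole)
   fix si tau assume si: "si : I" "tau : I"
   have "Par * C * Gm * eu si tau = (mpar si * mpar tau) *c (Par * (C * eu si tau) * Gm)"
    by (simp add: Gamma_eu si mult.assoc)
   also have "... = (mpar si * mpar tau) *c ((Par * eu si tau) * C * Gm)" by (simp add: C_eu si mult.assoc)
   also have "... = mpar tau *c (eu si tau * C * Gm)" unfolding Par_eu(1)[OF si(1)] bop_mult_scaleC scaleC_scaleC
    by (rule arg_cong[of _ _ "%z. z *c _"]) (simp add: mult_ac mpar_cancel)
   also have "... = (eu si tau * Par) * C * Gm" by (simp add: Par_eu si)
   finally show "Par * C * Gm * eu si tau = eu si tau * (Par * C * Gm)" by (simp add: mult.assoc)
  next
   fix g assume g: "g : Gens {1..}"
   have "g * (Par * C * Gm) = (g * Par) * C * Gm" by (simp add: mult.assoc)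
   also have "g * Par = Par * g" by (rule Par_props(5)[OF g]) simp
   also have "Par * g * C * Gm = Par * (g * C) * Gm" by (simp add: mult.assoc)
   also have "... = Par * C * (- (g * Gm))" by (simp add: C_Gens[OF g] p mult.assoc)
   also have "- (g * Gm) = Gm * g" using Gens_Gamma[OF g] by simp
   finally show "g * (Par * C * Gm) = Par * C * Gm * g" by (simp add: mult.assoc)
  qed
  from M_commD[OF y(1) this] have *: "y * (Par * C * Gm) = Par * C * Gm * y" .
  have yPar: "y * Par = Par * y" by (rule Par_commutes) (rule y(3))
  have "Par * (y * (Par * C * Gm)) * Gm = Par * (y * Par) * C * (Gm * Gm)" by (simp only: mult.assoc)
  also have "... = (Par * Par) * y * C" unfolding yPar Gamma_sq by (simp add: mult.assoc)
  finally have 1: "Par * (y * (Par * C * Gm)) * Gm = y * C" by (simp add: Par_props)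
  have "Par * (Par * C * Gm * y) * Gm = (Par * Par) * C * (Gm * y) * Gm" by (simp only: mult.assoc)
  also have "... = C * y * (Gm * Gm)" unfolding y(2) by (simp add: Par_props mult.assoc)
  finally have "Par * (Par * C * Gm * y) * Gm = C * y" by (simp add: Gamma_sq)
  with 1 * show ?thesis by simp
 qed
 then show ?thesis unfolding C_def .
qed

text \<open>An operator in the commutant of the chain from site 1 on expands in the units of site 0
  with coefficients that commute with \<open>y\<close>. So \<open>y\<close> lies in the bicommutant
  of that chain, and \<open>rhoi\<close> takes it back to \<open>M\<close>.\<close>

lemma rho_surj:
 assumes y: "y : M" "Gm * y = y * Gm" "!!mu nu. y * eu mu nu = eu mu nu * y"
 shows "EX T. T : M & Gm * T = T * Gm & y = rho T"
proof -
 have "T * y = y * T" if T: "T : comm (Gens {1..})" for T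
 proof -
  define C where "C mu nu = (SUM ka:I. eu ka mu * T * eu nu ka)" for mu nu
  have "C mu nu * eu mu nu = eu mu mu * T * eu nu nu" if "mu : I" "nu : I" for mu nu
  proof -
   have "C mu nu * eu mu nu = (SUM ka:I. if ka = mu then eu mu mu * T * eu nu nu else 0)"
    unfolding C_def sum_distrib_right by (rule sum.cong[OF refl]) (auto simp: eu_mult that mult.assoc)
   then show ?thesis using that I(1) by simp
  qed
  then have "(SUM mu:I. SUM nu:I. C mu nu * eu mu nu) = (SUM mu:I. SUM nu:I. eu mu mu * T * eu nu nu)"
   by (intro sum.cong refl) auto
  also have "... = (SUM mu:I. eu mu mu) * T * (SUM nu:I. eu nu nu)"
   unfolding sum_distrib_right[of "%mu. eu mu mu" I T] sum_product ..
  finally have T_eq: "T = (SUM mu:I. SUM nu:I. C mu nu * eu mu nu)" by (simp add: sum_eu)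
  have "C mu nu * eu mu nu * y = y * (C mu nu * eu mu nu)" if "mu : I" "nu : I" for mu nu
  proof -
   have "C mu nu * eu mu nu * y = C mu nu * y * eu mu nu" by (simp add: mult.assoc y(3))
   also have "C mu nu * y = y * C mu nu" unfolding C_def by (rule coefficient_commutes[OF y T that, symmetric])
   finally show ?thesis by (simp add: mult.assoc)
  qed
  then have "(SUM mu:I. SUM nu:I. C mu nu * eu mu nu) * y = y * (SUM mu:I. SUM nu:I. C mu nu * eu mu nu)"
   unfolding sum_distrib_left sum_distrib_right by (intro sum.cong refl) auto
  then show ?thesis unfolding T_eq[symmetric] .
 qed
 then have "y : comm (comm (Gens {1..}))" by (simp add: comm_def)
 then have "rhoi y : M" by (rule rho_M')
 moreover have "rhoi Gm = Gm" using rho_Gamma rho_simps(9)[of Gm] by simp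
 then have "Gm * rhoi y = rhoi y * Gm" using arg_cong[OF y(2), of rhoi] by simp
 ultimately show ?thesis using rho_simps(10)[of y] by (intro exI[of _ "rhoi y"]) simp
qed

end

section \<open>Implementing homomorphisms of B(K) by isometries\<close>

lemma bop_neg_self: "x = - x ==> x = (0 :: 'h::complex_hilbert bop)"
proof -
 assume "x = - x"
 then have "x + x = 0" by (metis add.right_inverse)
 then have "(2::real) *r x = 0" by (simp add: scaleR_2)
 then show ?thesis by simp
qed

lemma ketbra_linear: "ketbra (x + y) z = ketbra x z + ketbra y z" "ketbra (c *c x) z = c *c ketbra x z"
 by (rule bop_eqI, simp add: scaleC_add_right scaleC_scaleC mult.commute)+

lemma exists_unit_vector:
 fixes x :: "'k::complex_hilbert"
 assumes "x ~= 0"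
 shows "ip (complex_of_real (1 / norm x) *c x) (complex_of_real (1 / norm x) *c x) = 1"
 using assms by (simp add: cinner_self norm_scaleC_hilbert norm_mult norm_divide)

lemma minimal_vector:
 fixes th :: "'k::complex_hilbert bop => 'h::complex_hilbert bop"
 assumes th: "!!x y. th (x * y) = th x * th y" "!!x. th x = 0 ==> x = 0" and one: "(1 :: 'k bop) ~= 0"
 obtains xi eta where "ip xi xi = 1" "ip eta eta = 1" "app (th (ketbra xi xi)) eta = eta"
proof -
 obtain xi0 :: 'k where xi0: "xi0 ~= 0" using one bop_eqI[of "1 :: 'k bop" 0] by auto
 define xi where "xi = complex_of_real (1 / norm xi0) *c xi0"
 have xi: "ip xi xi = 1" unfolding xi_def by (rule exists_unit_vector[OF xi0])
 define f where "f = th (ketbra xi xi)"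
 have "ketbra xi xi ~= 0"
 proof
  assume "ketbra xi xi = 0"
  from arg_cong[OF this, of "%T. ip xi (app T xi)"] show False by (simp add: xi)
 qed
 then obtain eta0 where eta0: "app f eta0 ~= 0" using th(2) bop_eqI[of f 0] unfolding f_def by auto
 have ff: "f * f = f" by (simp add: f_def th(1)[symmetric] ketbra_mult_ketbra xi)
 define eta where "eta = complex_of_real (1 / norm (app f eta0)) *c app f eta0"
 have "ip eta eta = 1" unfolding eta_def by (rule exists_unit_vector[OF eta0])
 moreover have "app f eta = eta" using arg_cong[OF ff, of "%T. app T eta0"] by (simp add: eta_def)
 ultimately show thesis using that[OF xi, of eta] by (simp only: f_def)
qed

text \<open>A unit vector \<open>\<eta>\<close> in the range of the image of a minimal projection \<open>|\<xi>\<rangle>\<langle>\<xi>|\<close> gives the implementing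
 isometry \<open>\<zeta> \<mapsto> \<theta>(|\<zeta>\<rangle>\<langle>\<xi>|) \<eta>\<close>.\<close>

lemma corner_implemented:
 fixes th :: "'k::complex_hilbert bop => 'k bop"
 assumes th: "!!x y. th (x + y) = th x + th y" "!!x y. th (x * y) = th x * th y" "!!c x. th (c *c x) = c *c th x"
   "!!x. th (adj x) = adj (th x)"
  and surj: "!!y. EX x. th x = th 1 * y * th 1" and inj: "!!x. th x = 0 ==> x = 0" and one: "(1 :: 'k bop) ~= 0"
 shows "EX S. adj S * S = 1 & S * adj S = th 1 & (ALL x. th x = S * x * adj S)"
proof -
 obtain xi eta where xi: "ip xi xi = 1" and eta: "ip eta eta = 1" and feta: "app (th (ketbra xi xi)) eta = eta"
  by (rule minimal_vector[of th, OF th(2) inj one])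
 define s where "s ze = app (th (ketbra ze xi)) eta" for ze
 have s_add: "s (x + y) = s x + s y" and s_scale: "s (c *c x) = c *c s x" for x y c by (simp_all add: s_def ketbra_linear th)
 have s_inner: "ip (s x) (s y) = ip x y" for x y
 proof -
  have "ip (s x) (s y) = ip eta (app (th (adj (ketbra x xi) * ketbra y xi)) eta)"
   by (simp add: s_def cinner_adj th(2,4) del: adj_ketbra)
  also have "adj (ketbra x xi) * ketbra y xi = ip x y *c ketbra xi xi" by (simp add: ketbra_mult_ketbra)
  finally show ?thesis by (simp add: th(3) cinner_scaleC_right feta eta)
 qed
 have s_norm: "norm (s x) = norm x" for x
 proof -
  have "complex_of_real ((norm (s x))\<^sup>2) = of_real ((norm x)\<^sup>2)" using s_inner[of x x] by (simp only: cinner_self)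
  then have "(norm (s x))\<^sup>2 = (norm x)\<^sup>2" by (simp only: of_real_eq_iff)
  then show ?thesis by (simp add: power2_eq_iff_nonneg)
 qed
 have "bounded_linear s"
 proof
  show "s (x + y) = s x + s y" for x y by (rule s_add)
  show "s (r *r x) = r *r s x" for r x using s_scale[of "of_real r" x] by (simp add: scaleC_of_real)
  show "EX K. ALL x. norm (s x) <= norm x * K" by (rule exI[of _ 1]) (simp add: s_norm)
 qed
 then have "bounded_op 0 s" by (simp add: bounded_op_def s_scale)
 define S where "S = Bop s"
 have S: "app S x = s x" for x unfolding S_def using \<open>bounded_op 0 s\<close> by (simp add: Bop_inverse)
 have SS: "adj S * S = 1"
  by (rule bop_eqI, rule cinner_eqI) (simp add: cinner_adj[symmetric] S s_inner cinner_adj'[symmetric])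
 have thS: "th x * S = S * x" for x by (rule bop_eqI) (simp add: S s_def ketbra_mult_left[symmetric] th(2))
 have thS': "adj S * th x = x * adj S" for x using arg_cong[OF thS[of "adj x"], of adj] by (simp add: th(4)[symmetric])
 have eS: "th 1 * S = S" "adj S * th 1 = adj S" using thS[of 1] thS'[of 1] by simp_all
 \<comment> \<open>The range projection of \<open>S\<close> lies in the corner and its preimage is
   central, so \<open>p\<close> is a multiple of \<open>th 1\<close>; as \<open>p * S = S\<close>,
   the factor is 1.\<close>
 define p where "p = S * adj S"
 obtain y where y: "th y = th 1 * p * th 1" using surj by blast
 then have yp: "th y = p" unfolding p_def by (metis eS mult.assoc)
 have "y * x = x * y" for x
 proof -
  have "th (y * x) = th (x * y)" unfolding th(2) yp p_def by (metis thS thS' mult.assoc)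
  then have "th (y * x + (-1) *c (x * y)) = 0" unfolding th(1,3) by simp
  from inj[OF this] show ?thesis by simp
 qed
 then obtain c where c: "y = c *c 1" using central_bop_scalar by blast
 have "p * S = S" by (simp add: p_def mult.assoc SS)
 moreover have "p = c *c th 1" using yp c th(3)[of c 1] by simp
 ultimately have "c *c S = S" by (simp add: eS)
 then have "adj S * (c *c S) = 1" using SS by simp
 then have "c *c (1 :: 'k bop) = 1" by (simp add: SS)
 then have "p = th 1" using yp c by simp
 moreover have "th x = S * x * adj S" for x
 proof -
  have "th x = th x * th 1" by (simp flip: th(2))
  also have "... = th x * S * adj S" using \<open>p = th 1\<close> by (simp add: p_def mult.assoc)
  finally show ?thesis by (simp add: thS)
 qed
 ultimately show ?thesis using SS p_def by (intro exI[of _ S]) auto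
qed

section \<open>Half-chain algebras with index kappa = 1\<close>

locale index_rep = chain_rep d a om pi Om Gm
 for d :: nat and a :: "(int => complex vec) => 'a::cstar_algebra" and om and pi :: "'a => 'h::complex_hilbert bop" and Om and Gm +
 fixes j :: "'k::complex_hilbert bop => 'h bop" and Z :: "'h bop"
 assumes j_add: "j (A + B) = j A + j B" and j_mult: "j (A * B) = j A * j B" and j_scaleC: "j (z *c A) = z *c j A"
  and j_adj: "j (adj A) = adj (j A)" and j_one: "j 1 = 1" and j_inj: "j A = j B ==> A = B"
  and j_even: "j A : M" "Gm * j A = j A * Gm" and j_onto: "T : M ==> Gm * T = T * Gm ==> T : range j"
  and Z: "Z : M" "Z * Z = 1" "adj Z = Z" "Gm * Z = - (Z * Gm)" and Z_central: "T : M ==> Z * T = T * Z"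
begin

lemma j_zero: "j 0 = 0" using j_scaleC[of 0 0] by simp
lemma j_sum: "j (sum f K) = (SUM i:K. j (f i))" by (induction K rule: infinite_finite_induct) (simp_all add: j_zero j_add)

definition ji :: "'h bop => 'k bop" where "ji T = (SOME A. j A = T)"

lemma ji_j [simp]: "ji (j A) = A" unfolding ji_def by (rule someI2[of _ A]) (auto intro: j_inj)

lemma j_ji: "T : M ==> Gm * T = T * Gm ==> j (ji T) = T" using j_onto[of T] by (metis imageE ji_j)

lemma one_neq_zero: "(1 :: 'k bop) ~= 0"
proof
 assume "(1 :: 'k bop) = 0"
 then have "(1 :: 'h bop) = 0" using j_one j_zero by simp
 then have "app 1 Om = app 0 Om" by simp
 then show False using norm_Omega(2) by simp
qed

text \<open>\<open>T * Gm\<close> lies in the commutant of \<open>M\<close> and so commutes with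
  \<open>Z\<close>. But \<open>Z\<close> commutes with \<open>T\<close> and anticommutes with
  \<open>Gm\<close>, which forces \<open>T\<close> to vanish.\<close>

lemma twist_free:
 assumes T: "T : M" and anti: "!!g. g : Gens {0..} ==> g * T = - (T * g)"
 shows "T = 0"
proof -
 have "g * (T * Gm) = (T * Gm) * g" if "g : Gens {0..}" for g
 proof -
  have "g * (T * Gm) = (g * T) * Gm" by (simp add: mult.assoc)
  also have "... = T * (- (g * Gm))" by (simp add: anti[OF that] mult.assoc)
  also have "- (g * Gm) = Gm * g" using Gens_Gamma[OF that] by simp
  finally show ?thesis by (simp add: mult.assoc)
 qed
 then have "T * Gm : comm (Gens {0..})" by (simp add: comm_def)
 from M_commD[OF Z(1) this] have "Z * T * Gm = T * (Gm * Z)" by (simp add: mult.assoc)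
 also have "... = - (T * Z * Gm)" by (simp add: Z(4) mult.assoc)
 also have "T * Z = Z * T" using Z_central[OF T] by simp
 finally have "Z * T * Gm = 0" by (rule bop_neg_self)
 then have "Z * (Z * T * Gm) * Gm = 0" by simp
 then have "(Z * Z) * T * (Gm * Gm) = 0" by (simp only: mult.assoc)
 then show ?thesis by (simp add: Z(2) Gamma_sq)
qed

text \<open>An odd self-adjoint unitary from a single mode. Multiplication by it reduces statements
  on odd elements to even ones.\<close>

definition hh :: "'h bop" where "hh = cg 0 0 + adj (cg 0 0)"

lemma hh: "hh * hh = 1" "hh : M" "Gm * hh = - (hh * Gm)"
proof -
 have "gen 0 0 * gen 0 0 = 0" by (rule site0.sq_zero[OF d_pos])
 moreover from arg_cong[OF this, of cstar] have "cstar (gen 0 0) * cstar (gen 0 0) = 0" by (simp add: cstar_mult cstar_simps)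
 moreover have "gen 0 0 * cstar (gen 0 0) = 1 - cstar (gen 0 0) * gen 0 0"
  using gen_anti_star[OF d_pos d_pos, of 0 0] by simp
 ultimately have "(gen 0 0 + cstar (gen 0 0)) * (gen 0 0 + cstar (gen 0 0)) = 1" by (simp add: distrib_left distrib_right)
 from arg_cong[OF this, of pi] show "hh * hh = 1" by (simp add: hh_def cg_def pi_mult pi_add pi_cstar pi_one)
 have g: "cg 0 0 : Gens {0..}" "adj (cg 0 0) : Gens {0..}" using d_pos unfolding Gens_def by auto
 then show "hh : M" unfolding hh_def by (intro M_ops Gens_M)
 show "Gm * hh = - (hh * Gm)"
  unfolding hh_def by (simp add: distrib_left distrib_right Gens_Gamma[OF g(1)] Gens_Gamma[OF g(2)])
qed

text \<open>Commutation with even products gives \<open>g * T' = T * g\<close> for the conjugate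
  \<open>T'\<close> of \<open>T\<close> by \<open>hh\<close>. Hence \<open>T - T'\<close>
  anticommutes with every generator and vanishes by \<open>twist_free\<close>, so \<open>T\<close>
  commutes with all generators.\<close>

lemma even_commutant_scalar:
 assumes T: "!!g g'. g : Gens {0..} ==> g' : Gens {0..} ==> j S * (g * g') = (g * g') * j S"
 shows "EX c. S = c *c 1"
proof -
 have g: "cg 0 0 : Gens {0..}" "adj (cg 0 0) : Gens {0..}" using d_pos unfolding Gens_def by auto
 define T where "T = j S"
 have Tgh: "T * (g * hh) = (g * hh) * T" "T * (hh * g) = (hh * g) * T" if "g : Gens {0..}" for g
  unfolding T_def hh_def distrib_left distrib_right by (simp_all only: assms[OF that g(1)] assms[OF that g(2)] assms[OF g(1) that] assms[OF g(2) that])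
 define T' where "T' = hh * T * hh"
 have 1: "g * T' = T * g" "T' * g = g * T" if "g : Gens {0..}" for g
 proof -
  have "g * T' = ((g * hh) * T) * hh" by (simp add: T'_def mult.assoc)
  also have "... = T * g * (hh * hh)" unfolding Tgh(1)[OF that, symmetric] by (simp only: mult.assoc)
  finally show "g * T' = T * g" by (simp add: hh)
  have "T' * g = hh * (T * (hh * g))" by (simp add: T'_def mult.assoc)
  also have "... = (hh * hh) * g * T" unfolding Tgh(2)[OF that] by (simp only: mult.assoc)
  finally show "T' * g = g * T" by (simp add: hh)
 qed
 have "T - T' = 0"
 proof (rule twist_free)
  show "T - T' : M" unfolding T'_def T_def by (intro M_ops hh j_even)
  show "g * (T - T') = - ((T - T') * g)" if "g : Gens {0..}" for g
   by (simp add: right_diff_distrib left_diff_distrib 1[OF that])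
 qed
 then have "T = T'" by simp
 then have "T : comm (Gens {0..})" using 1(1) unfolding comm_def by auto
 then have "S * B = B * S" for B using M_commD[OF j_even(1)[of B]] by (intro j_inj) (simp add: T_def j_mult)
 then show ?thesis by (rule central_bop_scalar)
qed

text \<open>\<open>al\<close> and conjugation by \<open>Y\<close> are given to agree on generators
  only. On the even part their quotient is an automorphism of B(K), implemented by some
  \<open>S\<close>; it fixes the even products of generators, so \<open>S\<close> is scalar.
  \<open>Z\<close> is then reached through the even element \<open>hh * Z\<close>.\<close>

lemma extension_implemented:
 assumes Y: "unitary_op s Y" and V: "unitary_op s V"
  and M: "!!A. A : M ==> conj_by Y A : M" "!!A. A : M ==> conj_by (adjoint Y) A : M" and Gm: "conj_by Y Gm = Gm"
  and al: "!!A. al (j A) = j (conj_by V A)" "al Z = z *c Z" "!!S T. S : M ==> T : M ==> al (S * T) = al S * al T"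
   "!!S T. S : M ==> T : M ==> al (S + T) = al S + al T" "!!g. g : Gens {0..} ==> al g = conj_by Y g"
 shows "conj_by Y (j A) = j (conj_by V A)" "conj_by Y Z = z *c Z"
proof -
 note cY = conj_by_simps[OF Y] and cV = conj_by_simps[OF V]
 note cY' = conj_by_simps[OF unitary_op_inverse(1)[OF Y]] and cV' = conj_by_simps[OF unitary_op_inverse(1)[OF V]]
 have Gm': "conj_by (adjoint Y) Gm = Gm" using cY(9)[of Gm] Gm by simp
 have ss: "conj_bit s (conj_bit s w) = w" for w by (cases s) auto
 define si where "si A = ji (conj_by (adjoint Y) (j (conj_by V A)))" for A
 have jsi: "j (si A) = conj_by (adjoint Y) (j (conj_by V A))" for A unfolding si_def
 proof (rule j_ji)
  show "conj_by (adjoint Y) (j (conj_by V A)) : M" by (intro M j_even)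
  show "Gm * conj_by (adjoint Y) (j (conj_by V A)) = conj_by (adjoint Y) (j (conj_by V A)) * Gm"
   using arg_cong[OF j_even(2)[of "conj_by V A"], of "conj_by (adjoint Y)"] by (simp add: cY' Gm')
 qed
 have si1: "si 1 = 1" by (rule j_inj) (simp add: jsi cV cY' j_one)
 have "EX S. adj S * S = 1 & S * adj S = si 1 & (ALL x. si x = S * x * adj S)"
 proof (rule corner_implemented)
  show "si (x + y) = si x + si y" for x y by (rule j_inj) (simp add: jsi j_add cV cY')
  show "si (x * y) = si x * si y" for x y by (rule j_inj) (simp add: jsi j_mult cV cY')
  show "si (c *c x) = c *c si x" for c x by (rule j_inj) (simp add: jsi j_scaleC cV cY' ss)
  show "si (adj x) = adj (si x)" for x by (rule j_inj) (simp add: jsi j_adj flip: cV(8) cY'(8))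
  show "EX x. si x = si 1 * y * si 1" for y
  proof -
   have "j (ji (conj_by Y (j y))) = conj_by Y (j y)"
   proof (rule j_ji)
    show "conj_by Y (j y) : M" by (intro M j_even)
    show "Gm * conj_by Y (j y) = conj_by Y (j y) * Gm"
     using arg_cong[OF j_even(2)[of y], of "conj_by Y"] by (simp add: cY Gm)
   qed
   then have "si (conj_by (adjoint V) (ji (conj_by Y (j y)))) = y" by (intro j_inj) (simp add: jsi cV(10) cY(9))
   then show ?thesis unfolding si1 by auto
  qed
  show "x = 0" if "si x = 0" for x
  proof -
   have "conj_by (adjoint Y) (j (conj_by V x)) = 0" using jsi[of x] that by (simp add: j_zero)
   then have "j (conj_by V x) = j 0" using cY(10)[of "j (conj_by V x)"] by (simp add: cY(5) j_zero)
   from j_inj[OF this] have "conj_by V x = 0" .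
   then show ?thesis using cV(9)[of x] by (simp add: cV'(5))
  qed
  show "(1 :: 'k bop) ~= 0" by (rule one_neq_zero)
 qed
 then obtain S where S: "adj S * S = 1" "S * adj S = 1" "!!x. si x = S * x * adj S" unfolding si1 by blast
 have "EX c. S = c *c 1"
 proof (rule even_commutant_scalar)
  fix g g' assume g: "g : Gens {0..}" "g' : Gens {0..}"
  have gM: "g : M" "g' : M" using g Gens_M by blast+
  have even: "Gm * (g * g') = g * g' * Gm"
  proof -
   have "Gm * (g * g') = - (g * (Gm * g'))" by (simp add: mult.assoc[symmetric] Gens_Gamma[OF g(1)])
   then show ?thesis by (simp add: Gens_Gamma[OF g(2)] mult.assoc)
  qed
  define A where "A = ji (g * g')"
  have jA: "j A = g * g'" unfolding A_def by (rule j_ji[OF M_ops(3)[OF gM] even])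
  have "j (conj_by V A) = conj_by Y (g * g')" using al(1)[of A] by (simp add: jA al(3)[OF gM] al(5) g cY(1))
  then have "j (si A) = j A" by (simp add: jsi cY(9) jA)
  then have "S * A * adj S = A" using S(3)[of A] by (simp add: j_inj)
  then have "S * A * (adj S * S) = A * S" by (simp only: mult.assoc[symmetric])
  then have "S * A = A * S" by (simp add: S(1))
  then show "j S * (g * g') = g * g' * j S" unfolding jA[symmetric] j_mult[symmetric] by simp
 qed
 then obtain c where c: "S = c *c 1" by blast
 have "(cnj c * c) *c (1 :: 'k bop) = 1" using S(2) by (simp add: c scaleC_scaleC)
 then have "si x = x" for x
 proof -
  have "si x = (cnj c * c) *c 1 * x" by (simp add: S(3) c scaleC_scaleC)
  then show ?thesis using \<open>(cnj c * c) *c (1 :: 'k bop) = 1\<close> by simp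
 qed
 then have "conj_by (adjoint Y) (j (conj_by V A)) = j A" for A using jsi[of A] by simp
 then have *: "conj_by Y (j A) = j (conj_by V A)" for A using cY(10)[of "j (conj_by V A)"] by simp
 then show "conj_by Y (j A) = j (conj_by V A)" .
 have even: "Gm * (hh * Z) = hh * Z * Gm"
 proof -
  have "Gm * (hh * Z) = - (hh * (Gm * Z))" by (simp add: mult.assoc[symmetric] hh)
  then show ?thesis by (simp add: Z(4) mult.assoc)
 qed
 have "j (ji (hh * Z)) = hh * Z" by (rule j_ji[OF M_ops(3)[OF hh(2) Z(1)] even])
 then have "conj_by Y (hh * Z) = al (hh * Z)" using * al(1) by metis
 also have "... = al hh * (z *c Z)" by (simp add: al(3)[OF hh(2) Z(1)] al(2))
 also have "al hh = conj_by Y hh"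
 proof -
  have g: "cg 0 0 : Gens {0..}" "adj (cg 0 0) : Gens {0..}" using d_pos unfolding Gens_def by auto
  then have gM: "cg 0 0 : M" "adj (cg 0 0) : M" using Gens_M by blast+
  show ?thesis unfolding hh_def al(4)[OF gM] cY(2) by (simp only: al(5)[OF g(1)] al(5)[OF g(2)])
 qed
 finally have "conj_by Y hh * conj_by Y Z = conj_by Y hh * (z *c Z)" by (simp add: cY(1))
 then have "(conj_by Y hh * conj_by Y hh) * conj_by Y Z = (conj_by Y hh * conj_by Y hh) * (z *c Z)"
  by (simp only: mult.assoc)
 moreover have "conj_by Y hh * conj_by Y hh = 1" by (simp add: cY(1)[symmetric] hh(1) cY(4))
 ultimately show "conj_by Y Z = z *c Z" by simp
qed

end

section \<open>Even matrix units, the isometries and the operators of words\<close>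

lemma bit_sign_simps [simp]: "bit_sign 0 = 1" "bit_sign 1 = - 1" "bit_sign b * bit_sign b = 1" "bit_sign b ~= 0"
 "cnj (bit_sign b) = bit_sign b" "cmod (bit_sign b) = 1" "bit_sign b * (bit_sign b * z) = z" by (auto simp: bit_sign_def)

lemma bit_sign_add: "bit_sign (b + c) = bit_sign b * bit_sign c" by (cases b; cases c) (simp_all add: bit_sign_def)

context index_rep
begin

definition Zb :: "bit => 'h bop" where "Zb b = (if b = 0 then 1 else Z)"

lemma Zb: "Zb b : M" "Zb b * Zb b = 1" "adj (Zb b) = Zb b" "Gm * Zb b = bit_sign b *c (Zb b * Gm)"
 "T : M ==> Zb b * T = T * Zb b" "Zb (b + c) = Zb b * Zb c" "Zb 0 = 1" "Zb 1 = Z"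
proof -
 show "Zb (b + c) = Zb b * Zb c" by (cases b; cases c) (simp_all add: Zb_def Z)
qed (auto simp: Zb_def Z M_ops Z_central bit_sign_def)

definition Et :: "nat set => nat set => 'h bop" where
 "Et mu nu = eu mu nu * Zb (card_parity mu + card_parity nu)"

lemma eu_Et: "eu mu nu = Et mu nu * Zb (card_parity mu + card_parity nu)" by (simp add: Et_def mult.assoc Zb)

lemma Et_in_M: "Et mu nu : M" unfolding Et_def by (intro M_ops eu_in_M Zb)

lemma Et_even: "mu : I ==> nu : I ==> Gm * Et mu nu = Et mu nu * Gm"
proof -
 assume mu: "mu : I" "nu : I"
 have "Gm * Et mu nu = (mpar mu * mpar nu) *c (eu mu nu * (Gm * Zb (card_parity mu + card_parity nu)))"
  unfolding Et_def mult.assoc[symmetric] Gamma_eu[OF mu] by simp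
 also have "Gm * Zb (card_parity mu + card_parity nu) = (mpar mu * mpar nu) *c (Zb (card_parity mu + card_parity nu) * Gm)"
  by (simp only: Zb(4) bit_sign_add mpar_bit_sign)
 also have "(mpar mu * mpar nu) *c (eu mu nu * ...) = ((mpar mu * mpar nu) * (mpar mu * mpar nu)) *c (Et mu nu * Gm)"
  by (simp only: bop_mult_scaleC scaleC_scaleC Et_def mult.assoc)
 also have "(mpar mu * mpar nu) * (mpar mu * mpar nu) = 1" by (simp add: mult_ac mpar_cancel)
 finally show ?thesis by simp
qed

lemma Et_mult:
 assumes "nu : I" "si : I"
 shows "Et mu nu * Et si tau = (if nu = si then Et mu tau else 0)"
proof -
 let ?p = card_parity
 have "Et mu nu * Et si tau = eu mu nu * (Zb (?p mu + ?p nu) * eu si tau) * Zb (?p si + ?p tau)"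
  by (simp add: Et_def mult.assoc)
 also have "... = (eu mu nu * eu si tau) * (Zb (?p mu + ?p nu) * Zb (?p si + ?p tau))"
  unfolding Zb(5)[OF eu_in_M] by (simp only: mult.assoc)
 also have "... = (eu mu nu * eu si tau) * Zb (?p mu + ?p nu + (?p si + ?p tau))" by (simp only: Zb(6)[symmetric])
 also have "... = (if nu = si then Et mu tau else 0)"
 proof (cases "nu = si")
  case True
  have "?p mu + ?p si + (?p si + ?p tau) = ?p mu + ?p tau" by (cases "?p si"; cases "?p mu"; cases "?p tau") simp_all
  then show ?thesis using True by (simp add: eu_mult assms Et_def)
 qed (simp add: eu_mult assms)
 finally show ?thesis .
qed

lemma adj_Et: "adj (Et mu nu) = Et nu mu"
 unfolding Et_def by (simp only: adj_simps adj_eu Zb(3) Zb(5)[OF eu_in_M] add.commute[of "card_parity nu" "card_parity mu"])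

lemma Et_diag: "Et mu mu = eu mu mu" by (cases "card_parity mu") (simp_all add: Et_def Zb)

definition jE :: "nat set => nat set => 'k bop" where "jE mu nu = ji (Et mu nu)"

lemma j_jE: "mu : I ==> nu : I ==> j (jE mu nu) = Et mu nu" unfolding jE_def by (rule j_ji[OF Et_in_M Et_even])

lemma jE_mult: "mu : I ==> nu : I ==> si : I ==> tau : I ==> jE mu nu * jE si tau = (if nu = si then jE mu tau else 0)"
 by (rule j_inj) (simp add: j_mult j_jE Et_mult j_zero)

lemma adj_jE: "mu : I ==> nu : I ==> adj (jE mu nu) = jE nu mu" by (rule j_inj) (simp add: j_adj j_jE adj_Et)

lemma sum_jE: "(SUM mu:I. jE mu mu) = 1" by (rule j_inj) (simp add: j_sum j_one j_jE Et_diag sum_eu cong: sum.cong)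

definition rk :: "'k bop => 'k bop" where "rk A = ji (rho (j A))"

lemma rho_j_even: "rho (j A) : M" "Gm * rho (j A) = rho (j A) * Gm"
 using rho_in_M[OF j_even(1)] arg_cong[OF j_even(2)[of A], of rho] by (simp_all add: rho_Gamma)

lemma j_rk: "j (rk A) = rho (j A)" unfolding rk_def by (rule j_ji[OF rho_j_even])

lemma rk_simps: "rk (A + B) = rk A + rk B" "rk (A * B) = rk A * rk B" "rk (z *c A) = z *c rk A"
 "rk (adj A) = adj (rk A)" "rk 1 = 1" "rk A = 0 ==> A = 0"
proof -
 show "rk (A + B) = rk A + rk B" "rk (A * B) = rk A * rk B" "rk (z *c A) = z *c rk A"
  "rk (adj A) = adj (rk A)" "rk 1 = 1" by (rule j_inj; simp add: j_rk j_add j_mult j_scaleC j_adj j_one)+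
 assume "rk A = 0"
 then have "rho (j A) = 0" using j_rk[of A] by (simp add: j_zero)
 then have "j A = j 0" using rho_simps(9)[of "j A"] rho_simps(9)[of 0] by (simp add: j_zero)
 then show "A = 0" by (rule j_inj)
qed

lemma rho_j_Et: "rho (j A) * Et mu nu = Et mu nu * rho (j A)" unfolding Et_def mult.assoc Zb(5)[OF rho_j_even(1)]
 unfolding mult.assoc[symmetric] rho_even_eu[OF j_even] ..

lemma rk_jE: "mu : I ==> nu : I ==> rk A * jE mu nu = jE mu nu * rk A" by (rule j_inj) (simp add: j_mult j_jE j_rk rho_j_Et)

text \<open>The power of \<open>Z\<close> in \<open>Et\<close> is central in \<open>M\<close>, so
  commuting with \<open>Et\<close> amounts to commuting with \<open>eu\<close>, and
  \<open>rho_surj\<close> supplies the preimage.\<close>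

lemma rk_onto:
 assumes y: "!!mu nu. mu : I ==> nu : I ==> y * jE mu nu = jE mu nu * y"
 shows "EX x. rk x = y"
proof -
 have yE: "j y * eu mu nu = eu mu nu * j y" if "mu : I" "nu : I" for mu nu
 proof -
  have "j y * Et mu nu = Et mu nu * j y" using arg_cong[OF y[OF that], of j] by (simp add: j_mult j_jE that)
  then show ?thesis unfolding eu_Et mult.assoc Zb(5)[OF j_even(1)] by (simp only: mult.assoc[symmetric])
 qed
 have "j y : comm (Gens {0})" by (rule comm_eu_Gens0[OF yE])
 from rho_surj[OF j_even comm_Gens0_eu[OF this]] obtain T where
  T: "T : M" "Gm * T = T * Gm" "j y = rho T" by blast
 have "j (rk (ji T)) = j y" by (simp add: j_rk j_ji[OF T(1,2)] T(3))
 from j_inj[OF this] show ?thesis by blast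
qed

text \<open>Cut by the vacuum unit, \<open>rk\<close> becomes a homomorphism of B(K) onto the corner
  of that unit, and such a homomorphism is implemented by an isometry.\<close>

lemma isometry_exists:
 "EX S. adj S * S = 1 & S * adj S = jE {} {} & (ALL x. jE {} {} * rk x = S * x * adj S)"
proof -
 define th where "th A = jE {} {} * rk A" for A
 have e: "jE {} {} * jE {} {} = jE {} {}" "adj (jE {} {}) = jE {} {}" using I by (simp_all add: jE_mult adj_jE)
 have th1: "th 1 = jE {} {}" by (simp add: th_def rk_simps)
 have com: "rk A * jE {} {} = jE {} {} * rk A" for A by (rule rk_jE) (rule I(2))+
 have "EX S. adj S * S = 1 & S * adj S = th 1 & (ALL x. th x = S * x * adj S)"
 proof (rule corner_implemented)
  show "th (x + y) = th x + th y" for x y by (simp add: th_def rk_simps distrib_left)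
  show "th (x * y) = th x * th y" for x y
  proof -
   have "th x * th y = jE {} {} * (rk x * jE {} {}) * rk y" by (simp add: th_def mult.assoc)
   also have "... = (jE {} {} * jE {} {}) * (rk x * rk y)" unfolding com by (simp only: mult.assoc)
   finally show ?thesis by (simp add: e th_def rk_simps)
  qed
  show "th (c *c x) = c *c th x" for c x by (simp add: th_def rk_simps)
  show "th (adj x) = adj (th x)" for x by (simp add: th_def rk_simps e com[symmetric])
  show "(1 :: 'k bop) ~= 0" by (rule one_neq_zero)
  show "x = 0" if "th x = 0" for x
  proof -
   have "jE mu mu * rk x = 0" if "mu : I" for mu
   proof -
    have "jE mu mu * rk x = jE mu {} * (jE {} {} * (jE {} mu * rk x))"
     using that I(2) by (simp add: mult.assoc[symmetric] jE_mult)
    also have "jE {} mu * rk x = rk x * jE {} mu" using rk_jE that I(2) by simp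
    also have "jE mu {} * (jE {} {} * (rk x * jE {} mu)) = jE mu {} * th x * jE {} mu" by (simp add: th_def mult.assoc)
    finally show ?thesis by (simp add: \<open>th x = 0\<close>)
   qed
   then have "(SUM mu:I. jE mu mu) * rk x = 0" by (simp add: sum_distrib_right)
   then show ?thesis using rk_simps(6)[of x] by (simp add: sum_jE)
  qed
  show "EX x. th x = th 1 * y * th 1" for y
  proof -
   \<comment> \<open>Copies the corner of \<open>y\<close> at \<open>{}\<close> to every diagonal
     position; the result commutes with all units and is therefore in the range of
     \<open>rk\<close>.\<close>
   define w where "w = (SUM mu:I. jE mu {} * y * jE {} mu)"
   have l: "jE si tau * w = jE si {} * y * jE {} tau" if "si : I" "tau : I" for si tau
   proof -
    have "jE si tau * w = (SUM mu:I. if mu = tau then jE si {} * y * jE {} tau else 0)" unfolding w_def sum_distrib_left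
     by (rule sum.cong[OF refl]) (use I(2) that in "auto simp: mult.assoc[symmetric] jE_mult")
    then show ?thesis using that I(1) by simp
   qed
   have r: "w * jE si tau = jE si {} * y * jE {} tau" if "si : I" "tau : I" for si tau
   proof -
    have "w * jE si tau = (SUM mu:I. if mu = si then jE si {} * y * jE {} tau else 0)" unfolding w_def sum_distrib_right
     by (rule sum.cong[OF refl]) (use I(2) that in "auto simp: mult.assoc jE_mult")
    then show ?thesis using that I(1) by simp
   qed
   have "EX x. rk x = w" by (rule rk_onto) (simp only: l r)
   then obtain x where "rk x = w" ..
   then have "th x = jE {} {} * y * jE {} {}" using l[OF I(2) I(2)] by (simp add: th_def)
   then show ?thesis unfolding th1 by blast
  qed
 qed
 then show ?thesis unfolding th1 unfolding th_def .
qed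

definition S0 :: "'k bop" where
 "S0 = (SOME S. adj S * S = 1 & S * adj S = jE {} {} & (ALL x. jE {} {} * rk x = S * x * adj S))"

lemma S0: "adj S0 * S0 = 1" "S0 * adj S0 = jE {} {}" "S0 * x * adj S0 = jE {} {} * rk x"
proof -
 note s = someI_ex[OF isometry_exists, folded S0_def]
 show "adj S0 * S0 = 1" "S0 * adj S0 = jE {} {}" using s by (blast dest: conjunct1 conjunct2)+
 show "S0 * x * adj S0 = jE {} {} * rk x" using s by (metis (no_types))
qed

definition Sm :: "nat set => 'k bop" where "Sm mu = jE mu {} * S0"

lemma Sm_sandwich:
 assumes "mu : I" "nu : I"
 shows "Sm mu * A * adj (Sm nu) = jE mu nu * rk A"
proof -
 have "Sm mu * A * adj (Sm nu) = jE mu {} * (S0 * A * adj S0) * jE {} nu"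
  using assms I(2) by (simp add: Sm_def adj_jE mult.assoc)
 also have "... = (jE mu {} * jE {} {}) * (rk A * jE {} nu)" unfolding S0(3) by (simp only: mult.assoc)
 also have "rk A * jE {} nu = jE {} nu * rk A" using rk_jE assms I(2) by simp
 finally show ?thesis using assms I(2) by (simp add: jE_mult mult.assoc[symmetric])
qed

lemma Sm_ortho:
 assumes "mu : I" "nu : I"
 shows "adj (Sm mu) * Sm nu = (if mu = nu then 1 else 0)"
proof -
 have "adj (Sm mu) * Sm nu = adj S0 * (jE {} mu * jE nu {}) * S0" using assms I(2) by (simp add: Sm_def adj_jE mult.assoc)
 also have "... = (if mu = nu then adj S0 * (S0 * adj S0) * S0 else 0)" using assms I(2) by (simp add: jE_mult S0(2))
 also have "adj S0 * (S0 * adj S0) * S0 = (adj S0 * S0) * (adj S0 * S0)" by (simp only: mult.assoc)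
 finally show ?thesis by (simp add: S0(1))
qed

lemma rk_sum: "rk A = (SUM mu:I. Sm mu * A * adj (Sm mu))"
 by (simp add: Sm_sandwich sum_distrib_right[symmetric] sum_jE cong: sum.cong)

lemma Sm_sum: "(SUM mu:I. Sm mu * adj (Sm mu)) = 1" using rk_sum[of 1] by (simp add: rk_simps)

text \<open>By the resolution of the identity \<open>Sm_sum\<close> every operator is a finite sum
  of sandwiches.\<close>

lemma commutes_sandwich_scalar:
 assumes "!!mu nu A. mu : I ==> nu : I ==> x * (Sm mu * A * adj (Sm nu)) = (Sm mu * A * adj (Sm nu)) * x"
 shows "EX c. x = c *c 1"
proof (rule central_bop_scalar)
 fix B
 have "B = (SUM mu:I. Sm mu * adj (Sm mu)) * B * (SUM nu:I. Sm nu * adj (Sm nu))" by (simp add: Sm_sum)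
 also have "... = (SUM mu:I. SUM nu:I. Sm mu * adj (Sm mu) * B * (Sm nu * adj (Sm nu)))"
  unfolding sum_distrib_right[of "%mu. Sm mu * adj (Sm mu)" I B] sum_product ..
 also have "... = (SUM mu:I. SUM nu:I. Sm mu * (adj (Sm mu) * B * Sm nu) * adj (Sm nu))" by (simp only: mult.assoc)
 finally have B: "B = ..." .
 have "x * (SUM mu:I. SUM nu:I. Sm mu * (adj (Sm mu) * B * Sm nu) * adj (Sm nu)) =
   (SUM mu:I. SUM nu:I. Sm mu * (adj (Sm mu) * B * Sm nu) * adj (Sm nu)) * x"
  unfolding sum_distrib_left sum_distrib_right by (intro sum.cong refl assms)
 then show "x * B = B * x" unfolding B[symmetric] .
qed

lemma rho_Z_Gamma: "Gm * rho Z = - (rho Z * Gm)" using arg_cong[OF Z(4), of rho] by (simp add: rho_Gamma)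

lemma rho_Z_eu: "mu : I ==> nu : I ==> rho Z * eu mu nu = (mpar mu * mpar nu) *c (eu mu nu * rho Z)"
 by (rule rho_odd_eu[OF Z(1,4)])

lemma rho_Z_Par: "rho Z * Par = Par * rho Z" by (rule Par_commutes) (simp add: rho_Z_eu)

lemma Par_rho_j: "rho (j A) * Par = Par * rho (j A)" by (rule Par_commutes) (rule rho_even_eu[OF j_even])

text \<open>The quotient \<open>X\<close> of the two odd operators is even and commutes with the
  units of site 0 and with the range of \<open>rho\<close> on the even part, hence with all
  sandwiches. So it is scalar, and its square is 1.\<close>

lemma rho_Z: "EX si. rho Z = bit_sign si *c (Z * Par)"
proof -
 define X where "X = rho Z * (Z * Par)"
 have ZM: "rho Z : M" by (rule rho_in_M[OF Z(1)])
 have Z1: "Z * rho Z = rho Z * Z" by (rule Z_central[OF ZM])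
 have Z2: "Z * Par = Par * Z" by (rule Z_central[OF Par_props(4)])
 have Z3: "Z * eu mu nu = eu mu nu * Z" for mu nu by (rule Z_central[OF eu_in_M])
 have XM: "X : M" unfolding X_def by (intro M_ops ZM Z Par_props)
 have "Gm * X = (Gm * rho Z) * (Z * Par)" by (simp add: X_def mult.assoc)
 also have "... = - (rho Z * ((Gm * Z) * Par))" by (simp add: rho_Z_Gamma mult.assoc)
 also have "... = rho Z * Z * (Gm * Par)" by (simp add: Z(4) mult.assoc)
 also have "... = X * Gm" by (simp add: Par_props(3) X_def mult.assoc)
 finally have XGm: "Gm * X = X * Gm" .
 have ZP: "(Z * Par) * (Z * Par) = 1"
 proof -
  have "(Z * Par) * (Z * Par) = Z * (Par * Z) * Par" by (simp only: mult.assoc)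
  also have "... = (Z * Z) * (Par * Par)" unfolding Z2[symmetric] by (simp only: mult.assoc)
  finally show ?thesis by (simp add: Z Par_props)
 qed
 have X_eu: "X * eu mu nu = eu mu nu * X" if mu: "mu : I" "nu : I" for mu nu
 proof -
  have "X * eu mu nu = mpar mu *c (rho Z * (Z * eu mu nu))" by (simp add: X_def mult.assoc Par_eu mu)
  also have "... = mpar mu *c ((rho Z * eu mu nu) * Z)" by (simp add: Z3 mult.assoc)
  also have "... = mpar nu *c (eu mu nu * rho Z * Z)" by (simp add: rho_Z_eu mu scaleC_scaleC mpar_cancel)
  finally have 1: "X * eu mu nu = mpar nu *c (eu mu nu * rho Z * Z)" .
  have "X = Par * rho Z * Z" by (simp add: X_def Z2 rho_Z_Par mult.assoc[symmetric])
  then have "eu mu nu * X = (eu mu nu * Par) * rho Z * Z" by (simp add: mult.assoc)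
  with 1 show ?thesis by (simp add: Par_eu mu)
 qed
 have X_rho: "X * rho (j A) = rho (j A) * X" for A
 proof -
  have "X * rho (j A) = rho Z * Z * (rho (j A) * Par)" by (simp add: X_def mult.assoc Par_rho_j)
  also have "... = rho Z * (Z * rho (j A)) * Par" by (simp only: mult.assoc)
  also have "Z * rho (j A) = rho (j A) * Z" by (rule Z_central[OF rho_j_even(1)])
  also have "rho Z * (rho (j A) * Z) * Par = rho (Z * j A) * Z * Par" by (simp add: mult.assoc)
  also have "Z * j A = j A * Z" by (rule Z_central[OF j_even(1)])
  finally show ?thesis by (simp add: X_def mult.assoc)
 qed
 define x where "x = ji X"
 have jx: "j x = X" unfolding x_def by (rule j_ji[OF XM XGm])
 have "EX c. x = c *c 1"
 proof (rule commutes_sandwich_scalar)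
  fix mu nu A assume mu: "mu : I" "nu : I"
  have XEt: "X * Et mu nu = Et mu nu * X"
   unfolding Et_def mult.assoc Zb(5)[OF XM] unfolding mult.assoc[symmetric] X_eu[OF mu] ..
  show "x * (Sm mu * A * adj (Sm nu)) = Sm mu * A * adj (Sm nu) * x" unfolding Sm_sandwich[OF mu]
  proof (rule j_inj)
   have "X * (Et mu nu * rho (j A)) = Et mu nu * (X * rho (j A))" by (simp only: mult.assoc[symmetric] XEt)
   then show "j (x * (jE mu nu * rk A)) = j (jE mu nu * rk A * x)" by (simp add: j_mult jx j_jE mu j_rk X_rho mult.assoc)
  qed
 qed
 then obtain c where "x = c *c 1" by blast
 then have X: "X = c *c 1" using jx by (simp add: j_scaleC j_one)
 have "adj X = Par * Z * rho Z" by (simp add: X_def Z Par_props)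
 also have "... = X" by (simp add: X_def mult.assoc Z1 Z2) (simp add: mult.assoc[symmetric] rho_Z_Par[symmetric])
 finally have "adj X = X" .
 have "adj X * X = (Z * Par) * (rho Z * rho Z) * (Z * Par)" by (simp add: X_def Z Par_props Z2 mult.assoc)
 also have "rho Z * rho Z = 1" using arg_cong[OF Z(2), of rho] by simp
 finally have XX: "X * X = 1" using \<open>adj X = X\<close> ZP by simp
 have one: "w = w'" if "w *c (1 :: 'h bop) = w' *c 1" for w w'
  using arg_cong[OF that, of "%T. ip Om (app T Om)"] by (simp add: cinner_scaleC_right norm_Omega)
 have "(c * c) *c (1 :: 'h bop) = 1 *c 1" using XX by (simp add: X scaleC_scaleC)
 from one[OF this] have "c = 1 \<or> c = - 1" by (simp add: square_eq_1_iff power2_eq_square)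
 moreover have "rho Z = X * (Z * Par)" unfolding X_def mult.assoc[of "rho Z"] ZP by simp
 then have "rho Z = c *c (Z * Par)" by (simp add: X)
 ultimately show ?thesis by (elim disjE) (rule exI[of _ 0], simp, rule exI[of _ 1], simp)
qed

definition si0 :: bit where "si0 = (SOME si. rho Z = bit_sign si *c (Z * Par))"

lemma rho_Z_eq: "rho Z = bit_sign si0 *c (Z * Par)" unfolding si0_def by (rule someI_ex[OF rho_Z])

definition p0 :: "'k bop" where "p0 = ji P"

lemma p0: "j p0 = P" "p0 * p0 = p0" "adj p0 = p0"
proof -
 show 1: "j p0 = P" unfolding p0_def by (rule j_ji[OF P_in_M Gamma_P])
 show "p0 * p0 = p0" by (rule j_inj) (simp add: j_mult 1 P(1))
 show "adj p0 = p0" by (rule j_inj) (simp add: j_adj 1 P(2))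
qed

text \<open>From \<open>rho_P\<close>: the adjoints of the isometries leave the range of
  \<open>p0\<close> invariant, which makes compression by \<open>p0\<close> multiplicative on
  words.\<close>

lemma Sm_p0:
 assumes nu: "nu : I"
 shows "adj (Sm nu) * p0 = p0 * adj (Sm nu) * p0" "p0 * Sm nu = p0 * Sm nu * p0"
proof -
 have rp: "rk p0 * p0 = p0" by (rule j_inj) (simp add: j_mult j_rk p0 rho_P)
 have "adj (Sm nu) * rk p0 = (SUM mu:I. if mu = nu then p0 * adj (Sm nu) else 0)" unfolding rk_sum sum_distrib_left
  by (rule sum.cong[OF refl]) (use nu in "auto simp: mult.assoc[symmetric] Sm_ortho")
 then have "adj (Sm nu) * rk p0 = p0 * adj (Sm nu)" using nu I(1) by simp
 then have "adj (Sm nu) * (rk p0 * p0) = p0 * adj (Sm nu) * p0" by (simp flip: mult.assoc)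
 then show 1: "adj (Sm nu) * p0 = p0 * adj (Sm nu) * p0" unfolding rp .
 from arg_cong[OF 1, of adj] show "p0 * Sm nu = p0 * Sm nu * p0" by (simp add: p0 mult.assoc)
qed

definition phi :: "'k bop => complex" where "phi B = ip Om (app (j B) Om)"

lemma phi_p0: "phi (p0 * B * p0) = phi B" by (simp add: phi_def j_mult p0 P_Omega cinner_adj' P)


text \<open>A product of matrix units at consecutive sites in Horner form with respect to the shift.
  Below, \<open>kw\<close> is its operator on K, \<open>ps\<close> its total parity and
  \<open>wsgn\<close> the sign collected on the way.\<close>

primrec wd :: "(nat set \<times> nat set) list => 'h bop" where
 "wd [] = 1" | "wd (x # L) = eu (fst x) (snd x) * rho (wd L)"

primrec kw :: "(nat set \<times> nat set) list => 'k bop" where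
 "kw [] = 1" | "kw (x # L) = Sm (fst x) * kw L * adj (Sm (snd x))"

primrec ps :: "(nat set \<times> nat set) list => bit" where
 "ps [] = 0" | "ps (x # L) = card_parity (fst x) + card_parity (snd x) + ps L"

primrec wsgn :: "(nat set \<times> nat set) list => complex" where
 "wsgn [] = 1" | "wsgn (x # L) = bit_sign ((si0 + card_parity (snd x)) * ps L) * wsgn L"

text \<open>An odd remainder carries a factor \<open>Z\<close>, which the shift turns into
  \<open>Z * Par\<close> up to the sign of \<open>si0\<close>; the matrix unit absorbs
  \<open>Par\<close> as the parity of \<open>nu\<close>. This is the origin of the sign in
  (ii).\<close>

lemma word_step:
 assumes mu: "mu : I" "nu : I"
 shows "eu mu nu * rho (j A * Zb s) =
  bit_sign ((si0 + card_parity nu) * s) *c (j (Sm mu * A * adj (Sm nu)) * Zb (card_parity mu + card_parity nu + s))"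
proof -
 define b where "b = card_parity mu + card_parity nu"
 have jS: "j (Sm mu * A * adj (Sm nu)) = Et mu nu * rho (j A)" by (simp add: Sm_sandwich[OF mu] j_mult j_jE mu j_rk)
 have e: "eu mu nu * rho (j A) = Et mu nu * rho (j A) * Zb b"
  unfolding eu_Et b_def[symmetric] mult.assoc Zb(5)[OF rho_j_even(1)] ..
 show ?thesis
 proof (cases "s = 0")
  case True
  then show ?thesis unfolding True jS b_def[symmetric] by (simp add: Zb(7) e)
 next
  case False
  then have s: "s = 1" by (cases s) simp_all
  have "eu mu nu * rho (j A * Zb s) = bit_sign si0 *c (eu mu nu * (rho (j A) * (Z * Par)))" by (simp add: s Zb(8) rho_Z_eq)
  also have "Z * Par = Par * Z" by (rule Z_central[OF Par_props(4)])
  also have "eu mu nu * (rho (j A) * (Par * Z)) = (eu mu nu * Par) * rho (j A) * Z"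
   by (simp only: mult.assoc[symmetric]) (simp only: mult.assoc Par_rho_j[symmetric])
  also have "... = mpar nu *c (Et mu nu * rho (j A) * (Zb b * Z))" by (simp add: Par_eu mu e mult.assoc)
  also have "Zb b * Z = Zb (b + s)" unfolding s Zb(6) Zb(8) ..
  finally show ?thesis unfolding jS b_def[symmetric] by (simp only: s mult_1_right bit_sign_add mpar_bit_sign scaleC_scaleC)
 qed
qed

lemma wd_eq: "ALL x:set L. fst x : I & snd x : I ==> wd L = wsgn L *c (j (kw L) * Zb (ps L))"
proof (induction L)
 case Nil
 then show ?case by (simp add: j_one Zb(7))
next
 case (Cons x L)
 then have mu: "fst x : I" "snd x : I" by auto
 have "wd (x # L) = wsgn L *c (eu (fst x) (snd x) * rho (j (kw L) * Zb (ps L)))" using Cons by simp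
 also have "... = wsgn (x # L) *c (j (kw (x # L)) * Zb (ps (x # L)))"
  unfolding word_step[OF mu] by (simp only: scaleC_scaleC wsgn.simps kw.simps ps.simps mult.commute[of "wsgn L"])
 finally show ?case .
qed

text \<open>An odd word keeps a factor \<open>Z\<close>, and the parity-invariant vector Om gives it
  expectation zero; this is the Kronecker delta.\<close>

lemma word_value:
 assumes "ALL x:set L. fst x : I & snd x : I"
 shows "ip Om (app (wd L) Om) = wsgn L * (if ps L = 0 then 1 else 0) * phi (kw L)"
proof (cases "ps L = 0")
 case True
 then show ?thesis unfolding wd_eq[OF assms] by (simp add: Zb(7) phi_def cinner_scaleC_right)
next
 case False
 then have 1: "ps L = 1" by (cases "ps L") simp_all
 have "Gm * (j (kw L) * Z) = (Gm * j (kw L)) * Z" by (simp add: mult.assoc)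
 also have "... = - (j (kw L) * Z * Gm)" unfolding j_even(2) by (simp add: mult.assoc Z(4))
 finally have "ip Om (app (j (kw L) * Z) Om) = 0" by (rule odd_vector_zero)
 then show ?thesis unfolding wd_eq[OF assms] 1 Zb(8) by (simp add: cinner_scaleC_right)
qed

text \<open>The map that \<open>rho\<close> induces on the coefficient of \<open>Z\<close>; after
  compression it is the \<open>pauli_x\<close> component of the transfer map.\<close>

definition rk' :: "'k bop => 'k bop" where
 "rk' A = bit_sign si0 *c (SUM mu:I. mpar mu *c (Sm mu * A * adj (Sm mu)))"

lemma rho_j_Z: "rho (j A * Z) = j (rk' A) * Z"
proof -
 have "j (SUM mu:I. mpar mu *c (Sm mu * A * adj (Sm mu))) = (SUM mu:I. mpar mu *c (eu mu mu * rho (j A)))"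
  unfolding j_sum by (rule sum.cong[OF refl]) (simp add: Sm_sandwich j_scaleC j_mult j_jE j_rk Et_diag)
 also have "... = Par * rho (j A)" by (simp add: Par_def sum_distrib_right)
 finally have 1: "j (rk' A) = bit_sign si0 *c (rho (j A) * Par)" by (simp add: rk'_def j_scaleC Par_rho_j)
 have "rho (j A * Z) = bit_sign si0 *c (rho (j A) * (Z * Par))" by (simp add: rho_Z_eq)
 also have "Z * Par = Par * Z" by (rule Z_central[OF Par_props(4)])
 finally show ?thesis unfolding 1 by (simp add: mult.assoc)
qed

text \<open>Represents matrix elements on K as matrix elements of \<open>j A\<close>, so that weak
  limits descend from the GNS space to K.\<close>

lemma vector_embedding: "EX V. ALL u v A. ip u (app A v) = ip (V u) (app (j A) (V v))"
proof -
 have inj: "j x = 0 ==> x = 0" for x using j_inj[of x 0] by (simp add: j_zero)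
 obtain xi eta where xi: "ip xi xi = 1" and eta: "ip eta eta = 1" and feta: "app (j (ketbra xi xi)) eta = eta"
  by (rule minimal_vector[of j, OF j_mult inj one_neq_zero])
 show ?thesis
 proof (intro exI[of _ "%u. app (j (ketbra u xi)) eta"] allI)
  fix u v A
  have "adj (ketbra u xi) * A * ketbra v xi = ip u (app A v) *c ketbra xi xi"
   by (simp add: mult.assoc ketbra_mult_left[of A] ketbra_mult_ketbra)
  from arg_cong[OF this, of "%B. ip eta (app (j B) eta)"]
  have "ip eta (app (j (adj (ketbra u xi)) * j A * j (ketbra v xi)) eta) = ip u (app A v)"
   by (simp only: j_mult j_scaleC app_simps cinner_scaleC_right feta eta mult_1_right)
  then show "ip u (app A v) = ip (app (j (ketbra u xi)) eta) (app (j A) (app (j (ketbra v xi)) eta))"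
   by (simp add: cinner_adj flip: j_adj)
 qed
qed

lemma even_limit: "(%n. ip u (app ((rk ^^ n) A) v)) ----> phi A * ip u v"
proof -
 obtain V where V: "!!u v A. ip u (app A v) = ip (V u) (app (j A) (V v))" using vector_embedding by blast
 have "j ((rk ^^ n) A) = (rho ^^ n) (j A)" for n by (induction n) (simp_all add: j_rk)
 then show ?thesis using weak_limit_even[OF j_even, of "V u" A "V v"] V[of u 1 v] by (simp add: V[of u _ v] j_one phi_def)
qed

lemma odd_limit: "(%n. ip u (app ((rk' ^^ n) A) v)) ----> 0"
proof -
 obtain V where V: "!!u v A. ip u (app A v) = ip (V u) (app (j A) (V v))" using vector_embedding by blast
 have odd: "Gm * (j A * Z) = - (j A * Z * Gm)"
 proof -
  have "Gm * (j A * Z) = (Gm * j A) * Z" by (simp add: mult.assoc)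
  then show ?thesis unfolding j_even(2) by (simp add: mult.assoc Z(4))
 qed
 have "j ((rk' ^^ n) A) * Z = (rho ^^ n) (j A * Z)" for n
  by (induction n) (simp_all only: funpow.simps o_apply id_apply rho_j_Z[symmetric])
 from arg_cong[OF this, of "%T. T * Z"]
 have "j ((rk' ^^ n) A) = (rho ^^ n) (j A * Z) * Z" for n by (simp only: mult.assoc Z(2) mult_1_right)
 then show ?thesis using weak_limit_odd[OF M_ops(3)[OF j_even(1) Z(1)] odd, of "V u" "app Z (V v)"] by (simp add: V)
qed

text \<open>Two families with the same sandwiches \<open>A \<mapsto> X\<^sub>\<mu> A X\<^sub>\<nu>\<^sup>*\<close> differ by a phase.\<close>

lemma sandwich_unique:
 fixes X X' :: "nat set => 'k bop"
 assumes iso: "!!mu. mu : I ==> adj (X mu) * X mu = 1"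
  and eq: "!!mu nu A. mu : I ==> nu : I ==> X mu * A * adj (X nu) = X' mu * A * adj (X' nu)"
 shows "EX c. cmod c = 1 & (ALL mu:I. X' mu = c *c X mu)"
proof -
 \<comment> \<open>These quotients satisfy \<open>x mu * A * adj (x nu) = A\<close> for all
   \<open>A\<close>, which makes each of them scalar and all the scalars one common phase.\<close>
 define x where "x mu = adj (X mu) * X' mu" for mu
 have xx: "x mu * A * adj (x nu) = A" if "mu : I" "nu : I" for mu nu A
 proof -
  have "x mu * A * adj (x nu) = adj (X mu) * (X' mu * A * adj (X' nu)) * X nu" by (simp add: x_def mult.assoc)
  also have "... = (adj (X mu) * X mu) * A * (adj (X nu) * X nu)" unfolding eq[OF that, symmetric] by (simp only: mult.assoc)
  finally show ?thesis by (simp add: iso that)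
 qed
 have scalar: "EX c. x nu = c *c 1" if nu: "nu : I" for nu
 proof -
  have comm: "adj (x nu) * A = A * adj (x nu)" for A
  proof -
   have "x nu * (adj (x nu) * A - A * adj (x nu)) = x nu * 1 * adj (x nu) * A - x nu * A * adj (x nu)"
    by (simp add: right_diff_distrib mult.assoc)
   also have "... = 0" by (simp only: xx[OF nu nu]) simp
   finally have "x nu * (adj (x nu) * A - A * adj (x nu)) * adj (x nu) = 0" by simp
   then show ?thesis unfolding xx[OF nu nu] by simp
  qed
  obtain c where "adj (x nu) = c *c 1" using central_bop_scalar[OF comm] by blast
  from arg_cong[OF this, of adj] show ?thesis by auto
 qed
 then obtain k where k: "!!nu. nu : I ==> x nu = k nu *c 1" by metis
 have one: "w = w'" if "w *c (1 :: 'k bop) = w' *c 1" for w w'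
 proof -
  have "(w - w') *c (1 :: 'k bop) = 0" using that by (simp add: cvs.scale_left_diff_distrib)
  then show ?thesis using one_neq_zero by (simp add: cvs.scale_eq_0_iff)
 qed
 have kk: "k mu * cnj (k nu) = 1" if "mu : I" "nu : I" for mu nu
 proof (rule one)
  show "(k mu * cnj (k nu)) *c (1 :: 'k bop) = 1 *c 1"
   using xx[OF that, of 1] by (simp add: k that scaleC_scaleC mult.commute)
 qed
 define c where "c = k {}"
 have c1: "c * cnj c = 1" using kk I(2) by (simp add: c_def)
 then have "(cmod c)\<^sup>2 = 1" by (metis complex_norm_square of_real_1 of_real_eq_iff)
 then have "cmod c = 1" using power2_eq_1_iff[of "cmod c"] by (smt (verit) norm_ge_zero)
 moreover have "X' mu = c *c X mu" if mu: "mu : I" for mu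
 proof -
  have "X mu = X' mu * adj (x {})"
  proof -
   have "X mu * 1 * adj (X {}) * X {} = X' mu * 1 * adj (X' {}) * X {}" using eq[OF mu I(2), of 1] by simp
   then have "X mu * (adj (X {}) * X {}) = X' mu * adj (x {})" by (simp add: x_def mult.assoc)
   then show ?thesis by (simp add: iso I(2))
  qed
  then have "X mu = cnj c *c X' mu" by (simp add: k I(2) c_def)
  then have "c *c X mu = (c * cnj c) *c X' mu" by (simp add: scaleC_scaleC)
  then show ?thesis by (simp add: c1)
 qed
 ultimately show ?thesis by blast
qed

text \<open>Conjugation by \<open>Y\<close> multiplies \<open>Z\<close> by the sign of
  \<open>q\<close>, whence the factor \<open>bit_sign (q * card_parity mu)\<close>. Since
  \<open>K\<close> preserves parity, the same power of \<open>Z\<close> corrects the rotated units,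
  so both families have equal sandwiches.\<close>

lemma covariance:
 assumes Y: "unitary_op s Y" and V: "unitary_op s V"
  and YV: "!!A. conj_by Y (j A) = j (conj_by V A)" "conj_by Y Z = bit_sign q *c Z"
  and Yrho: "!!T. conj_by Y (rho T) = rho (conj_by Y T)"
  and YE: "!!mu nu. mu : I ==> nu : I ==>
   conj_by Y (eu mu nu) = (SUM si:I. SUM tau:I. (K si mu * cnj (K tau nu)) *c eu si tau)"
  and K: "!!si mu. si : I ==> mu : I ==> K si mu ~= 0 ==> card_parity si = card_parity mu"
 shows "EX c. cmod c = 1 &
  (ALL mu:I. bit_sign (q * card_parity mu) *c (SUM si:I. K si mu *c Sm si) = c *c conj_by V (Sm mu))"
proof -
 note cY = conj_by_simps[OF Y] and cV = conj_by_simps[OF V]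
 define X' where "X' mu = bit_sign (q * card_parity mu) *c (SUM si:I. K si mu *c Sm si)" for mu
 have YZ: "conj_by Y (Zb b) = bit_sign (q * b) *c Zb b" for b by (cases b) (simp_all add: Zb cY YV)
 have "EX c. cmod c = 1 & (ALL mu:I. X' mu = c *c conj_by V (Sm mu))"
 proof (rule sandwich_unique)
  fix mu assume mu: "mu : I"
  show "adj (conj_by V (Sm mu)) * conj_by V (Sm mu) = 1" by (simp add: cV(8) cV(1)[symmetric] Sm_ortho mu cV(4))
  fix nu A assume nu: "nu : I"
  define B where "B = conj_by (adjoint V) A"
  have BA: "conj_by V B = A" by (simp add: B_def cV(10))
  let ?b = "card_parity mu + card_parity nu"
  show "conj_by V (Sm mu) * A * adj (conj_by V (Sm nu)) = X' mu * A * adj (X' nu)"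
  proof (rule j_inj)
   have "conj_by V (Sm mu) * A * adj (conj_by V (Sm nu)) = conj_by V (Sm mu * B * adj (Sm nu))" by (simp add: cV BA)
   then have "j (conj_by V (Sm mu) * A * adj (conj_by V (Sm nu))) = conj_by Y (Et mu nu * rho (j B))"
    by (simp add: YV(1)[symmetric] Sm_sandwich mu nu j_mult j_jE j_rk)
   also have "... = conj_by Y (eu mu nu) * (bit_sign (q * ?b) *c Zb ?b) * rho (j A)"
    by (simp only: Et_def cY(1) YZ Yrho YV(1) BA)
   also have "... = (SUM si:I. SUM tau:I. (bit_sign (q * ?b) * (K si mu * cnj (K tau nu))) *c (eu si tau * Zb ?b * rho (j A)))"
    by (simp add: YE mu nu sum_distrib_left sum_distrib_right cvs.scale_sum_right scaleC_scaleC del: bit_sign_simps)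
   also have "... = (SUM si:I. SUM tau:I. (bit_sign (q * ?b) * (K si mu * cnj (K tau nu))) *c (Et si tau * rho (j A)))"
   proof (intro sum.cong refl)
    fix si tau assume st: "si : I" "tau : I"
    show "(bit_sign (q * ?b) * (K si mu * cnj (K tau nu))) *c (eu si tau * Zb ?b * rho (j A)) =
     (bit_sign (q * ?b) * (K si mu * cnj (K tau nu))) *c (Et si tau * rho (j A))"
    proof (cases "K si mu = 0 \<or> K tau nu = 0")
     case True
     then show ?thesis by auto
    next
     case False
     then have "card_parity si = card_parity mu" "card_parity tau = card_parity nu"
      using K[OF st(1) mu] K[OF st(2) nu] by blast+
     then show ?thesis by (simp only: Et_def)
    qed
   qed
   also have "... = (SUM si:I. SUM tau:I. (bit_sign (q * ?b) * (K si mu * cnj (K tau nu))) *c j (Sm si * A * adj (Sm tau)))"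
    by (intro sum.cong refl) (simp only: Sm_sandwich j_mult j_jE j_rk)
   also have "... = j (bit_sign (q * ?b) *c (SUM si:I. SUM tau:I. (K si mu * cnj (K tau nu)) *c (Sm si * A * adj (Sm tau))))"
    by (simp only: j_sum j_scaleC cvs.scale_sum_right scaleC_scaleC)
   also have "(SUM si:I. SUM tau:I. (K si mu * cnj (K tau nu)) *c (Sm si * A * adj (Sm tau))) =
     (SUM si:I. K si mu *c Sm si) * A * adj (SUM tau:I. K tau nu *c Sm tau)"
   proof -
    have "(SUM si:I. K si mu *c Sm si) * A * adj (SUM tau:I. K tau nu *c Sm tau) =
      (SUM si:I. SUM tau:I. (K si mu *c Sm si * A) * adj (K tau nu *c Sm tau))"
     unfolding adj_sum sum_distrib_right[of "%si. K si mu *c Sm si" I A] sum_product ..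
    then show ?thesis by (simp add: scaleC_scaleC mult.commute)
   qed
   also have "bit_sign (q * ?b) *c ... = X' mu * A * adj (X' nu)"
    by (simp only: X'_def distrib_left bit_sign_add bop_mult_scaleC adj_simps(7) complex_cnj_mult bit_sign_simps scaleC_scaleC mult.commute)
   finally show "j (conj_by V (Sm mu) * A * adj (conj_by V (Sm nu))) = j (X' mu * A * adj (X' nu))" .
  qed
 qed
 then show ?thesis unfolding X'_def .
qed

lemma conj_p0:
 assumes "unitary_op s V" "!!A. conj_by Y (j A) = j (conj_by V A)" "conj_by Y P = P"
 shows "conj_by V p0 = p0" by (rule j_inj) (simp add: assms(2)[symmetric] p0 assms(3))

lemma phi_invariant:
 assumes Y: "unitary_op s Y" "Y Om = Om" "adjoint Y Om = Om" and "!!A. conj_by Y (j A) = j (conj_by V A)"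
 shows "phi (conj_by V A) = conj_bit s (phi A)"
by (metis (full_types) Y(1,2,3) phi_def app_conj_by assms(4) unitary_op_linear(6))

end

section \<open>Kronecker products, transfer maps and the operator norm of matrices\<close>

lemma sum_div_mod: "(SUM k<m * n. f (k div n) (k mod n)) = (SUM i<m. SUM j<n. f i (j :: nat))"
proof (cases "n = 0")
 case False
 show ?thesis
 proof (induction m)
  case (Suc m)
  have "(SUM k<Suc m * n. f (k div n) (k mod n)) =
    (SUM k<m * n. f (k div n) (k mod n)) + (SUM k=m * n..<m * n + n. f (k div n) (k mod n))"
   by (simp add: sum.atLeastLessThan_concat add.commute flip: atLeast0LessThan)
  also have "(SUM k=m * n..<m * n + n. f (k div n) (k mod n)) = (SUM j<n. f ((j + m * n) div n) ((j + m * n) mod n))"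
   using sum.shift_bounds_nat_ivl[of "%k. f (k div n) (k mod n)" 0 "m * n" n] by (simp add: atLeast0LessThan add.commute)
  also have "... = (SUM j<n. f m j)" by (rule sum.cong[OF refl]) simp
  finally show ?case using Suc by simp
 qed simp
qed simp

lemma kron_carrier: "A : carrier_mat m m ==> B : carrier_mat n n ==> kron A B : carrier_mat (m * n) (m * n)"
 by (simp add: kron_def)

lemma kron_index:
 "A : carrier_mat m m ==> B : carrier_mat n n ==> i < m * n ==> j < m * n ==>
  kron A B $$ (i, j) = A $$ (i div n, j div n) * B $$ (i mod n, j mod n)" by (simp add: kron_def)

lemma div_mod_less: "i < m * n ==> i div n < m & i mod n < (n :: nat)"
 by (metis less_mult_imp_div_less mod_less_divisor mult_0_right not_gr_zero not_less_zero)

lemma kron_mult: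
 assumes "A : carrier_mat m m" "B : carrier_mat n n" "A' : carrier_mat m m" "B' : carrier_mat n n"
 shows "kron A B * kron A' B' = kron (A * A') (B * B')"
proof (rule eq_matI)
 fix i j assume "i < dim_row (kron (A * A') (B * B'))" "j < dim_col (kron (A * A') (B * B'))"
 then have ij: "i < m * n" "j < m * n" using assms by (simp_all add: kron_def)
 note dm = div_mod_less[OF ij(1)] div_mod_less[OF ij(2)]
 have "(kron A B * kron A' B') $$ (i, j) = (SUM k<m * n. kron A B $$ (i, k) * kron A' B' $$ (k, j))"
  using ij kron_carrier[OF assms(1,2)] kron_carrier[OF assms(3,4)] by (simp add: scalar_prod_def atLeast0LessThan)
 also have "... = (SUM k<m * n. (A $$ (i div n, k div n) * B $$ (i mod n, k mod n)) * (A' $$ (k div n, j div n) * B' $$ (k mod n, j mod n)))"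
  by (rule sum.cong[OF refl]) (simp add: kron_index[OF assms(1,2)] kron_index[OF assms(3,4)] ij)
 also have "... = (SUM k<m. SUM l<n. (A $$ (i div n, k) * B $$ (i mod n, l)) * (A' $$ (k, j div n) * B' $$ (l, j mod n)))"
  by (rule sum_div_mod)
 also have "... = (SUM k<m. A $$ (i div n, k) * A' $$ (k, j div n)) * (SUM l<n. B $$ (i mod n, l) * B' $$ (l, j mod n))"
  unfolding sum_product by (intro sum.cong refl) (simp add: mult_ac)
 also have "... = kron (A * A') (B * B') $$ (i, j)"
  using assms dm ij by (simp add: kron_def scalar_prod_def atLeast0LessThan)
 finally show "(kron A B * kron A' B') $$ (i, j) = kron (A * A') (B * B') $$ (i, j)" .
qed (use assms in "simp_all add: kron_def")

lemma kron_adjoint: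
 assumes "A : carrier_mat m m" "B : carrier_mat n n"
 shows "mat_adjoint (kron A B) = kron (mat_adjoint A) (mat_adjoint B)"
 by (rule eq_matI) (use assms in "auto simp: kron_def mat_adjoint_index div_mod_less")

lemma pauli_carrier [simp]: "pauli_x : carrier_mat 2 2" "pauli_z : carrier_mat 2 2" "mat_bit_power pauli_z b : carrier_mat 2 2"
 by (auto simp: pauli_x_def pauli_z_def mat_bit_power_def mat_of_rows_list_def)

lemma less_2_cases': "i < (2 :: nat) ==> i = 0 \<or> i = 1" by auto

lemma mat2_eqI:
 assumes "A : carrier_mat 2 2" "B : carrier_mat 2 2" "A $$ (0, 0) = B $$ (0, 0)" "A $$ (0, 1) = B $$ (0, 1)"
  "A $$ (1, 0) = B $$ (1, 0)" "A $$ (1, 1) = B $$ (1, 1)"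
 shows "A = B" using assms by (intro eq_matI) (auto dest!: less_2_cases')

lemma pauli_index [simp]:
 "pauli_x $$ (0, 0) = 0" "pauli_x $$ (0, 1) = 1" "pauli_x $$ (1, 0) = 1" "pauli_x $$ (1, 1) = 0"
 "pauli_z $$ (0, 0) = 1" "pauli_z $$ (0, 1) = 0" "pauli_z $$ (1, 0) = 0" "pauli_z $$ (1, 1) = - 1"
 by (simp_all add: pauli_x_def pauli_z_def mat_of_rows_list_def)

lemmas pauli_index_Suc [simp] = pauli_index[unfolded One_nat_def]

lemma sum_less_2: "(SUM i<2. f i) = f 0 + f (1 :: nat)" by (simp add: numeral_2_eq_2)

lemma mult2_index:
 "A : carrier_mat 2 2 ==> B : carrier_mat 2 2 ==> i < 2 ==> j < 2 ==>
  (A * B) $$ (i, j) = A $$ (i, 0) * B $$ (0, j) + A $$ (i, 1) * (B $$ (1, j) :: complex)"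
 by (simp add: scalar_prod_def atLeast0LessThan sum_less_2)

lemma pauli_z_power:
 "mat_adjoint (mat_bit_power pauli_z b) = mat_bit_power pauli_z b"
 "mat_bit_power pauli_z b * mat_bit_power pauli_z b = idm 2"
 "mat_bit_power pauli_z b * pauli_x * mat_bit_power pauli_z b = bit_sign b *m pauli_x"
proof -
 have d: "dim_row pauli_z = 2" "dim_col pauli_z = 2" "dim_row pauli_x = 2" "dim_col pauli_x = 2"
  using carrier_matD[OF pauli_carrier(1)] carrier_matD[OF pauli_carrier(2)] by simp_all
 have c: "pauli_z * pauli_x : carrier_mat 2 2" by (rule mult_carrier_mat[OF pauli_carrier(2,1)])
 have b: "mat_bit_power pauli_z b = (if b = 0 then idm 2 else pauli_z)" by (simp add: mat_bit_power_def d)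
 have z: "mat_adjoint pauli_z = pauli_z" "mat_adjoint (idm 2) = (idm 2 :: complex mat)" by (rule mat2_eqI; simp add: d)+
 have zz: "pauli_z * pauli_z = idm 2"
  by (rule mat2_eqI) (simp_all add: mult2_index mult_carrier_mat[OF pauli_carrier(2,2)] del: index_mult_mat(1))
 have zxz: "pauli_z * pauli_x * pauli_z = - 1 *m pauli_x"
  by (rule mat2_eqI) (simp_all add: mult2_index[OF c] mult2_index c d mult_carrier_mat[OF c pauli_carrier(2)] smult_carrier_mat[OF pauli_carrier(1)] del: index_mult_mat(1))
 have one: "1 *m pauli_x = pauli_x" by (rule mat2_eqI) (simp_all add: d)
 show "mat_adjoint (mat_bit_power pauli_z b) = mat_bit_power pauli_z b" by (simp add: b z)
 show "mat_bit_power pauli_z b * mat_bit_power pauli_z b = idm 2" by (simp add: b zz)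
 show "mat_bit_power pauli_z b * pauli_x * mat_bit_power pauli_z b = bit_sign b *m pauli_x"
  using left_mult_one_mat[OF pauli_carrier(1)] right_mult_one_mat[OF pauli_carrier(1)] by (simp add: b zxz bit_sign_def one)
qed

lemma mat_sum_carrier [simp]: "mat_sum n F K : carrier_mat n n" by (simp add: mat_sum_def)

text \<open>Conjugation by \<open>s\<close> fixes the identity and multiplies \<open>pauli_x\<close>
  by \<open>z\<close>, so the even and the odd component do not mix.\<close>

lemma kron_sandwich:
 assumes v: "v : carrier_mat m m" and xy: "x : carrier_mat m m" "y : carrier_mat m m"
  and s: "s : carrier_mat 2 2" "mat_adjoint s = s" "s * s = idm 2" "s * pauli_x * s = z *m pauli_x"
 shows "kron v s * (kron x (idm 2) + kron y pauli_x) * mat_adjoint (kron v s) =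
  kron (v * x * mat_adjoint v) (idm 2) + kron (v * y * mat_adjoint v) (z *m pauli_x)"
proof -
 have one: "idm 2 : carrier_mat 2 2" by simp
 have va: "mat_adjoint v : carrier_mat m m" by (rule mat_adjoint_carrier[OF v])
 have vx: "v * x : carrier_mat m m" "v * y : carrier_mat m m" "s * pauli_x : carrier_mat 2 2"
  by (rule mult_carrier_mat[OF v xy(1)], rule mult_carrier_mat[OF v xy(2)], rule mult_carrier_mat[OF s(1) pauli_carrier(1)])
 have k: "kron v s : carrier_mat (m * 2) (m * 2)" "kron x (idm 2) : carrier_mat (m * 2) (m * 2)"
  "kron y pauli_x : carrier_mat (m * 2) (m * 2)" "kron (mat_adjoint v) s : carrier_mat (m * 2) (m * 2)"
  by (rule kron_carrier[OF v s(1)], rule kron_carrier[OF xy(1) one], rule kron_carrier[OF xy(2) pauli_carrier(1)],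
   rule kron_carrier[OF va s(1)])
 have "kron v s * (kron x (idm 2) + kron y pauli_x) * mat_adjoint (kron v s) =
   kron v s * kron x (idm 2) * kron (mat_adjoint v) s + kron v s * kron y pauli_x * kron (mat_adjoint v) s"
  unfolding kron_adjoint[OF v s(1)] s(2) mult_add_distrib_mat[OF k(1-3)]
  by (rule add_mult_distrib_mat[OF mult_carrier_mat[OF k(1,2)] mult_carrier_mat[OF k(1,3)] k(4)])
 also have "kron v s * kron x (idm 2) * kron (mat_adjoint v) s = kron (v * x * mat_adjoint v) (s * s)"
  unfolding kron_mult[OF v s(1) xy(1) one] right_mult_one_mat[OF s(1)] by (rule kron_mult[OF vx(1) s(1) va s(1)])
 also have "kron v s * kron y pauli_x * kron (mat_adjoint v) s = kron (v * y * mat_adjoint v) (s * pauli_x * s)"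
  unfolding kron_mult[OF v s(1) xy(2) pauli_carrier(1)] by (rule kron_mult[OF vx(2,3) va s(1)])
 finally show ?thesis unfolding s .
qed

lemma mat_sum_kron:
 assumes A: "!!k. k : K ==> A k : carrier_mat m m" and B: "!!k. k : K ==> B k : carrier_mat m m"
 shows "mat_sum (m * 2) (%k. kron (A k) (idm 2) + kron (B k) (z k *m pauli_x)) K =
  kron (mat_sum m A K) (idm 2) + kron (mat_sum m (%k. z k *m B k) K) pauli_x" (is "?l = ?r")
proof -
 have one: "idm 2 : carrier_mat 2 2" by simp
 have zx: "z k *m pauli_x : carrier_mat 2 2" for k by (rule smult_carrier_mat[OF pauli_carrier(1)])
 note kc = kron_carrier[OF mat_sum_carrier one, of m A K]
  kron_carrier[OF mat_sum_carrier pauli_carrier(1), of m "%k. z k *m B k" K]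
 have rc: "?r : carrier_mat (m * 2) (m * 2)" by (rule add_carrier_mat[OF kc(2)])
 show ?thesis
 proof (rule eq_matI)
  fix i j assume "i < dim_row ?r" "j < dim_col ?r"
  then have ij: "i < m * 2" "j < m * 2" using carrier_matD[OF rc] by (simp_all only:)
  note dm = div_mod_less[OF ij(1)] div_mod_less[OF ij(2)]
  have "?l $$ (i, j) = (SUM k:K. (kron (A k) (idm 2) + kron (B k) (z k *m pauli_x)) $$ (i, j))"
   using ij by (simp only: mat_sum_def index_mat split)
  also have "... = (SUM k:K. A k $$ (i div 2, j div 2) * (idm 2) $$ (i mod 2, j mod 2) +
    (z k *m B k) $$ (i div 2, j div 2) * pauli_x $$ (i mod 2, j mod 2))"
  proof (rule sum.cong[OF refl])
   fix k assume k: "k : K"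
   have 1: "(kron (A k) (idm 2) + kron (B k) (z k *m pauli_x)) $$ (i, j) = kron (A k) (idm 2) $$ (i, j) + kron (B k) (z k *m pauli_x) $$ (i, j)"
    using carrier_matD[OF kron_carrier[OF B[OF k] zx]] ij by (intro index_add_mat(1)) auto
   have 2: "(z k *m pauli_x) $$ (i mod 2, j mod 2) = z k * pauli_x $$ (i mod 2, j mod 2)"
    using carrier_matD[OF pauli_carrier(1)] dm by (intro index_smult_mat(1)) auto
   have 3: "(z k *m B k) $$ (i div 2, j div 2) = z k * B k $$ (i div 2, j div 2)"
    using carrier_matD[OF B[OF k]] dm by (intro index_smult_mat(1)) auto
   show "(kron (A k) (idm 2) + kron (B k) (z k *m pauli_x)) $$ (i, j) =
    A k $$ (i div 2, j div 2) * (idm 2) $$ (i mod 2, j mod 2) +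
    (z k *m B k) $$ (i div 2, j div 2) * pauli_x $$ (i mod 2, j mod 2)"
    unfolding 1 kron_index[OF A[OF k] one ij] kron_index[OF B[OF k] zx ij] 2 3 by (simp only: mult_ac)
  qed
  also have "... = mat_sum m A K $$ (i div 2, j div 2) * (idm 2) $$ (i mod 2, j mod 2) +
    mat_sum m (%k. z k *m B k) K $$ (i div 2, j div 2) * pauli_x $$ (i mod 2, j mod 2)"
   using dm by (simp only: mat_sum_def index_mat split sum.distrib sum_distrib_right)
  also have "... = kron (mat_sum m A K) (idm 2) $$ (i, j) + kron (mat_sum m (%k. z k *m B k) K) pauli_x $$ (i, j)"
   unfolding kron_index[OF mat_sum_carrier one ij] kron_index[OF mat_sum_carrier pauli_carrier(1) ij] ..
  also have "... = ?r $$ (i, j)" using carrier_matD[OF kc(2)] ij by (intro index_add_mat(1)[symmetric]) auto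
  finally show "?l $$ (i, j) = ?r $$ (i, j)" .
 qed (simp_all only: carrier_matD[OF rc] carrier_matD[OF mat_sum_carrier])
qed

lemma transfer_map_kron:
 assumes v: "!!mu. mu : Pow {..<d} ==> v mu : carrier_mat m m" and xy: "x : carrier_mat m m" "y : carrier_mat m m"
 shows "transfer_map (m * 2) d (vhat si v) (kron x (idm 2) + kron y pauli_x) =
  kron (mat_sum m (%mu. v mu * x * mat_adjoint (v mu)) (Pow {..<d})) (idm 2) +
  kron (mat_sum m (%mu. bit_sign (si + card_parity mu) *m (v mu * y * mat_adjoint (v mu))) (Pow {..<d})) pauli_x"
proof -
 have "mat_sum (m * 2) (%mu. vhat si v mu * (kron x (idm 2) + kron y pauli_x) * mat_adjoint (vhat si v mu)) (Pow {..<d}) =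
   mat_sum (m * 2) (%mu. kron (v mu * x * mat_adjoint (v mu)) (idm 2) +
    kron (v mu * y * mat_adjoint (v mu)) (bit_sign (si + card_parity mu) *m pauli_x)) (Pow {..<d})"
  unfolding mat_sum_def vhat_def
  by (intro arg_cong[of _ _ "mat (m * 2) (m * 2)"] ext sum.cong refl arg_cong[of _ _ "%M. M $$ _"]
   kron_sandwich[where m = m] v xy pauli_carrier pauli_z_power)
 then show ?thesis
  unfolding transfer_map_def by (subst (asm) mat_sum_kron) (use v xy in "auto intro!: mult_carrier_mat mat_adjoint_carrier")
qed

text \<open>A crude bound by the entries, enough to turn entrywise into norm convergence in a fixed
  dimension.\<close>

lemma mat_op_norm_bound:
 assumes "A : carrier_mat n n"
 shows "0 <= mat_op_norm A" "mat_op_norm A <= (SUM i<n. SUM j<n. cmod (A $$ (i, j)))"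
proof -
 define X where "X = {x : carrier_vec n. Re (x \<bullet>c x) <= 1}"
 define f where "f x = sqrt (Re ((A *mv x) \<bullet>c (A *mv x)))" for x
 have self: "Re (y \<bullet>c y) = (SUM i<n. (cmod (y $ i))\<^sup>2)" if "y : carrier_vec n" for y
  using that by (simp add: scalar_prod_def atLeast0LessThan complex_mult_cnj cmod_power2)
 have bd: "f x <= (SUM i<n. SUM j<n. cmod (A $$ (i, j)))" if x: "x : X" for x
 proof -
  have xc: "x : carrier_vec n" and x1: "(SUM i<n. (cmod (x $ i))\<^sup>2) <= 1" using x self by (auto simp: X_def)
  have xi: "cmod (x $ i) <= 1" if "i < n" for i
  proof -
   have "(cmod (x $ i))\<^sup>2 <= (SUM i<n. (cmod (x $ i))\<^sup>2)" using that by (intro member_le_sum) auto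
   then have "(cmod (x $ i))\<^sup>2 <= 1\<^sup>2" using x1 by simp
   then show ?thesis by (rule power2_le_imp_le) simp
  qed
  have Ax: "A *mv x : carrier_vec n" using assms xc by simp
  have "f x = sqrt (SUM i<n. (cmod ((A *mv x) $ i))\<^sup>2)" unfolding f_def self[OF Ax] ..
  also have "... <= (SUM i<n. \<bar>cmod ((A *mv x) $ i)\<bar>)"
   using L2_set_le_sum_abs[of "%i. cmod ((A *mv x) $ i)" "{..<n}"] by (simp add: L2_set_def)
  also have "... <= (SUM i<n. SUM j<n. cmod (A $$ (i, j)))"
  proof (rule sum_mono)
   fix i assume "i : {..<n}"
   then have "(A *mv x) $ i = (SUM j<n. A $$ (i, j) * x $ j)" using assms xc by (simp add: scalar_prod_def atLeast0LessThan)
   also have "cmod ... <= (SUM j<n. cmod (A $$ (i, j) * x $ j))" by (rule norm_sum)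
   also have "... <= (SUM j<n. cmod (A $$ (i, j)))" by (rule sum_mono) (use xi in "simp add: norm_mult mult_left_le")
   finally show "\<bar>cmod ((A *mv x) $ i)\<bar> <= (SUM j<n. cmod (A $$ (i, j)))" by simp
  qed
  finally show ?thesis .
 qed
 have norm: "mat_op_norm A = (SUP x\<in>X. f x)" using assms by (simp add: mat_op_norm_def X_def f_def)
 have 0: "0\<^sub>v n : X" by (simp add: X_def)
 have "f (0\<^sub>v n) <= (SUP x\<in>X. f x)" by (rule cSUP_upper[OF 0]) (use bd in "auto simp: bdd_above_def")
 moreover have "0 <= f (0\<^sub>v n)" using assms self[of "A *mv 0\<^sub>v n"] by (simp add: f_def sum_nonneg)
 ultimately show "0 <= mat_op_norm A" unfolding norm by linarith
 show "mat_op_norm A <= (SUM i<n. SUM j<n. cmod (A $$ (i, j)))" unfolding norm by (rule cSUP_least) (use 0 bd in auto)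
qed

lemma mat_op_norm_tendsto_0:
 assumes "!!N. A N : carrier_mat n n" "!!i j. i < n ==> j < n ==> (%N. A N $$ (i, j)) ----> 0"
 shows "(%N. mat_op_norm (A N)) ----> 0"
proof (rule tendsto_sandwich[of "%N. 0"])
 have "(%N. SUM i<n. SUM j<n. cmod (A N $$ (i, j))) ----> (SUM i<n. SUM j<n. cmod 0)"
  by (intro tendsto_sum tendsto_norm assms(2)) auto
 then show "(%N. SUM i<n. SUM j<n. cmod (A N $$ (i, j))) ----> 0" by simp
qed (use mat_op_norm_bound[OF assms(1)] in auto)

lemma mat_list_prod_carrier: "ALL A:set As. A : carrier_mat m m ==> mat_list_prod m As : carrier_mat m m"
 by (induction As) (auto simp: mat_list_prod_def)

lemma mat_list_prod_snoc:
 "ALL A:set As. A : carrier_mat m m ==> B : carrier_mat m m ==> mat_list_prod m (As @ [B]) = mat_list_prod m As * B"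
proof (induction As)
 case Nil
 then show ?case by (simp add: mat_list_prod_def)
next
 case (Cons A As)
 have "mat_list_prod m ((A # As) @ [B]) = A * mat_list_prod m (As @ [B])" by (simp add: mat_list_prod_def)
 also have "... = A * (mat_list_prod m As * B)" using Cons by simp
 also have "... = A * mat_list_prod m As * B"
  by (rule assoc_mult_mat[symmetric, of _ m m _ m _ m]) (use Cons mat_list_prod_carrier in auto)
 finally show ?case by (simp add: mat_list_prod_def)
qed

lemma mat_trace_mult:
 "A : carrier_mat n n ==> B : carrier_mat n n ==> mat_trace (A * B) = (SUM i<n. SUM j<n. A $$ (i, j) * B $$ (j, i))"
 by (simp add: mat_trace_def scalar_prod_def atLeast0LessThan)

text \<open>\<open>pauli_x\<close> is traceless and half the identity has trace 1, so only the even
  component contributes.\<close>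

lemma mat_trace_kron:
 assumes D: "D : carrier_mat m m" and xy: "x : carrier_mat m m" "y : carrier_mat m m"
 shows "mat_trace (kron D ((1 / 2) *m idm 2) * (kron x (idm 2) + kron y pauli_x)) = mat_trace (D * x)"
proof -
 let ?h = "(1 / 2 :: complex) *m idm 2"
 have c: "?h : carrier_mat 2 2" "idm 2 : carrier_mat 2 (2::nat)" by simp_all
 have "kron D ?h * (kron x (idm 2) + kron y pauli_x) = kron (D * x) (?h * idm 2) + kron (D * y) (?h * pauli_x)"
  using kron_carrier[OF D c(1)] kron_carrier[OF xy(1) c(2)] kron_carrier[OF xy(2) pauli_carrier(1)]
  by (simp add: mult_add_distrib_mat[of _ "m * 2" "m * 2"] kron_mult[OF D c(1) xy(1) c(2)] kron_mult[OF D c(1) xy(2) pauli_carrier(1)])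
 moreover have "?h * idm 2 = ?h" by simp
 moreover have "mat_trace (kron (D * x) ?h + kron (D * y) (?h * pauli_x)) = mat_trace (D * x)"
 proof -
  have Dx: "D * x : carrier_mat m m" "D * y : carrier_mat m m" "?h * pauli_x : carrier_mat 2 2" using D xy mult_carrier_mat[OF c(1) pauli_carrier(1)] by simp_all
  have "mat_trace (kron (D * x) ?h + kron (D * y) (?h * pauli_x)) =
    (SUM k<m * 2. (D * x) $$ (k div 2, k div 2) * ?h $$ (k mod 2, k mod 2) + (D * y) $$ (k div 2, k div 2) * (?h * pauli_x) $$ (k mod 2, k mod 2))"
   unfolding mat_trace_def using kron_carrier[OF Dx(2,3)]
   by (intro sum.cong) (auto simp: kron_index[OF Dx(1) c(1)] kron_index[OF Dx(2,3)] simp del: index_mult_mat index_smult_mat)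
  also have "... = (SUM i<m. SUM a<2. (D * x) $$ (i, i) * ?h $$ (a, a) + (D * y) $$ (i, i) * (?h * pauli_x) $$ (a, a))"
   by (rule sum_div_mod)
  also have "... = (SUM i<m. (D * x) $$ (i, i))"
   by (rule sum.cong[OF refl]) (simp add: sum_less_2 mult2_index[OF c(1) pauli_carrier(1)] del: index_mult_mat(1))
  also have "... = mat_trace (D * x)" unfolding mat_trace_def using carrier_matD(1)[OF Dx(1)] by (simp only:)
  finally show ?thesis .
 qed
 ultimately show ?thesis by simp
qed

section \<open>Compression to the finite-dimensional range of p0\<close>

definition orthonormal :: "nat => (nat => 'k::complex_hilbert) => bool" where
 "orthonormal m e \<longleftrightarrow> (ALL i<m. ALL j<m. ip (e i) (e j) = (if i = j then 1 else 0))"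

text \<open>Takes an orthonormal family of maximal length in the range of \<open>p\<close>. The
  length is bounded because the rank-one operators from \<open>e 0\<close> to the \<open>e k\<close>
  are independent and lie in the corner.\<close>

lemma finite_rank_basis:
 fixes p :: "'k::complex_hilbert bop"
 assumes p: "p * p = p" "adj p = p"
  and fin: "!!A. EX l :: nat => complex. (EX k<Suc R. l k ~= 0) & (SUM k<Suc R. l k *c (p * A k * p)) = 0"
 shows "EX m e. orthonormal m e & (ALL i<m. app p (e i) = e i) & (SUM i<m. ketbra (e i) (e i)) = p"
proof -
 define Q where "Q m \<longleftrightarrow> (EX e. orthonormal m e & (ALL i<m. app p (e i) = e i))" for m
 have bound: "m <= R" if Qm: "Q m" for m
 proof (rule ccontr)
  assume "\<not> m <= R"
  then have mR: "k < m" if "k < Suc R" for k using that by simp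
  obtain e where e: "orthonormal m e" "ALL i<m. app p (e i) = e i" using Qm by (auto simp: Q_def)
  obtain l where l: "EX k<Suc R. l k ~= 0" "(SUM k<Suc R. l k *c (p * ketbra (e k) (e 0) * p)) = 0"
   using fin[of "%k. ketbra (e k) (e 0)"] by blast
  have pk: "p * ketbra (e k) (e 0) * p = ketbra (e k) (e 0)" if "k < Suc R" for k
   using e(2) mR[OF that] mR[of 0] by (simp add: ketbra_mult_left ketbra_mult_right p(2))
  have "l i = 0" if i: "i < Suc R" for i
  proof -
   have "ip (e i) (app (SUM k<Suc R. l k *c (p * ketbra (e k) (e 0) * p)) (e 0)) = (SUM k<Suc R. if k = i then l i else 0)"
    unfolding app_sum cinner_sum_right by (rule sum.cong[OF refl])
     (use e(1) mR i in "auto simp: pk cinner_scaleC_right orthonormal_def simp del: app_simps(6)")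
   also have "... = l i" using i by (simp del: sum.lessThan_Suc)
   finally show ?thesis unfolding l(2) by simp
  qed
  then show False using l(1) by blast
 qed
 have "Q 0" by (simp add: Q_def orthonormal_def)
 then obtain m where m: "Q m" "!!n. Q n ==> n <= m" using Nat.ex_has_greatest_nat[of Q 0 R] bound by blast
 obtain e where e: "orthonormal m e" "ALL i<m. app p (e i) = e i" using m(1) by (auto simp: Q_def)
 define s where "s = (SUM i<m. ketbra (e i) (e i))"
 have ps: "p * s = s" unfolding s_def sum_distrib_left by (rule sum.cong[OF refl]) (use e(2) in "simp add: ketbra_mult_left")
 have es: "ip (e i) (app s x) = ip (e i) x" if "i < m" for i x
 proof -
  have "ip (e i) (app s x) = (SUM k<m. if k = i then ip (e i) x else 0)" unfolding s_def app_sum cinner_sum_right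
   by (rule sum.cong[OF refl]) (use e(1) that in "auto simp: orthonormal_def cinner_scaleC_right")
  then show ?thesis using that by simp
 qed
 have "s = p"
 proof (rule ccontr)
  assume "s ~= p"
  then obtain x where "app s x ~= app p x" using bop_eqI[of s p] by blast
  then have x: "app (p - s) x ~= 0" by simp
  define y where "y = complex_of_real (1 / norm (app (p - s) x)) *c app (p - s) x"
  have yy: "ip y y = 1" unfolding y_def by (rule exists_unit_vector[OF x])
  have "p * (p - s) = p - s" by (simp add: right_diff_distrib p ps)
  then have "app p (app (p - s) x) = app (p - s) x" by (metis app_simps(6))
  then have py: "app p y = y" by (simp only: y_def app_linear(4))
  have "ip (e i) (app (p - s) x) = 0" if "i < m" for i
   using es[OF that, of x] e(2) that by (simp add: cinner_diff_right cinner_adj' p(2))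
  then have ey: "ip (e i) y = 0" if "i < m" for i using that by (simp only: y_def cinner_scaleC_right mult_zero_right)
  then have ye: "ip y (e i) = 0" if "i < m" for i using that by (metis cinner_commute complex_cnj_zero)
  have "Q (Suc m)" unfolding Q_def
  proof (intro exI[of _ "%i. if i = m then y else e i"] conjI)
   show "orthonormal (Suc m) (%i. if i = m then y else e i)" using e(1) yy ey ye by (auto simp: orthonormal_def less_Suc_eq)
   show "ALL i<Suc m. app p (if i = m then y else e i) = (if i = m then y else e i)"
    using e(2) py by (auto simp: less_Suc_eq)
  qed
  then show False using m(2) by fastforce
 qed
 then show ?thesis using e unfolding s_def by blast
qed

locale matrix_rep = index_rep d a om pi Om Gm j Z
 for d :: nat and a :: "(int => complex vec) => 'a::cstar_algebra" and om and pi :: "'a => 'h::complex_hilbert bop" and Om and Gm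
  and j :: "'k::complex_hilbert bop => 'h bop" and Z +
 fixes m :: nat and e :: "nat => 'k"
 assumes ortho: "orthonormal m e" and p0_e: "i < m ==> app p0 (e i) = e i" and sum_e: "(SUM i<m. ketbra (e i) (e i)) = p0"
begin

lemma inner_e: "i < m ==> k < m ==> ip (e i) (e k) = (if i = k then 1 else 0)" using ortho by (simp add: orthonormal_def)

lemma expand_p0: "app p0 x = (SUM i<m. ip (e i) x *c e i)" by (simp add: sum_e[symmetric] app_sum)

definition mx :: "'k bop => complex mat" where
 "mx x = mat m m (%(i, k). ip (e i) (app x (e k)))"

lemma mx_carrier [simp]: "mx x : carrier_mat m m" "dim_row (mx x) = m" "dim_col (mx x) = m" by (simp_all add: mx_def)

lemma mx_index [simp]: "i < m ==> k < m ==> mx x $$ (i, k) = ip (e i) (app x (e k))" by (simp add: mx_def)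

lemma mx_mult: "mx (x * p0 * y) = mx x * mx y"
proof (rule eq_matI)
 fix i k assume "i < dim_row (mx x * mx y)" "k < dim_col (mx x * mx y)"
 then have ik: "i < m" "k < m" by simp_all
 have "mx (x * p0 * y) $$ (i, k) = (SUM l<m. ip (e l) (app y (e k)) * ip (e i) (app x (e l)))"
  using ik by (simp add: expand_p0 app_sum_right cinner_sum_right cinner_scaleC_right)
 also have "... = (mx x * mx y) $$ (i, k)" using ik by (simp add: scalar_prod_def atLeast0LessThan mult.commute)
 finally show "mx (x * p0 * y) $$ (i, k) = (mx x * mx y) $$ (i, k)" .
qed simp_all

lemma mx_p0: "mx (p0 * x) = mx x" "mx (x * p0) = mx x" by (rule eq_matI; simp add: cinner_adj' p0 p0_e)+

lemma mx_one: "mx 1 = idm m" by (rule eq_matI) (simp_all add: inner_e)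

lemma mx_adj: "mx (adj x) = mat_adjoint (mx x)"
proof (rule eq_matI)
 fix i k assume "i < dim_row (mat_adjoint (mx x))" "k < dim_col (mat_adjoint (mx x))"
 then have ik: "i < m" "k < m" by simp_all
 have "ip (e i) (app (adj x) (e k)) = cnj (ip (e k) (app x (e i)))"
  by (simp add: cinner_adj[symmetric]) (metis cinner_commute)
 then show "mx (adj x) $$ (i, k) = mat_adjoint (mx x) $$ (i, k)" using ik by simp
qed simp_all

lemma mx_linear: "mx (z *c x) = z *m mx x" "mx (x + y) = mx x + mx y" "mx 0 = 0\<^sub>m m m"
 by (rule eq_matI; simp add: cinner_scaleC_right cinner_add_right)+

lemma mx_sum: "mx (sum f K) = mat_sum m (%k. mx (f k)) K"
 by (rule eq_matI) (simp_all add: mat_sum_def app_sum cinner_sum_right)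

definition um :: "complex mat => 'k bop" where
 "um b = (SUM i<m. SUM k<m. b $$ (i, k) *c ketbra (e i) (e k))"

lemma mx_um: "b : carrier_mat m m ==> mx (um b) = b"
proof (rule eq_matI)
 fix i k assume b: "b : carrier_mat m m" and "i < dim_row b" "k < dim_col b"
 then have ik: "i < m" "k < m" by simp_all
 have "mx (um b) $$ (i, k) = (SUM i'<m. SUM k'<m. b $$ (i', k') * (ip (e k') (e k) * ip (e i) (e i')))"
  using ik by (simp add: um_def app_sum cinner_sum_right cinner_scaleC_right mult.assoc)
 also have "... = (SUM i'<m. SUM k'<m. if k' = k then (if i' = i then b $$ (i, k) else 0) else 0)"
  by (intro sum.cong refl) (use ik in "auto simp: inner_e")
 also have "... = b $$ (i, k)" using ik by simp
 finally show "mx (um b) $$ (i, k) = b $$ (i, k)" .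
qed simp_all

lemma um_p0: "p0 * um b * p0 = um b" unfolding um_def sum_distrib_left sum_distrib_right
 by (intro sum.cong refl) (simp add: ketbra_mult_left ketbra_mult_right p0 p0_e)

lemma um_mx: "um (mx x) = p0 * x * p0"
proof -
 have "p0 * x * p0 = (SUM i<m. ketbra (e i) (e i)) * x * (SUM k<m. ketbra (e k) (e k))" by (simp add: sum_e)
 also have "... = (SUM i<m. SUM k<m. ketbra (e i) (e i) * x * ketbra (e k) (e k))"
  unfolding sum_distrib_right[of "%i. ketbra (e i) (e i)" "{..<m}" x] sum_product ..
 also have "... = um (mx x)" unfolding um_def
  by (intro sum.cong refl) (simp add: mult.assoc ketbra_mult_left[of x] ketbra_mult_ketbra)
 finally show ?thesis by simp
qed

lemma phi_linear: "phi (x + y) = phi x + phi y" "phi (z *c x) = z * phi x" "phi (sum f K) = (SUM k:K. phi (f k))"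
 by (simp_all add: phi_def j_add j_scaleC j_sum app_sum cinner_sum_right cinner_add_right cinner_scaleC_right)

text \<open>The indices are interchanged so that the trace pairing with \<open>mx\<close> returns
  \<open>phi\<close>.\<close>

definition Dm :: "complex mat" where "Dm = mat m m (%(i, k). phi (ketbra (e k) (e i)))"

lemma Dm_carrier [simp]: "Dm : carrier_mat m m" "dim_row Dm = m" "dim_col Dm = m" by (simp_all add: Dm_def)

lemma Dm_trace: "mat_trace (Dm * mx x) = phi x"
proof -
 have "phi x = phi (um (mx x))" by (simp add: um_mx phi_p0)
 also have "... = (SUM i<m. SUM k<m. mx x $$ (i, k) * phi (ketbra (e i) (e k)))" by (simp only: um_def phi_linear)
 also have "... = (SUM k<m. SUM i<m. mx x $$ (i, k) * phi (ketbra (e i) (e k)))" by (rule sum.swap)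
 also have "... = mat_trace (Dm * mx x)" unfolding mat_trace_mult[OF Dm_carrier(1) mx_carrier(1)]
  by (intro sum.cong refl) (simp add: Dm_def mult.commute)
 finally show ?thesis by simp
qed

lemma phi_positive: "phi (adj x * x) = of_real ((norm (app (j x) Om))\<^sup>2)"
 by (simp add: phi_def j_mult j_adj cinner_adj[symmetric] cinner_self)

text \<open>\<open>M_separating\<close> pulled back to K: this is why cutting down to
  \<open>p0\<close> yields a faithful density matrix.\<close>

lemma phi_faithful: "phi (adj x * x) = 0 ==> x * p0 = 0"
proof -
 assume "phi (adj x * x) = 0"
 then have "app (j x) Om = 0" unfolding phi_positive by simp
 then have "j x * P = 0" by (rule M_separating[OF j_even(1)])
 then have "j (x * p0) = j 0" by (simp add: j_mult p0 j_zero)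
 then show ?thesis by (rule j_inj)
qed

lemma m_pos: "0 < m"
proof (rule ccontr)
 assume "\<not> 0 < m"
 then have "p0 = 0" using sum_e by simp
 then have "P = 0" using p0(1) j_zero by simp
 then show False using P_Omega norm_Omega(2) by simp
qed

lemma Dm_density: "faithful_density_matrix m Dm" unfolding faithful_density_matrix_def density_matrix_def
proof (intro conjI ballI impI)
 show "mat_trace Dm = 1"
 proof -
  have "mat_trace (Dm * mx 1) = 1" unfolding Dm_trace by (simp add: phi_def j_one norm_Omega)
  then show ?thesis by (simp add: mx_one)
 qed
 show "(Dm *mv x) \<bullet>c x : \<real>\<^sub>\<ge>\<^sub>0" if x: "x : carrier_vec m" for x
 proof -
  define w where "w = (SUM i<m. x $ i *c e i)"
  \<comment> \<open>Chosen so that \<open>adj t * t\<close> is the rank-one operator of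
    \<open>w\<close>; the unit vector \<open>e 0\<close> exists because \<open>m\<close> is
    positive.\<close>
  define t where "t = ketbra (e 0) w"
  have kw: "ketbra w w = (SUM k<m. SUM i<m. (x $ k * cnj (x $ i)) *c ketbra (e k) (e i))"
  proof (rule bop_eqI)
   fix y
   show "app (ketbra w w) y = app (SUM k<m. SUM i<m. (x $ k * cnj (x $ i)) *c ketbra (e k) (e i)) y"
    by (simp add: w_def app_sum cinner_sum_left cinner_scaleC_left cvs.scale_sum_left cvs.scale_sum_right scaleC_scaleC sum_distrib_left mult_ac)
  qed
  have "(Dm *mv x) \<bullet>c x = (SUM i<m. (SUM k<m. phi (ketbra (e k) (e i)) * x $ k) * cnj (x $ i))"
   using x by (simp add: scalar_prod_def atLeast0LessThan Dm_def)
  also have "... = (SUM i<m. SUM k<m. (x $ k * cnj (x $ i)) * phi (ketbra (e k) (e i)))"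
   by (simp add: sum_distrib_left sum_distrib_right mult_ac)
  also have "... = (SUM k<m. SUM i<m. (x $ k * cnj (x $ i)) * phi (ketbra (e k) (e i)))" by (rule sum.swap)
  also have "... = phi (ketbra w w)" unfolding kw phi_linear ..
  also have "ketbra w w = adj t * t" using inner_e[OF m_pos m_pos] by (simp add: t_def ketbra_mult_ketbra)
  finally show ?thesis unfolding phi_positive by simp
 qed
 show "b = 0\<^sub>m m m" if b: "b : carrier_mat m m" and z: "mat_trace (Dm * (mat_adjoint b * b)) = 0" for b
 proof -
  have up: "um b * p0 = um b" by (subst (1 2) um_p0[symmetric]) (simp add: mult.assoc p0)
  have "adj (um b) * p0 * um b = adj (um b) * um b"
   by (subst (2 4) um_p0[symmetric]) (simp add: mult.assoc[symmetric] p0, simp add: mult.assoc p0)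
  then have "mx (adj (um b) * um b) = mat_adjoint b * b" using mx_mult[of "adj (um b)" "um b"] by (simp add: mx_adj mx_um b)
  then have "phi (adj (um b) * um b) = 0" using z Dm_trace[of "adj (um b) * um b"] by simp
  then have "um b = 0" using phi_faithful[of "um b"] up by simp
  then show ?thesis using mx_um[OF b] mx_linear(3) by simp
 qed
qed simp

definition v :: "nat set => complex mat" where "v mu = mx (Sm mu)"

lemma v_carrier: "v mu : carrier_mat m m" by (simp add: v_def)

text \<open>\<open>Sm_p0\<close> inserts \<open>p0\<close> between the factors, so the compression
  of the product is the product of the compressions.\<close>

lemma mx_sandwich:
 assumes "mu : I" "nu : I"
 shows "mx (Sm mu * A * adj (Sm nu)) = v mu * mx A * mat_adjoint (v nu)"
proof -
 have "mx (Sm mu * A * adj (Sm nu)) = mx (p0 * (Sm mu * A * adj (Sm nu)) * p0)" by (simp add: mx_p0)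
 also have "p0 * (Sm mu * A * adj (Sm nu)) * p0 = (p0 * Sm mu) * A * (adj (Sm nu) * p0)" by (simp only: mult.assoc)
 also have "... = (p0 * Sm mu * p0) * A * (p0 * adj (Sm nu) * p0)" using Sm_p0(2)[OF assms(1)] Sm_p0(1)[OF assms(2)] by simp
 also have "... = p0 * ((Sm mu * p0 * A) * p0 * adj (Sm nu)) * p0" by (simp only: mult.assoc)
 also have "mx ... = v mu * mx A * mat_adjoint (v nu)" by (simp add: mx_p0 mx_mult v_def mx_adj)
 finally show ?thesis .
qed

lemma mx_rk: "mx (rk A) = mat_sum m (%mu. v mu * mx A * mat_adjoint (v mu)) (Pow {..<d})"
proof -
 have "mx (rk A) = mat_sum m (%mu. mx (Sm mu * A * adj (Sm mu))) I" unfolding rk_sum mx_sum ..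
 also have "... = mat_sum m (%mu. v mu * mx A * mat_adjoint (v mu)) I"
  unfolding mat_sum_def by (simp add: mx_sandwich cong: sum.cong)
 finally show ?thesis unfolding I_def .
qed

lemma mx_rk': "mx (rk' A) = mat_sum m (%mu. bit_sign (si0 + card_parity mu) *m (v mu * mx A * mat_adjoint (v mu))) (Pow {..<d})"
proof -
 have "rk' A = (SUM mu:I. (bit_sign si0 * mpar mu) *c (Sm mu * A * adj (Sm mu)))"
  by (simp add: rk'_def cvs.scale_sum_right scaleC_scaleC)
 then have "mx (rk' A) = mat_sum m (%mu. (bit_sign si0 * mpar mu) *m mx (Sm mu * A * adj (Sm mu))) I"
  by (simp only: mx_sum mx_linear)
 also have "... = mat_sum m (%mu. (bit_sign si0 * mpar mu) *m (v mu * mx A * mat_adjoint (v mu))) I"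
  unfolding mat_sum_def by (simp add: mx_sandwich cong: sum.cong)
 finally show ?thesis unfolding I_def bit_sign_add mpar_bit_sign .
qed

lemma transfer_power:
 assumes "x : carrier_mat m m" "y : carrier_mat m m"
 shows "(transfer_map (m * 2) d (vhat si0 v) ^^ N) (kron x (idm 2) + kron y pauli_x) =
  kron (mx ((rk ^^ N) (um x))) (idm 2) + kron (mx ((rk' ^^ N) (um y))) pauli_x"
proof (induction N)
 case 0
 then show ?case by (simp add: mx_um assms)
next
 case (Suc N)
 have "(transfer_map (m * 2) d (vhat si0 v) ^^ Suc N) (kron x (idm 2) + kron y pauli_x) =
   transfer_map (m * 2) d (vhat si0 v) (kron (mx ((rk ^^ N) (um x))) (idm 2) + kron (mx ((rk' ^^ N) (um y))) pauli_x)"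
  by (simp only: funpow.simps o_apply Suc)
 also have "... = kron (mx (rk ((rk ^^ N) (um x)))) (idm 2) + kron (mx (rk' ((rk' ^^ N) (um y)))) pauli_x"
  unfolding mx_rk mx_rk' by (rule transfer_map_kron) (simp_all add: v_carrier)
 finally show ?case by simp
qed

text \<open>Entry by entry, the even component tends to a multiple of the identity by
  \<open>even_limit\<close> and the odd one to zero by \<open>odd_limit\<close>.\<close>

lemma transfer_limit:
 assumes b: "b : graded_matrices m"
 shows "(%N. mat_op_norm ((transfer_map (m * 2) d (vhat si0 v) ^^ N) b -
     mat_trace (kron Dm ((1 / 2) *m idm 2) * b) *m kron (idm m) (idm 2))) ----> 0"
proof -
 obtain x y where xy: "x : carrier_mat m m" "y : carrier_mat m m" and b: "b = kron x (idm 2) + kron y pauli_x"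
  using b by (auto simp: graded_matrices_def)
 have one: "idm 2 : carrier_mat 2 2" "idm m : carrier_mat m m" by simp_all
 have t: "mat_trace (kron Dm ((1 / 2) *m idm 2) * b) = phi (um x)"
  unfolding b mat_trace_kron[OF Dm_carrier(1) xy] using Dm_trace[of "um x"] by (simp add: mx_um xy)
 define A where "A N = mx ((rk ^^ N) (um x))" for N
 define B where "B N = mx ((rk' ^^ N) (um y))" for N
 have AB: "A N : carrier_mat m m" "B N : carrier_mat m m" for N by (simp_all add: A_def B_def)
 note k1 = kron_carrier[OF one(2,1)] and kA = kron_carrier[OF AB(1) one(1)] and kB = kron_carrier[OF AB(2) pauli_carrier(1)]
 show ?thesis unfolding t unfolding b transfer_power[OF xy] A_def[symmetric] B_def[symmetric]
 proof (rule mat_op_norm_tendsto_0)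
  show "kron (A N) (idm 2) + kron (B N) pauli_x - phi (um x) *m kron (idm m) (idm 2) : carrier_mat (m * 2) (m * 2)" for N
   by (rule minus_carrier_mat[OF smult_carrier_mat[OF k1]])
  fix i k assume ik: "i < m * 2" "k < m * 2"
  note dm = div_mod_less[OF ik(1)] div_mod_less[OF ik(2)]
  define de where "de = (idm 2 :: complex mat) $$ (i mod 2, k mod 2)"
  define de' where "de' = pauli_x $$ (i mod 2, k mod 2)"
  have "(kron (A N) (idm 2) + kron (B N) pauli_x - phi (um x) *m kron (idm m) (idm 2)) $$ (i, k) =
    (kron (A N) (idm 2) + kron (B N) pauli_x) $$ (i, k) - (phi (um x) *m kron (idm m) (idm 2)) $$ (i, k)" for N
   using carrier_matD[OF k1] ik by (intro index_minus_mat(1)) auto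
  also have "... N = (kron (A N) (idm 2) $$ (i, k) + kron (B N) pauli_x $$ (i, k)) - phi (um x) * kron (idm m) (idm 2) $$ (i, k)" for N
   using carrier_matD[OF k1] carrier_matD[OF kB[of N]] ik by simp
  also have "... N = ip (e (i div 2)) (app ((rk ^^ N) (um x)) (e (k div 2))) * de +
    ip (e (i div 2)) (app ((rk' ^^ N) (um y)) (e (k div 2))) * de' -
    phi (um x) * (ip (e (i div 2)) (e (k div 2)) * de)" for N
   unfolding kron_index[OF AB(1) one(1) ik] kron_index[OF AB(2) pauli_carrier(1) ik] kron_index[OF one(2,1) ik]
    de_def[symmetric] de'_def[symmetric] using dm by (simp add: A_def B_def inner_e)
  finally have eq: "(kron (A N) (idm 2) + kron (B N) pauli_x - phi (um x) *m kron (idm m) (idm 2)) $$ (i, k) = ... N" for N .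
  have "(%N. ip (e (i div 2)) (app ((rk ^^ N) (um x)) (e (k div 2))) * de +
    ip (e (i div 2)) (app ((rk' ^^ N) (um y)) (e (k div 2))) * de' -
    phi (um x) * (ip (e (i div 2)) (e (k div 2)) * de)) ---->
    (phi (um x) * ip (e (i div 2)) (e (k div 2))) * de + 0 * de' - phi (um x) * (ip (e (i div 2)) (e (k div 2)) * de)"
   by (intro tendsto_intros even_limit odd_limit)
  then show "(%N. (kron (A N) (idm 2) + kron (B N) pauli_x - phi (um x) *m kron (idm m) (idm 2)) $$ (i, k)) ----> 0"
   unfolding eq by simp
 qed
qed

lemma mx_kw:
 assumes "ALL x:set L. fst x : I & snd x : I"
 shows "mx (kw L) = mat_list_prod m (map (%x. v (fst x)) L @ rev (map (%x. mat_adjoint (v (snd x))) L))" using assms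
proof (induction L)
 case Nil
 then show ?case by (simp add: mat_list_prod_def mx_one)
next
 case (Cons x L)
 let ?As = "map (%x. v (fst x)) L @ rev (map (%x. mat_adjoint (v (snd x))) L)"
 have c: "ALL A:set ?As. A : carrier_mat m m" by (auto simp: v_carrier intro!: mat_adjoint_carrier)
 have c': "ALL A:set (v (fst x) # ?As). A : carrier_mat m m" using c by (auto simp: v_carrier)
 have "mx (kw (x # L)) = v (fst x) * mx (kw L) * mat_adjoint (v (snd x))" using Cons.prems by (simp add: mx_sandwich)
 also have "mx (kw L) = mat_list_prod m ?As" using Cons by simp
 also have "v (fst x) * mat_list_prod m ?As = mat_list_prod m (v (fst x) # ?As)" by (simp add: mat_list_prod_def)
 also have "... * mat_adjoint (v (snd x)) = mat_list_prod m ((v (fst x) # ?As) @ [mat_adjoint (v (snd x))])"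
  by (rule mat_list_prod_snoc[OF c' mat_adjoint_carrier[OF v_carrier], symmetric])
 finally show ?case by simp
qed

text \<open>For anti-unitary \<open>V\<close> this is the unitary matrix of the encoding used by
  \<open>mat_apply\<close>: the conjugation is recorded in the bit \<open>s\<close>.\<close>

definition Wm :: "('k => 'k) => complex mat" where
 "Wm V = mat m m (%(i, k). ip (e i) (V (e k)))"

lemma Wm_carrier [simp]: "Wm V : carrier_mat m m" "dim_row (Wm V) = m" "dim_col (Wm V) = m" by (simp_all add: Wm_def)

context
 fixes s V
 assumes V: "unitary_op s V" and Vp: "conj_by V p0 = p0"
begin

lemma V_p0: "V (app p0 x) = app p0 (V x)"
proof -
 have "app (conj_by V p0) (V x) = V (app p0 x)" unfolding app_conj_by[OF V] unitary_op_adjoint(1)[OF V] ..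
 then show ?thesis by (simp add: Vp)
qed

lemma V_sum: "V (sum f K) = (SUM k:K. V (f k))"
 by (induction K rule: infinite_finite_induct) (simp_all add: unitary_op_linear[OF V])

lemma V_expand: "V (app p0 x) = (SUM k<m. conj_bit s (ip (e k) x) *c V (e k))"
 by (simp add: expand_p0 V_sum unitary_op_linear(5)[OF V])

lemma adjoint_V_inner: "ip (e k) (adjoint V x) = conj_bit s (ip (V (e k)) x)"
proof -
 have "ip (V (e k)) (V (adjoint V x)) = conj_bit s (ip (e k) (adjoint V x))" by (rule unitary_op_linear(6)[OF V])
 then show ?thesis unfolding unitary_op_adjoint(2)[OF V] by (cases s) simp_all
qed

text \<open>\<open>V\<close> commutes with \<open>p0\<close>, so compressing the conjugate is
  conjugating the compression; the conjugations of an anti-unitary \<open>V\<close> collect in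
  \<open>mat_conj s\<close>.\<close>

lemma mx_conj_by: "mx (conj_by V A) = mat_Ad s (Wm V) (mx A)"
proof (rule eq_matI)
 fix i k assume "i < dim_row (mat_Ad s (Wm V) (mx A))" "k < dim_col (mat_Ad s (Wm V) (mx A))"
 then have ik: "i < m" "k < m" by (simp_all add: mat_Ad_def)
 have ss: "conj_bit s (conj_bit s w) = w" for w by (cases s) auto
 have p: "p0 * (adj p0) = p0" by (simp add: p0)
 have eV: "ip (e i) (V x) = (SUM l<m. ip (e i) (V (e l)) * conj_bit s (ip (e l) x))" for x
 proof -
  have "ip (e i) (V x) = ip (app p0 (e i)) (V x)" using ik by (simp add: p0_e)
  also have "... = ip (e i) (V (app p0 x))" by (simp add: V_p0 cinner_adj p0)
  finally show ?thesis unfolding V_expand by (simp add: cinner_sum_right cinner_scaleC_right mult.commute)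
 qed
 have aV: "adjoint V (e k) = (SUM l<m. conj_bit s (ip (V (e l)) (e k)) *c e l)"
 proof -
  have "adjoint V (e k) = adjoint V (V (app p0 (adjoint V (e k))))"
   unfolding V_p0 unitary_op_adjoint(2)[OF V] using ik by (simp add: p0_e)
  then have "adjoint V (e k) = app p0 (adjoint V (e k))" unfolding unitary_op_adjoint(1)[OF V] .
  then show ?thesis unfolding expand_p0 adjoint_V_inner .
 qed
 have "mx (conj_by V A) $$ (i, k) = ip (e i) (V (app A (adjoint V (e k))))" using ik by (simp add: app_conj_by[OF V])
 also have "... = (SUM l<m. ip (e i) (V (e l)) * conj_bit s (ip (e l) (app A (adjoint V (e k)))))" by (rule eV)
 also have "... = (SUM l<m. ip (e i) (V (e l)) * conj_bit s (SUM l'<m. conj_bit s (ip (V (e l')) (e k)) * ip (e l) (app A (e l'))))"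
  unfolding aV by (simp add: app_sum_right cinner_sum_right cinner_scaleC_right)
 also have "... = (SUM l<m. SUM l'<m. ip (e i) (V (e l)) * conj_bit s (ip (e l) (app A (e l'))) * ip (V (e l')) (e k))"
  by (cases s) (simp_all add: sum_distrib_left mult_ac)
 also have "... = (SUM l'<m. (SUM l<m. ip (e i) (V (e l)) * conj_bit s (ip (e l) (app A (e l')))) * ip (V (e l')) (e k))"
  unfolding sum_distrib_right by (rule sum.swap)
 also have "... = (SUM l'<m. (SUM l<m. ip (e i) (V (e l)) * conj_bit s (ip (e l) (app A (e l')))) * cnj (ip (e k) (V (e l'))))"
  by (rule sum.cong[OF refl]) (simp only: cinner_commute[of "V (e _)" "e k"])
 also have "... = mat_Ad s (Wm V) (mx A) $$ (i, k)"
  using ik by (simp add: mat_Ad_def mat_conj_def Wm_def scalar_prod_def atLeast0LessThan)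
 finally show "mx (conj_by V A) $$ (i, k) = mat_Ad s (Wm V) (mx A) $$ (i, k)" .
qed (simp_all add: mat_Ad_def)

lemma Wm_unitary: "Wm V * mat_adjoint (Wm V) = idm m"
proof -
 have "mat_conj s (idm m) = idm m" by (rule eq_matI) (cases s; simp add: mat_conj_def)+
 then have "mat_Ad s (Wm V) (idm m) = Wm V * mat_adjoint (Wm V)"
  unfolding mat_Ad_def using right_mult_one_mat[OF Wm_carrier(1)] by simp
 then show ?thesis using mx_conj_by[of 1] by (simp add: mx_one conj_by_simps[OF V])
qed

lemma Wm_mult:
 assumes V': "unitary_op s' V'" "conj_by V' p0 = p0"
 shows "Wm V * mat_conj s (Wm V') = Wm (V \<circ> V')"
proof (rule eq_matI)
 fix i k assume "i < dim_row (Wm (V \<circ> V'))" "k < dim_col (Wm (V \<circ> V'))"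
 then have ik: "i < m" "k < m" by simp_all
 have "app (conj_by V' p0) (V' (e k)) = V' (app p0 (e k))" unfolding app_conj_by[OF V'(1)] unitary_op_adjoint(1)[OF V'(1)] ..
 then have "app p0 (V' (e k)) = V' (e k)" using ik by (simp add: V'(2) p0_e)
 then have "ip (e i) (V (V' (e k))) = (SUM l<m. conj_bit s (ip (e l) (V' (e k))) * ip (e i) (V (e l)))"
  using V_expand[of "V' (e k)"] by (simp add: cinner_sum_right cinner_scaleC_right)
 then show "(Wm V * mat_conj s (Wm V')) $$ (i, k) = Wm (V \<circ> V') $$ (i, k)"
  using ik by (simp add: mat_conj_def Wm_def scalar_prod_def atLeast0LessThan mult.commute)
qed (simp_all add: mat_conj_def)

lemma Dm_invariant:
 assumes phi: "!!A. phi (conj_by V A) = conj_bit s (phi A)"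
 shows "mat_Ad s (Wm V) Dm = Dm"
proof (rule eq_matI)
 fix i k assume "i < dim_row Dm" "k < dim_col Dm"
 then have ik: "i < m" "k < m" by simp_all
 have kb: "conj_by V (ketbra x y) = ketbra (V x) (V y)" for x y
 proof (rule bop_eqI)
  fix z
  have "conj_bit s (ip y (adjoint V z)) = ip (V y) z"
   using unitary_op_linear(6)[OF V, of y "adjoint V z"] by (simp add: unitary_op_adjoint(2)[OF V])
  then show "app (conj_by V (ketbra x y)) z = app (ketbra (V x) (V y)) z"
   by (simp add: app_conj_by[OF V] unitary_op_linear(5)[OF V])
 qed
 \<comment> \<open>The images of the \<open>e l\<close> under \<open>V\<close> form a second
   orthonormal basis of the range of \<open>p0\<close>, in which \<open>p0\<close> may be
   expanded.\<close>
 have basis: "(SUM l<m. ip (V (e l)) x *c V (e l)) = app p0 x" for x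
 proof -
  have "p0 = (SUM l<m. ketbra (V (e l)) (V (e l)))"
   using Vp sum_e conj_by_sum[OF V, of "%i. ketbra (e i) (e i)" "{..<m}"] by (simp add: kb)
  from arg_cong[OF this, of "%T. app T x"] show ?thesis by (simp add: app_sum)
 qed
 have "mat_Ad s (Wm V) Dm $$ (i, k) = (SUM l'<m. (SUM l<m. ip (e i) (V (e l)) * conj_bit s (phi (ketbra (e l') (e l)))) * cnj (ip (e k) (V (e l'))))"
  using ik by (simp add: mat_Ad_def mat_conj_def Wm_def Dm_def scalar_prod_def atLeast0LessThan)
 also have "... = (SUM l'<m. SUM l<m. (ip (V (e l')) (e k) * cnj (ip (V (e l)) (e i))) * phi (ketbra (V (e l')) (V (e l))))"
  unfolding sum_distrib_right
 proof (intro sum.cong refl)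
  fix l l'
  have "cnj (ip (e k) (V (e l'))) = ip (V (e l')) (e k)" "ip (e i) (V (e l)) = cnj (ip (V (e l)) (e i))"
   by (metis cinner_commute)+
  then show "ip (e i) (V (e l)) * conj_bit s (phi (ketbra (e l') (e l))) * cnj (ip (e k) (V (e l'))) =
   ip (V (e l')) (e k) * cnj (ip (V (e l)) (e i)) * phi (ketbra (V (e l')) (V (e l)))"
   by (simp add: kb[symmetric] phi mult_ac)
 qed
 also have "... = phi (SUM l'<m. SUM l<m. (ip (V (e l')) (e k) * cnj (ip (V (e l)) (e i))) *c ketbra (V (e l')) (V (e l)))"
  by (simp only: phi_linear)
 also have "(SUM l'<m. SUM l<m. (ip (V (e l')) (e k) * cnj (ip (V (e l)) (e i))) *c ketbra (V (e l')) (V (e l))) =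
   ketbra (app p0 (e k)) (app p0 (e i))"
 proof (rule bop_eqI)
  fix z
  show "app (SUM l'<m. SUM l<m. (ip (V (e l')) (e k) * cnj (ip (V (e l)) (e i))) *c ketbra (V (e l')) (V (e l))) z =
   app (ketbra (app p0 (e k)) (app p0 (e i))) z" unfolding basis[symmetric]
   by (simp add: app_sum cinner_sum_left cinner_scaleC_left cvs.scale_sum_left cvs.scale_sum_right scaleC_scaleC sum_distrib_left mult_ac)
 qed
 also have "phi ... = Dm $$ (i, k)" using ik by (simp add: p0_e Dm_def)
 finally show "mat_Ad s (Wm V) Dm $$ (i, k) = Dm $$ (i, k)" .
qed (simp_all add: mat_Ad_def)

end

end

section \<open>Implementers of the on-site symmetry\<close>

context chain_rep
begin

lemma implementer_commutes:
 assumes Y: "unitary_op s Y" "!!x. Y (app (pi x) Om) = app (pi (be x)) Om"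
  and V: "unitary_op t V" "!!x. V (app (pi x) Om) = app (pi (\<gamma> x)) Om" and com: "!!x. be (\<gamma> x) = \<gamma> (be x)"
 shows "conj_by Y (conj_by V T) = conj_by V (conj_by Y T)"
proof -
 have YV: "Y (V xi) = V (Y xi)" for xi
 proof -
  have "bounded_linear Y" "bounded_linear V" using Y(1) V(1) by (auto simp: unitary_op_def bounded_op_def)
  then have "closed {xi. Y (V xi) = V (Y xi)}"
   by (intro closed_Collect_eq continuous_intros bounded_linear.continuous_on[of Y] bounded_linear.continuous_on[of V])
  from cyclic_dense[OF this closure_UNIV] show ?thesis by (simp add: Y(2) V(2) com)
 qed
 have "adjoint V (adjoint Y xi) = adjoint Y (adjoint V xi)" for xi
 proof -
  have "adjoint V (adjoint Y xi) = adjoint Y (Y (adjoint V (adjoint Y (V (adjoint V xi)))))"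
   by (simp only: unitary_op_adjoint[OF Y(1)] unitary_op_adjoint[OF V(1)])
  also have "V (adjoint V xi) = V (Y (adjoint Y (adjoint V xi)))" by (simp only: unitary_op_adjoint[OF Y(1)])
  also have "... = Y (V (adjoint Y (adjoint V xi)))" by (simp only: YV)
  also have "adjoint Y (Y (V (adjoint Y (adjoint V xi)))) = V (adjoint Y (adjoint V xi))"
   by (simp only: unitary_op_adjoint[OF Y(1)])
  finally show ?thesis by (simp only: unitary_op_adjoint[OF Y(1)] unitary_op_adjoint[OF V(1)])
 qed
 then show ?thesis by (intro bop_eqI) (simp add: app_conj_by[OF Y(1)] app_conj_by[OF V(1)] YV)
qed

lemma onsite_expand:
 fixes Mt :: "complex mat"
 assumes Mt: "Mt : carrier_mat d d" "Mt * mat_adjoint Mt = idm d" and i: "i < d"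
 shows "car_aut d a s (%f x. mat_apply s Mt (f x)) (gen x i) = (SUM k<d. cnj (Mt $$ (k, i)) *c gen x k)"
proof -
 have "vec d (%k. Mt $$ (k, i)) : carrier_vec d" by simp
 from a_site[OF this] show ?thesis unfolding onsite_gen[OF Mt i] by simp
qed

text \<open>Exhibits the preimage of a generator, so that conjugation by the inverse implementer is
  known on generators as well.\<close>

lemma onsite_back:
 fixes Mt :: "complex mat"
 assumes Mt: "Mt : carrier_mat d d" "Mt * mat_adjoint Mt = idm d" and k: "k < d"
 shows "car_aut d a s (%f x. mat_apply s Mt (f x)) (SUM i<d. conj_bit s (Mt $$ (k, i)) *c gen x i) = gen x k"
proof -
 define al where "al = car_aut d a s (%f x. mat_apply s Mt (f x))"
 have "star_automorphism s al" unfolding al_def by (rule car_aut(1)[OF d_pos car l2_unitary_onsite[OF Mt]])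
 then have add: "al (x + y) = al x + al y" and scale: "al (c *c x) = conj_bit s c *c al x" for x y c
  by (simp_all add: star_automorphism_def)
 have "al 0 = 0" using add[of 0 0] by simp
 then have sum: "al (sum f A) = (SUM i:A. al (f i))" for f and A :: "nat set"
  by (induction A rule: infinite_finite_induct) (simp_all add: add)
 have ss: "conj_bit s (conj_bit s w) = w" for w by (cases s) auto
 have "al (SUM i<d. conj_bit s (Mt $$ (k, i)) *c gen x i) = (SUM i<d. SUM l<d. (Mt $$ (k, i) * cnj (Mt $$ (l, i))) *c gen x l)"
  unfolding sum scale ss
  by (rule sum.cong[OF refl]) (simp add: al_def onsite_expand[OF Mt] cvs.scale_sum_right scaleC_scaleC)
 also have "... = (SUM l<d. (SUM i<d. Mt $$ (k, i) * cnj (Mt $$ (l, i))) *c gen x l)"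
  by (subst sum.swap) (simp only: cvs.scale_sum_left)
 also have "... = (SUM l<d. if l = k then gen x k else 0)"
 proof (rule sum.cong[OF refl])
  fix l assume l: "l : {..<d}"
  have "(SUM i<d. Mt $$ (k, i) * cnj (Mt $$ (l, i))) = (Mt * mat_adjoint Mt) $$ (k, l)"
   using Mt(1) k l by (simp add: scalar_prod_def atLeast0LessThan)
  then show "(SUM i<d. Mt $$ (k, i) * cnj (Mt $$ (l, i))) *c gen x l = (if l = k then gen x k else 0)"
   unfolding Mt(2) using k l by auto
 qed
 also have "... = gen x k" using k by simp
 finally show ?thesis unfolding al_def .
qed

lemma comm_cg_sum:
 assumes T: "T : comm (Gens X)" and x: "x : X" and S: "S = (SUM i<d. c i *c cg x i)"
 shows "S * T = T * S" "adj S * T = T * adj S"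
proof -
 have g: "cg x i * T = T * cg x i" "adj (cg x i) * T = T * adj (cg x i)" if "i < d" for i
 proof -
  have "cg x i : Gens X" "adj (cg x i) : Gens X" using that x unfolding Gens_def by blast+
  then show "cg x i * T = T * cg x i" "adj (cg x i) * T = T * adj (cg x i)" using T by (simp_all add: comm_def)
 qed
 show "S * T = T * S" "adj S * T = T * adj S"
  unfolding S adj_sum sum_distrib_left sum_distrib_right by (rule sum.cong[OF refl]; simp add: g)+
qed

text \<open>The implementer and its inverse map the span of the generators of each site to itself.
  Hence both preserve commutants of generators and so \<open>M\<close>; commutation with shift and
  parity is checked on generators.\<close>

lemma onsite_implementer:
 fixes Mt :: "complex mat" and s :: bit
 assumes Mt: "Mt : carrier_mat d d" "Mt * mat_adjoint Mt = idm d"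
  and inv: "!!x. om (car_aut d a s (%f x. mat_apply s Mt (f x)) x) = conj_bit s (om x)"
 shows "EX Y. unitary_op s Y & Y Om = Om & adjoint Y Om = Om &
  (ALL x. conj_by Y (pi x) = pi (car_aut d a s (%f x. mat_apply s Mt (f x)) x)) &
  (ALL A:M. conj_by Y A : M & conj_by (adjoint Y) A : M) & conj_by Y Gm = Gm &
  (ALL T. conj_by Y (rho T) = rho (conj_by Y T))"
proof -
 define al where "al = car_aut d a s (%f x. mat_apply s Mt (f x))"
 have al: "star_automorphism s al" unfolding al_def by (rule car_aut(1)[OF d_pos car l2_unitary_onsite[OF Mt]])
 note exp = onsite_expand[OF Mt, of _ s, folded al_def] and gback = onsite_back[OF Mt, of _ s, folded al_def]
 obtain Y where Y: "unitary_op s Y" "!!x. Y (app (pi x) Om) = app (pi (al x)) Om"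
  using implement[OF al inv[folded al_def]] by blast
 note imp = implementer[OF al Y] and cY = conj_by_simps[OF Y(1)] and Y' = unitary_op_inverse(1)[OF Y(1)]
 have Ycg: "conj_by Y (cg x i) = (SUM k<d. cnj (Mt $$ (k, i)) *c cg x k)" if "i < d" for x i
  unfolding cg_def imp(3) exp[OF that] pi_sum pi_scaleC ..
 have Y'cg: "conj_by (adjoint Y) (cg x i) = (SUM k<d. conj_bit s (Mt $$ (i, k)) *c cg x k)" if "i < d" for x i
  using imp(4)[of "SUM k<d. conj_bit s (Mt $$ (i, k)) *c gen x k"]
  unfolding gback[OF that] by (simp add: cg_def pi_sum pi_scaleC)
 have comm: "conj_by W T : comm (Gens X)" if W: "unitary_op s W"
  and cg: "!!x i. i < d ==> conj_by (adjoint W) (cg x i) = (SUM k<d. C i k *c cg x k)" and T: "T : comm (Gens X)" for W C T X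
 proof -
  note cW = conj_by_simps[OF W] and cW' = conj_by_simps[OF unitary_op_inverse(1)[OF W]]
  have "g * conj_by W T = conj_by W T * g" if g: "g : Gens X" for g
  proof -
   obtain x i where xi: "x : X" "i < d" "g = cg x i \<or> g = adj (cg x i)" using g by (auto simp: Gens_def)
   have "conj_by (adjoint W) g * T = T * conj_by (adjoint W) g"
    using xi(3) comm_cg_sum[OF T xi(1) cg[OF xi(2)]] cW'(8) by metis
   from arg_cong[OF this, of "conj_by W"] show ?thesis by (simp add: cW cW(10))
  qed
  then show ?thesis by (simp add: comm_def)
 qed
 have in_M: "conj_by W A : M" if W: "unitary_op s W" and c: "!!T. T : comm (Gens {0..}) ==> conj_by (adjoint W) T : comm (Gens {0..})"
  and A: "A : M" for W A
 proof (rule M_I)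
  fix T assume "T : comm (Gens {0..})"
  from arg_cong[OF M_commD[OF A c[OF this]], of "conj_by W"]
  show "conj_by W A * T = T * conj_by W A" by (simp add: conj_by_simps[OF W])
 qed
 note YY = unitary_op_inverse(2)[OF Y(1)]
 have c1: "conj_by (adjoint Y) T : comm (Gens X)" if "T : comm (Gens X)" for T X
  by (rule comm[OF Y', where C = "%i k. cnj (Mt $$ (k, i))", unfolded YY, OF Ycg that])
 have c2: "conj_by Y T : comm (Gens X)" if "T : comm (Gens X)" for T X
  by (rule comm[OF Y(1), where C = "%i k. conj_bit s (Mt $$ (i, k))", OF Y'cg that])
 have M: "conj_by Y A : M" "conj_by (adjoint Y) A : M" if "A : M" for A
  using in_M[OF Y(1) c1 that] in_M[OF Y', unfolded YY, OF c2 that] by blast+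
 have sum: "f (sum h K) = (SUM i:K. f (h i))" if "star_automorphism 0 f" for f :: "'a => 'a" and h and K :: "nat set"
 proof -
  have add: "f (x + y) = f x + f y" for x y using that by (simp add: star_automorphism_def)
  have "f 0 = 0" using add[of 0 0] by simp
  then show ?thesis by (induction K rule: infinite_finite_induct) (simp_all add: add)
 qed
 have scale: "f (c *c x) = c *c f x" if "star_automorphism 0 f" for f :: "'a => 'a" and c x
  using that by (simp add: star_automorphism_def)
 have "al (shift 1 x) = shift 1 (al x)" for x
 proof (rule aut_ext[where f = "%x. al (shift 1 x)" and g = "%x. shift 1 (al x)" and s = s])
  show "star_automorphism s (%x. al (shift 1 x))" by (rule aut_comp(1)[OF al shift_aut])
  show "star_automorphism s (%x. shift 1 (al x))" by (rule aut_comp(2)[OF al shift_aut])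
  show "al (shift 1 (gen x i)) = shift 1 (al (gen x i))" if "i < d" for x i
   by (simp add: shift_gen exp[OF that] sum[OF shift_aut] scale[OF shift_aut])
 qed
 from implementer_commutes[OF Y U this] have rho: "conj_by Y (rho T) = rho (conj_by Y T)" for T unfolding rho_def .
 have par: "al (parity x) = parity (al x)" for x
 proof (rule aut_ext[where f = "%x. al (parity x)" and g = "%x. parity (al x)" and s = s])
  show "star_automorphism s (%x. al (parity x))" by (rule aut_comp(1)[OF al parity_aut])
  show "star_automorphism s (%x. parity (al x))" by (rule aut_comp(2)[OF al parity_aut])
  have "al ((- 1) *c x) = conj_bit s (- 1) *c al x" for x using al unfolding star_automorphism_def by blast
  then have minus: "al (- x) = - al x" for x by (cases s) simp_all
  show "al (parity (gen x i)) = parity (al (gen x i))" if "i < d" for x i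
  proof -
   have "parity (al (gen x i)) = (SUM k<d. - (cnj (Mt $$ (k, i)) *c gen x k))"
    unfolding exp[OF that] sum[OF parity_aut] scale[OF parity_aut] by (rule sum.cong[OF refl]) (simp add: parity_gen)
   then show ?thesis by (simp add: parity_gen that minus exp sum_negf)
  qed
 qed
 have Gm: "conj_by Y Gm = Gm"
 proof (rule bop_cyclic_eqI)
  fix x
  have "surj al" using al by (simp add: star_automorphism_def bij_def)
  then obtain y where y: "x = al y" by (metis surjD)
  have "adjoint Y (app (pi (al y)) Om) = app (pi y) Om"
   using unitary_op_adjoint(1)[OF Y(1), of "app (pi y) Om"] by (simp add: Y(2))
  then show "app (conj_by Y Gm) (app (pi x) Om) = app Gm (app (pi x) Om)"
   by (simp add: y app_conj_by[OF Y(1)] Gamma Y(2) par)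
 qed
 show ?thesis unfolding al_def[symmetric] using Y(1) imp(1-3) M rho Gm by (intro exI[of _ Y]) simp
qed

lemma pi_shift: "pi (shift (int k) x) = (rho ^^ k) (pi x)"
proof (induction k arbitrary: x)
 case 0
 have id: "star_automorphism 0 (%x :: 'a. x)" using bij_id by (simp add: star_automorphism_def id_def)
 have "shift 0 x = x" by (rule aut_ext[OF shift_aut id]) (simp add: shift_gen)
 then show ?case by simp
next
 case (Suc k)
 have "shift (int (Suc k)) x = shift 1 (shift (int k) x)"
  by (rule aut_ext[OF shift_aut aut_comp(1)[OF shift_aut shift_aut]]) (simp add: shift_gen add_ac)
 then show ?case by (simp add: rho_pi[symmetric] Suc)
qed

end

section \<open>Words of matrix units and their signs\<close>

context index_rep
begin

lemma pi_word:
 assumes "!!k. fst (f k) : I & snd (f k) : I"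
 shows "pi (prod_list (map (%k. matrix_unit d a (int k) (fst (f k)) (snd (f k))) [i..<i + n])) =
  (rho ^^ i) (wd (map f [i..<i + n]))"
proof (induction n arbitrary: i)
 case 0
 have "(rho ^^ i) 1 = 1" by (induction i) simp_all
 then show ?case by (simp add: pi_one)
next
 case (Suc n)
 have "pi (matrix_unit d a (int i) (fst (f i)) (snd (f i))) = (rho ^^ i) (eu (fst (f i)) (snd (f i)))"
  using assms[of i] I(3) by (simp add: matrix_unit_def matrix_unit0 pi_shift eu_def)
 moreover have "[i..<i + Suc n] = i # [Suc i..<Suc i + n]" using upt_conv_Cons[of i "i + Suc n"] by simp
 ultimately show ?case
  by (simp only: list.map prod_list.Cons pi_mult wd.simps rho_pow_hom(1) Suc[of "Suc i"] funpow_Suc_right o_apply)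
qed

lemma ps_sum: "ps (map f [i..<i + n]) = (SUM k = i..<i + n. card_parity (fst (f k)) + card_parity (snd (f k)))"
proof (induction n arbitrary: i)
 case (Suc n)
 have "[i..<i + Suc n] = i # [Suc i..<Suc i + n]" using upt_conv_Cons[of i "i + Suc n"] by simp
 moreover have "{i..<i + Suc n} = insert i {Suc i..<Suc i + n}" by auto
 moreover have "sum g (insert i {Suc i..<Suc i + n}) = g i + sum g {Suc i..<Suc i + n}" for g :: "nat => bit"
  by (rule sum.insert) simp_all
 ultimately show ?case by (simp only: list.map ps.simps Suc[of "Suc i"])
qed simp

text \<open>Reordering of a double sum: the recursion pairs each site with the total parity to its
  right, the formula pairs it with the twists to its left.\<close>

lemma wsgn_sum:
 "wsgn (map f [i..<i + n]) = bit_sign (SUM k = i..<i + n. (card_parity (fst (f k)) + card_parity (snd (f k))) *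
   (SUM l = i..<k. si0 + card_parity (snd (f l))))"
proof (induction n arbitrary: i)
 case (Suc n)
 define s where "s k = card_parity (fst (f k)) + card_parity (snd (f k))" for k
 define t where "t l = si0 + card_parity (snd (f l))" for l
 have u: "[i..<i + Suc n] = i # [Suc i..<Suc i + n]" using upt_conv_Cons[of i "i + Suc n"] by simp
 have set: "{i..<i + Suc n} = insert i {Suc i..<Suc i + n}" by auto
 have "(SUM k = i..<i + Suc n. s k * (SUM l = i..<k. t l)) = (SUM k = Suc i..<Suc i + n. s k * (SUM l = i..<k. t l))"
  unfolding set by (subst sum.insert) auto
 also have "... = (SUM k = Suc i..<Suc i + n. t i * s k + s k * (SUM l = Suc i..<k. t l))"
 proof (rule sum.cong[OF refl])
  fix k assume "k : {Suc i..<Suc i + n}"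
  then have "(SUM l = i..<k. t l) = t i + (SUM l = Suc i..<k. t l)" by (intro sum.atLeast_Suc_lessThan) simp
  then show "s k * (SUM l = i..<k. t l) = t i * s k + s k * (SUM l = Suc i..<k. t l)"
   by (simp only: distrib_left mult.commute)
 qed
 also have "... = t i * (SUM k = Suc i..<Suc i + n. s k) + (SUM k = Suc i..<Suc i + n. s k * (SUM l = Suc i..<k. t l))"
  by (simp only: sum.distrib sum_distrib_left)
 finally have "bit_sign (SUM k = i..<i + Suc n. s k * (SUM l = i..<k. t l)) =
   bit_sign (t i * (SUM k = Suc i..<Suc i + n. s k)) * bit_sign (SUM k = Suc i..<Suc i + n. s k * (SUM l = Suc i..<k. t l))"
  by (simp only: bit_sign_add)
 then show ?case unfolding u list.map wsgn.simps ps_sum Suc[of "Suc i"] s_def t_def by (simp only:)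
qed simp

end

context matrix_rep
begin

lemma word_formula:
 assumes munu: "ALL k<=l. mu k : Pow {..<d} & nu k : Pow {..<d}"
 shows "om (prod_list (map (%k. matrix_unit d a (int k) (mu k) (nu k)) [0..<Suc l])) =
     bit_sign (SUM k=1..l. (card_parity (mu k) + card_parity (nu k)) * (SUM j<k. si0 + card_parity (nu j))) *
     (if (SUM k<=l. card_parity (mu k) + card_parity (nu k)) = 0 then 1 else 0) *
     mat_trace (Dm * mat_list_prod m (map (%k. v (mu k)) [0..<Suc l] @
             map (%k. mat_adjoint (v (nu k))) (rev [0..<Suc l])))"
proof -
 \<comment> \<open>Beyond \<open>l\<close> the sequences are unrestricted; the default keeps every
   pair inside \<open>I\<close>.\<close>
 define f where "f k = (if k <= l then (mu k, nu k) else ({}, {}))" for k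
 have f: "fst (f k) : I & snd (f k) : I" for k using munu by (auto simp: f_def I_def)
 have fk: "f k = (mu k, nu k)" if "k < Suc l" for k using that by (simp add: f_def)
 let ?L = "map f [0..<Suc l]"
 have "map (%k. matrix_unit d a (int k) (mu k) (nu k)) [0..<Suc l] =
   map (%k. matrix_unit d a (int k) (fst (f k)) (snd (f k))) [0..<Suc l]" by (rule map_cong[OF refl]) (use fk in auto)
 then have "om (prod_list (map (%k. matrix_unit d a (int k) (mu k) (nu k)) [0..<Suc l])) = ip Om (app (wd ?L) Om)"
  using pi_word[where f = f and i = 0 and n = "Suc l", OF f] by (simp only: vector_state add_0 funpow_0)
 also have "... = wsgn ?L * (if ps ?L = 0 then 1 else 0) * phi (kw ?L)" by (rule word_value) (use f in auto)
 also have "ps ?L = (SUM k<=l. card_parity (mu k) + card_parity (nu k))"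
 proof -
  have "ps ?L = (SUM k = 0..<Suc l. card_parity (fst (f k)) + card_parity (snd (f k)))" using ps_sum[where f = f and i = 0 and n = "Suc l"] by (simp only: add_0)
  also have "... = (SUM k = 0..<Suc l. card_parity (mu k) + card_parity (nu k))"
   by (rule sum.cong[OF refl]) (use fk in "simp only: atLeastLessThan_iff fst_conv snd_conv")
  finally show ?thesis by (simp only: atLeast0LessThan lessThan_Suc_atMost)
 qed
 also have "wsgn ?L = bit_sign (SUM k=1..l. (card_parity (mu k) + card_parity (nu k)) * (SUM j<k. si0 + card_parity (nu j)))"
 proof -
  have "wsgn ?L = bit_sign (SUM k = 0..<Suc l. (card_parity (fst (f k)) + card_parity (snd (f k))) * (SUM j = 0..<k. si0 + card_parity (snd (f j))))"
   using wsgn_sum[where f = f and i = 0 and n = "Suc l"] by (simp only: add_0)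
  \<comment> \<open>The inner sum at \<open>k = 0\<close> is empty, so the range may start at 1 as
    in the statement.\<close>
  also have "(SUM k = 0..<Suc l. (card_parity (fst (f k)) + card_parity (snd (f k))) * (SUM j = 0..<k. si0 + card_parity (snd (f j)))) =
    (SUM k = Suc 0..<Suc l. (card_parity (fst (f k)) + card_parity (snd (f k))) * (SUM j = 0..<k. si0 + card_parity (snd (f j))))"
   by (subst sum.atLeast_Suc_lessThan) simp_all
  also have "... = (SUM k = Suc 0..<Suc l. (card_parity (mu k) + card_parity (nu k)) * (SUM j<k. si0 + card_parity (nu j)))"
  proof (rule sum.cong[OF refl])
   fix k assume k: "k : {Suc 0..<Suc l}"
   have "(SUM j = 0..<k. si0 + card_parity (snd (f j))) = (SUM j<k. si0 + card_parity (nu j))" unfolding atLeast0LessThan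
   proof (rule sum.cong[OF refl])
    fix j assume "j : {..<k}"
    then have "j < Suc l" using k by auto
    then show "si0 + card_parity (snd (f j)) = si0 + card_parity (nu j)" by (simp only: fk snd_conv)
   qed
   moreover have "f k = (mu k, nu k)" using k fk by auto
   ultimately show "(card_parity (fst (f k)) + card_parity (snd (f k))) * (SUM j = 0..<k. si0 + card_parity (snd (f j))) =
    (card_parity (mu k) + card_parity (nu k)) * (SUM j<k. si0 + card_parity (nu j))" by (simp only: fst_conv snd_conv)
  qed
  finally show ?thesis by (simp only: atLeastLessThanSuc_atLeastAtMost One_nat_def)
 qed
 also have "phi (kw ?L) = mat_trace (Dm * mat_list_prod m (map (%k. v (mu k)) [0..<Suc l] @
             map (%k. mat_adjoint (v (nu k))) (rev [0..<Suc l])))"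
 proof -
  have kw: "mx (kw ?L) = mat_list_prod m (map (%x. v (fst x)) ?L @ rev (map (%x. mat_adjoint (v (snd x))) ?L))"
   by (rule mx_kw) (use f in auto)
  have 1: "map (%x. v (fst x)) ?L = map (%k. v (mu k)) [0..<Suc l]"
   unfolding map_map o_def by (rule map_cong[OF refl]) (use fk in auto)
  have "map (%x. mat_adjoint (v (snd x))) ?L = map (%k. mat_adjoint (v (nu k))) [0..<Suc l]"
   unfolding map_map o_def by (rule map_cong[OF refl]) (use fk in auto)
  then have 2: "rev (map (%x. mat_adjoint (v (snd x))) ?L) = map (%k. mat_adjoint (v (nu k))) (rev [0..<Suc l])"
   by (simp only: rev_map)
  show ?thesis unfolding Dm_trace[symmetric] kw 1 2 ..
 qed
 finally show ?thesis .
qed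

end

section \<open>From functions to bounded operators, and the model algebra of index kappa = 1\<close>

lemma adjoint_app: "adjoint (app T) = app (adj T)" by (simp add: adj.rep_eq)

lemma app_Bop: "bounded_op 0 f ==> app (Bop f) = f" by (simp add: Bop_inverse)

lemma app_funs: "app (S * T) = app S \<circ> app T" "app (S + T) = (%x. app S x + app T x)" "app (c *c T) = (%x. c *c app T x)"
 by (simp_all add: fun_eq_iff)

lemma commutant_app: "commutant (app ` S) = app ` comm S"
proof (intro equalityI subsetI)
 fix f assume f: "f : commutant (app ` S)"
 then have b: "bounded_op 0 f" by (simp add: commutant_def)
 have "T * Bop f = Bop f * T" if "T : S" for T
 proof -
  have "app T \<circ> f = f \<circ> app T" using f that unfolding commutant_def by blast
  then show ?thesis by (simp add: app_inject[symmetric] app_funs app_Bop[OF b])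
 qed
 then have "Bop f : comm S" by (simp add: comm_def)
 then show "f : app ` comm S" using app_Bop[OF b] by (metis imageI)
next
 fix f assume "f : app ` comm S"
 then obtain T where T: "T : comm S" "f = app T" by blast
 have "app A \<circ> app T = app T \<circ> app A" if "A : S" for A
  using T(1) that unfolding comm_def by (simp flip: app_funs)
 then show "f : commutant (app ` S)" by (simp add: commutant_def T(2) bounded_op_app)
qed

text \<open>The element of the model algebra with components \<open>A\<close> at the identity and
  \<open>B\<close> at \<open>pauli_x\<close>, in the coordinates of pairs.\<close>

definition dbl :: "'k::complex_hilbert bop => 'k bop => 'k \<times> 'k => 'k \<times> 'k" where
 "dbl A B = (%z. (app A (fst z) + app B (snd z), app B (fst z) + app A (snd z)))"

lemma op_tensor_apply:
 "op_tensor A (idm 2) z = (A (fst z), A (snd z))" "op_tensor A pauli_x z = (A (snd z), A (fst z))"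
 "op_tensor A pauli_z z = (A (fst z), - A (snd z))" by (simp_all add: op_tensor_def split_beta)

lemma model_algebra_dbl: "model_algebra 1 = {dbl A B | A B. True}"
proof (intro equalityI subsetI)
 fix f :: "'a \<times> 'a => 'a \<times> 'a" assume "f : model_algebra 1"
 then obtain A B where AB: "bounded_op 0 A" "bounded_op 0 B" "f = (%z. op_tensor A (idm 2) z + op_tensor B pauli_x z)"
  by (auto simp: model_algebra_def)
 have "f = dbl (Bop A) (Bop B)" by (simp add: AB(3) dbl_def app_Bop AB(1,2) op_tensor_apply add.commute)
 then show "f : {dbl A B | A B. True}" by blast
next
 fix f :: "'a \<times> 'a => 'a \<times> 'a" assume "f : {dbl A B | A B. True}"
 then obtain A B where AB: "f = dbl A B" by blast
 have "f = (%z. op_tensor (app A) (idm 2) z + op_tensor (app B) pauli_x z)"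
  by (simp add: AB dbl_def op_tensor_apply add.commute)
 then show "f : model_algebra 1" using bounded_op_app by (auto simp: model_algebra_def)
qed

lemma dbl_algebra:
 "dbl A B \<circ> dbl A' B' = dbl (A * A' + B * B') (A * B' + B * A')"
 "(%z. dbl A B z + dbl A' B' z) = dbl (A + A') (B + B')" "(%z. c *c dbl A B z) = dbl (c *c A) (c *c B)"
 by (auto simp: dbl_def fun_eq_iff scaleC_prod_def scaleC_add_right add_ac)

lemma dbl_inject: "dbl A B = dbl A' B' \<longleftrightarrow> A = A' & B = B'"
proof
 assume eq: "dbl A B = dbl A' B'"
 have "app A x = app A' x" "app B x = app B' x" for x using fun_cong[OF eq, of "(x, 0)"] by (simp_all add: dbl_def)
 then show "A = A' & B = B'" using bop_eqI by blast
qed simp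

lemma inner_adj: "inner (app T x) y = inner x (app (adj T) y)" unfolding Re_cinner[symmetric] cinner_adj ..

lemma adjoint_dbl: "adjoint (dbl A B) = dbl (adj A) (adj B)"
proof (rule adjoint_eqI)
 have l: "bounded_linear (%z. app T (fst z))" "bounded_linear (%z. app T (snd z))" for T :: "'a bop"
  by (rule bounded_linear_compose[OF bounded_linear_app bounded_linear_fst],
   rule bounded_linear_compose[OF bounded_linear_app bounded_linear_snd])
 show "bounded_linear (dbl A B)" unfolding dbl_def by (intro bounded_linear_Pair bounded_linear_add l)
 show "inner (dbl A B x) y = inner x (dbl (adj A) (adj B) y)" for x y
  by (simp add: dbl_def inner_prod_def inner_add_left inner_add_right inner_adj)
qed

lemma op_Ad_grading: "op_Ad (op_tensor id pauli_z) (dbl A B) = dbl A (- B)"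
proof -
 have "adjoint (op_tensor id pauli_z) = (op_tensor id pauli_z :: 'a \<times> 'a => 'a \<times> 'a)"
 proof (rule adjoint_eqI)
  have "bounded_linear (%z :: 'a \<times> 'a. (fst z, - snd z))"
   by (intro bounded_linear_Pair bounded_linear_minus bounded_linear_fst bounded_linear_snd)
  then show "bounded_linear (op_tensor id pauli_z :: 'a \<times> 'a => 'a \<times> 'a)" by (simp add: op_tensor_apply[abs_def] fun_eq_iff)
  show "inner (op_tensor id pauli_z x) y = inner x (op_tensor id pauli_z y)" for x y :: "'a \<times> 'a"
   by (simp add: op_tensor_apply inner_prod_def)
 qed
 then show ?thesis by (simp add: op_Ad_def fun_eq_iff op_tensor_apply dbl_def)
qed

lemma op_Ad_tensor:
 assumes V: "unitary_op s (op_tensor V K)" and V0: "unitary_op s V"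
 shows "op_Ad (op_tensor V K) (dbl A 0) = dbl (conj_by V A) 0"
proof
 fix z
 \<comment> \<open>Writing \<open>z\<close> as an image under the unitary avoids computing the
   adjoint of the tensor product.\<close>
 define w where "w = adjoint (op_tensor V K) z"
 have z: "z = op_tensor V K w" unfolding w_def unitary_op_adjoint(2)[OF V] ..
 have c: "app (conj_by V A) (V x) = V (app A x)" for x unfolding app_conj_by[OF V0] unitary_op_adjoint(1)[OF V0] ..
 show "op_Ad (op_tensor V K) (dbl A 0) z = dbl (conj_by V A) 0 z" unfolding op_Ad_def o_apply z unitary_op_adjoint(1)[OF V]
  by (simp add: op_tensor_def split_beta dbl_def c)
qed

context chain_rep
begin

lemma comm_pi: "comm (pi ` car_sub d a X) = comm (Gens X)"
proof
 have "A : pi ` car_sub d a X" if "A : Gens X" for A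
 proof -
  obtain x i where xi: "x : X" "i < d" "A = cg x i \<or> A = adj (cg x i)" using \<open>A : Gens X\<close> by (auto simp: Gens_def)
  have "gen x i : car_sub d a X" "cstar (gen x i) : car_sub d a X" using gen_in_sub[OF xi(1,2)] car_sub_ops(5) by blast+
  then show ?thesis using xi(3) unfolding cg_def pi_cstar[symmetric] by blast
 qed
 then show "comm (pi ` car_sub d a X) <= comm (Gens X)" by (intro comm_antimono subsetI)
 show "comm (Gens X) <= comm (pi ` car_sub d a X)" using comm_Gens_pi[of _ X] by (auto simp: comm_def[of "pi ` _"])
qed

lemma M_eq: "app ` M = commutant (commutant (app ` pi ` car_sub d a {0..}))" by (simp add: commutant_app comm_pi M_def)

text \<open>\<open>j\<close> and \<open>Z\<close> are the preimages of the operators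
  \<open>dbl A 0\<close> and of \<open>dbl 0 1\<close>. The model grading changes the sign of the
  \<open>pauli_x\<close> component, so even elements have none.\<close>

lemma index_rep_exists:
 fixes io :: "('h => 'h) => ('k::complex_hilbert \<times> 'k => 'k \<times> 'k)"
 assumes io: "vN_iso 0 (app ` M) (model_algebra 1) io"
  and th: "!!T. T : M ==> io (op_Ad (app Gm) (app T)) = op_Ad (op_tensor id pauli_z) (io (app T))"
 shows "EX j Z. index_rep d a om pi Om Gm j Z & (ALL A. io (app (j A)) = dbl A 0) & io (app Z) = dbl 0 1"
proof -
 define J where "J T = io (app T)" for T
 have bij: "bij_betw io (app ` M) (model_algebra 1)" using io by (simp add: vN_iso_def)
 have hom: "io (adjoint S) = adjoint (io S)" "io (%x. c *c S x) = (%x. conj_bit 0 c *c io S x)"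
  "T : app ` M ==> io (%x. S x + T x) = (%x. io S x + io T x)" "T : app ` M ==> io (S \<circ> T) = io S \<circ> io T"
  if "S : app ` M" for S T c using io that unfolding vN_iso_def by blast+
 have J_inj: "S = T" if "S : M" "T : M" "J S = J T" for S T
 proof -
  have "app S = app T" using bij that unfolding J_def bij_betw_def by (meson imageI inj_onD)
  then show ?thesis by (simp add: app_inject)
 qed
 have J_mult: "J (S * T) = J S \<circ> J T" and J_add: "J (S + T) = (%x. J S x + J T x)" if "S : M" "T : M" for S T
  unfolding J_def app_funs using hom(3,4) that by blast+
 have J_scale: "J (c *c S) = (%x. c *c J S x)" and J_adj: "J (adj S) = adjoint (J S)" if "S : M" for S c
  using hom(1,2)[of "app S"] that unfolding J_def app_funs adjoint_app[symmetric] by auto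
 have J_Gm: "J (Gm * T * Gm) = op_Ad (op_tensor id pauli_z) (J T)" if "T : M" for T
 proof -
  have "op_Ad (app Gm) (app T) = app (Gm * T * Gm)" by (simp add: op_Ad_def adjoint_app adj_Gamma app_funs comp_assoc)
  then show ?thesis using th[OF that] by (simp add: J_def)
 qed
 have onto: "EX T. T : M & J T = dbl A B" for A B
 proof -
  have "dbl A B : io ` app ` M" using bij unfolding bij_betw_def model_algebra_dbl by blast
  then obtain T where "T : M" "dbl A B = io (app T)" by blast
  then show ?thesis unfolding J_def by (intro exI[of _ T]) simp
 qed
 have into: "EX A B. J T = dbl A B" if "T : M" for T
 proof -
  have "J T : model_algebra 1" using bij that unfolding bij_betw_def J_def by blast
  then show ?thesis unfolding model_algebra_dbl by blast
 qed
 have "ALL A. EX T. T : M & J T = dbl A 0" using onto by blast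
 from choice[OF this] obtain j where j: "!!A. j A : M" "!!A. J (j A) = dbl A 0" by blast
 obtain Z where Z: "Z : M" "J Z = dbl 0 1" using onto by blast
 have even: "Gm * T = T * Gm" if "Gm * T * Gm = T" for T
 proof -
  have "Gm * T * Gm * Gm = T * Gm" using that by simp
  then show ?thesis by (simp add: mult.assoc Gamma_sq)
 qed
 \<comment> \<open>Preservation of the unit is recovered from multiplicativity: the image of 1 is
   neutral for \<open>J (j 1)\<close>, which is the identity of the model algebra.\<close>
 have J1: "J 1 = dbl 1 0"
 proof -
  have "J (j 1) \<circ> J 1 = J (j 1)" using J_mult[OF j(1)[of 1] M_ops(1)] by simp
  moreover obtain A B where "J 1 = dbl A B" using into[OF M_ops(1)] by blast
  ultimately show ?thesis by (simp add: j(2) dbl_algebra dbl_inject)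
 qed
 have "index_rep d a om pi Om Gm j Z"
 proof unfold_locales
  show "j (A + B) = j A + j B" for A B by (rule J_inj) (simp_all add: j M_ops J_add dbl_algebra)
  show "j (A * B) = j A * j B" for A B by (rule J_inj) (simp_all add: j M_ops J_mult dbl_algebra)
  show "j (z *c A) = z *c j A" for z A by (rule J_inj) (simp_all add: j M_ops J_scale dbl_algebra)
  show "j (adj A) = adj (j A)" for A by (rule J_inj) (simp_all add: j M_ops J_adj adjoint_dbl)
  show "j 1 = 1" by (rule J_inj) (simp_all add: j M_ops J1)
  show "A = B" if "j A = j B" for A B using arg_cong[OF that, of J] by (simp add: j dbl_inject)
  show "j A : M" for A by (rule j)
  show "Gm * j A = j A * Gm" for A by (intro even J_inj) (simp_all add: j Gamma_M J_Gm op_Ad_grading)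
  show "T : range j" if T: "T : M" "Gm * T = T * Gm" for T
  proof -
   obtain A B where AB: "J T = dbl A B" using into[OF T(1)] by blast
   have "Gm * T * Gm = T" using T(2) by (simp add: mult.assoc Gamma_sq)
   then have "dbl A (- B) = dbl A B" using J_Gm[OF T(1)] by (simp add: AB op_Ad_grading)
   then have "B = - B" by (simp add: dbl_inject)
   then have "B = 0" by (rule bop_neg_self)
   then have "T = j A" by (intro J_inj T j) (simp add: j AB)
   then show ?thesis by blast
  qed
  show "Z : M" by (rule Z)
  show "Z * Z = 1" by (rule J_inj) (simp_all add: Z M_ops J_mult J1 dbl_algebra)
  show "adj Z = Z" by (rule J_inj) (simp_all add: Z M_ops J_adj adjoint_dbl)
  show "Gm * Z = - (Z * Gm)"
  proof -
   have "Gm * Z * Gm = (-1) *c Z"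
    by (rule J_inj) (simp_all only: Z M_ops Gamma_M J_Gm J_scale op_Ad_grading dbl_algebra, simp)
   then have "Gm * Z * Gm * Gm = - (Z * Gm)" by simp
   then show ?thesis by (simp add: mult.assoc Gamma_sq)
  qed
  show "Z * T = T * Z" if T: "T : M" for T
  proof -
   obtain A B where AB: "J T = dbl A B" using into[OF T] by blast
   show ?thesis by (rule J_inj) (simp_all add: Z T M_ops J_mult AB dbl_algebra)
  qed
 qed
 then show ?thesis using j(2) Z(2) unfolding J_def by blast
qed

end

section \<open>Covariance under the symmetry group and assembly of the theorem\<close>

context index_rep
begin

text \<open>The action on the von Neumann algebra enters as the map \<open>al\<close>, the state
  only through the implementer of the on-site automorphism; \<open>extension_implemented\<close>
  reconciles the two.\<close>

lemma symmetry:
 fixes Mt :: "complex mat" and s q :: bit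
 defines "be \<equiv> car_aut d a s (%f x. mat_apply s Mt (f x))"
  and "K \<equiv> %si mu. fock_inner d (fock_basis d si) (fock_second_quant d s Mt (fock_basis d mu))"
 assumes Mt: "Mt : carrier_mat d d" "Mt * mat_adjoint Mt = idm d"
  and inv: "!!x. om (be x) = conj_bit s (om x)" and V: "unitary_op s V"
  and al: "!!A. al (j A) = j (conj_by V A)" "al Z = bit_sign q *c Z" "!!S T. S : M ==> T : M ==> al (S * T) = al S * al T"
   "!!S T. S : M ==> T : M ==> al (S + T) = al S + al T" "!!x. x : car_sub d a {0..} ==> al (pi x) = pi (be x)"
 shows "conj_by V p0 = p0" "phi (conj_by V A) = conj_bit s (phi A)"
  "EX c. cmod c = 1 &
   (ALL nu:I. bit_sign (q * card_parity nu) *c (SUM mu:I. K mu nu *c Sm mu) = c *c conj_by V (Sm nu))"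
proof -
 obtain Y where Y: "unitary_op s Y" "Y Om = Om" "adjoint Y Om = Om"
  and Ypi: "!!x. conj_by Y (pi x) = pi (be x)"
  and YM: "!!A. A : M ==> conj_by Y A : M" "!!A. A : M ==> conj_by (adjoint Y) A : M"
  and YGm: "conj_by Y Gm = Gm" and Yrho: "!!T. conj_by Y (rho T) = rho (conj_by Y T)"
  using onsite_implementer[OF Mt inv[unfolded be_def]] unfolding be_def by blast
 have alg: "al g = conj_by Y g" if "g : Gens {0..}" for g
 proof -
  obtain x i where xi: "x : {0..}" "i < d" "g = cg x i \<or> g = adj (cg x i)" using \<open>g : Gens {0..}\<close> by (auto simp: Gens_def)
  have "gen x i : car_sub d a {0..}" "cstar (gen x i) : car_sub d a {0..}"
   using gen_in_sub[OF xi(1,2)] car_sub_ops(5) by blast+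
  then show ?thesis using xi(3) unfolding cg_def pi_cstar[symmetric] by (auto simp: Ypi al(5))
 qed
 note ext = extension_implemented[OF Y(1) V YM YGm al(1-4) alg]
 show "conj_by V p0 = p0" by (rule conj_p0[OF V ext(1) P_invariant[OF Y YM]])
 show "phi (conj_by V A) = conj_bit s (phi A)" by (rule phi_invariant[OF Y ext(1)])
 show "EX c. cmod c = 1 &
   (ALL nu:I. bit_sign (q * card_parity nu) *c (SUM mu:I. K mu nu *c Sm mu) = c *c conj_by V (Sm nu))"
 proof (rule covariance[OF Y(1) V ext Yrho])
  fix mu nu assume mu: "mu : I" "nu : I"
  show "conj_by Y (eu mu nu) = (SUM si:I. SUM tau:I. (K si mu * cnj (K tau nu)) *c eu si tau)"
   unfolding eu_def Ypi be_def onsite_E[OF Mt I(3)[OF mu(1)] I(3)[OF mu(2)]] K_def I_def pi_sum pi_scaleC ..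
 next
  fix si mu assume s: "si : I" "mu : I" and nz: "K si mu ~= 0"
  have "K si mu = fock_second_quant d s Mt (fock_basis d mu) si"
   unfolding K_def fock_basis_fket[OF I(3)[OF s(1)]] by (rule fock_inner_fket[OF I(3)[OF s(1)]])
  then have "mpar si = mpar mu" using second_quant_parity[OF I(3)[OF s(2)]] nz by metis
  then have "bit_sign (card_parity si) = bit_sign (card_parity mu)" by (simp only: mpar_bit_sign)
  then show "card_parity si = card_parity mu"
   by (cases "card_parity si"; cases "card_parity mu") (simp_all add: bit_sign_def)
 qed
qed

end

theorem theorem6p6:
  fixes G :: "('g, 'b) monoid_scheme" and p q :: "'g \<Rightarrow> bit"
    and d :: nat and U :: "'g \<Rightarrow> complex mat" and \<upsilon>\<^sub>U \<upsilon> :: "'g \<Rightarrow> 'g \<Rightarrow> complex"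
    and a :: "(int \<Rightarrow> complex vec) \<Rightarrow> 'a::cstar_algebra" and \<omega> :: "'a \<Rightarrow> complex"
  assumes "0 < d" and "group G" and "finite (carrier G)" and "z2_hom G p"
    and "proj_rep_mat G p d U \<upsilon>\<^sub>U"
    and "car_algebra d a"
    and "pure_state \<omega>"
    and "split_state TYPE('r::complex_hilbert) d a \<omega>"
    and "translation_invariant d a \<omega>"
    and "action_invariant G p (car_onsite d a p U) \<omega>"
    and "z2_hom G q" and "cocycle G p \<upsilon>"
    and "has_ind TYPE('h::complex_hilbert) TYPE('k::complex_hilbert) G p d a U \<omega>
           (1, q, coh_class G p \<upsilon>)"
    and "bdd_above {vec_space.rank (2 ^ (d * N)) Q | N Q. 1 \<le> N \<and> local_support d a \<omega> N Q}"
  shows "\<exists>m D v \<sigma>\<^sub>0. 0 < m \<and> faithful_density_matrix m D \<and>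
    (\<forall>\<mu>\<in>Pow {..<d}. v \<mu> \<in> carrier_mat m m) \<and>
    (\<forall>b\<in>graded_matrices m.
       (\<lambda>N. mat_op_norm ((transfer_map (m * 2) d (vhat \<sigma>\<^sub>0 v) ^^ N) b -
          mat_trace (kron D ((1 / 2) \<cdot>\<^sub>m 1\<^sub>m 2) * b) \<cdot>\<^sub>m kron (1\<^sub>m m) (1\<^sub>m 2))) \<longlonglongrightarrow> 0) \<and>
    (\<forall>l \<mu> \<nu>. (\<forall>k\<le>l. \<mu> k \<in> Pow {..<d} \<and> \<nu> k \<in> Pow {..<d}) \<longrightarrow>
       \<omega> (prod_list (map (\<lambda>k. matrix_unit d a (int k) (\<mu> k) (\<nu> k)) [0..<Suc l])) =
         bit_sign (\<Sum>k=1..l. (card_parity (\<mu> k) + card_parity (\<nu> k)) *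
                     (\<Sum>j<k. \<sigma>\<^sub>0 + card_parity (\<nu> j))) *
         (if (\<Sum>k\<le>l. card_parity (\<mu> k) + card_parity (\<nu> k)) = 0 then 1 else 0) *
         mat_trace (D * mat_list_prod m (map (\<lambda>k. v (\<mu> k)) [0..<Suc l] @
                          map (\<lambda>k. mat_adjoint (v (\<nu> k))) (rev [0..<Suc l])))) \<and>
    (\<exists>W \<upsilon>\<^sub>W c. proj_rep_mat G p m W \<upsilon>\<^sub>W \<and>
       (\<forall>g\<in>carrier G. cmod (c g) = 1 \<and>
          (\<forall>\<nu>\<in>Pow {..<d}.
             bit_sign (q g * card_parity \<nu>) \<cdot>\<^sub>m
               mat_sum m (\<lambda>\<mu>. fock_inner d (fock_basis d \<mu>)
                  (fock_second_quant d (p g) (U g) (fock_basis d \<nu>)) \<cdot>\<^sub>m v \<mu>) (Pow {..<d}) =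
             c g \<cdot>\<^sub>m mat_Ad (p g) (W g) (v \<nu>)) \<and>
          mat_Ad (p g) (W g) D = D) \<and>
       coh_class G p \<upsilon>\<^sub>W = coh_class G p \<upsilon>)"
proof -
 obtain \<pi>0 and \<Omega> :: 'h and \<Gamma>0 \<alpha>' M0 where
  gns: "gns_triple UNIV \<omega> \<pi>0 \<Omega>" and M0: "M0 = commutant (commutant (\<pi>0 ` car_sub d a {0..}))"
  and \<Gamma>0: "bounded_op 0 \<Gamma>0" "!!A. \<Gamma>0 (\<pi>0 A \<Omega>) = \<pi>0 (car_parity d a A) \<Omega>"
  and \<alpha>': "!!g. g : carrier G ==> vN_iso (p g) M0 M0 (\<alpha>' g)"
   "!!g A. g : carrier G ==> A : car_sub d a {0..} ==> \<alpha>' g (\<pi>0 A) = \<pi>0 (car_onsite d a p U g A)"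
  and Ind: "has_Ind TYPE('k) G p M0 (op_Ad \<Gamma>0) \<alpha>' (1, q, coh_class G p \<upsilon>)"
  using assms(13) unfolding has_ind_def by blast
 obtain V :: "'g => 'k \<times> 'k => 'k \<times> 'k" and \<upsilon>V \<iota> where
  V: "model_system G p 1 q V \<upsilon>V" "model_class G p 1 q V \<upsilon>V (coh_class G p \<upsilon>)" and
  \<iota>: "vN_iso 0 M0 (model_algebra 1) \<iota>" and
  \<iota>\<theta>: "!!T. T : M0 ==> \<iota> (op_Ad \<Gamma>0 T) = op_Ad (op_tensor id pauli_z) (\<iota> T)" and
  \<iota>\<alpha>: "!!T g. T : M0 ==> g : carrier G ==> \<iota> (\<alpha>' g T) = op_Ad (V g) (\<iota> T)"
  using Ind unfolding has_Ind_def by auto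
 have "(1 :: bit) ~= 0" by simp
 then obtain V0 \<upsilon>0 where V0: "proj_rep_op G p V0 \<upsilon>0" "!!g. g : carrier G ==> V g = op_tensor (V0 g) (mat_conj (p g) (mat_bit_power pauli_y (q g)))"
  and cls: "coh_class G p \<upsilon> = coh_class G p \<upsilon>0" using V(2) unfolding model_class_def by auto
 have Vu: "unitary_op (p g) (V g)" "unitary_op (p g) (V0 g)" if "g : carrier G" for g
  using V(1) V0(1) that unfolding model_system_def proj_rep_op_def by blast+
 \<comment> \<open>The representation is given by functions; it is repackaged as values of type
   \<open>bop\<close>, on which the locales operate.\<close>
 define \<pi> where "\<pi> x = Bop (\<pi>0 x)" for x
 have g: "\<pi>0 1 = id" "bounded_op 0 (\<pi>0 x)" "\<pi>0 (cstar x) = adjoint (\<pi>0 x)" "\<pi>0 (c *c x) = (%\<xi>. c *c \<pi>0 x \<xi>)"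
  "\<pi>0 (x + y) = (%\<xi>. \<pi>0 x \<xi> + \<pi>0 y \<xi>)" "\<pi>0 (x * y) = \<pi>0 x \<circ> \<pi>0 y" "\<omega> x = ip \<Omega> (\<pi>0 x \<Omega>)"
  "closure (range (%x. \<pi>0 x \<Omega>)) = UNIV" for x y c using gns unfolding gns_triple_def by auto
 have app\<pi>: "app (\<pi> x) = \<pi>0 x" for x unfolding \<pi>_def by (rule app_Bop[OF g(2)])
 define \<Gamma> where "\<Gamma> = Bop \<Gamma>0"
 have app\<Gamma>: "app \<Gamma> = \<Gamma>0" unfolding \<Gamma>_def by (rule app_Bop[OF \<Gamma>0(1)])
 interpret chain_rep d a \<omega> \<pi> \<Omega> \<Gamma>
 proof unfold_locales
  show "\<pi> (x + y) = \<pi> x + \<pi> y" "\<pi> (x * y) = \<pi> x * \<pi> y" "\<pi> (cstar x) = adj (\<pi> x)" "\<pi> (z *c x) = z *c \<pi> x" for x y z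
   by (simp_all add: app_inject[symmetric] app_funs app\<pi> g(3-6) adjoint_app[symmetric])
  show "\<pi> 1 = 1" by (simp add: app_inject[symmetric] app\<pi> g(1) one_bop.rep_eq)
  show "\<omega> x = ip \<Omega> (app (\<pi> x) \<Omega>)" for x by (simp add: app\<pi> g(7))
  show "closure (range (%x. app (\<pi> x) \<Omega>)) = UNIV" by (simp add: app\<pi> g(8))
  show "app \<Gamma> (app (\<pi> x) \<Omega>) = app (\<pi> (car_parity d a x)) \<Omega>" for x by (simp add: app\<Gamma> app\<pi> \<Gamma>0(2))
 qed (fact assms)+
 have M0M: "M0 = app ` M" unfolding M_eq M0 by (simp add: image_image app\<pi>)
 obtain j :: "'k bop => 'h bop" and Z where jZ: "index_rep d a \<omega> \<pi> \<Omega> \<Gamma> j Z"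
  and \<iota>j: "!!A. \<iota> (app (j A)) = dbl A 0" and \<iota>Z: "\<iota> (app Z) = dbl 0 1"
  using index_rep_exists[OF \<iota>[unfolded M0M]] \<iota>\<theta> unfolding M0M app\<Gamma> by blast
 interpret index_rep d a \<omega> \<pi> \<Omega> \<Gamma> j Z by (rule jZ)
 obtain R where R: "!!N Q. 1 <= N ==> local_support d a \<omega> N Q ==> vec_space.rank (2 ^ (d * N)) Q <= R"
  using assms(14) unfolding bdd_above_def by blast
 \<comment> \<open>The linear relation in the corner of \<open>P\<close> is pulled back to K:
   \<open>j\<close> is linear and injective and takes \<open>p0\<close> to \<open>P\<close>.\<close>
 have "EX l :: nat => complex. (EX k<Suc (R * R). l k ~= 0) & (SUM k<Suc (R * R). l k *c (p0 * A k * p0)) = 0" for A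
 proof -
  obtain l where l: "EX k<Suc (R * R). l k ~= 0" "(SUM k<Suc (R * R). l k *c (P * j (A k) * P)) = 0"
   using finite_corner[OF R, of "%k. j (A k)"] j_even(1) by blast
  have "j (SUM k<Suc (R * R). l k *c (p0 * A k * p0)) = j 0" unfolding j_sum j_scaleC j_mult p0 l(2) j_zero ..
  then show ?thesis using l(1) j_inj by blast
 qed
 from finite_rank_basis[OF p0(2,3) this] obtain m e where
  "orthonormal m e" "ALL i<m. app p0 (e i) = e i" "(SUM i<m. ketbra (e i) (e i)) = p0" by blast
 then interpret matrix_rep d a \<omega> \<pi> \<Omega> \<Gamma> j Z m e by unfold_locales auto
 define K where "K g \<mu> \<nu> = fock_inner d (fock_basis d \<mu>) (fock_second_quant d (p g) (U g) (fock_basis d \<nu>))" for g \<mu> \<nu>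
 have Um: "U g : carrier_mat d d" "U g * mat_adjoint (U g) = idm d" if "g : carrier G" for g
  using assms(5) that unfolding proj_rep_mat_def by blast+
 have sym: "conj_by (V0 g) p0 = p0 & (ALL A. phi (conj_by (V0 g) A) = conj_bit (p g) (phi A)) &
   (EX c. cmod c = 1 & (ALL \<nu>:I. bit_sign (q g * card_parity \<nu>) *c (SUM \<mu>:I. K g \<mu> \<nu> *c Sm \<mu>) = c *c conj_by (V0 g) (Sm \<nu>)))"
  if gG: "g : carrier G" for g
 proof -
  \<comment> \<open>The given extension acts on functions and is constrained only on the half-chain
    algebra, so each use below carries membership in \<open>M\<close>.\<close>
  define \<alpha> where "\<alpha> T = Bop (\<alpha>' g (app T))" for T
  have iso: "vN_iso (p g) (app ` M) (app ` M) (\<alpha>' g)" using \<alpha>'(1)[OF gG] unfolding M0M .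
  have \<alpha>M: "\<alpha>' g (app T) = app (\<alpha> T)" "\<alpha> T : M" if "T : M" for T
  proof -
   have "\<alpha>' g (app T) : app ` M" using iso that unfolding vN_iso_def bij_betw_def by blast
   then obtain S where S: "S : M" "\<alpha>' g (app T) = app S" by blast
   then show "\<alpha>' g (app T) = app (\<alpha> T)" "\<alpha> T : M" unfolding \<alpha>_def by (simp_all add: app_inverse)
  qed
  have inj: "S = T" if "S : M" "T : M" "\<iota> (app S) = \<iota> (app T)" for S T
  proof -
   have "app S = app T" using \<iota> that unfolding M0M vN_iso_def bij_betw_def by (meson imageI inj_onD)
   then show ?thesis by (simp add: app_inject)
  qed
  have \<iota>g: "\<iota> (app (\<alpha> T)) = op_Ad (V g) (\<iota> (app T))" if "T : M" for T
   using \<iota>\<alpha>[of "app T" g] that gG unfolding M0M \<alpha>M(1)[OF that] by blast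
  have a1: "\<alpha> (j A) = j (conj_by (V0 g) A)" for A
  proof (rule inj[OF \<alpha>M(2)[OF j_even(1)] j_even(1)])
   show "\<iota> (app (\<alpha> (j A))) = \<iota> (app (j (conj_by (V0 g) A)))"
    unfolding \<iota>g[OF j_even(1)] \<iota>j V0(2)[OF gG]
    by (rule op_Ad_tensor[OF _ Vu(2)[OF gG]]) (use Vu(1)[OF gG] V0(2)[OF gG] in simp)
  qed
  have a2: "\<alpha> Z = bit_sign (q g) *c Z"
  proof (rule inj[OF \<alpha>M(2)[OF Z(1)] M_ops(6)[OF Z(1)]])
   have X: "op_tensor id pauli_x = (dbl 0 1 :: 'k \<times> 'k => _)" by (simp add: fun_eq_iff op_tensor_apply dbl_def)
   have "op_Ad (V g) (op_tensor id pauli_x) = (%z. bit_sign (q g) *c op_tensor id pauli_x z)"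
    using V(1) gG unfolding model_system_def by blast
   moreover have "\<iota> (%x. bit_sign (q g) *c app Z x) = (%x. conj_bit 0 (bit_sign (q g)) *c \<iota> (app Z) x)"
    using \<iota> Z(1) unfolding M0M vN_iso_def by blast
   ultimately show "\<iota> (app (\<alpha> Z)) = \<iota> (app (bit_sign (q g) *c Z))"
    unfolding \<iota>g[OF Z(1)] \<iota>Z app_funs X by simp
  qed
  have a3: "\<alpha> (S * T) = \<alpha> S * \<alpha> T" "\<alpha> (S + T) = \<alpha> S + \<alpha> T" if "S : M" "T : M" for S T
  proof -
   have "\<alpha>' g (app S \<circ> app T) = \<alpha>' g (app S) \<circ> \<alpha>' g (app T)"
    "\<alpha>' g (%x. app S x + app T x) = (%x. \<alpha>' g (app S) x + \<alpha>' g (app T) x)"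
    using iso that unfolding vN_iso_def by blast+
   then have "app (\<alpha> (S * T)) = app (\<alpha> S * \<alpha> T)" "app (\<alpha> (S + T)) = app (\<alpha> S + \<alpha> T)"
    unfolding app_funs \<alpha>M(1)[OF that(1), symmetric] \<alpha>M(1)[OF that(2), symmetric]
     \<alpha>M(1)[OF M_ops(3)[OF that], symmetric] \<alpha>M(1)[OF M_ops(4)[OF that], symmetric] by blast+
   then show "\<alpha> (S * T) = \<alpha> S * \<alpha> T" "\<alpha> (S + T) = \<alpha> S + \<alpha> T" by (simp_all only: app_inject)
  qed
  have a4: "\<alpha> (\<pi> x) = \<pi> (car_aut d a (p g) (%f x. mat_apply (p g) (U g) (f x)) x)" if "x : car_sub d a {0..}" for x
   using \<alpha>'(2)[OF gG that] unfolding \<alpha>_def app\<pi> by (simp add: \<pi>_def car_onsite_def)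
  \<comment> \<open>For anti-linear symmetries invariance is stated with an adjoint inside; since
    states are hermitian, it says that the symmetry conjugates the values of the state.\<close>
  have inv: "\<omega> (car_aut d a (p g) (%f x. mat_apply (p g) (U g) (f x)) x) = conj_bit (p g) (\<omega> x)" for x
  proof -
   have *: "\<omega> (car_onsite d a p U g (if p g = 0 then A else cstar A)) = \<omega> A" for A
    using assms(10) gG unfolding action_invariant_def by blast
   have star: "\<omega> (cstar x) = cnj (\<omega> x)"
    unfolding vector_state pi_cstar cinner_adj[symmetric] by (rule cinner_commute)
   show ?thesis
    using *[of "if p g = 0 then x else cstar x"] by (cases "p g = 0") (simp_all add: car_onsite_def cstar_cstar star conj_bit_def)
  qed
  show ?thesis using symmetry[OF Um[OF gG] inv Vu(2)[OF gG] a1 a2 a3(1) a3(2) a4] unfolding K_def by blast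
 qed
 have "ALL g:carrier G. EX c. cmod c = 1 & (ALL \<nu>:I. bit_sign (q g * card_parity \<nu>) *c (SUM \<mu>:I. K g \<mu> \<nu> *c Sm \<mu>) = c *c conj_by (V0 g) (Sm \<nu>))"
  using sym by blast
 from bchoice[OF this] obtain c where c: "!!g. g : carrier G ==> cmod (c g) = 1"
  "!!g \<nu>. g : carrier G ==> \<nu> : I ==> bit_sign (q g * card_parity \<nu>) *c (SUM \<mu>:I. K g \<mu> \<nu> *c Sm \<mu>) = c g *c conj_by (V0 g) (Sm \<nu>)"
  by blast
 define W where "W g = Wm (V0 g)" for g
 have Vp: "conj_by (V0 g) p0 = p0" "phi (conj_by (V0 g) A) = conj_bit (p g) (phi A)" if "g : carrier G" for g A
  using sym[OF that] by blast+
 \<comment> \<open>Compression by the common invariant projection \<open>p0\<close> is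
   multiplicative on the \<open>V0 g\<close>, so \<open>W\<close> inherits their multiplier
   \<open>\<upsilon>0\<close> unchanged, and with it the class.\<close>
 have rep: "proj_rep_mat G p m W \<upsilon>0" unfolding proj_rep_mat_def
 proof (intro conjI ballI)
  show "normalized_multiplier G \<upsilon>0" using V0(1) by (simp add: proj_rep_op_def)
  show "W g : carrier_mat m m" for g by (simp add: W_def)
  show "W g * mat_adjoint (W g) = idm m" if "g : carrier G" for g
   unfolding W_def by (rule Wm_unitary[OF Vu(2)[OF that] Vp(1)[OF that]])
  show "W g * mat_conj (p g) (W h) = \<upsilon>0 g h *m W (g \<otimes>\<^bsub>G\<^esub> h)" if "g : carrier G" "h : carrier G" for g h
  proof -
   have "V0 g \<circ> V0 h = (%x. \<upsilon>0 g h *c V0 (g \<otimes>\<^bsub>G\<^esub> h) x)" using V0(1) that unfolding proj_rep_op_def by blast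
   moreover have "Wm (%x. z *c f x) = z *m Wm f" for z f by (rule eq_matI) (simp_all add: Wm_def cinner_scaleC_right)
   ultimately show ?thesis
    unfolding W_def Wm_mult[OF Vu(2)[OF that(1)] Vp(1)[OF that(1)] Vu(2)[OF that(2)] Vp(1)[OF that(2)]] by simp
  qed
 qed
 have cov: "bit_sign (q g * card_parity \<nu>) *m mat_sum m (%\<mu>. K g \<mu> \<nu> *m v \<mu>) (Pow {..<d}) = c g *m mat_Ad (p g) (W g) (v \<nu>)"
  if "g : carrier G" "\<nu> : Pow {..<d}" for g \<nu>
 proof -
  have "\<nu> : I" using that(2) by (simp add: I_def)
  from arg_cong[OF c(2)[OF that(1) this], of mx] show ?thesis
   unfolding mx_linear mx_sum mx_conj_by[OF Vu(2)[OF that(1)] Vp(1)[OF that(1)]] W_def v_def I_def .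
 qed
 have D: "mat_Ad (p g) (W g) Dm = Dm" if "g : carrier G" for g
  unfolding W_def by (rule Dm_invariant[OF Vu(2)[OF that] Vp(1)[OF that] Vp(2)[OF that]])
 show ?thesis using m_pos Dm_density v_carrier transfer_limit word_formula rep c(1) cov[unfolded K_def] D cls
  by (intro exI[of _ m] exI[of _ Dm] exI[of _ v] exI[of _ si0] conjI exI[of _ W] exI[of _ \<upsilon>0] exI[of _ c] allI impI ballI) auto
qed

end
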